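(* Every triangulation $G\in\mathcal{F}_{\circ}^2(4)$ of the disk can be obtained from a flag or an octahedron component (each regarded as a triangulation of the disk) by a sequence of 3-splitting triodes, additions of flags, 4-splittings and additions of octahedra.
   Context: A triangulation of a compact connected surface $F^2$ (possibly with boundary) is a simple graph $G$ embedded in $F^2$ such that every face is bounded by a 3-cycle and any two faces share at most one edge; triangulations are considered up to homeomorphism. $\partial G$ is the subgraph triangulating $\partial F^2$; its vertices/edges are boundary vertices/edges, others are inner. Contracting an edge $e=uv$ identifies $u,v$ and deletes multiple edges, giving $G/e$; $e$ is contractible if $G/e$ is again a triangulation of $F^2$; vertex splitting is the inverse. A contractible edge $e$ is 4-contractible if $G/e$ has minimum degree $\ge4$; a 4-splitting is the inverse of such a contraction. $\mathcal{F}_{\circ}^2(4)$ is the class of triangulations of $F^2$ in which every vertex has degree $\ge3$ and every inner vertex has degree $\ge4$; all operations stay in this class. A triode is a boundary vertex of degree $3$. A contractible edge $e$ is a triode detecting edge if all vertices of degree $3$ produced by its contraction are triodes; a 3-splitting triode is the inverse of contracting a triode detecting edge. Flag: an inner vertex $x$ of degree $4$, none of whose neighbours has degree $4$, with link the cycle $x_1abx_2x_1$, where $x_1a,ab,bx_2\in\partial G$, the edge $x_1x_2$ meets $\partial G$ only in $\{x_1,x_2\}$, and $\deg a=\deg b=3$; the subgraph induced by $\{x,x_1,x_2,a,b\}$ is a flag (as a disk triangulation it is the wheel with one inner vertex of degree 4). It is removable if $G-\{a,b,x\}\in\mathcal{F}_{\circ}^2(4)$; adding a flag is the inverse of removing a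 removable flag. Octahedron component: let $v_1v_2v_3$ be a cycle with $\deg v_i=4$ and $a_1,a_2,a_3$ the only vertices with $a_i$ adjacent to $v_j,v_k$ ($\{i,j,k\}=\{1,2,3\}$). The subgraph induced by $\{a_i,v_i\}$ is an octahedron component if the cycle $a_1a_2a_3$ exists and one of: (1) no $v_i\in\partial G$; (2) exactly one $v_i\in\partial G$ and $\partial G=v_ia_ja_k$; (3) exactly $v_i,v_j\in\partial G$ and $\partial G=v_iv_ja_k$; (4) $\partial G=v_1v_2v_3$. It is external if two edges $a_ia_j,a_ja_k$ lie in $\partial G$. It is removable if $G-\{v_1,v_2,v_3\}\in\mathcal{F}_{\circ}^2(4)$; an external one is redundant if $G-\{a_j,v_1,v_2,v_3\}\in\mathcal{F}_{\circ}^2(4)$. An addition of an octahedron is the inverse of removing a removable octahedron or deleting a redundant one. *)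

theory Defs
  imports "HOL-Analysis.Analysis"
begin

section \<open>Triangulations of the disk\<close>

text \<open>A triangulation is represented by the set of its vertex sets: singletons for vertices,
  two-element sets for edges, three-element sets for faces.  Since the graph is simple and two
  faces share at most one edge, a face is determined by its three vertices.\<close>

definition pure_2_complex :: "'a set set \<Rightarrow> bool" where
  "pure_2_complex K \<longleftrightarrow>
     finite K \<and> {} \<notin> K \<and>
     (\<forall>s\<in>K. \<forall>t. t \<noteq> {} \<and> t \<subseteq> s \<longrightarrow> t \<in> K) \<and>
     (\<forall>s\<in>K. \<exists>t\<in>K. s \<subseteq> t \<and> card t = 3)"

definition complex_of :: "'a set set \<Rightarrow> 'a set set" where
  "complex_of T = {s. s \<noteq> {} \<and> (\<exists>t\<in>T. s \<subseteq> t)}"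

definition verts :: "'a set set \<Rightarrow> 'a set" where
  "verts K = \<Union> K"

definition edges :: "'a set set \<Rightarrow> 'a set set" where
  "edges K = {e \<in> K. card e = 2}"

definition faces :: "'a set set \<Rightarrow> 'a set set" where
  "faces K = {t \<in> K. card t = 3}"

definition neighbours :: "'a set set \<Rightarrow> 'a \<Rightarrow> 'a set" where
  "neighbours K v = {w. {v, w} \<in> edges K}"

definition degree :: "'a set set \<Rightarrow> 'a \<Rightarrow> nat" where
  "degree K v = card (neighbours K v)"

definition link :: "'a set set \<Rightarrow> 'a \<Rightarrow> 'a set set" where
  "link K v = {s \<in> K. v \<notin> s \<and> insert v s \<in> K}"

text \<open>Points of the geometric realization are given by their barycentric coordinates, with the
  topology of pointwise convergence (the usual topology, as complexes are finite).\<close>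

definition realization :: "'a set set \<Rightarrow> ('a \<Rightarrow> real) set" where
  "realization K =
     {p. (\<forall>v. 0 \<le> p v) \<and> {v. p v \<noteq> 0} \<in> K \<and> (\<Sum>v | p v \<noteq> 0. p v) = 1}"

definition boundary :: "'a set set \<Rightarrow> 'a set set" where
  "boundary K = complex_of {e \<in> edges K. card {t \<in> faces K. e \<subseteq> t} = 1}"

definition inner_verts :: "'a set set \<Rightarrow> 'a set" where
  "inner_verts K = verts K - verts (boundary K)"

text \<open>By invariance of domain, any homeomorphism onto the disk maps the edges lying on exactly one
  face onto the boundary circle; the last conjunct records that \<^const>\<open>boundary\<close> is the
  subcomplex triangulating the boundary of the disk.\<close>

definition triangulates_disk :: "'a set set \<Rightarrow> bool" where
  "triangulates_disk K \<longleftrightarrow>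
     pure_2_complex K \<and>
     (\<exists>h g. homeomorphism (realization K) (cball (0::complex) 1) h g \<and>
            h ` realization (boundary K) = sphere 0 1)"

text \<open>The class of disk triangulations with all degrees at least 3 and all inner degrees at
  least 4.\<close>

definition disk_class_4 :: "'a set set \<Rightarrow> bool" where
  "disk_class_4 K \<longleftrightarrow>
     triangulates_disk K \<and>
     (\<forall>v\<in>verts K. 3 \<le> degree K v) \<and>
     (\<forall>v\<in>inner_verts K. 4 \<le> degree K v)"

definition delete_verts :: "'a set set \<Rightarrow> 'a set \<Rightarrow> 'a set set" where
  "delete_verts K X = {s \<in> K. s \<inter> X = {}}"


section \<open>Edge contractions\<close>

definition identify :: "'a \<Rightarrow> 'a \<Rightarrow> 'a \<Rightarrow> 'a" where
  "identify u v w = (if w = v then u else w)"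

definition contract :: "'a set set \<Rightarrow> 'a \<Rightarrow> 'a \<Rightarrow> 'a set set" where
  "contract K u v = (\<lambda>s. identify u v ` s) ` K"

text \<open>The faces of the contracted graph are the images of the faces not incident with the
  contracted edge.  Two of them with the same vertices would share three edges, which is what the
  injectivity condition excludes: the set representation alone would silently merge them.\<close>

definition contractible_edge :: "'a set set \<Rightarrow> 'a \<Rightarrow> 'a \<Rightarrow> bool" where
  "contractible_edge K u v \<longleftrightarrow>
     {u, v} \<in> edges K \<and>
     inj_on (\<lambda>t. identify u v ` t) {t \<in> faces K. \<not> {u, v} \<subseteq> t} \<and>
     triangulates_disk (contract K u v)"

definition four_contractible :: "'a set set \<Rightarrow> 'a \<Rightarrow> 'a \<Rightarrow> bool" where
  "four_contractible K u v \<longleftrightarrow>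
     contractible_edge K u v \<and>
     (\<forall>w\<in>verts (contract K u v). 4 \<le> degree (contract K u v) w)"

definition triode :: "'a set set \<Rightarrow> 'a \<Rightarrow> bool" where
  "triode K v \<longleftrightarrow> v \<in> verts (boundary K) \<and> degree K v = 3"

text \<open>The vertices of degree 3 produced by the contraction are the vertex resulting from the
  identification, if it has degree 3, and those whose degree was not 3 before.\<close>

definition triode_detecting :: "'a set set \<Rightarrow> 'a \<Rightarrow> 'a \<Rightarrow> bool" where
  "triode_detecting K u v \<longleftrightarrow>
     contractible_edge K u v \<and>
     (\<forall>w\<in>verts (contract K u v).
        degree (contract K u v) w = 3 \<and> (w = u \<or> degree K w \<noteq> 3) \<longrightarrow> triode (contract K u v) w)"


section \<open>Flags\<close>

definition flag :: "'a set set \<Rightarrow> 'a \<Rightarrow> 'a \<Rightarrow> 'a \<Rightarrow> 'a \<Rightarrow> 'a \<Rightarrow> bool" where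
  "flag K x x1 a b x2 \<longleftrightarrow>
     x \<in> inner_verts K \<and> degree K x = 4 \<and>
     (\<forall>y\<in>neighbours K x. degree K y \<noteq> 4) \<and>
     distinct [x1, a, b, x2] \<and>
     link K x = complex_of {{x1, a}, {a, b}, {b, x2}, {x2, x1}} \<and>
     {{x1, a}, {a, b}, {b, x2}} \<subseteq> boundary K \<and>
     {x1, x2} \<notin> boundary K \<and>
     degree K a = 3 \<and> degree K b = 3"

definition flag_disk :: "'a set set \<Rightarrow> bool" where
  "flag_disk K \<longleftrightarrow>
     (\<exists>x x1 a b x2. distinct [x, x1, a, b, x2] \<and>
        K = complex_of {{x, x1, a}, {x, a, b}, {x, b, x2}, {x, x2, x1}})"


section \<open>Octahedron components\<close>

definition boundary_is_3_cycle :: "'a set set \<Rightarrow> 'a \<Rightarrow> 'a \<Rightarrow> 'a \<Rightarrow> bool" where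
  "boundary_is_3_cycle K x y z \<longleftrightarrow> boundary K = complex_of {{x, y}, {y, z}, {x, z}}"

definition octahedron_component ::
  "'a set set \<Rightarrow> 'a \<Rightarrow> 'a \<Rightarrow> 'a \<Rightarrow> 'a \<Rightarrow> 'a \<Rightarrow> 'a \<Rightarrow> bool" where
  "octahedron_component K v1 v2 v3 a1 a2 a3 \<longleftrightarrow>
     distinct [v1, v2, v3, a1, a2, a3] \<and>
     {{v1, v2}, {v2, v3}, {v1, v3}} \<subseteq> edges K \<and>
     degree K v1 = 4 \<and> degree K v2 = 4 \<and> degree K v3 = 4 \<and>
     neighbours K v2 \<inter> neighbours K v3 = {v1, a1} \<and>
     neighbours K v1 \<inter> neighbours K v3 = {v2, a2} \<and>
     neighbours K v1 \<inter> neighbours K v2 = {v3, a3} \<and>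
     {{a1, a2}, {a2, a3}, {a1, a3}} \<subseteq> edges K \<and>
     ({v1, v2, v3} \<inter> verts (boundary K) = {} \<or>
      boundary_is_3_cycle K v1 a2 a3 \<or>
      boundary_is_3_cycle K v2 a1 a3 \<or>
      boundary_is_3_cycle K v3 a1 a2 \<or>
      boundary_is_3_cycle K v1 v2 a3 \<or>
      boundary_is_3_cycle K v1 v3 a2 \<or>
      boundary_is_3_cycle K v2 v3 a1 \<or>
      boundary_is_3_cycle K v1 v2 v3)"

text \<open>If no \<open>v\<^sub>i\<close> lies on the boundary, deleting the \<open>v\<^sub>i\<close> from the embedded graph leaves the region
  inside \<open>a\<^sub>1a\<^sub>2a\<^sub>3\<close> as a new face.  Otherwise that region is open towards the boundary, and the cycle
  \<open>a\<^sub>1a\<^sub>2a\<^sub>3\<close> becomes the new boundary.\<close>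

definition remove_octahedron ::
  "'a set set \<Rightarrow> 'a \<Rightarrow> 'a \<Rightarrow> 'a \<Rightarrow> 'a \<Rightarrow> 'a \<Rightarrow> 'a \<Rightarrow> 'a set set" where
  "remove_octahedron K v1 v2 v3 a1 a2 a3 =
     delete_verts K {v1, v2, v3} \<union>
     (if {v1, v2, v3} \<inter> verts (boundary K) = {} then {{a1, a2, a3}} else {})"

text \<open>The middle vertex of the two boundary edges is called \<open>a\<^sub>1\<close>; the other cases arise by
  renumbering, under which \<^const>\<open>octahedron_component\<close> is invariant.\<close>

definition external_octahedron ::
  "'a set set \<Rightarrow> 'a \<Rightarrow> 'a \<Rightarrow> 'a \<Rightarrow> 'a \<Rightarrow> 'a \<Rightarrow> 'a \<Rightarrow> bool" where
  "external_octahedron K v1 v2 v3 a1 a2 a3 \<longleftrightarrow>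
     octahedron_component K v1 v2 v3 a1 a2 a3 \<and> {{a1, a2}, {a1, a3}} \<subseteq> boundary K"

text \<open>As a triangulation of the disk, an octahedron component is an octahedron minus one face, here
  \<open>a\<^sub>1a\<^sub>2a\<^sub>3\<close>.  Up to renaming of vertices it does not matter which face is left out.\<close>

definition octahedron_disk :: "'a set set \<Rightarrow> bool" where
  "octahedron_disk K \<longleftrightarrow>
     (\<exists>v1 v2 v3 a1 a2 a3. distinct [v1, v2, v3, a1, a2, a3] \<and>
        K = complex_of {{v1, v2, v3}, {a1, v2, v3}, {v1, a2, v3}, {v1, v2, a3},
                        {v1, a2, a3}, {a1, v2, a3}, {a1, a2, v3}})"


section \<open>Generating operations\<close>

text \<open>\<open>op H K\<close> means that \<open>K\<close> is obtained from \<open>H\<close>, that is, \<open>H\<close> from \<open>K\<close> by the inverse reduction.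
  The reductions introduce no new vertices, so that each homeomorphism class of results has a
  canonical representative on the vertices of \<open>K\<close>.\<close>

definition three_splitting_triode :: "'a set set \<Rightarrow> 'a set set \<Rightarrow> bool" where
  "three_splitting_triode H K \<longleftrightarrow> (\<exists>u v. triode_detecting K u v \<and> H = contract K u v)"

definition four_splitting :: "'a set set \<Rightarrow> 'a set set \<Rightarrow> bool" where
  "four_splitting H K \<longleftrightarrow> (\<exists>u v. four_contractible K u v \<and> H = contract K u v)"

definition flag_addition :: "'a set set \<Rightarrow> 'a set set \<Rightarrow> bool" where
  "flag_addition H K \<longleftrightarrow>
     (\<exists>x x1 a b x2. flag K x x1 a b x2 \<and> H = delete_verts K {a, b, x} \<and> disk_class_4 H)"

definition octahedron_addition :: "'a set set \<Rightarrow> 'a set set \<Rightarrow> bool" where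
  "octahedron_addition H K \<longleftrightarrow>
     (\<exists>v1 v2 v3 a1 a2 a3.
        octahedron_component K v1 v2 v3 a1 a2 a3 \<and>
          H = remove_octahedron K v1 v2 v3 a1 a2 a3 \<and> disk_class_4 H \<or>
        external_octahedron K v1 v2 v3 a1 a2 a3 \<and>
          H = delete_verts K {a1, v1, v2, v3} \<and> disk_class_4 H)"

definition generating_step :: "'a set set \<Rightarrow> 'a set set \<Rightarrow> bool" where
  "generating_step H K \<longleftrightarrow>
     disk_class_4 H \<and> disk_class_4 K \<and>
     (three_splitting_triode H K \<or> flag_addition H K \<or>
      four_splitting H K \<or> octahedron_addition H K)"

end

theory Submission
  imports Defs "HOL-Complex_Analysis.Contour_Integration"
begin

text \<open>A disk triangulation is characterised combinatorially: edges lie on at most two faces, links and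
  the complex are connected, there is a boundary edge, and every integral 1-cocycle is a coboundary.
  The cocycle condition comes from logarithms of circle-valued maps on the disk, and it passes to
  contracted and reduced complexes by pulling cocycles back along simplicial maps.  Conversely it
  splits such a complex along chords into triangles, which are glued back to a topological disk.

  Coning off the boundary turns the degree conditions into minimum degree 4 on the sphere.  Call a
  vertex small if its degree is 4 there.  An edge in no chord or non-facial 3-cycle can be contracted
  within the class unless one of its opposite vertices is small.  If all 3-cycles are facial, the
  vertex opposite to a boundary edge is therefore small and, as it is inner, so are two consecutive
  neighbours of it; this forces a flag.  Otherwise the edges inside an innermost non-facial 3-cycle
  satisfy the same condition, and three mutually adjacent small vertices inside form an octahedron
  component on that 3-cycle.  If the flag or octahedron cannot be removed, an edge leaving it at a
  vertex of too small degree is contractible.\<close>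

section \<open>Edges and faces\<close>

text \<open>A triangulated disk is defined by a homeomorphism, which says little about what a
  contraction or a deletion leaves behind; the combinatorial conditions are chosen because each of
  them can be pulled back along a simplicial map. Jordan curve arguments are replaced in the same
  spirit: a chord separates because of a jump of an integral potential, and the inside of a 3-cycle
  is a set of faces whose boundary modulo two is that cycle, innermost meaning with the fewest
  faces.

  In coned degrees a contraction lowers only the two opposite vertices, by one each, and the merged
  vertex gets the sum of two degrees minus four; this singles out small vertices. Every spoke of a
  small inner vertex has a small opposite vertex, and one small vertex from each of the two pairs of
  opposite link vertices gives two consecutive ones. Removing a flag or an octahedron costs the
  vertices it hangs on two neighbours each, or three if an outer corner goes too. This is the origin
  of the degree bounds five and six that are secured before a removal.\<close>

definition adj :: "'a set set \<Rightarrow> 'a \<Rightarrow> 'a \<Rightarrow> bool" where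
  "adj K x y \<longleftrightarrow> x \<noteq> y \<and> {x, y} \<in> K"

text \<open>Ordered triples instead of face sets: the third vertex of a face at an edge becomes a
  variable, and the link of a vertex becomes a binary relation on its neighbours.\<close>

definition tri :: "'a set set \<Rightarrow> 'a \<Rightarrow> 'a \<Rightarrow> 'a \<Rightarrow> bool" where
  "tri K x y z \<longleftrightarrow> x \<noteq> y \<and> y \<noteq> z \<and> x \<noteq> z \<and> {x, y, z} \<in> K"

definition bd_edge :: "'a set set \<Rightarrow> 'a \<Rightarrow> 'a \<Rightarrow> bool" where
  "bd_edge K x y \<longleftrightarrow> (\<exists>!z. tri K x y z)"

definition bd_vert :: "'a set set \<Rightarrow> 'a \<Rightarrow> bool" where
  "bd_vert K x \<longleftrightarrow> (\<exists>y. bd_edge K x y)"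

lemma adj_sym: "adj K x y \<Longrightarrow> adj K y x"
  by (auto simp: adj_def insert_commute)

lemma adj_commute: "adj K x y \<longleftrightarrow> adj K y x"
  by (auto simp: adj_def insert_commute)

lemma tri_swap12: "tri K x y z \<longleftrightarrow> tri K y x z"
  by (auto simp: tri_def insert_commute)

lemma tri_swap23: "tri K x y z \<longleftrightarrow> tri K x z y"
  by (auto simp: tri_def insert_commute)

lemma tri_perms:
  assumes "tri K x y z"
  shows "tri K y x z" "tri K x z y" "tri K y z x" "tri K z x y" "tri K z y x"
  using assms tri_swap12 tri_swap23 by metis+

lemma tri_distinct:
  assumes "tri K x y z"
  shows "x \<noteq> y" "y \<noteq> z" "x \<noteq> z" "y \<noteq> x" "z \<noteq> y" "z \<noteq> x"
  using assms by (auto simp: tri_def)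

lemma adj_distinct: "adj K x y \<Longrightarrow> x \<noteq> y"
  by (simp add: adj_def)

lemma bd_edge_commute: "bd_edge K x y \<longleftrightarrow> bd_edge K y x"
  using tri_swap12 unfolding bd_edge_def by metis

lemma edges_adj: "{x, y} \<in> edges K \<longleftrightarrow> adj K x y"
  by (auto simp: edges_def adj_def card_2_iff doubleton_eq_iff)

lemma edges_adjE:
  assumes "e \<in> edges K" obtains x y where "e = {x, y}" "adj K x y"
  using assms by (auto simp: edges_def adj_def card_2_iff)

lemma faces_tri: "{x, y, z} \<in> faces K \<longleftrightarrow> tri K x y z"
proof -
  have "card {x, y, z} = 3 \<longleftrightarrow> x \<noteq> y \<and> y \<noteq> z \<and> x \<noteq> z"
    by (auto simp: card_insert_if)
  then show ?thesis by (auto simp: faces_def tri_def)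
qed

lemma faces_triE:
  assumes "t \<in> faces K" obtains x y z where "t = {x, y, z}" "tri K x y z"
  using assms by (auto simp: faces_def tri_def card_3_iff)

lemma neighbours_adj: "neighbours K x = {y. adj K x y}"
  by (simp add: neighbours_def edges_adj)

lemma pure_2_complex_subset:
  "\<lbrakk>pure_2_complex K; s \<in> K; t \<noteq> {}; t \<subseteq> s\<rbrakk> \<Longrightarrow> t \<in> K"
  unfolding pure_2_complex_def by blast

lemma pure_2_complex_face:
  assumes "pure_2_complex K" "s \<in> K"
  obtains x y z where "tri K x y z" "s \<subseteq> {x, y, z}"
proof -
  obtain t where t: "t \<in> K" "s \<subseteq> t" "card t = 3"
    using assms unfolding pure_2_complex_def by metis
  then have "t \<in> faces K" by (simp add: faces_def)
  then show thesis using t that by (metis faces_triE)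
qed

lemma pure_2_complex_tri_adj:
  assumes "pure_2_complex K" "tri K x y z"
  shows "adj K x y" "adj K y z" "adj K x z" "adj K y x" "adj K z y" "adj K z x"
  using assms pure_2_complex_subset[OF assms(1)] unfolding adj_def tri_def
  by (metis insert_not_empty insert_subset insertCI empty_subsetI)+

lemma pure_2_complex_adj_tri:
  assumes "pure_2_complex K" "adj K x y"
  obtains z where "tri K x y z"
proof -
  have xy: "{x, y} \<in> K" "x \<noteq> y" using assms by (auto simp: adj_def)
  obtain a b c where t: "tri K a b c" "{x, y} \<subseteq> {a, b, c}"
    by (rule pure_2_complex_face[OF assms(1) xy(1)])
  have "tri K x y c \<or> tri K x y b \<or> tri K x y a"
    using t xy tri_perms[OF t(1)] by auto
  then show thesis using that by blast
qed

lemma verts_iff: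
  assumes "pure_2_complex K" shows "x \<in> verts K \<longleftrightarrow> {x} \<in> K"
  using pure_2_complex_subset[OF assms] unfolding verts_def by blast

lemma vert_adj:
  assumes "pure_2_complex K" "x \<in> verts K"
  obtains y where "adj K x y"
proof -
  have x: "{x} \<in> K" using assms verts_iff[OF assms(1)] by simp
  obtain a b c where t: "tri K a b c" "{x} \<subseteq> {a, b, c}"
    by (rule pure_2_complex_face[OF assms(1) x])
  then have "x = a \<or> x = b \<or> x = c" by simp
  then show thesis using that pure_2_complex_tri_adj[OF assms(1) t(1)] by blast
qed

lemma adj_verts: "adj K x y \<Longrightarrow> x \<in> verts K"
  by (auto simp: adj_def verts_def)

lemma tri_verts: "tri K x y z \<Longrightarrow> x \<in> verts K"
  by (auto simp: tri_def verts_def)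

lemma finite_verts:
  assumes "pure_2_complex K" shows "finite (verts K)"
proof -
  have "finite s" if s: "s \<in> K" for s
  proof -
    obtain x y z where "s \<subseteq> {x, y, z}" by (rule pure_2_complex_face[OF assms s])
    then show ?thesis by (meson finite.emptyI finite_insert finite_subset)
  qed
  then show ?thesis using assms unfolding verts_def pure_2_complex_def by blast
qed

lemma finite_neighbours: "pure_2_complex K \<Longrightarrow> finite (neighbours K x)"
  by (rule finite_subset[OF _ finite_verts]) (auto simp: neighbours_adj adj_commute dest: adj_verts)

text \<open>Translates the face count in the definition of \<open>boundary\<close> into a count of
  third vertices, as used in \<open>bd_edge\<close>.\<close>

lemma edge_faces_bij:
  assumes "x \<noteq> y"
  shows "bij_betw (\<lambda>z. {x, y, z}) {z. tri K x y z} {t \<in> faces K. {x, y} \<subseteq> t}"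
proof (rule bij_betwI')
  fix z z' assume "z \<in> {z. tri K x y z}" "z' \<in> {z. tri K x y z}"
  then show "({x, y, z} = {x, y, z'}) = (z = z')" by (auto simp: tri_def)
next
  fix z assume "z \<in> {z. tri K x y z}"
  then show "{x, y, z} \<in> {t \<in> faces K. {x, y} \<subseteq> t}" by (auto simp: faces_tri)
next
  fix t assume t: "t \<in> {t \<in> faces K. {x, y} \<subseteq> t}"
  then obtain a b c where "t = {a, b, c}" "tri K a b c" by (auto elim: faces_triE)
  moreover have "{x, y} \<subseteq> t" using t by blast
  ultimately have "t = {x, y, c} \<and> tri K x y c \<or> t = {x, y, b} \<and> tri K x y b \<or> t = {x, y, a} \<and> tri K x y a"
    using assms tri_perms[of K a b c] by (auto simp: insert_commute)
  then show "\<exists>z\<in>{z. tri K x y z}. t = {x, y, z}" by blast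
qed

lemma card_edge_faces: "x \<noteq> y \<Longrightarrow> card {t \<in> faces K. {x, y} \<subseteq> t} = card {z. tri K x y z}"
  using bij_betw_same_card[OF edge_faces_bij] by metis

lemma bd_edge_card: "bd_edge K x y \<longleftrightarrow> card {z. tri K x y z} = 1"
  unfolding bd_edge_def One_nat_def card_1_singleton_iff
  by (auto simp: set_eq_iff)

lemma bd_edge_adj: "pure_2_complex K \<Longrightarrow> bd_edge K x y \<Longrightarrow> adj K x y"
  by (auto simp: bd_edge_def dest: pure_2_complex_tri_adj(1))

lemma boundary_eq:
  assumes "pure_2_complex K"
  shows "boundary K = complex_of {{x, y} |x y. bd_edge K x y}"
proof -
  have "{e \<in> edges K. card {t \<in> faces K. e \<subseteq> t} = 1} = {{x, y} |x y. bd_edge K x y}" (is "?A = ?B")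
  proof (intro set_eqI iffI)
    fix e assume e: "e \<in> ?A"
    then obtain x y where "e = {x, y}" "adj K x y" by (auto elim: edges_adjE)
    then show "e \<in> ?B" using e card_edge_faces[of x y K] by (auto simp: bd_edge_card adj_def)
  next
    fix e assume "e \<in> ?B"
    then obtain x y where e: "e = {x, y}" "bd_edge K x y" by blast
    then have "adj K x y" using assms bd_edge_adj by metis
    then show "e \<in> ?A" using e card_edge_faces[of x y K] by (auto simp: bd_edge_card adj_def edges_def)
  qed
  then show ?thesis unfolding boundary_def by simp
qed

lemma boundary_edge_iff:
  assumes "pure_2_complex K" "x \<noteq> y"
  shows "{x, y} \<in> boundary K \<longleftrightarrow> bd_edge K x y"
proof
  assume "{x, y} \<in> boundary K"
  then obtain a b where ab: "{x, y} \<subseteq> {a, b}" "bd_edge K a b"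
    unfolding boundary_eq[OF assms(1)] complex_of_def by blast
  then have "x = a \<and> y = b \<or> x = b \<and> y = a" using assms(2) by auto
  then show "bd_edge K x y" using ab bd_edge_commute[of K a b] by auto
next
  assume "bd_edge K x y"
  then show "{x, y} \<in> boundary K"
    unfolding boundary_eq[OF assms(1)] complex_of_def by blast
qed

lemma boundary_verts_iff:
  assumes "pure_2_complex K"
  shows "x \<in> verts (boundary K) \<longleftrightarrow> bd_vert K x"
proof
  assume "x \<in> verts (boundary K)"
  then obtain a b where ab: "x \<in> {a, b}" "bd_edge K a b"
    unfolding boundary_eq[OF assms(1)] complex_of_def verts_def by blast
  then show "bd_vert K x"
    unfolding bd_vert_def using bd_edge_commute[of K a b] by auto
next
  assume "bd_vert K x"
  then obtain y where y: "bd_edge K x y" unfolding bd_vert_def by blast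
  then have "{x, y} \<in> boundary K"
    unfolding boundary_eq[OF assms(1)] complex_of_def by blast
  then show "x \<in> verts (boundary K)" unfolding verts_def by blast
qed

section \<open>Combinatorial disks\<close>

text \<open>An integral simplicial 1-cocycle as a function on ordered pairs; only values on adjacent
  pairs are constrained.\<close>

definition cocycle :: "'a set set \<Rightarrow> ('a \<Rightarrow> 'a \<Rightarrow> int) \<Rightarrow> bool" where
  "cocycle K c \<longleftrightarrow> (\<forall>x y. adj K x y \<longrightarrow> c x y = - c y x) \<and>
     (\<forall>x y z. tri K x y z \<longrightarrow> c x y + c y z + c z x = 0)"

text \<open>Connectedness, of the complex and of the links, is expressed by locally constant predicates
  being constant; the last condition is the vanishing of the first integral cohomology.\<close>

definition comb_disk :: "'a set set \<Rightarrow> bool" where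
  "comb_disk K \<longleftrightarrow> pure_2_complex K \<and>
     (\<forall>x y a b c. tri K x y a \<longrightarrow> tri K x y b \<longrightarrow> tri K x y c \<longrightarrow> a = b \<or> a = c \<or> b = c) \<and>
     (\<forall>v P. (\<forall>x y. tri K v x y \<longrightarrow> (P x \<longleftrightarrow> P y)) \<longrightarrow> (\<forall>x y. adj K v x \<longrightarrow> adj K v y \<longrightarrow> (P x \<longleftrightarrow> P y))) \<and>
     (\<forall>P. (\<forall>x y. adj K x y \<longrightarrow> (P x \<longleftrightarrow> P y)) \<longrightarrow> (\<forall>x\<in>verts K. \<forall>y\<in>verts K. P x \<longleftrightarrow> P y)) \<and>
     (\<exists>x y. bd_edge K x y) \<and>
     (\<forall>c. cocycle K c \<longrightarrow> (\<exists>f. \<forall>x y. adj K x y \<longrightarrow> c x y = f y - f x))"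

lemma comb_disk_pure: "comb_disk K \<Longrightarrow> pure_2_complex K"
  by (simp add: comb_disk_def)

lemma comb_disk_two_faces:
  assumes "comb_disk K" "tri K x y a" "tri K x y b" "tri K x y c"
  shows "a = b \<or> a = c \<or> b = c"
proof -
  have "\<forall>x y a b c. tri K x y a \<longrightarrow> tri K x y b \<longrightarrow> tri K x y c \<longrightarrow> a = b \<or> a = c \<or> b = c"
    using assms(1) unfolding comb_disk_def by (elim conjE)
  then show ?thesis using assms(2-) by metis
qed

lemma comb_disk_link:
  assumes "comb_disk K" "\<And>x y. tri K v x y \<Longrightarrow> P x \<longleftrightarrow> P y" "adj K v x" "adj K v y"
  shows "P x \<longleftrightarrow> P y"
proof -
  have *: "(\<forall>x y. tri K v x y \<longrightarrow> (P x \<longleftrightarrow> P y)) \<longrightarrow> (\<forall>x y. adj K v x \<longrightarrow> adj K v y \<longrightarrow> (P x \<longleftrightarrow> P y))"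
    using assms(1) unfolding comb_disk_def by (elim conjE allE)
  have "\<forall>x y. tri K v x y \<longrightarrow> (P x \<longleftrightarrow> P y)" using assms(2) by (intro allI impI)
  from mp[OF * this, rule_format, OF assms(3,4)] show ?thesis .
qed

lemma comb_disk_connected:
  assumes "comb_disk K" "\<And>x y. adj K x y \<Longrightarrow> P x \<longleftrightarrow> P y" "x \<in> verts K" "y \<in> verts K"
  shows "P x \<longleftrightarrow> P y"
proof -
  have *: "(\<forall>x y. adj K x y \<longrightarrow> (P x \<longleftrightarrow> P y)) \<longrightarrow> (\<forall>x\<in>verts K. \<forall>y\<in>verts K. P x \<longleftrightarrow> P y)"
    using assms(1) unfolding comb_disk_def by (elim conjE allE)
  have "\<forall>x y. adj K x y \<longrightarrow> (P x \<longleftrightarrow> P y)" using assms(2) by (intro allI impI)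
  from mp[OF * this, rule_format, OF assms(3,4)] show ?thesis .
qed

lemma comb_disk_bd_edge:
  assumes "comb_disk K" obtains x y where "bd_edge K x y"
proof -
  have "\<exists>x y. bd_edge K x y"
    using assms(1) unfolding comb_disk_def by (elim conjE)
  then show thesis using that by auto
qed

lemma comb_disk_cocycle:
  assumes "comb_disk K" "cocycle K c"
  obtains f where "\<And>x y. adj K x y \<Longrightarrow> c x y = f y - f x"
proof -
  have "cocycle K c \<longrightarrow> (\<exists>f. \<forall>x y. adj K x y \<longrightarrow> c x y = f y - f x)"
    using assms(1) unfolding comb_disk_def by (elim conjE allE)
  then show thesis using assms(2) that by auto
qed

section \<open>From disks to combinatorial disks\<close>

lemma continuous_on_coordinate [continuous_intros]: "continuous_on S (\<lambda>p::'a \<Rightarrow> real. p v)"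
  by (rule continuous_on_subset[OF continuous_on_product_coordinates]) simp

lemma realization_support: "p \<in> realization K \<Longrightarrow> {v. p v \<noteq> 0} \<in> K"
  by (simp add: realization_def)

lemma realization_nonneg: "p \<in> realization K \<Longrightarrow> 0 \<le> p v"
  by (simp add: realization_def)

text \<open>The simplex \<open>s\<close> may be larger than the support of \<open>p\<close>, so
  explicit parametrisations need no case distinction at the faces of \<open>s\<close>.\<close>

lemma realizationI:
  assumes "\<And>v. 0 \<le> p v" "pure_2_complex K" "s \<in> K" "\<And>v. v \<notin> s \<Longrightarrow> p v = 0" "sum p s = 1"
  shows "p \<in> realization K"
proof -
  have fin: "finite s"
    using pure_2_complex_face[OF assms(2,3)] by (meson finite.emptyI finite_insert finite_subset)
  have sub: "{v. p v \<noteq> 0} \<subseteq> s" using assms(4) by blast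
  have "sum p {v. p v \<noteq> 0} = sum p s"
    by (rule sum.mono_neutral_left) (use fin sub in auto)
  then have 1: "sum p {v. p v \<noteq> 0} = 1" using assms by simp
  then have "{v. p v \<noteq> 0} \<noteq> {}" by force
  then have "{v. p v \<noteq> 0} \<in> K" by (rule pure_2_complex_subset[OF assms(2,3) _ sub])
  then show ?thesis using 1 assms(1) unfolding realization_def by simp
qed

lemma realization_sum_eq:
  assumes "p \<in> realization K" "finite A" "{v. p v \<noteq> 0} \<subseteq> A"
  shows "sum p A = 1"
proof -
  have "sum p {v. p v \<noteq> 0} = sum p A"
    by (rule sum.mono_neutral_left) (use assms in auto)
  then show ?thesis using assms by (simp add: realization_def)
qed

lemma realization_sum_verts:
  assumes "pure_2_complex K" "p \<in> realization K"
  shows "sum p (verts K) = 1"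
  using assms finite_verts realization_support[OF assms(2)]
  by (intro realization_sum_eq[OF assms(2)]) (auto simp: verts_def)

lemma realization_support_adj:
  assumes "pure_2_complex K" "p \<in> realization K" "p x \<noteq> 0" "p y \<noteq> 0" "x \<noteq> y"
  shows "adj K x y"
  using pure_2_complex_subset[OF assms(1) realization_support[OF assms(2)], of "{x, y}"] assms
  by (auto simp: adj_def)

definition point :: "'a \<Rightarrow> 'a \<Rightarrow> real" where
  "point v = (\<lambda>w. if w = v then 1 else 0)"

lemma point_realization: "pure_2_complex K \<Longrightarrow> v \<in> verts K \<Longrightarrow> point v \<in> realization K"
  by (rule realizationI[of _ _ "{v}"]) (auto simp: point_def verts_iff)

definition segment_point :: "'a \<Rightarrow> 'a \<Rightarrow> real \<Rightarrow> 'a \<Rightarrow> real" where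
  "segment_point x y t = (\<lambda>w. if w = x then 1 - t else if w = y then t else 0)"

lemma segment_point_realization:
  assumes "pure_2_complex K" "adj K x y" "0 \<le> t" "t \<le> 1"
  shows "segment_point x y t \<in> realization K"
  by (rule realizationI[of _ _ "{x, y}"]) (use assms in \<open>auto simp: segment_point_def adj_def\<close>)

lemma continuous_on_segment_point: "continuous_on S (segment_point x y)"
  unfolding segment_point_def
proof (intro continuous_on_coordinatewise_then_product)
  fix w show "continuous_on S (\<lambda>t. if w = x then 1 - t else if w = y then t else 0)"
    by (cases "w = x"; cases "w = y") (auto intro!: continuous_intros)
qed

lemma segment_point_ends: "x \<noteq> y \<Longrightarrow> segment_point x y 0 = point x" "x \<noteq> y \<Longrightarrow> segment_point x y 1 = point y"
  by (auto simp: segment_point_def point_def)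

lemma disk_realization_connected:
  assumes "homeomorphism (realization K) (cball (0::complex) 1) h g"
  shows "connected (realization K)"
  using assms homeomorphic_connectedness[of "realization K" "cball (0::complex) 1"]
  by (auto simp: homeomorphic_def)

text \<open>The indicator of \<open>P\<close> is interpolated linearly over the realization. As the
  support of a point is a clique, on which \<open>P\<close> is constant, the interpolation takes
  only the values 0 and 1; it is continuous on a connected set, hence constant.\<close>

lemma disk_connected:
  assumes K: "pure_2_complex K" and con: "connected (realization K)"
    and P: "\<And>x y. adj K x y \<Longrightarrow> P x \<longleftrightarrow> P y" and xy: "x \<in> verts K" "y \<in> verts K"
  shows "P x \<longleftrightarrow> P y"
proof -
  define F where "F p = (\<Sum>v\<in>verts K. p v * (if P v then 1 else 0))" for p :: "'a \<Rightarrow> real"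
  have fin: "finite (verts K)" using K by (rule finite_verts)
  have F: "F p = (if P x then 1 else 0)" if p: "p \<in> realization K" "p x \<noteq> 0" for p x
  proof -
    have "F p = (\<Sum>v\<in>verts K. p v * (if P x then 1 else 0))"
      unfolding F_def
    proof (rule sum.cong[OF refl])
      fix v
      show "p v * (if P v then 1 else 0) = p v * (if P x then 1 else 0)"
      proof (cases "p v = 0 \<or> v = x")
        case False
        then have "P v = P x" using realization_support_adj[OF K p(1)] p(2) P by metis
        then show ?thesis by simp
      qed auto
    qed
    then show ?thesis
      using realization_sum_verts[OF K p(1)] by (simp add: sum_distrib_right[symmetric])
  qed
  have ne: "\<exists>x. p x \<noteq> 0" if "p \<in> realization K" for p
    using that unfolding realization_def by (metis (mono_tags, lifting) mem_Collect_eq sum.neutral zero_neq_one)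
  have val: "F p \<in> {0, 1}" if "p \<in> realization K" for p
    using ne[OF that] F[OF that] by auto
  have "continuous_on (realization K) F"
    unfolding F_def by (intro continuous_intros)
  then have "F constant_on realization K"
  proof (rule continuous_discrete_range_constant[OF con])
    fix p assume p: "p \<in> realization K"
    show "\<exists>e>0. \<forall>q. q \<in> realization K \<and> F q \<noteq> F p \<longrightarrow> e \<le> norm (F q - F p)"
      using val[OF p] by (intro exI[of _ 1]) (auto dest!: val)
  qed
  then have "F (point x) = F (point y)"
    using point_realization[OF K] xy unfolding constant_on_def by metis
  moreover have "F (point x) = (if P x then 1 else 0)" "F (point y) = (if P y then 1 else 0)"
    using F[OF point_realization[OF K xy(1)], of x] F[OF point_realization[OF K xy(2)], of y]
    by (auto simp: point_def)
  ultimately show ?thesis by (auto split: if_splits)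
qed

text \<open>The neighbourhood is convex with nonempty interior, so it has dimension two, and a
  convex set of that dimension stays connected when a point is taken out.\<close>

lemma connected_punctured_disk_nbhd:
  fixes z :: complex
  assumes "z \<in> cball 0 1" "0 < e"
  shows "connected (cball 0 1 \<inter> ball z e - {z})"
proof -
  have "convex (cball 0 1 \<inter> ball z e)" by (intro convex_Int) auto
  moreover have "z \<in> closure (ball 0 1)" using assms by simp
  then have "ball 0 1 \<inter> ball z e \<noteq> {}"
    using assms closure_approachable[of z "ball 0 1"] by (metis disjoint_iff dist_commute mem_ball)
  then have "interior (cball 0 1 \<inter> ball z e) \<noteq> {}"
    by (simp)
  then have "aff_dim (cball 0 1 \<inter> ball z e) = int (DIM(complex))"
    by (rule aff_dim_nonempty_interior)
  ultimately show ?thesis by (intro connected_punctured_convex) auto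
qed

text \<open>Near \<open>v\<close> the total weight of the link vertices with \<open>P\<close> and
  that of those without \<open>P\<close> cannot both be positive, and away from \<open>v\<close>
  itself one of them is. If both kinds of neighbours existed, these two open conditions would
  disconnect a small punctured neighbourhood of \<open>v\<close>, which corresponds to a punctured
  part of the disk.\<close>

lemma disk_link_connected:
  assumes K: "pure_2_complex K" and hom: "homeomorphism (realization K) (cball (0::complex) 1) h g"
    and P: "\<And>x y. tri K v x y \<Longrightarrow> P x \<longleftrightarrow> P y" and xy: "adj K v x" "adj K v y"
  shows "P x \<longleftrightarrow> P y"
proof (rule ccontr)
  assume neq: "\<not> (P x \<longleftrightarrow> P y)"
  define O1 where "O1 = {p \<in> realization K. p v > 0}"
  define A where "A Q p = (\<Sum>w\<in>{w \<in> verts K. w \<noteq> v \<and> Q w}. p w)" for Q and p :: "'a \<Rightarrow> real"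
  have fin: "finite (verts K)" using K by (rule finite_verts)
  have v: "v \<in> verts K" using xy adj_verts by metis
  have cont: "continuous_on S (A Q)" for S Q unfolding A_def by (intro continuous_intros)
  have disj: "\<not> (A P p > 0 \<and> A (\<lambda>w. \<not> P w) p > 0)" if p: "p \<in> O1" for p
  proof
    assume "A P p > 0 \<and> A (\<lambda>w. \<not> P w) p > 0"
    then obtain a b where ab: "a \<noteq> v" "b \<noteq> v" "P a" "\<not> P b" "p a \<noteq> 0" "p b \<noteq> 0"
      unfolding A_def by (metis (mono_tags, lifting) less_numeral_extra(3) mem_Collect_eq sum.neutral)
    have "{v, a, b} \<in> K"
      by (rule pure_2_complex_subset[OF K realization_support[of p]]) (use ab p in \<open>auto simp: O1_def\<close>)
    then have "tri K v a b" using ab by (auto simp: tri_def)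
    then show False using P[of a b] ab by simp
  qed
  have cover: "p = point v \<or> A P p > 0 \<or> A (\<lambda>w. \<not> P w) p > 0" if p: "p \<in> realization K" for p
  proof (rule ccontr)
    assume *: "\<not> ?thesis"
    have nn: "A Q p \<ge> 0" for Q unfolding A_def using p by (intro sum_nonneg) (auto simp: realization_def)
    have z: "A P p = 0" "A (\<lambda>w. \<not> P w) p = 0" using * nn[of P] nn[of "\<lambda>w. \<not> P w"] by auto
    have z': "p w = 0" if "w \<noteq> v" for w
    proof (cases "w \<in> verts K")
      case True
      then show ?thesis using z that fin p unfolding A_def
        by (subst (asm) sum_nonneg_eq_0_iff; (subst (asm) sum_nonneg_eq_0_iff)?) (auto simp: realization_def)
    next
      case False
      then show ?thesis using p realization_support[OF p] by (auto simp: verts_def)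
    qed
    have "sum p (verts K) = p v"
      using z' v fin by (subst sum.remove[of _ v]) (auto intro!: sum.neutral)
    then have "p v = 1" using realization_sum_verts[OF K p] by simp
    then have "p = point v" using z' by (auto simp: point_def)
    then show False using * by simp
  qed
  have conth: "continuous_on (realization K) h" "continuous_on (cball 0 1) g"
    and im: "h ` realization K = cball 0 1" "g ` cball 0 1 = realization K"
    and inv: "\<And>p. p \<in> realization K \<Longrightarrow> g (h p) = p" "\<And>z. z \<in> cball 0 1 \<Longrightarrow> h (g z) = z"
    using hom unfolding homeomorphism_def by auto
  have pv: "point v \<in> realization K" using point_realization[OF K v] .
  define z0 where "z0 = h (point v)"
  have z0: "z0 \<in> cball 0 1" using pv im z0_def by blast
  \<comment> \<open>The radius \<open>e\<close> is chosen so that the coordinate of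
    \<open>v\<close>, which is 1 at the centre, changes by less than 1; the neighbourhood then lies
    in the open star of \<open>v\<close>.\<close>
  have "continuous_on (cball 0 1) (\<lambda>z. g z v)"
    using continuous_on_compose2[OF continuous_on_coordinate conth(2)] by blast
  then obtain e where e: "e > 0" "\<And>z. z \<in> cball 0 1 \<Longrightarrow> dist z z0 < e \<Longrightarrow> \<bar>g z v - g z0 v\<bar> < 1"
    using z0 unfolding continuous_on_iff dist_real_def by (metis zero_less_one)
  have gz0: "g z0 = point v" using inv(1)[OF pv] z0_def by simp
  define N where "N = cball 0 1 \<inter> ball z0 e - {z0}"
  have NO: "g z \<in> O1" "g z \<noteq> point v" if "z \<in> N" for z
  proof -
    have z: "z \<in> cball 0 1" "dist z z0 < e" "z \<noteq> z0" using that by (auto simp: N_def dist_commute)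
    have "\<bar>g z v - 1\<bar> < 1" using e(2)[OF z(1,2)] gz0 by (simp add: point_def)
    then show "g z \<in> O1" using z im unfolding O1_def by auto
    show "g z \<noteq> point v" using z inv(2) z0_def by metis
  qed
  have conN: "connected N" unfolding N_def using z0 e by (intro connected_punctured_disk_nbhd) auto
  \<comment> \<open>Points of the edge \<open>vw\<close> close to \<open>v\<close> lie in the
    neighbourhood and give \<open>w\<close> a positive weight.\<close>
  have hit: "\<exists>z\<in>N. A Q (g z) > 0" if w: "adj K v w" "Q w" for Q w
  proof -
    have vw: "v \<noteq> w" using w by (auto simp: adj_def)
    have sr: "segment_point v w t \<in> realization K" if "0 \<le> t" "t \<le> 1" for t
      using segment_point_realization[OF K w(1)] that .
    have "continuous_on {0..1} (\<lambda>t. h (segment_point v w t))"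
      by (rule continuous_on_compose2[OF conth(1) continuous_on_segment_point]) (use sr in auto)
    then obtain d where d: "d > 0" "\<And>t. t \<in> {0..1} \<Longrightarrow> dist t 0 < d \<Longrightarrow> dist (h (segment_point v w t)) (h (segment_point v w 0)) < e"
      using e(1) unfolding continuous_on_iff by (metis atLeastAtMost_iff order_refl zero_le_one)
    define t where "t = min (1/2) (d/2)"
    have t: "0 < t" "t \<le> 1" "dist t 0 < d" using d(1) by (auto simp: t_def dist_real_def)
    define z where "z = h (segment_point v w t)"
    have gz: "g z = segment_point v w t" using inv(1) sr t z_def by simp
    have z1: "z \<in> cball 0 1" using im sr[of t] t z_def by auto
    have "dist z z0 < e" using d(2)[of t] t segment_point_ends(1)[OF vw] z_def z0_def by auto
    moreover have "segment_point v w t w \<noteq> point v w" using t vw by (simp add: segment_point_def point_def)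
    then have "z \<noteq> z0" using gz gz0 by metis
    ultimately have "z \<in> N" using z1 by (simp add: N_def dist_commute)
    moreover have "w \<in> verts K" using w adj_sym adj_verts by metis
    then have "A Q (g z) \<ge> g z w" unfolding A_def using fin vw w t gz
      by (intro member_le_sum) (auto simp: segment_point_def)
    ultimately show ?thesis using gz t vw by (intro bexI[of _ z]) (auto simp: segment_point_def)
  qed
  define B where "B Q = {z \<in> N. A Q (g z) > 0}" for Q
  have Ncont: "continuous_on N (\<lambda>z. A Q (g z))" for Q
    by (rule continuous_on_compose2[OF cont continuous_on_subset[OF conth(2)]]) (auto simp: N_def)
  have op: "openin (top_of_set N) (B Q)" for Q
    using continuous_openin_preimage_gen[OF Ncont[of Q], of "{0<..}"]
    by (simp add: B_def vimage_def Int_def)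
  have "B P \<inter> B (\<lambda>w. \<not> P w) = {}" using disj NO unfolding B_def by blast
  moreover have "N \<subseteq> B P \<union> B (\<lambda>w. \<not> P w)"
    using cover NO unfolding B_def O1_def by blast
  moreover have "B P \<noteq> {}" "B (\<lambda>w. \<not> P w) \<noteq> {}"
    using hit[of x P] hit[of y P] hit[of x "\<lambda>w. \<not> P w"] hit[of y "\<lambda>w. \<not> P w"] xy neq
    unfolding B_def by blast+
  ultimately show False using conN op[of P] op[of "\<lambda>w. \<not> P w"] unfolding connected_openin by blast
qed

text \<open>Two faces at \<open>xy\<close> already fill a planar open set around the midpoint of
  \<open>xy\<close>, so by invariance of domain their image is a neighbourhood in the disk. Points
  of a third face approach the same midpoint and would have to lie in the first two.\<close>

lemma disk_two_faces:
  assumes K: "pure_2_complex K" and hom: "homeomorphism (realization K) (cball (0::complex) 1) h g"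
    and t: "tri K x y a" "tri K x y b" "tri K x y c"
  shows "a = b \<or> a = c \<or> b = c"
proof (rule ccontr)
  assume neq: "\<not> ?thesis"
  have conth: "continuous_on (realization K) h"
    and inv: "\<And>p. p \<in> realization K \<Longrightarrow> g (h p) = p"
    using hom unfolding homeomorphism_def by auto
  have d: "x \<noteq> y" "x \<noteq> a" "y \<noteq> a" "x \<noteq> b" "y \<noteq> b" "x \<noteq> c" "y \<noteq> c" "a \<noteq> b" "a \<noteq> c" "b \<noteq> c"
    using t neq by (auto simp: tri_def)
  \<comment> \<open>A planar chart of the two faces: the real part runs along \<open>xy\<close>, and
    the imaginary part is the weight of \<open>a\<close> if positive and minus the weight of
    \<open>b\<close> if negative. Half of that weight is taken from \<open>x\<close> and half from
    \<open>y\<close>, so that the coordinates still sum to 1.\<close>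
  define psi where "psi z w = (if w = x then Re z - \<bar>Im z\<bar> / 2 else if w = y then 1 - Re z - \<bar>Im z\<bar> / 2
     else if w = a then max (Im z) 0 else if w = b then max (- Im z) 0 else 0)" for z w
  define U where "U = {z. Re z - \<bar>Im z\<bar> / 2 > 0 \<and> 1 - Re z - \<bar>Im z\<bar> / 2 > 0}"
  have "open {z. Re z - \<bar>Im z\<bar> / 2 > 0}" "open {z. 1 - Re z - \<bar>Im z\<bar> / 2 > 0}"
    by (intro open_Collect_less continuous_intros; simp)+
  then have opU: "open U" unfolding U_def Collect_conj_eq by (rule open_Int)
  have psiR: "psi z \<in> realization K" if "z \<in> U" for z
  proof (cases "Im z \<ge> 0")
    case True
    show ?thesis
      by (rule realizationI[of _ _ "{x, y, a}"]) (use that d t K True in \<open>auto simp: psi_def U_def tri_def\<close>)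
  next
    case False
    show ?thesis
      by (rule realizationI[of _ _ "{x, y, b}"]) (use that d t K False in \<open>auto simp: psi_def U_def tri_def\<close>)
  qed
  have contpsi: "continuous_on S psi" for S
  proof (rule continuous_on_coordinatewise_then_product)
    fix w show "continuous_on S (\<lambda>z. psi z w)"
      unfolding psi_def
      by (cases "w = x"; cases "w = y"; cases "w = a"; cases "w = b") (auto intro!: continuous_intros)
  qed
  have injpsi: "z = z'" if "psi z = psi z'" for z z'
  proof -
    have 1: "psi z x = psi z' x" "psi z a = psi z' a" "psi z b = psi z' b" using that by auto
    have "Im z = psi z a - psi z b" "Im z' = psi z' a - psi z' b"
      using d by (auto simp: psi_def)
    then have "Im z = Im z'" using 1 by simp
    moreover have "Re z = Re z'" using 1 calculation by (simp add: psi_def)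
    ultimately show ?thesis by (simp add: complex_eq_iff)
  qed
  have "open ((h \<circ> psi) ` U)"
  proof (rule invariance_of_domain)
    show "continuous_on U (h \<circ> psi)"
      by (intro continuous_on_compose contpsi continuous_on_subset[OF conth]) (use psiR in auto)
    show "inj_on (h \<circ> psi) U"
      by (intro inj_onI) (metis comp_apply injpsi inv psiR)
  qed (fact opU)
  \<comment> \<open>The median of the third face, from the midpoint of \<open>xy\<close> towards
    \<open>c\<close>.\<close>
  define m where "m s w = (if w = x \<or> w = y then 1/2 - s/2 else if w = c then s else 0)" for s :: real and w
  have mR: "m s \<in> realization K" if "0 \<le> s" "s \<le> 1" for s
    by (rule realizationI[of _ _ "{x, y, c}"]) (use that d t K in \<open>auto simp: m_def tri_def\<close>)
  have contm: "continuous_on S m" for S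
  proof (rule continuous_on_coordinatewise_then_product)
    fix w show "continuous_on S (\<lambda>s. m s w)"
      unfolding m_def by (cases "w = x \<or> w = y"; cases "w = c") (auto intro!: continuous_intros)
  qed
  have "psi (complex_of_real (1/2)) = m 0" unfolding psi_def m_def using d by auto
  moreover have "complex_of_real (1/2) \<in> U" unfolding U_def by simp
  ultimately have m0: "h (m 0) \<in> (h \<circ> psi) ` U" by (metis comp_apply imageI)
  have "continuous_on {0..1} (\<lambda>s. h (m s))"
    by (rule continuous_on_compose2[OF conth contm]) (use mR in auto)
  moreover obtain e where e: "e > 0" "ball (h (m 0)) e \<subseteq> (h \<circ> psi) ` U"
    using m0 \<open>open ((h \<circ> psi) ` U)\<close> openE by blast
  ultimately obtain dd where dd: "dd > 0" "\<And>s. s \<in> {0..1} \<Longrightarrow> dist s 0 < dd \<Longrightarrow> dist (h (m s)) (h (m 0)) < e"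
    unfolding continuous_on_iff by (metis atLeastAtMost_iff order_refl zero_le_one)
  define s where "s = min (1/2) (dd/2)"
  have s: "0 < s" "s \<le> 1" "dist s 0 < dd" using dd(1) by (auto simp: s_def dist_real_def)
  then have "h (m s) \<in> ball (h (m 0)) e" using dd(2)[of s] by (simp add: dist_commute)
  then obtain z where z: "z \<in> U" "h (m s) = h (psi z)" using e(2) by auto
  have "m s \<in> realization K" using mR s by simp
  then have "m s = g (h (m s))" using inv by metis
  also have "\<dots> = psi z" unfolding z(2) by (rule inv[OF psiR[OF z(1)]])
  finally have "m s c = psi z c" by (rule fun_cong)
  then show False using d s by (auto simp: m_def psi_def)
qed

text \<open>The cocycle prescribes the winding along edges of a circle-valued map \<open>gam\<close>
  on the realization that sends every vertex to 1. On a disk this map has a continuous logarithm;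
  the argument divided by \<open>2 * pi\<close> is an integer at each vertex, and these integers
  form the required potential.\<close>

lemma disk_cocycle:
  assumes K: "pure_2_complex K" and hom: "homeomorphism (realization K) (cball (0::complex) 1) h g"
    and c: "cocycle K c"
  shows "\<exists>f. \<forall>x y. adj K x y \<longrightarrow> c x y = f y - f x"
proof -
  define c' where "c' x y = (if x = y then 0 else real_of_int (c x y))" for x y
  have fin: "finite (verts K)" using K by (rule finite_verts)
  \<comment> \<open>The angle of \<open>gam\<close>, in full turns, seen from the vertex
    \<open>b\<close>: the barycentric extension of the values of \<open>c\<close> on the edges at
    \<open>b\<close>. Changing \<open>b\<close> within the support of a point shifts the angle by
    the integer \<open>c' b' b\<close>, invisible after exponentiation.\<close>
  define th where "th b p = (\<Sum>w\<in>verts K. p w * c' b w)" for b and p :: "'a \<Rightarrow> real"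
  have csum: "c' b' w = c' b' b + c' b w" if "{b, b', w} \<in> K" for b b' w
  proof -
    have "b \<noteq> w \<Longrightarrow> b' \<noteq> w \<Longrightarrow> b \<noteq> b' \<Longrightarrow> c b b' + c b' w + c w b = 0"
      using that c by (auto simp: cocycle_def tri_def)
    moreover have "{b, b'} \<in> K" "{b, w} \<in> K"
      by (rule pure_2_complex_subset[OF K that]; auto)+
    then have "b \<noteq> b' \<Longrightarrow> c b b' = - c b' b" "b \<noteq> w \<Longrightarrow> c b w = - c w b"
      using c by (auto simp: cocycle_def adj_def)
    ultimately show ?thesis unfolding c'_def by auto
  qed
  have th_change: "th b' p = c' b' b + th b p" if p: "p \<in> realization K" "p b \<noteq> 0" "p b' \<noteq> 0" for p b b'
  proof -
    have "th b' p = (\<Sum>w\<in>verts K. p w * (c' b' b + c' b w))"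
      unfolding th_def
    proof (rule sum.cong[OF refl])
      fix w
      show "p w * c' b' w = p w * (c' b' b + c' b w)"
      proof (cases "p w = 0")
        case False
        have "{b, b', w} \<in> K"
          by (rule pure_2_complex_subset[OF K realization_support[OF p(1)]]) (use p False in auto)
        then show ?thesis using csum by simp
      qed simp
    qed
    also have "\<dots> = (\<Sum>w\<in>verts K. p w) * c' b' b + th b p"
      by (simp add: th_def algebra_simps sum.distrib sum_distrib_left sum_distrib_right)
    finally show ?thesis using realization_sum_verts[OF K p(1)] by simp
  qed
  define G where "G b p = exp (of_real (2 * pi * th b p) * \<i>)" for b and p :: "'a \<Rightarrow> real"
  have G_eq: "G b' p = G b p" if p: "p \<in> realization K" "p b \<noteq> 0" "p b' \<noteq> 0" for p b b'
  proof -
    have "c' b' b \<in> \<int>" by (simp add: c'_def)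
    then obtain n :: int where n: "c' b' b = of_int n" by (auto elim: Ints_cases)
    have "G b' p = exp (of_real (2 * pi * th b p) * \<i> + (2 * of_int n * pi) * \<i>)"
      unfolding G_def th_change[OF p] n by (simp add: algebra_simps)
    also have "\<dots> = G b p"
      unfolding G_def by (subst exp_plus_2pin[symmetric, of _ n]) (simp add: algebra_simps)
    finally show ?thesis .
  qed
  define B where "B p = (SOME b. p b \<noteq> (0::real))" for p :: "'a \<Rightarrow> real"
  have ne: "p (B p) \<noteq> 0" if "p \<in> realization K" for p
  proof -
    have "\<exists>x. p x \<noteq> 0"
      using that unfolding realization_def by (metis (mono_tags, lifting) mem_Collect_eq sum.neutral zero_neq_one)
    then show ?thesis unfolding B_def by (rule someI_ex)
  qed
  define gam where "gam p = G (B p) p" for p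
  have gam: "gam p = G b p" if "p \<in> realization K" "p b \<noteq> 0" for p b
    unfolding gam_def using G_eq[OF that(1) that(2) ne[OF that(1)]] .
  have contG: "continuous_on S (G b)" for S b
    unfolding G_def th_def by (intro continuous_intros)
  have contgam: "continuous_on (realization K) gam"
  proof -
    \<comment> \<open>The open stars of the vertices cover the realization, and on each of them
      \<open>gam\<close> is one of the functions \<open>G b\<close>.\<close>
    have "continuous_map (top_of_set (realization K)) euclidean gam"
    proof (rule pasting_lemma[where I = UNIV and T = "\<lambda>b. {p \<in> realization K. p b \<noteq> 0}" and f = G])
      fix b
      show "openin (top_of_set (realization K)) {p \<in> realization K. p b \<noteq> 0}"
        using continuous_openin_preimage_gen[OF continuous_on_coordinate open_Compl[OF closed_singleton[of 0]], of "realization K" b]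
        by (simp add: vimage_def Int_def)
      show "continuous_map (subtopology (top_of_set (realization K)) {p \<in> realization K. p b \<noteq> 0}) euclidean (G b)"
        using contG by (simp add: subtopology_subtopology)
    next
      fix i j p assume "p \<in> topspace (top_of_set (realization K)) \<inter> {p \<in> realization K. p i \<noteq> 0} \<inter> {p \<in> realization K. p j \<noteq> 0}"
      then show "G i p = G j p" using G_eq by simp
    next
      fix p assume "p \<in> topspace (top_of_set (realization K))"
      then show "\<exists>j. j \<in> UNIV \<and> p \<in> {p \<in> realization K. p j \<noteq> 0} \<and> gam p = G j p"
        using gam ne by auto
    qed
    then show ?thesis by simp
  qed
  have conth: "continuous_on (realization K) h" "continuous_on (cball 0 1) g"
    and im: "h ` realization K = cball 0 1" "g ` cball 0 1 = realization K"
    and inv: "\<And>p. p \<in> realization K \<Longrightarrow> g (h p) = p"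
    using hom unfolding homeomorphism_def by auto
  have "continuous_on (cball 0 1) (\<lambda>z. gam (g z))"
    by (rule continuous_on_compose2[OF contgam conth(2)]) (simp add: im)
  then obtain L where L: "continuous_on (cball 0 1) L" "\<And>z. z \<in> cball 0 1 \<Longrightarrow> gam (g z) = exp (L z)"
    by (rule continuous_logarithm_on_cball) (auto simp: gam_def G_def)
  define l where "l p = Im (L (h p)) / (2 * pi)" for p
  have contl: "continuous_on (realization K) l"
    unfolding l_def by (intro continuous_intros continuous_on_compose2[OF L(1) conth(1)]) (use im in auto)
  have l: "l p - th b p \<in> \<int>" if p: "p \<in> realization K" "p b \<noteq> 0" for p b
  proof -
    have "h p \<in> cball 0 1" using im p by blast
    then have "exp (L (h p)) = exp (of_real (2 * pi * th b p) * \<i>)"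
      using L(2)[of "h p"] inv[OF p(1)] gam[OF p] by (simp add: G_def)
    then obtain n :: int where "L (h p) = of_real (2 * pi * th b p) * \<i> + complex_of_real (real_of_int (2 * n) * pi) * \<i>"
      unfolding exp_eq by blast
    then have "Im (L (h p)) = 2 * pi * th b p + 2 * of_int n * pi" by simp
    then have "l p = th b p + of_int n" unfolding l_def by (simp add: field_simps)
    then show ?thesis by simp
  qed
  have edge: "l (point y) - l (point x) = of_int (c x y)" if xy: "adj K x y" for x y
  proof -
    have V: "x \<in> verts K" "y \<in> verts K" "x \<noteq> y"
      using xy adj_verts adj_sym by (metis, metis, auto simp: adj_def)
    have sr: "segment_point x y t \<in> realization K" if "t \<in> {0..1}" for t
      using segment_point_realization[OF K xy] that by simp
    have sum2: "(\<Sum>w\<in>verts K. segment_point x y t w * q w) = (1 - t) * q x + t * q y" for t q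
    proof -
      have "(\<Sum>w\<in>verts K. segment_point x y t w * q w) = (\<Sum>w\<in>{x, y}. segment_point x y t w * q w)"
        by (rule sum.mono_neutral_right) (use fin V in \<open>auto simp: segment_point_def\<close>)
      then show ?thesis using V by (simp add: segment_point_def)
    qed
    \<comment> \<open>Along the edge the lifted angle differs from its linear model by an integer;
      this difference is continuous, so it is constant, and the increments of both over the edge
      agree.\<close>
    define k where "k t = l (segment_point x y t) - t * of_int (c x y)" for t
    have "continuous_on {0..1} (\<lambda>t. l (segment_point x y t))"
      by (rule continuous_on_compose2[OF contl continuous_on_segment_point]) (use sr in auto)
    then have ck: "continuous_on {0..1} k" unfolding k_def by (intro continuous_intros)
    \<comment> \<open>At \<open>t = 1\<close> the vertex \<open>x\<close> has left the support, and
      the angle has to be measured from \<open>y\<close> instead.\<close>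
    have kZ: "k t \<in> \<int>" if t: "t \<in> {0..1}" for t
    proof (cases "t = 1")
      case True
      have "l (segment_point x y 1) - th y (segment_point x y 1) \<in> \<int>"
        by (rule l) (use sr V in \<open>auto simp: segment_point_def\<close>)
      moreover have "th y (segment_point x y 1) = 0" unfolding th_def sum2 by (simp add: c'_def)
      ultimately show ?thesis using True unfolding k_def by simp
    next
      case False
      have "l (segment_point x y t) - th x (segment_point x y t) \<in> \<int>"
        by (rule l) (use sr t False in \<open>auto simp: segment_point_def\<close>)
      moreover have "th x (segment_point x y t) = t * of_int (c x y)"
        unfolding th_def sum2 using V by (simp add: c'_def)
      ultimately show ?thesis unfolding k_def by simp
    qed
    have "k constant_on {0..1}"
    proof (rule continuous_discrete_range_constant[OF _ ck])
      fix t :: real assume t: "t \<in> {0..1}"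
      show "\<exists>e>0. \<forall>u. u \<in> {0..1} \<and> k u \<noteq> k t \<longrightarrow> e \<le> norm (k u - k t)"
      proof (intro exI[of _ 1] conjI allI impI)
        fix u assume u: "u \<in> {0..1} \<and> k u \<noteq> k t"
        then have "k u - k t \<in> \<int>" "k u - k t \<noteq> 0" using kZ t by auto
        then show "1 \<le> norm (k u - k t)" unfolding real_norm_def by (rule Ints_nonzero_abs_ge1)
      qed simp
    qed simp
    then have "k 0 = k 1" unfolding constant_on_def by (metis atLeastAtMost_iff order_refl zero_le_one)
    then show ?thesis using segment_point_ends[OF V(3)] unfolding k_def by simp
  qed
  have pZ: "l (point x) \<in> \<int>" if "x \<in> verts K" for x
  proof -
    have "l (point x) - th x (point x) \<in> \<int>"
      by (rule l) (use point_realization[OF K that] in \<open>auto simp: point_def\<close>)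
    moreover have "th x (point x) = 0"
      unfolding th_def by (rule sum.neutral) (auto simp: point_def c'_def)
    ultimately show ?thesis by simp
  qed
  have "c x y = \<lfloor>l (point y)\<rfloor> - \<lfloor>l (point x)\<rfloor>" if xy: "adj K x y" for x y
  proof -
    have "l (point x) \<in> \<int>" "l (point y) \<in> \<int>" using pZ xy adj_verts adj_sym by (metis, metis)
    then obtain m n where mn: "l (point x) = of_int m" "l (point y) = of_int n" by (auto elim!: Ints_cases)
    then have "real_of_int (c x y) = of_int (n - m)" using edge[OF xy] by simp
    then have "c x y = n - m" by (simp only: of_int_eq_iff)
    then show ?thesis using mn by simp
  qed
  then show ?thesis by (intro exI[of _ "\<lambda>v. \<lfloor>l (point v)\<rfloor>"]) simp
qed

theorem triangulates_disk_comb_disk: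
  assumes "triangulates_disk K" shows "comb_disk K"
proof -
  have K: "pure_2_complex K" using assms by (simp add: triangulates_disk_def)
  obtain h g where hom: "homeomorphism (realization K) (cball (0::complex) 1) h g"
    and bd: "h ` realization (boundary K) = sphere 0 1"
    using assms unfolding triangulates_disk_def by blast
  have "1 \<in> h ` realization (boundary K)" unfolding bd by simp
  then obtain p where "p \<in> realization (boundary K)" by blast
  then have "{v. p v \<noteq> 0} \<in> boundary K" by (rule realization_support)
  then have "\<exists>x y. bd_edge K x y" unfolding boundary_eq[OF K] complex_of_def by blast
  then show ?thesis
    unfolding comb_disk_def
  proof (intro conjI allI impI ballI)
    fix x y a b c assume "tri K x y a" "tri K x y b" "tri K x y c"
    then show "a = b \<or> a = c \<or> b = c" by (rule disk_two_faces[OF K hom])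
  next
    fix v P x y assume "\<forall>x y. tri K v x y \<longrightarrow> (P x \<longleftrightarrow> P y)" and xy: "adj K v x" "adj K v y"
    then have "\<And>x y. tri K v x y \<Longrightarrow> P x \<longleftrightarrow> P y" by simp
    then show "P x \<longleftrightarrow> P y" by (rule disk_link_connected[OF K hom _ xy])
  next
    fix P x y assume "\<forall>x y. adj K x y \<longrightarrow> (P x \<longleftrightarrow> P y)" and xy: "x \<in> verts K" "y \<in> verts K"
    then have "\<And>x y. adj K x y \<Longrightarrow> P x \<longleftrightarrow> P y" by simp
    then show "P x \<longleftrightarrow> P y" by (rule disk_connected[OF K disk_realization_connected[OF hom] _ xy])
  qed (use K disk_cocycle[OF K hom] in auto)
qed

section \<open>Gluing disks along boundary arcs\<close>

text \<open>The endpoints of \<open>a\<close> cut the circle into two arcs. The open part of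
  \<open>a\<close> is connected and avoids the endpoints, so it lies in one of these arcs, and
  \<open>a\<close> then fills that arc; the other one is the complement.\<close>

lemma circle_arc_complement:
  fixes a :: "complex set"
  assumes a: "a \<subseteq> sphere 0 1" and hom: "homeomorphism {-1..1::real} a k k'"
  obtains d where "arc d" "pathstart d = k 1" "pathfinish d = k (-1)"
    "path_image d \<inter> a = {k (-1), k 1}" "path_image d \<union> a = sphere 0 1"
proof -
  define p q where "p = k (-1)" and "q = k 1"
  have contk: "continuous_on {-1..1} k" and ima: "a = k ` {-1..1}" and injk: "inj_on k {-1..1}"
    using hom unfolding homeomorphism_def by (auto intro: inj_on_inverseI[of _ k'])
  have pq: "p \<in> a" "q \<in> a" unfolding p_def q_def ima by auto
  have ne: "p \<noteq> q" using inj_onD[OF injk, of "-1" 1] unfolding p_def q_def by auto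
  have sphere: "path_image (circlepath 0 1) = sphere (0::complex) 1" by simp
  obtain u d where ud: "arc u" "arc d" "pathstart u = p" "pathfinish u = q"
      "pathstart d = q" "pathfinish d = p"
      "path_image u \<inter> path_image d = {p, q}" "path_image u \<union> path_image d = sphere 0 1"
    using exists_double_arc[of "circlepath 0 1" p q] subsetD[OF a pq(1)] subsetD[OF a pq(2)] ne
    unfolding sphere simple_path_circlepath by auto
  define A where "A = k ` {-1<..<1}"
  have conA: "connected A" unfolding A_def
    by (intro connected_continuous_image continuous_on_subset[OF contk]) auto
  have split: "{-1..1} = {-1<..<1} \<union> {-1, 1::real}" by auto
  have aA: "a = A \<union> {p, q}" unfolding ima A_def p_def q_def split by auto
  have Apq: "A \<inter> {p, q} = {}"
    using inj_onD[OF injk] unfolding A_def p_def q_def by fastforce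
  \<comment> \<open>In the parameter interval of \<open>v\<close> the set \<open>a\<close> becomes a
    connected set containing 0 and 1, hence everything.\<close>
  have full: "a = path_image v" if v: "arc v" "pathstart v = p" "pathfinish v = q" "a \<subseteq> path_image v" for v
  proof -
    obtain v' where hv: "homeomorphism {0..1} (path_image v) v v'" using homeomorphism_arc[OF v(1)] by blast
    have cv: "continuous_on a v'" using hv v(4) unfolding homeomorphism_def by (meson continuous_on_subset)
    have cona: "connected a" unfolding ima by (intro connected_continuous_image contk) auto
    have "connected (v' ` a)" by (rule connected_continuous_image[OF cv cona])
    moreover have "v' p = 0" "v' q = 1"
      using hv v(2,3) unfolding homeomorphism_def pathstart_def pathfinish_def by auto
    then have "0 \<in> v' ` a" "1 \<in> v' ` a" using pq by force+
    ultimately have "{0..1} \<subseteq> v' ` a" by (simp add: connected_contains_Icc)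
    then have "v ` {0..1} \<subseteq> v ` v' ` a" by blast
    also have "\<dots> \<subseteq> a" using hv v(4) unfolding homeomorphism_def by auto
    finally show ?thesis using v(4) unfolding path_image_def by blast
  qed
  have "closed (path_image u)" "closed (path_image d)"
    using ud by (auto simp: arc_imp_path closed_path_image)
  moreover have "A \<subseteq> path_image u \<union> path_image d" using a aA ud(8) by blast
  moreover have "path_image u \<inter> path_image d \<inter> A = {}" using Apq ud(7) by blast
  ultimately have "path_image u \<inter> A = {} \<or> path_image d \<inter> A = {}"
    using conA unfolding connected_closed by blast
  then show thesis
  proof
    assume "path_image u \<inter> A = {}"
    then have "a \<subseteq> path_image (reversepath d)" using a aA ud(7,8) by (auto simp: path_image_reversepath)
    then have "a = path_image d" using full[of "reversepath d"] ud by (auto simp: arc_reversepath path_image_reversepath)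
    then show thesis
      using that[of "reversepath u"] ud by (auto simp: arc_reversepath path_image_reversepath p_def q_def)
  next
    assume "path_image d \<inter> A = {}"
    then have "a \<subseteq> path_image u" using a aA ud(7,8) by auto
    then have "a = path_image u" using full[of u] ud by auto
    then show thesis
      using that[of d] ud by (simp add: p_def q_def Int_commute Un_commute)
  qed
qed

text \<open>The lower unit semicircle, parametrised by the abscissa; in normal form it carries the
  arc along which disks are glued.\<close>

definition low :: "real \<Rightarrow> complex" where
  "low r = Complex r (- sqrt (1 - r\<^sup>2))"

lemma norm_Complex_eq_1_iff: "cmod z = 1 \<longleftrightarrow> (Re z)\<^sup>2 + (Im z)\<^sup>2 = 1"
  by (simp add: cmod_def)

lemma low_sphere: "\<bar>r\<bar> \<le> 1 \<Longrightarrow> cmod (low r) = 1"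
  by (simp add: low_def norm_Complex_eq_1_iff abs_square_le_1)

lemma continuous_on_low: "continuous_on S low"
proof -
  have *: "low = (\<lambda>r. of_real r - \<i> * of_real (sqrt (1 - r\<^sup>2)))"
    by (auto simp: low_def fun_eq_iff complex_eq_iff)
  show ?thesis unfolding * by (intro continuous_intros)
qed

lemma low_eqI:
  assumes "cmod z = 1" "Im z \<le> 0" shows "z = low (Re z)"
proof -
  have "(Im z)\<^sup>2 = 1 - (Re z)\<^sup>2" using assms by (simp add: norm_Complex_eq_1_iff)
  then have "sqrt (1 - (Re z)\<^sup>2) = \<bar>Im z\<bar>" by (metis real_sqrt_abs)
  then show ?thesis using assms(2) by (simp add: low_def complex_eq_iff)
qed

text \<open>The Alexander trick.\<close>

lemma circle_homeomorphism_extend: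
  fixes f :: "complex \<Rightarrow> complex"
  assumes cont: "continuous_on (sphere 0 1) f" and inj: "inj_on f (sphere 0 1)"
    and im: "f ` sphere 0 1 = sphere 0 1"
  obtains F G where "homeomorphism (cball 0 1) (cball 0 1) F G" "\<And>z. z \<in> sphere 0 1 \<Longrightarrow> F z = f z"
proof -
  define F where "F z = cmod z *\<^sub>R f (sgn z)" for z
  have sg: "sgn z \<in> sphere 0 1" if "z \<noteq> 0" for z :: complex using that by (simp add: norm_sgn)
  have nf: "cmod (f (sgn z)) = 1" if "z \<noteq> 0" for z using sg[OF that] im by auto
  have nF: "cmod (F z) = cmod z" for z using nf by (cases "z = 0") (auto simp: F_def)
  have c0: "continuous_on (- {0}) F"
  proof -
    have "continuous_on (- {0::complex}) sgn" by (intro continuous_intros continuous_on_sgn) auto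
    then have "continuous_on (- {0}) (\<lambda>z. f (sgn z))"
      by (rule continuous_on_compose2[OF cont]) (use sg in blast)
    then show ?thesis unfolding F_def by (intro continuous_intros)
  qed
  have "isCont F z" for z
  proof (cases "z = 0")
    case True
    have "(F \<longlongrightarrow> 0) (at 0)"
    proof (rule Lim_null_comparison)
      show "\<forall>\<^sub>F x in at 0. norm (F x) \<le> norm x" by (simp add: nF)
      show "((\<lambda>x::complex. norm x) \<longlongrightarrow> 0) (at 0)" by (intro tendsto_norm_zero tendsto_ident_at)
    qed
    moreover have "F 0 = 0" by (simp add: F_def)
    ultimately show ?thesis using True by (simp add: isCont_def)
  next
    case False
    then show ?thesis using c0 continuous_on_interior[of "- {0}" F z]
      by (simp add: open_Compl interior_open)
  qed
  then have contF: "continuous_on (cball 0 1) F" by (simp add: continuous_at_imp_continuous_on)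
  have injF: "inj_on F (cball 0 1)"
  proof (rule inj_onI)
    fix z w assume eq: "F z = F w"
    then have n: "cmod z = cmod w" using nF by metis
    show "z = w"
    proof (cases "z = 0")
      case False
      then have w: "w \<noteq> 0" using n by auto
      have "f (sgn z) = f (sgn w)" using eq n w unfolding F_def by simp
      then have "sgn z = sgn w" using inj_onD[OF inj] sg False w by blast
      moreover have "cmod v *\<^sub>R sgn v = v" for v :: complex by (cases "v = 0") (auto simp: sgn_div_norm)
      ultimately show ?thesis using n by metis
    qed (use n in auto)
  qed
  have imF: "F ` cball 0 1 = cball 0 1"
  proof (intro equalityI subsetI)
    fix w :: complex assume w: "w \<in> cball 0 1"
    show "w \<in> F ` cball 0 1"
    proof (cases "w = 0")
      case True
      then have "F 0 = w" by (simp add: F_def)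
      then show ?thesis by (metis image_eqI centre_in_cball zero_le_one)
    next
      case False
      then have "sgn w \<in> f ` sphere 0 1" using sg im by simp
      then obtain v where v: "v \<in> sphere 0 1" "sgn w = f v" by blast
      have "sgn (cmod w *\<^sub>R v) = v" using v(1) False by (simp add: sgn_div_norm)
      then have "F (cmod w *\<^sub>R v) = w"
        using v False by (simp add: F_def flip: v(2)) (simp add: sgn_div_norm)
      moreover have "cmod w *\<^sub>R v \<in> cball 0 1" using w v by simp
      ultimately show ?thesis by (metis image_eqI)
    qed
  qed (auto simp: nF)
  obtain G where "homeomorphism (cball 0 1) (cball 0 1) F G"
    using homeomorphism_compact[OF compact_cball contF imF injF] by blast
  moreover have "F z = f z" if "z \<in> sphere 0 1" for z
    using that by (auto simp: F_def sgn_div_norm)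
  ultimately show thesis by (rule that)
qed

text \<open>The homeomorphism can be prescribed on a boundary arc: the given one is followed by a
  map of the circle that sends the image of the arc to the lower semicircle in the coordinate
  \<open>phi\<close> and the complementary arc to the upper semicircle, extended over the disk. Two
  disks normalised with the same \<open>phi\<close> agree on the common arc.\<close>

lemma disk_normal_form:
  fixes X :: "'b::topological_space set"
  assumes hom: "homeomorphism X (cball (0::complex) 1) h g" and BX: "h ` BX = sphere 0 1" "BX \<subseteq> X"
    and al: "homeomorphism al {-1..1::real} phi psi" "al \<subseteq> BX"
  obtains h' g' where "homeomorphism X (cball 0 1) h' g'" "h' ` BX = sphere 0 1"
    "\<And>p. p \<in> al \<Longrightarrow> h' p = low (phi p)" "\<And>p. p \<in> BX - al \<Longrightarrow> Im (h' p) > 0"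
proof -
  define a where "a = h ` al"
  have inj: "inj_on h X" using hom unfolding homeomorphism_def by (auto intro: inj_on_inverseI[of _ g])
  have gh: "\<And>p. p \<in> X \<Longrightarrow> g (h p) = p" and conth: "continuous_on X h" and contg: "continuous_on (cball 0 1) g"
    using hom unfolding homeomorphism_def by auto
  have contphi: "continuous_on al phi" and impsi: "psi ` {-1..1} = al"
    using al(1) unfolding homeomorphism_def by auto
  have "homeomorphism al a h g"
    unfolding a_def using homeomorphism_of_subsets[OF hom _ _ refl] al(2) BX hom
    by (metis (no_types, lifting) dual_order.trans homeomorphism_image1 image_mono)
  then have homa: "homeomorphism {-1..1} a (h \<circ> psi) (phi \<circ> g)"
    using homeomorphism_compose[OF homeomorphism_symD[OF al(1)]] by blast
  have asub: "a \<subseteq> sphere 0 1" using al(2) BX(1) a_def by blast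
  obtain d where d: "arc d" "pathstart d = h (psi 1)" "pathfinish d = h (psi (-1))"
      "path_image d \<inter> a = {h (psi (-1)), h (psi 1)}" "path_image d \<union> a = sphere 0 1"
    using circle_arc_complement[OF asub homa] by auto
  obtain d' where d': "homeomorphism {0..1} (path_image d) d d'" using homeomorphism_arc[OF d(1)] by blast
  have contd': "continuous_on (path_image d) d'" and d'd: "\<And>t. t \<in> {0..1} \<Longrightarrow> d' (d t) = t"
    and dd': "\<And>z. z \<in> path_image d \<Longrightarrow> d (d' z) = z" and imd': "d' ` path_image d = {0..1}"
    and imd: "d ` {0..1} = path_image d"
    using d' unfolding homeomorphism_def by auto
  have phipsi: "phi (psi t) = t" if "t \<in> {-1..1}" for t using al(1) that unfolding homeomorphism_def by auto
  \<comment> \<open>The complementary arc \<open>d\<close> runs from the endpoint with coordinate 1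
    to the one with coordinate -1, so the angle \<open>pi * d' z\<close> goes from 0 to
    \<open>pi\<close> and fits \<open>low\<close> at both ends.\<close>
  define f where "f z = (if z \<in> a then low (phi (g z)) else cis (pi * d' z))" for z
  have end1: "f (h (psi 1)) = cis (pi * d' (h (psi 1)))" and end2: "f (h (psi (-1))) = cis (pi * d' (h (psi (-1))))"
    and ends: "low (phi (g (h (psi 1)))) = cis (pi * d' (h (psi 1)))"
      "low (phi (g (h (psi (-1))))) = cis (pi * d' (h (psi (-1))))"
  proof -
    have p: "psi 1 \<in> al" "psi (-1) \<in> al" using impsi by auto
    then have gp: "g (h (psi 1)) = psi 1" "g (h (psi (-1))) = psi (-1)" using gh al(2) BX(2) by blast+
    have "d' (h (psi 1)) = 0" "d' (h (psi (-1))) = 1"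
      using d'd[of 0] d'd[of 1] d(2,3) by (auto simp: pathstart_def pathfinish_def)
    then show e: "low (phi (g (h (psi 1)))) = cis (pi * d' (h (psi 1)))"
      "low (phi (g (h (psi (-1))))) = cis (pi * d' (h (psi (-1))))"
      unfolding gp using phipsi by (auto simp: low_def complex_eq_iff)
    then show "f (h (psi 1)) = cis (pi * d' (h (psi 1)))" "f (h (psi (-1))) = cis (pi * d' (h (psi (-1))))"
      unfolding f_def by auto
  qed
  have fd: "f z = cis (pi * d' z)" if "z \<in> path_image d" for z
  proof (cases "z \<in> a")
    case True
    then have "z = h (psi (- 1)) \<or> z = h (psi 1)" using that d(4) by blast
    then show ?thesis using end1 end2 by blast
  qed (simp add: f_def)
  have cpa: "compact a" using homa compact_continuous_image[of "{-1..1}" "h \<circ> psi"]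
    unfolding homeomorphism_def by auto
  have cpd: "closed (path_image d)" using d by (auto simp: arc_imp_path closed_path_image)
  have conta: "continuous_on a (\<lambda>z. low (phi (g z)))"
  proof -
    have "continuous_on a (phi \<circ> g)" using homa unfolding homeomorphism_def by auto
    then show ?thesis by (intro continuous_on_compose2[OF continuous_on_low[of UNIV]]) (auto simp: o_def)
  qed
  have "continuous_on (a \<union> path_image d) f"
    unfolding f_def
  proof (rule continuous_on_cases)
    show "closed a" using cpa by (rule compact_imp_closed)
    show "continuous_on (path_image d) (\<lambda>z. cis (pi * d' z))"
      by (intro continuous_on_cis continuous_intros contd')
    show "\<forall>z. z \<in> a \<and> z \<notin> a \<or> z \<in> path_image d \<and> z \<in> a \<longrightarrow> low (phi (g z)) = cis (pi * d' z)"
    proof (intro allI impI)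
      fix z assume "z \<in> a \<and> z \<notin> a \<or> z \<in> path_image d \<and> z \<in> a"
      then have "z = h (psi (- 1)) \<or> z = h (psi 1)" using d(4) by blast
      then show "low (phi (g z)) = cis (pi * d' z)" using ends by blast
    qed
  qed (use cpd conta in auto)
  then have contf: "continuous_on (sphere 0 1) f" using d(5) by (simp add: Un_commute)
  have low_a: "cmod (f z) = 1 \<and> Im (f z) \<le> 0 \<and> Re (f z) = phi (g z)" if "z \<in> a" for z
  proof -
    have "(phi \<circ> g) z \<in> {-1..1}" using that homa unfolding homeomorphism_def by blast
    then have r: "\<bar>phi (g z)\<bar> \<le> 1" by auto
    then have "f z = low (phi (g z))" "1 - (phi (g z))\<^sup>2 \<ge> 0"
      using that abs_square_le_1[of "phi (g z)"] by (auto simp: f_def)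
    then show ?thesis using low_sphere[OF r] by (auto simp: low_def)
  qed
  have up_d: "cmod (f z) = 1 \<and> Im (f z) \<ge> 0" if "z \<in> path_image d" for z
  proof -
    have "0 \<le> d' z" "d' z \<le> 1" using imd' that by auto
    then have "0 \<le> sin (pi * d' z)" by (intro sin_ge_zero) (auto simp: mult_le_cancel_left1)
    then show ?thesis using fd[OF that] by simp
  qed
  have up_strict: "Im (f z) > 0" if "z \<in> path_image d" "z \<notin> a" for z
  proof -
    have "d 0 \<in> a" "d 1 \<in> a" using d(2,3,4) unfolding pathstart_def pathfinish_def by auto
    then have "d' z \<noteq> 0" "d' z \<noteq> 1" using dd'[OF that(1)] that(2) by metis+
    moreover have "0 \<le> d' z" "d' z \<le> 1" using imd' that by auto
    ultimately have "0 < sin (pi * d' z)" by (intro sin_gt_zero) auto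
    then show ?thesis using fd[OF that(1)] by simp
  qed
  have inj_a: "inj_on f a"
  proof (rule inj_onI)
    fix z w assume zw: "z \<in> a" "w \<in> a" "f z = f w"
    then have "(phi \<circ> g) z = (phi \<circ> g) w" using low_a by (metis comp_apply)
    then show "z = w" using zw homa unfolding homeomorphism_def by metis
  qed
  have inj_d: "inj_on f (path_image d)"
  proof (rule inj_onI)
    fix z w assume zw: "z \<in> path_image d" "w \<in> path_image d" "f z = f w"
    then have eq: "cos (pi * d' z) = cos (pi * d' w)" using fd by (metis cis.sel(1))
    have b: "0 \<le> pi * d' v" "pi * d' v \<le> pi" if "v \<in> path_image d" for v
    proof -
      have "d' v \<in> {0..1}" using imd' that by blast
      then show "0 \<le> pi * d' v" "pi * d' v \<le> pi" by (auto simp: mult_le_cancel_left1)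
    qed
    have "pi * d' z = pi * d' w" by (rule cos_inj_pi[OF b[OF zw(1)] b[OF zw(2)] eq])
    then show "z = w" using dd' zw by (metis mult_cancel_left pi_neq_zero)
  qed
  have injf: "inj_on f (sphere 0 1)"
  proof (rule inj_onI)
    have mix: "z = w" if "z \<in> a" "w \<in> path_image d" "f z = f w" for z w
    proof (cases "w \<in> a")
      case True then show ?thesis using that inj_a by (auto dest: inj_onD)
    next
      case False then show ?thesis using low_a up_strict that by fastforce
    qed
    fix z w assume "z \<in> sphere 0 1" "w \<in> sphere 0 1" "f z = f w"
    then show "z = w" using mix[of z w] mix[of w z] inj_a inj_d d(5) by (metis UnE inj_onD)
  qed
  have imf: "f ` sphere 0 1 = sphere 0 1"
  proof (intro equalityI subsetI)
    fix w assume "w \<in> f ` sphere 0 1"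
    then obtain z where z: "z \<in> path_image d \<or> z \<in> a" "w = f z" using d(5) by blast
    then have "cmod (f z) = 1" using low_a up_d by blast
    then show "w \<in> sphere 0 1" using z(2) by simp
  next
    fix w :: complex assume w: "w \<in> sphere 0 1"
    show "w \<in> f ` sphere 0 1"
    proof (cases "Im w \<le> 0")
      case True
      have "\<bar>Re w\<bar> \<le> 1" using w abs_Re_le_cmod[of w] by simp
      then have "Re w \<in> {-1..1}" by auto
      then have "Re w \<in> (phi \<circ> g) ` a" using homa unfolding homeomorphism_def by simp
      then obtain z where z: "z \<in> a" "phi (g z) = Re w" by auto
      have "f z = low (Re w)" using z by (simp add: f_def)
      also have "\<dots> = w" using low_eqI[of w] w True by simp
      finally show ?thesis using z asub by blast
    next
      case False
      define t where "t = arccos (Re w) / pi"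
      have "\<bar>Re w\<bar> \<le> 1" using w abs_Re_le_cmod[of w] by simp
      then have r: "-1 \<le> Re w" "Re w \<le> 1" by auto
      have "0 \<le> arccos (Re w)" "arccos (Re w) \<le> pi" using arccos_bounded[OF r] by auto
      then have t: "t \<in> {0..1}" by (auto simp: t_def)
      then have z: "d t \<in> path_image d" using imd by blast
      have "f (d t) = cis (pi * t)" using fd[OF z] d'd[OF t] by simp
      also have "\<dots> = w"
      proof -
        have s: "sin (arccos (Re w)) = sqrt (1 - (Re w)\<^sup>2)" using r by (rule sin_arccos)
        have "(Im w)\<^sup>2 = 1 - (Re w)\<^sup>2" using w by (simp add: norm_Complex_eq_1_iff)
        then have "sqrt (1 - (Re w)\<^sup>2) = \<bar>Im w\<bar>" by (metis real_sqrt_abs)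
        then show ?thesis using s False r by (simp add: t_def complex_eq_iff cos_arccos)
      qed
      finally show ?thesis using z d(5) by blast
    qed
  qed
  obtain F G where FG: "homeomorphism (cball 0 1) (cball 0 1) F G" "\<And>z. z \<in> sphere 0 1 \<Longrightarrow> F z = f z"
    using circle_homeomorphism_extend[OF contf injf imf] by blast
  show thesis
  proof (rule that)
    show "homeomorphism X (cball 0 1) (F \<circ> h) (g \<circ> G)" by (rule homeomorphism_compose[OF hom FG(1)])
    have "(F \<circ> h) ` BX = f ` sphere 0 1"
      unfolding image_comp[symmetric] BX(1) using FG(2) by (intro image_cong) auto
    then show "(F \<circ> h) ` BX = sphere 0 1" using imf by simp
  next
    fix p assume p: "p \<in> al"
    then have "h p \<in> sphere 0 1" "h p \<in> a" using asub by (auto simp: a_def)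
    then show "(F \<circ> h) p = low (phi p)" using FG(2)[of "h p"] gh[of p] p al(2) BX(2) by (auto simp: f_def)
  next
    fix p assume p: "p \<in> BX - al"
    have "h p \<notin> a"
    proof
      assume "h p \<in> a"
      then obtain q where "q \<in> al" "h p = h q" unfolding a_def by blast
      then have "p = q" using inj_onD[OF inj, of p q] p al(2) BX(2) by blast
      then show False using p \<open>q \<in> al\<close> by blast
    qed
    moreover have "h p \<in> sphere 0 1" using p BX(1) by blast
    moreover from this have "h p \<in> path_image d" using calculation d(5) by blast
    ultimately show "Im ((F \<circ> h) p) > 0" using up_strict[of "h p"] FG(2)[of "h p"] by simp
  qed
qed

section \<open>Gluing two topological disks along an arc\<close>

lemma half_disk_shift:
  fixes z :: complex
  assumes "cmod z \<le> 1"
  shows "\<bar>Im z\<bar> \<le> sqrt (1 - (Re z)\<^sup>2)" "(Re z)\<^sup>2 \<le> 1"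
proof -
  have "(cmod z)\<^sup>2 \<le> 1" using assms by (simp add: power_le_one)
  then have "(Im z)\<^sup>2 \<le> 1 - (Re z)\<^sup>2" by (simp add: cmod_power2)
  then show "\<bar>Im z\<bar> \<le> sqrt (1 - (Re z)\<^sup>2)" by (metis real_sqrt_abs real_sqrt_le_mono)
  show "(Re z)\<^sup>2 \<le> 1" using \<open>(Im z)\<^sup>2 \<le> 1 - (Re z)\<^sup>2\<close> zero_le_power2[of "Im z"] by linarith
qed

lemma in_disk_iff: "cmod z \<le> 1 \<longleftrightarrow> (Re z)\<^sup>2 \<le> 1 \<and> \<bar>Im z\<bar> \<le> sqrt (1 - (Re z)\<^sup>2)"
proof
  assume *: "(Re z)\<^sup>2 \<le> 1 \<and> \<bar>Im z\<bar> \<le> sqrt (1 - (Re z)\<^sup>2)"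
  then have "\<bar>Im z\<bar>\<^sup>2 \<le> (sqrt (1 - (Re z)\<^sup>2))\<^sup>2" by (intro power_mono) auto
  then have "(Re z)\<^sup>2 + (Im z)\<^sup>2 \<le> 1" using * by simp
  then show "cmod z \<le> 1" by (simp add: cmod_def)
qed (use half_disk_shift in auto)

text \<open>In normal form, vertical contractions move the two disks to the upper and the lower half of
  the unit disk, the arcs going to the common diameter.\<close>

lemma glue_disks:
  fixes X Y :: "'b::topological_space set"
  assumes hX: "homeomorphism X (cball (0::complex) 1) h1 g1" "h1 ` BX = sphere 0 1" "BX \<subseteq> X"
    and hY: "homeomorphism Y (cball (0::complex) 1) h2 g2" "h2 ` BY = sphere 0 1" "BY \<subseteq> Y"
    and al: "homeomorphism (X \<inter> Y) {-1..1::real} phi psi" "X \<inter> Y \<subseteq> BX" "X \<inter> Y \<subseteq> BY"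
    and clo: "closedin (top_of_set (X \<union> Y)) X" "closedin (top_of_set (X \<union> Y)) Y"
  obtains h g where "homeomorphism (X \<union> Y) (cball (0::complex) 1) h g"
    "h ` ((BX \<union> BY) - {p \<in> X \<inter> Y. \<bar>phi p\<bar> < 1}) = sphere 0 1"
proof -
  obtain k1 l1 where k1: "homeomorphism X (cball 0 1) k1 l1" "k1 ` BX = sphere 0 1"
    "\<And>p. p \<in> X \<inter> Y \<Longrightarrow> k1 p = low (phi p)" "\<And>p. p \<in> BX - X \<inter> Y \<Longrightarrow> Im (k1 p) > 0"
    using disk_normal_form[OF hX al(1,2)] by blast
  obtain k2 l2 where k2: "homeomorphism Y (cball 0 1) k2 l2" "k2 ` BY = sphere 0 1"
    "\<And>p. p \<in> X \<inter> Y \<Longrightarrow> k2 p = low (phi p)" "\<And>p. p \<in> BY - X \<inter> Y \<Longrightarrow> Im (k2 p) > 0"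
    using disk_normal_form[OF hY al(1,3)] by blast
  define s where "s x = sqrt (1 - x\<^sup>2)" for x :: real
  \<comment> \<open>Averages the height with that of the upper semicircle at the same abscissa: the
    upper semicircle stays fixed and the lower one goes to the diameter.\<close>
  define up where "up z = Complex (Re z) ((Im z + s (Re z)) / 2)" for z
  have phi_range: "\<bar>phi p\<bar> \<le> 1" if "p \<in> X \<inter> Y" for p
  proof -
    have "phi p \<in> {-1..1}" using homeomorphism_image1[OF al(1)] that by blast
    then show ?thesis by auto
  qed
  have phi_onto: "\<exists>p\<in>X \<inter> Y. phi p = r" if "\<bar>r\<bar> \<le> 1" for r
  proof -
    have "r \<in> phi ` (X \<inter> Y)" unfolding homeomorphism_image1[OF al(1)] using that by auto
    then show ?thesis by blast
  qed
  have phi_inj: "p = q" if "p \<in> X \<inter> Y" "q \<in> X \<inter> Y" "phi p = phi q" for p q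
    using homeomorphism_apply1[OF al(1)] that by metis
  have up_nonneg: "Im (up z) \<ge> 0" if "cmod z \<le> 1" for z
    using half_disk_shift[OF that] by (auto simp: up_def s_def)
  have up_disk: "cmod (up z) \<le> 1" if "cmod z \<le> 1" for z
    unfolding in_disk_iff using half_disk_shift[OF that] by (auto simp: up_def s_def abs_le_iff)
  have up_inj: "z = w" if "up z = up w" for z w
    using that by (auto simp: up_def complex_eq_iff)
  have up_onto: "\<exists>z. cmod z \<le> 1 \<and> up z = w" if "cmod w \<le> 1" "Im w \<ge> 0" for w
    by (rule exI[of _ "Complex (Re w) (2 * Im w - s (Re w))"])
      (use half_disk_shift[OF that(1)] that in \<open>auto simp: in_disk_iff up_def s_def complex_eq_iff abs_le_iff\<close>)
  have up_low: "up (low r) = of_real r" for r by (simp add: up_def low_def s_def complex_eq_iff)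
  have up_circle: "up z = z" if "cmod z = 1" "Im z \<ge> 0" for z
  proof -
    have "(Im z)\<^sup>2 = 1 - (Re z)\<^sup>2" using that by (simp add: norm_Complex_eq_1_iff)
    then have "s (Re z) = \<bar>Im z\<bar>" unfolding s_def by (metis real_sqrt_abs)
    then show ?thesis using that by (simp add: up_def complex_eq_iff)
  qed
  have up_zero: "z = low (Re z)" if "Im (up z) = 0" for z
    using that by (simp add: up_def low_def s_def complex_eq_iff)
  have contup: "continuous_on S up" for S
  proof -
    have *: "up = (\<lambda>z. of_real (Re z) + \<i> * of_real ((Im z + s (Re z)) / 2))"
      by (auto simp: up_def fun_eq_iff complex_eq_iff)
    show ?thesis unfolding * s_def by (intro continuous_intros) auto
  qed
  \<comment> \<open>Conjugation puts the second disk into the lower half. On the common arc both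
    formulas give the real number \<open>phi p\<close>.\<close>
  define F where "F p = (if p \<in> X then up (k1 p) else cnj (up (k2 p)))" for p
  have in1: "cmod (k1 p) \<le> 1" if "p \<in> X" for p
    using homeomorphism_image1[OF k1(1)] that by (metis imageI mem_cball_0)
  have in2: "cmod (k2 p) \<le> 1" if "p \<in> Y" for p
    using homeomorphism_image1[OF k2(1)] that by (metis imageI mem_cball_0)
  have injk: "inj_on k1 X" "inj_on k2 Y"
    using k1(1) k2(1) unfolding homeomorphism_def by (metis inj_on_inverseI)+
  have zero1: "p \<in> X \<inter> Y \<and> up (k1 p) = of_real (phi p)" if p: "p \<in> X" "Im (up (k1 p)) = 0" for p
  proof -
    have kp: "k1 p = low (Re (k1 p))" by (rule up_zero[OF p(2)])
    have "\<bar>Re (k1 p)\<bar> \<le> 1" using in1[OF p(1)] abs_Re_le_cmod[of "k1 p"] by linarith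
    then obtain q where q: "q \<in> X \<inter> Y" "phi q = Re (k1 p)" using phi_onto by blast
    then have "k1 q = k1 p" using k1(3) kp by simp
    then have "q = p" using injk(1) q p by (auto dest: inj_onD)
    then show ?thesis using q kp up_low by metis
  qed
  have zero2: "p \<in> X \<inter> Y \<and> up (k2 p) = of_real (phi p)" if p: "p \<in> Y" "Im (up (k2 p)) = 0" for p
  proof -
    have kp: "k2 p = low (Re (k2 p))" by (rule up_zero[OF p(2)])
    have "\<bar>Re (k2 p)\<bar> \<le> 1" using in2[OF p(1)] abs_Re_le_cmod[of "k2 p"] by linarith
    then obtain q where q: "q \<in> X \<inter> Y" "phi q = Re (k2 p)" using phi_onto by blast
    then have "k2 q = k2 p" using k2(3) kp by simp
    then have "q = p" using injk(2) q p by (auto dest: inj_onD)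
    then show ?thesis using q kp up_low by metis
  qed
  have FY: "F p = cnj (up (k2 p))" if "p \<in> Y" for p
    using that k1(3)[of p] k2(3)[of p] by (auto simp: F_def up_low)
  have contF: "continuous_on (X \<union> Y) F"
    unfolding F_def
  proof (rule continuous_on_cases_local[OF clo])
    show "continuous_on X (\<lambda>p. up (k1 p))"
      by (rule continuous_on_compose2[OF contup[of UNIV]]) (use k1(1) in \<open>auto simp: homeomorphism_def\<close>)
    show "continuous_on Y (\<lambda>p. cnj (up (k2 p)))"
      by (intro continuous_on_cnj continuous_on_compose2[OF contup[of UNIV]])
        (use k2(1) in \<open>auto simp: homeomorphism_def\<close>)
    fix p assume "p \<in> X \<and> p \<notin> X \<or> p \<in> Y \<and> p \<in> X"
    then show "up (k1 p) = cnj (up (k2 p))" using k1(3)[of p] k2(3)[of p] by (auto simp: up_low)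
  qed
  have injF: "inj_on F (X \<union> Y)"
  proof (rule inj_onI)
    have mix: "p = q" if "p \<in> X" "q \<in> Y" "F p = F q" for p q
    proof -
      have eq: "up (k1 p) = cnj (up (k2 q))" using that FY by (simp add: F_def)
      have "Im (up (k1 p)) \<ge> 0" "Im (up (k2 q)) \<ge> 0" using up_nonneg in1 in2 that by auto
      moreover have "Im (up (k1 p)) = - Im (up (k2 q))" using eq by simp
      ultimately have "Im (up (k1 p)) = 0" "Im (up (k2 q)) = 0" by auto
      then have "p \<in> X \<inter> Y \<and> up (k1 p) = of_real (phi p)" "q \<in> X \<inter> Y \<and> up (k2 q) = of_real (phi q)"
        using zero1 zero2 that by blast+
      then show ?thesis using phi_inj eq by simp
    qed
    have sX: "p = q" if "p \<in> X" "q \<in> X" "F p = F q" for p q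
      using that injk(1) up_inj[of "k1 p" "k1 q"] by (auto simp: F_def dest: inj_onD)
    have sY: "p = q" if "p \<in> Y" "q \<in> Y" "F p = F q" for p q
      using that injk(2) up_inj[of "k2 p" "k2 q"] FY by (auto dest: inj_onD)
    fix p q assume "p \<in> X \<union> Y" "q \<in> X \<union> Y" "F p = F q"
    then show "p = q" using mix[of p q] mix[of q p] sX[of p q] sY[of p q] by auto
  qed
  have imF: "F ` (X \<union> Y) = cball 0 1"
  proof (intro equalityI subsetI)
    fix w assume "w \<in> F ` (X \<union> Y)"
    then obtain p where "p \<in> X \<or> p \<in> Y" "w = F p" by blast
    then show "w \<in> cball 0 1" using FY up_disk in1 in2 by (auto simp: F_def)
  next
    fix w :: complex assume w: "w \<in> cball 0 1"
    show "w \<in> F ` (X \<union> Y)"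
    proof (cases "Im w \<ge> 0")
      case True
      then obtain z where z: "cmod z \<le> 1" "up z = w" using up_onto[of w] w by auto
      then have "z \<in> k1 ` X" using k1(1) unfolding homeomorphism_def by simp
      then obtain p where "p \<in> X" "k1 p = z" by blast
      then have "F p = w" using z by (simp add: F_def)
      then show ?thesis using \<open>p \<in> X\<close> by blast
    next
      case False
      then obtain z where z: "cmod z \<le> 1" "up z = cnj w" using up_onto[of "cnj w"] w by auto
      then have "z \<in> k2 ` Y" using k2(1) unfolding homeomorphism_def by simp
      then obtain p where "p \<in> Y" "k2 p = z" by blast
      then have "F p = w" using z FY by simp
      then show ?thesis using \<open>p \<in> Y\<close> by blast
    qed
  qed
  have "compact X" "compact Y"
    using k1(1) k2(1) compact_continuous_image[OF _ compact_cball] unfolding homeomorphism_def by metis+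
  then have "compact (X \<union> Y)" by (rule compact_Un)
  then obtain G where FG: "homeomorphism (X \<union> Y) (cball 0 1) F G"
    using homeomorphism_compact[OF _ contF imF injF] by blast
  have end_: "low r = of_real r" if "\<bar>r\<bar> \<le> 1" "\<not> \<bar>r\<bar> < 1" for r :: real
  proof -
    have "\<bar>r\<bar> = 1" using that by simp
    then have "r\<^sup>2 = 1" by (metis power2_abs power_one)
    then show ?thesis by (simp add: low_def complex_eq_iff)
  qed
  let ?B = "(BX \<union> BY) - {p \<in> X \<inter> Y. \<bar>phi p\<bar> < 1}"
  have B1: "F p = k1 p" "Im (k1 p) \<ge> 0" if "p \<in> BX" "p \<in> ?B" for p
  proof -
    have c: "cmod (k1 p) = 1" using k1(2) that(1) by auto
    show im: "Im (k1 p) \<ge> 0"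
    proof (cases "p \<in> X \<inter> Y")
      case True
      then show ?thesis using k1(3)[OF True] end_[of "phi p"] phi_range that(2) by simp
    qed (use k1(4)[of p] that in auto)
    show "F p = k1 p" using up_circle[OF c im] that hX(3) by (auto simp: F_def)
  qed
  have B2: "F p = cnj (k2 p)" "Im (k2 p) \<ge> 0" if "p \<in> BY" "p \<in> ?B" for p
  proof -
    have c: "cmod (k2 p) = 1" using k2(2) that(1) by auto
    show im: "Im (k2 p) \<ge> 0"
    proof (cases "p \<in> X \<inter> Y")
      case True
      then show ?thesis using k2(3)[OF True] end_[of "phi p"] phi_range that(2) by simp
    qed (use k2(4)[of p] that in auto)
    show "F p = cnj (k2 p)" using up_circle[OF c im] that hY(3) FY[of p] by auto
  qed
  \<comment> \<open>Points in the relative interior of the arc have normal form strictly below the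
    real axis; a preimage of a point in the closed upper semicircle is therefore not among the
    points taken out of the boundary.\<close>
  have notin: "p \<notin> {p \<in> X \<inter> Y. \<bar>phi p\<bar> < 1}" if "k p = low (phi p)" "Im (k p) \<ge> 0" for p and k :: "'b \<Rightarrow> complex"
  proof
    assume p: "p \<in> {p \<in> X \<inter> Y. \<bar>phi p\<bar> < 1}"
    then have "(phi p)\<^sup>2 < 1" by (simp add: abs_square_less_1)
    then have "Im (k p) < 0" using that(1) by (simp add: low_def)
    then show False using that(2) by simp
  qed
  have "F ` ?B = sphere 0 1"
  proof (intro equalityI subsetI)
    fix w assume "w \<in> F ` ?B"
    then obtain p where p: "p \<in> ?B" "w = F p" by blast
    then have "p \<in> BX \<or> p \<in> BY" by blast
    then show "w \<in> sphere 0 1"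
      using B1[OF _ p(1)] B2[OF _ p(1)] k1(2) k2(2) p(2) by force
  next
    fix w :: complex assume w: "w \<in> sphere 0 1"
    show "w \<in> F ` ?B"
    proof (cases "Im w \<ge> 0")
      case True
      have "w \<in> k1 ` BX" using w k1(2) by simp
      then obtain p where p: "p \<in> BX" "w = k1 p" by blast
      then have "p \<in> ?B" using notin[of k1 p] k1(3)[of p] True by blast
      then show ?thesis using B1 p by (metis image_eqI)
    next
      case False
      have "cnj w \<in> k2 ` BY" using w k2(2) by simp
      then obtain p where p: "p \<in> BY" "cnj w = k2 p" by blast
      moreover have "Im (cnj w) \<ge> 0" using False by simp
      ultimately have "p \<in> ?B" using notin[of k2 p] k2(3)[of p] by fastforce
      then have "F p = w" using B2 p by (metis complex_cnj_cnj)
      then show ?thesis using \<open>p \<in> ?B\<close> by blast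
    qed
  qed
  then show thesis using FG that by blast
qed

section \<open>A single triangle as a disk\<close>

definition flat_triangle :: "complex set" where
  "flat_triangle = {z. 0 \<le> Im z \<and> Im z \<le> 1 - \<bar>Re z\<bar>}"

definition flat_triangle_frontier :: "complex set" where
  "flat_triangle_frontier = {z. \<bar>Re z\<bar> \<le> 1 \<and> (Im z = 0 \<or> Im z = 1 - \<bar>Re z\<bar>)}"

text \<open>Each vertical chord of the disk is moved and scaled linearly onto the vertical segment
  of the triangle over the same abscissa. The map is built from the disk to the triangle, because in
  this direction the scaling factor stays bounded.\<close>

lemma flat_triangle_disk:
  obtains h g where "homeomorphism flat_triangle (cball (0::complex) 1) h g" "h ` flat_triangle_frontier = sphere 0 1"
proof -
  \<comment> \<open>The factor from the half chord \<open>sqrt (1 - x^2)\<close> to the height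
    \<open>1 - \<bar>x\<bar>\<close> of the triangle. With the common factor cancelled under the
    root it remains continuous at \<open>x = 1\<close> and \<open>x = -1\<close>, where both lengths
    vanish.\<close>
  define r where "r x = sqrt ((1 - \<bar>x\<bar>) / (1 + \<bar>x\<bar>))" for x :: real
  define s where "s x = sqrt (1 - x\<^sup>2)" for x :: real
  define k where "k z = Complex (Re z) ((Im z + s (Re z)) / 2 * r (Re z))" for z
  have rs: "s x * r x = 1 - \<bar>x\<bar>" if "\<bar>x\<bar> \<le> 1" for x
  proof -
    have "(1 - x\<^sup>2) * ((1 - \<bar>x\<bar>) / (1 + \<bar>x\<bar>)) = (1 - \<bar>x\<bar>)\<^sup>2"
    proof -
      have "1 - x\<^sup>2 = (1 - \<bar>x\<bar>) * (1 + \<bar>x\<bar>)" by (simp add: algebra_simps power2_eq_square flip: power2_abs)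
      then show ?thesis by (simp add: power2_eq_square field_simps)
    qed
    then have "s x * r x = sqrt ((1 - \<bar>x\<bar>)\<^sup>2)" unfolding s_def r_def by (metis real_sqrt_mult)
    then show ?thesis using that by simp
  qed
  have r0: "r x > 0" if "\<bar>x\<bar> < 1" for x using that by (simp add: r_def)
  have contk: "continuous_on S k" for S
  proof -
    have *: "k = (\<lambda>z. of_real (Re z) + \<i> * of_real ((Im z + s (Re z)) / 2 * r (Re z)))"
      by (auto simp: k_def fun_eq_iff complex_eq_iff)
    show ?thesis unfolding * s_def r_def by (intro continuous_intros) auto
  qed
  have re: "\<bar>Re z\<bar> \<le> 1" if "cmod z \<le> 1" for z using that abs_Re_le_cmod[of z] by linarith
  have im: "\<bar>Im z\<bar> \<le> s (Re z)" if "cmod z \<le> 1" for z using half_disk_shift(1)[OF that] by (simp add: s_def)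
  \<comment> \<open>Over the two extreme abscissae the chords degenerate to points, so the vanishing
    of \<open>r\<close> there does not hurt injectivity.\<close>
  have flat: "z = of_real (Re z)" if "cmod z \<le> 1" "\<bar>Re z\<bar> = 1" for z
  proof -
    have "s (Re z) = 0" using that(2) unfolding s_def by (metis diff_self power2_abs power_one real_sqrt_zero)
    then show ?thesis using im[OF that(1)] by (simp add: complex_eq_iff)
  qed
  have into: "k z \<in> flat_triangle" if z: "cmod z \<le> 1" for z
  proof -
    have "r (Re z) \<ge> 0" using re[OF z] by (simp add: r_def)
    moreover have "(Im z + s (Re z)) / 2 \<ge> 0" "(Im z + s (Re z)) / 2 \<le> s (Re z)" using im[OF z] by auto
    ultimately have "0 \<le> (Im z + s (Re z)) / 2 * r (Re z)" "(Im z + s (Re z)) / 2 * r (Re z) \<le> s (Re z) * r (Re z)"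
      by (blast intro: mult_right_mono mult_nonneg_nonneg)+
    then show ?thesis using rs[OF re[OF z]] by (simp add: flat_triangle_def k_def)
  qed
  have inj: "inj_on k (cball 0 1)"
  proof (rule inj_onI)
    fix z w assume zw: "z \<in> cball 0 1" "w \<in> cball 0 1" "k z = k w"
    then have eq: "Re z = Re w" by (simp add: k_def)
    show "z = w"
    proof (cases "\<bar>Re z\<bar> = 1")
      case True
      then show ?thesis using flat[of z] flat[of w] zw eq by simp
    next
      case False
      then have "r (Re w) \<noteq> 0" using r0[of "Re w"] re[of z] zw eq by fastforce
      then have "Im z = Im w" using zw(3) eq by (simp add: k_def)
      then show ?thesis using eq by (simp add: complex_eq_iff)
    qed
  qed
  have onto: "\<exists>z. cmod z \<le> 1 \<and> k z = w \<and> (w \<in> flat_triangle_frontier \<longrightarrow> cmod z = 1)" if w: "w \<in> flat_triangle" for w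
  proof (cases "\<bar>Re w\<bar> = 1")
    case True
    then have "w = of_real (Re w)" using w by (simp add: flat_triangle_def complex_eq_iff)
    then have w1: "cmod w = 1" using True by (metis norm_of_real)
    then have "k w = w" using True \<open>w = of_real (Re w)\<close> by (simp add: k_def r_def complex_eq_iff flat_triangle_def)
    then show ?thesis using w1 by (intro exI[of _ w]) simp
  next
    case False
    then have a: "\<bar>Re w\<bar> < 1" using w by (auto simp: flat_triangle_def)
    let ?x = "Re w"
    define z where "z = Complex ?x (2 * (Im w / r ?x) - s ?x)"
    have rp: "r ?x > 0" using r0[OF a] .
    have kz: "k z = w" using rp by (simp add: k_def z_def complex_eq_iff)
    have s: "s ?x = (1 - \<bar>?x\<bar>) / r ?x" using rs[of ?x] a rp by (simp add: field_simps)
    have "0 \<le> Im w / r ?x" "Im w / r ?x \<le> s ?x" using w rp unfolding s flat_triangle_def by (auto intro: divide_right_mono)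
    then have "\<bar>Im z\<bar> \<le> s ?x" by (auto simp: z_def)
    moreover have x2: "?x\<^sup>2 \<le> 1" using a by (simp add: abs_square_le_1)
    ultimately have z1: "cmod z \<le> 1" unfolding in_disk_iff by (simp add: z_def s_def)
    have "cmod z = 1" if "w \<in> flat_triangle_frontier"
    proof -
      have "Im w = 0 \<or> Im w / r ?x = s ?x" using that unfolding flat_triangle_frontier_def s by auto
      then have "Im z = - s ?x \<or> Im z = s ?x" by (auto simp: z_def simp del: times_divide_eq_right)
      then have "(Im z)\<^sup>2 = (s ?x)\<^sup>2" by auto
      also have "\<dots> = 1 - ?x\<^sup>2" using x2 by (simp add: s_def)
      finally show ?thesis by (simp add: norm_Complex_eq_1_iff z_def)
    qed
    then show ?thesis using z1 kz by blast
  qed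
  have front: "k z \<in> flat_triangle_frontier" if z: "cmod z = 1" for z
  proof -
    have "(Im z)\<^sup>2 = 1 - (Re z)\<^sup>2" using z by (simp add: norm_Complex_eq_1_iff)
    then have "s (Re z) = \<bar>Im z\<bar>" unfolding s_def by (metis real_sqrt_abs)
    then have "(Im z + s (Re z)) / 2 = 0 \<or> (Im z + s (Re z)) / 2 = s (Re z)" by auto
    moreover have "\<bar>Re z\<bar> \<le> 1" using re z by simp
    ultimately show ?thesis using rs[of "Re z"] unfolding flat_triangle_frontier_def k_def by auto
  qed
  have "k ` cball 0 1 = flat_triangle" using into onto by force
  then obtain k' where hom: "homeomorphism (cball 0 1) flat_triangle k k'"
    using homeomorphism_compact[OF compact_cball contk _ inj] by blast
  have sub: "flat_triangle_frontier \<subseteq> flat_triangle" by (auto simp: flat_triangle_frontier_def flat_triangle_def)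
  have "k' ` flat_triangle_frontier = sphere 0 1"
  proof (intro equalityI subsetI)
    fix z assume "z \<in> k' ` flat_triangle_frontier"
    then obtain w where w: "w \<in> flat_triangle_frontier" "z = k' w" by blast
    then obtain z' where z': "cmod z' \<le> 1" "k z' = w" "cmod z' = 1" using onto sub by blast
    then have "z = z'" using w homeomorphism_apply1[OF hom] by auto
    then show "z \<in> sphere 0 1" using z' by simp
  next
    fix z :: complex assume z: "z \<in> sphere 0 1"
    then have "k z \<in> flat_triangle_frontier" using front by simp
    moreover have "k' (k z) = z" using homeomorphism_apply1[OF hom] z by simp
    ultimately show "z \<in> k' ` flat_triangle_frontier" by (metis image_eqI)
  qed
  then show thesis by (rule that[OF homeomorphism_symD[OF hom]])
qed

lemma complex_of_triangle_pure:
  assumes "a \<noteq> b" "b \<noteq> c" "a \<noteq> c"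
  shows "pure_2_complex (complex_of {{a, b, c}})"
proof -
  have "complex_of {{a, b, c}} = Pow {a, b, c} - {{}}" by (auto simp: complex_of_def)
  then have "finite (complex_of {{a, b, c}})" by simp
  moreover have "\<forall>s\<in>complex_of {{a, b, c}}. \<exists>t\<in>complex_of {{a, b, c}}. s \<subseteq> t \<and> card t = 3"
    using assms by (intro ballI bexI[of _ "{a, b, c}"]) (auto simp: complex_of_def)
  ultimately show ?thesis unfolding pure_2_complex_def by (auto simp: complex_of_def)
qed

lemma tri_complex_of_triangle:
  assumes "a \<noteq> b" "b \<noteq> c" "a \<noteq> c"
  shows "tri (complex_of {{a, b, c}}) x y z \<longleftrightarrow> {x, y, z} = {a, b, c}"
proof
  assume *: "{x, y, z} = {a, b, c}"
  then have "card {x, y, z} = 3" using assms by simp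
  then have "x \<noteq> y \<and> y \<noteq> z \<and> x \<noteq> z" by (auto simp: card_insert_if split: if_splits)
  then show "tri (complex_of {{a, b, c}}) x y z" using * by (auto simp: tri_def complex_of_def)
next
  assume t: "tri (complex_of {{a, b, c}}) x y z"
  then have "{x, y, z} \<subseteq> {a, b, c}" by (simp add: tri_def complex_of_def)
  moreover have "card {x, y, z} = card {a, b, c}" using t assms by (simp add: tri_def)
  ultimately show "{x, y, z} = {a, b, c}" by (intro card_subset_eq) auto
qed

lemma bd_edge_triangle:
  assumes "a \<noteq> b" "b \<noteq> c" "a \<noteq> c"
  shows "bd_edge (complex_of {{a, b, c}}) x y \<longleftrightarrow> x \<noteq> y \<and> {x, y} \<subseteq> {a, b, c}"
proof
  assume "bd_edge (complex_of {{a, b, c}}) x y"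
  then obtain z where t: "tri (complex_of {{a, b, c}}) x y z" unfolding bd_edge_def by (elim ex1E)
  then have "{x, y, z} = {a, b, c}" unfolding tri_complex_of_triangle[OF assms] .
  then show "x \<noteq> y \<and> {x, y} \<subseteq> {a, b, c}" using tri_distinct(1)[OF t] by auto
next
  assume "x \<noteq> y \<and> {x, y} \<subseteq> {a, b, c}"
  then have "(x = a \<and> y = b) \<or> (x = b \<and> y = a) \<or> (x = a \<and> y = c) \<or> (x = c \<and> y = a) \<or> (x = b \<and> y = c) \<or> (x = c \<and> y = b)"
    by auto
  then show "bd_edge (complex_of {{a, b, c}}) x y"
    unfolding bd_edge_def tri_complex_of_triangle[OF assms] using assms
    by (elim disjE) (auto simp: insert_commute doubleton_eq_iff)
qed

lemma realization_triangle:
  assumes d: "a \<noteq> b" "b \<noteq> c" "a \<noteq> c"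
  shows "p \<in> realization (complex_of {{a, b, c}}) \<longleftrightarrow>
    (\<forall>v. 0 \<le> p v) \<and> (\<forall>v. v \<notin> {a, b, c} \<longrightarrow> p v = 0) \<and> p a + p b + p c = 1"
proof
  assume p: "p \<in> realization (complex_of {{a, b, c}})"
  then have sub: "{v. p v \<noteq> 0} \<subseteq> {a, b, c}" by (auto simp: realization_def complex_of_def)
  have "sum p {a, b, c} = 1" by (rule realization_sum_eq[OF p _ sub]) simp
  then show "(\<forall>v. 0 \<le> p v) \<and> (\<forall>v. v \<notin> {a, b, c} \<longrightarrow> p v = 0) \<and> p a + p b + p c = 1"
    using p sub d by (auto simp: realization_nonneg add.assoc)
next
  assume "(\<forall>v. 0 \<le> p v) \<and> (\<forall>v. v \<notin> {a, b, c} \<longrightarrow> p v = 0) \<and> p a + p b + p c = 1"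
  then show "p \<in> realization (complex_of {{a, b, c}})"
    by (intro realizationI[of _ _ "{a, b, c}"] complex_of_triangle_pure d)
      (use d in \<open>auto simp: complex_of_def add.assoc\<close>)
qed

lemma realization_boundary:
  assumes "pure_2_complex K"
  shows "realization (boundary K) = {p \<in> realization K. \<exists>x y. bd_edge K x y \<and> {v. p v \<noteq> 0} \<subseteq> {x, y}}"
proof (intro set_eqI iffI)
  fix p assume p: "p \<in> realization (boundary K)"
  then have "{v. p v \<noteq> 0} \<in> boundary K" by (rule realization_support)
  then obtain x y where xy: "bd_edge K x y" "{v. p v \<noteq> 0} \<subseteq> {x, y}" "{v. p v \<noteq> 0} \<noteq> {}"
    unfolding boundary_eq[OF assms] complex_of_def by blast
  then have "{x, y} \<in> K" using bd_edge_adj[OF assms] by (simp add: adj_def)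
  then have "{v. p v \<noteq> 0} \<in> K" using pure_2_complex_subset[OF assms] xy by metis
  then show "p \<in> {p \<in> realization K. \<exists>x y. bd_edge K x y \<and> {v. p v \<noteq> 0} \<subseteq> {x, y}}"
    using p xy unfolding realization_def by blast
next
  fix p assume p: "p \<in> {p \<in> realization K. \<exists>x y. bd_edge K x y \<and> {v. p v \<noteq> 0} \<subseteq> {x, y}}"
  then obtain x y where xy: "bd_edge K x y" "{v. p v \<noteq> 0} \<subseteq> {x, y}" by blast
  have "{v. p v \<noteq> 0} \<in> K" using p realization_support by blast
  then have "{v. p v \<noteq> 0} \<noteq> {}" using assms unfolding pure_2_complex_def by metis
  then have "{v. p v \<noteq> 0} \<in> boundary K"
    unfolding boundary_eq[OF assms] complex_of_def using xy by blast
  then show "p \<in> realization (boundary K)" using p unfolding realization_def by simp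
qed

text \<open>An affine chart: \<open>a\<close>, \<open>b\<close> and \<open>c\<close> go to -1, 1 and
  the imaginary unit. The boundary is where some barycentric coordinate vanishes, which matches the
  frontier of the flat triangle.\<close>

lemma triangle_triangulates_disk:
  assumes d: "a \<noteq> b" "b \<noteq> c" "a \<noteq> c"
  shows "triangulates_disk (complex_of {{a, b, c}})"
proof -
  let ?K = "complex_of {{a, b, c}}"
  have pure: "pure_2_complex ?K" using d by (rule complex_of_triangle_pure)
  define m where "m p = Complex (p b - p a) (p c)" for p :: "'a \<Rightarrow> real"
  define m' where "m' z v = (if v = a then (1 - Im z - Re z) / 2 else if v = b then (1 - Im z + Re z) / 2
     else if v = c then Im z else 0)" for z v
  note R = realization_triangle[OF d]
  have hom: "homeomorphism (realization ?K) flat_triangle m m'"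
  proof (rule homeomorphismI)
    have *: "m = (\<lambda>p. of_real (p b - p a) + \<i> * of_real (p c))"
      by (auto simp: m_def fun_eq_iff complex_eq_iff)
    show "continuous_on (realization ?K) m" unfolding * by (intro continuous_intros)
    show "continuous_on flat_triangle m'"
    proof (rule continuous_on_coordinatewise_then_product)
      fix v show "continuous_on flat_triangle (\<lambda>z. m' z v)"
        unfolding m'_def by (cases "v = a"; cases "v = b"; cases "v = c") (auto intro!: continuous_intros)
    qed
    show "m ` realization ?K \<subseteq> flat_triangle"
    proof (intro subsetI, elim imageE)
      fix z p assume zp: "z = m p" "p \<in> realization ?K"
      then have "0 \<le> p a" "0 \<le> p b" "0 \<le> p c" "p a + p b + p c = 1" unfolding R by auto
      then show "z \<in> flat_triangle" using zp(1) by (auto simp: m_def flat_triangle_def abs_le_iff)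
    qed
    show "m' ` flat_triangle \<subseteq> realization ?K"
    proof (intro subsetI, elim imageE)
      fix p z assume "p = m' z" "z \<in> flat_triangle"
      then show "p \<in> realization ?K"
        using d unfolding R by (auto simp: m'_def flat_triangle_def field_simps abs_le_iff)
    qed
    show "m' (m p) = p" if "p \<in> realization ?K" for p
    proof
      have "p a + p b + p c = 1" "\<And>v. v \<notin> {a, b, c} \<Longrightarrow> p v = 0" using that unfolding R by auto
      then show "m' (m p) v = p v" for v using d by (auto simp: m'_def m_def)
    qed
    show "m (m' z) = z" if "z \<in> flat_triangle" for z
      using d by (auto simp: m'_def m_def complex_eq_iff field_simps)
  qed
  have bd: "p \<in> realization (boundary ?K) \<longleftrightarrow> p \<in> realization ?K \<and> (p a = 0 \<or> p b = 0 \<or> p c = 0)" for p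
  proof -
    have "(\<exists>x y. bd_edge ?K x y \<and> {v. p v \<noteq> 0} \<subseteq> {x, y}) \<longleftrightarrow> (p a = 0 \<or> p b = 0 \<or> p c = 0)"
      if "p \<in> realization ?K"
    proof
      assume "\<exists>x y. bd_edge ?K x y \<and> {v. p v \<noteq> 0} \<subseteq> {x, y}"
      then obtain x y where "{v. p v \<noteq> 0} \<subseteq> {x, y}" by blast
      then show "p a = 0 \<or> p b = 0 \<or> p c = 0" using d by auto
    next
      have z: "\<And>v. v \<notin> {a, b, c} \<Longrightarrow> p v = 0" using that unfolding R by auto
      assume "p a = 0 \<or> p b = 0 \<or> p c = 0"
      then obtain x y where xy: "x \<noteq> y" "{x, y} \<subseteq> {a, b, c}" "\<And>v. v \<in> {a, b, c} \<Longrightarrow> v \<notin> {x, y} \<Longrightarrow> p v = 0"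
      proof (elim disjE)
        assume "p a = 0" then show thesis using d by (intro that[of b c]) auto
      next
        assume "p b = 0" then show thesis using d by (intro that[of a c]) auto
      next
        assume "p c = 0" then show thesis using d by (intro that[of a b]) auto
      qed
      then have "{v. p v \<noteq> 0} \<subseteq> {x, y}" using z by blast
      then show "\<exists>x y. bd_edge ?K x y \<and> {v. p v \<noteq> 0} \<subseteq> {x, y}"
        unfolding bd_edge_triangle[OF d] using xy(1,2) by blast
    qed
    then show ?thesis unfolding realization_boundary[OF pure] by blast
  qed
  have "m ` realization (boundary ?K) = flat_triangle_frontier"
  proof (intro equalityI subsetI)
    fix z assume "z \<in> m ` realization (boundary ?K)"
    then obtain p where "p \<in> realization ?K" "p a = 0 \<or> p b = 0 \<or> p c = 0" and zm: "z = m p"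
      using bd by (elim imageE) auto
    moreover from this have "0 \<le> p a" "0 \<le> p b" "0 \<le> p c" "p a + p b + p c = 1" unfolding R by auto
    ultimately show "z \<in> flat_triangle_frontier"
      unfolding flat_triangle_frontier_def by (auto simp: m_def abs_if)
  next
    fix z assume z: "z \<in> flat_triangle_frontier"
    then have zt: "z \<in> flat_triangle" by (auto simp: flat_triangle_frontier_def flat_triangle_def)
    have "m' z a = 0 \<or> m' z b = 0 \<or> m' z c = 0"
      using z d unfolding m'_def flat_triangle_frontier_def by (auto simp: abs_if split: if_splits)
    then have "m' z \<in> realization (boundary ?K)" unfolding bd using homeomorphism_image2[OF hom] zt by blast
    moreover have "m (m' z) = z" using homeomorphism_apply2[OF hom zt] .
    ultimately show "z \<in> m ` realization (boundary ?K)" by (metis image_eqI)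
  qed
  moreover obtain h g where hg: "homeomorphism flat_triangle (cball (0::complex) 1) h g" "h ` flat_triangle_frontier = sphere 0 1"
    by (rule flat_triangle_disk)
  ultimately have "(h \<circ> m) ` realization (boundary ?K) = sphere 0 1" by (metis image_comp)
  then show ?thesis
    unfolding triangulates_disk_def using pure homeomorphism_compose[OF hom hg(1)] by blast
qed

section \<open>Gluing triangulated disks\<close>

lemma pure_2_complex_finite:
  assumes "pure_2_complex K" "s \<in> K" shows "finite s"
proof -
  obtain x y z where "s \<subseteq> {x, y, z}" by (rule pure_2_complex_face[OF assms])
  then show ?thesis by (meson finite.emptyI finite_insert finite_subset)
qed

lemma pure_2_complex_nonempty: "pure_2_complex K \<Longrightarrow> s \<in> K \<Longrightarrow> s \<noteq> {}"
  unfolding pure_2_complex_def by metis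

lemma pure_2_complex_Un:
  assumes "pure_2_complex A" "pure_2_complex B" shows "pure_2_complex (A \<union> B)"
  unfolding pure_2_complex_def
proof (intro conjI ballI allI impI)
  show "finite (A \<union> B)" "{} \<notin> A \<union> B"
    using assms by (auto simp: pure_2_complex_def)
next
  fix s t assume "s \<in> A \<union> B" "t \<noteq> {} \<and> t \<subseteq> s"
  then show "t \<in> A \<union> B" using pure_2_complex_subset assms by (metis UnE UnI1 UnI2)
next
  fix s assume "s \<in> A \<union> B"
  then show "\<exists>t\<in>A \<union> B. s \<subseteq> t \<and> card t = 3"
    using assms unfolding pure_2_complex_def by (metis UnE UnI1 UnI2)
qed

lemma tri_Un: "tri (A \<union> B) x y z \<longleftrightarrow> tri A x y z \<or> tri B x y z"
  by (auto simp: tri_def)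

lemma realization_Un: "realization (A \<union> B) = realization A \<union> realization B"
  by (auto simp: realization_def)

lemma realization_Int: "realization (A \<inter> B) = realization A \<inter> realization B"
  by (auto simp: realization_def)

text \<open>Within the larger realization the smaller one is cut out by continuous equations: for
  every simplex outside \<open>A\<close> the product of its coordinates vanishes.\<close>

lemma closedin_realization:
  assumes A: "pure_2_complex A" and K: "pure_2_complex K" and sub: "A \<subseteq> K"
  shows "closedin (top_of_set (realization K)) (realization A)"
proof -
  have *: "realization A = realization K \<inter> (\<Inter>s\<in>K - A. {p. (\<Prod>v\<in>s. p v) = 0})"
  proof (intro equalityI subsetI)
    fix p assume p: "p \<in> realization A"
    have "(\<Prod>v\<in>s. p v) = 0" if s: "s \<in> K - A" for s
    proof (rule ccontr)
      have fin: "finite s" and ne: "s \<noteq> {}" using s pure_2_complex_finite[OF K] pure_2_complex_nonempty[OF K] by auto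
      assume "(\<Prod>v\<in>s. p v) \<noteq> 0"
      then have "s \<subseteq> {v. p v \<noteq> 0}" using fin by (auto simp: prod_zero_iff)
      then have "s \<in> A" by (rule pure_2_complex_subset[OF A realization_support[OF p] ne])
      then show False using s by simp
    qed
    then show "p \<in> realization K \<inter> (\<Inter>s\<in>K - A. {p. (\<Prod>v\<in>s. p v) = 0})"
      using p sub by (auto simp: realization_def)
  next
    fix p assume p: "p \<in> realization K \<inter> (\<Inter>s\<in>K - A. {p. (\<Prod>v\<in>s. p v) = 0})"
    then have sK: "{v. p v \<noteq> 0} \<in> K" by (auto simp: realization_def)
    have "(\<Prod>v\<in>{v. p v \<noteq> 0}. p v) \<noteq> 0" using pure_2_complex_finite[OF K sK] by (simp add: prod_zero_iff)
    then have "{v. p v \<noteq> 0} \<in> A" using p sK by blast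
    then show "p \<in> realization A" using p by (auto simp: realization_def)
  qed
  have "closed {p :: 'a \<Rightarrow> real. (\<Prod>v\<in>s. p v) = 0}" for s
    by (intro closed_Collect_eq continuous_intros)
  then have "closed (\<Inter>s\<in>K - A. {p :: 'a \<Rightarrow> real. (\<Prod>v\<in>s. p v) = 0})" by blast
  then show ?thesis unfolding * by (rule closedin_closed_Int)
qed

lemma triangulates_diskE:
  assumes "triangulates_disk K"
  obtains h g where "homeomorphism (realization K) (cball (0::complex) 1) h g"
    "h ` realization (boundary K) = sphere 0 1"
  using assms unfolding triangulates_disk_def by blast

lemma triangulates_disk_pure: "triangulates_disk K \<Longrightarrow> pure_2_complex K"
  by (simp add: triangulates_disk_def)

text \<open>Transfers the topological gluing to complexes whose intersection is an arc of common
  boundary edges \<open>E\<close>. Combinatorially the boundary of the union loses the edges in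
  \<open>E\<close>, topologically it loses the points with \<open>\<bar>phi p\<bar> < 1\<close>. The
  assumption \<open>interior\<close> says that such a point lies on no other boundary edge, and
  \<open>ends\<close> that each endpoint of the arc still lies on one.\<close>

lemma glue_triangulated_disks:
  assumes A: "triangulates_disk A" and B: "triangulates_disk B"
    and AB: "A \<inter> B = complex_of E"
    and E: "\<And>e. e \<in> E \<Longrightarrow> \<exists>x y. e = {x, y} \<and> bd_edge A x y \<and> bd_edge B x y"
    and phi: "homeomorphism (realization (A \<inter> B)) {-1..1::real} phi psi"
    and interior: "\<And>p x y. \<lbrakk>p \<in> realization (A \<inter> B); \<bar>phi p\<bar> < 1; {v. p v \<noteq> 0} \<subseteq> {x, y};
        bd_edge A x y \<or> bd_edge B x y\<rbrakk> \<Longrightarrow> {x, y} \<in> E"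
    and ends: "\<And>p. \<lbrakk>p \<in> realization (A \<inter> B); \<not> \<bar>phi p\<bar> < 1\<rbrakk> \<Longrightarrow>
        \<exists>x y. (bd_edge A x y \<or> bd_edge B x y) \<and> {x, y} \<notin> E \<and> {v. p v \<noteq> 0} \<subseteq> {x, y}"
  shows "triangulates_disk (A \<union> B)"
proof -
  have pA: "pure_2_complex A" and pB: "pure_2_complex B"
    using A B by (auto intro: triangulates_disk_pure)
  have pAB: "pure_2_complex (A \<union> B)" using pA pB by (rule pure_2_complex_Un)
  have EI: "{x, y} \<in> E" if "{x, y} \<in> A \<inter> B" "x \<noteq> y" for x y
  proof -
    have "{x, y} \<in> complex_of E" using that AB by simp
    then obtain e where e: "e \<in> E" "{x, y} \<subseteq> e" unfolding complex_of_def by blast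
    then obtain a b where "e = {a, b}" using E by blast
    then have "{x, y} = e" using e that by auto
    then show ?thesis using e by simp
  qed
  have E2: "bd_edge A x y \<and> bd_edge B x y" if xy: "{x, y} \<in> E" for x y
  proof -
    obtain a b where ab: "{x, y} = {a, b}" "bd_edge A a b" "bd_edge B a b" using E[OF xy] by blast
    then have "x = a \<and> y = b \<or> x = b \<and> y = a" by (auto simp: doubleton_eq_iff)
    then show ?thesis using ab bd_edge_commute[of _ a b] by auto
  qed
  have no_tri: False if t: "tri A x y z" "tri B x y z" for x y z
  proof -
    have "{x, y, z} \<in> complex_of E" using t AB by (auto simp: tri_def)
    then obtain e where e: "e \<in> E" "{x, y, z} \<subseteq> e" unfolding complex_of_def by blast
    then obtain a b where "e = {a, b}" using E by blast
    then show False using e t by (auto simp: tri_def)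
  qed
  have shared: "{x, y} \<in> E" if "tri A x y z" "tri B x y z'" for x y z z'
    using EI[of x y] pure_2_complex_tri_adj(1)[OF pA that(1)] pure_2_complex_tri_adj(1)[OF pB that(2)]
    by (simp add: adj_def)
  have bd: "bd_edge (A \<union> B) x y \<longleftrightarrow> (bd_edge A x y \<or> bd_edge B x y) \<and> {x, y} \<notin> E" for x y
  proof
    assume *: "bd_edge (A \<union> B) x y"
    then obtain z where z: "tri A x y z \<or> tri B x y z" "\<And>w. tri A x y w \<or> tri B x y w \<Longrightarrow> w = z"
      unfolding bd_edge_def tri_Un by (elim ex1E) metis
    have 1: "bd_edge A x y \<or> bd_edge B x y" using z unfolding bd_edge_def by metis
    have "{x, y} \<notin> E"
    proof
      assume "{x, y} \<in> E"
      then have "bd_edge A x y" "bd_edge B x y" using E2 by auto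
      then obtain w w' where "tri A x y w" "tri B x y w'" unfolding bd_edge_def by (elim ex1E)
      then show False using z(2)[of w] z(2)[of w'] no_tri by auto
    qed
    then show "(bd_edge A x y \<or> bd_edge B x y) \<and> {x, y} \<notin> E" using 1 by simp
  next
    assume *: "(bd_edge A x y \<or> bd_edge B x y) \<and> {x, y} \<notin> E"
    then show "bd_edge (A \<union> B) x y" using shared unfolding bd_edge_def tri_Un by metis
  qed
  have bdR: "realization (boundary (A \<union> B)) = (realization (boundary A) \<union> realization (boundary B))
      - {p \<in> realization A \<inter> realization B. \<bar>phi p\<bar> < 1}" (is "?L = ?R")
  proof (intro equalityI subsetI)
    fix p assume "p \<in> ?L"
    then obtain x y where xy: "p \<in> realization (A \<union> B)" "bd_edge (A \<union> B) x y" "{v. p v \<noteq> 0} \<subseteq> {x, y}"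
      unfolding realization_boundary[OF pAB] by blast
    have in1: "p \<in> realization K" if "pure_2_complex K" "bd_edge K x y" for K
    proof -
      have "{x, y} \<in> K" using bd_edge_adj[OF that] by (simp add: adj_def)
      moreover have "{v. p v \<noteq> 0} \<noteq> {}"
        using realization_support[OF xy(1)] pure_2_complex_nonempty[OF pAB] by blast
      ultimately have "{v. p v \<noteq> 0} \<in> K" using xy(3) pure_2_complex_subset[OF that(1)] by metis
      then show ?thesis using xy(1) unfolding realization_def by simp
    qed
    have *: "bd_edge A x y \<or> bd_edge B x y" "{x, y} \<notin> E" using xy(2) bd by auto
    then have "p \<in> realization (boundary A) \<union> realization (boundary B)"
      unfolding realization_boundary[OF pA] realization_boundary[OF pB]
      using in1[OF pA] in1[OF pB] xy(3) by blast
    moreover have "\<not> (p \<in> realization A \<inter> realization B \<and> \<bar>phi p\<bar> < 1)"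
      using interior[of p x y] xy(3) * by (auto simp: realization_Int)
    ultimately show "p \<in> ?R" by blast
  next
    fix p assume p: "p \<in> ?R"
    then obtain x y where xy: "p \<in> realization (A \<union> B)" "bd_edge A x y \<or> bd_edge B x y" "{v. p v \<noteq> 0} \<subseteq> {x, y}"
      unfolding realization_boundary[OF pA] realization_boundary[OF pB] realization_Un by blast
    show "p \<in> ?L"
    proof (cases "{x, y} \<in> E")
      case False
      then show ?thesis using xy bd unfolding realization_boundary[OF pAB] by blast
    next
      case True
      have ne: "{v. p v \<noteq> 0} \<noteq> {}"
        using realization_support[OF xy(1)] pure_2_complex_nonempty[OF pAB] by blast
      have "{v. p v \<noteq> 0} \<in> A \<inter> B"
        unfolding AB complex_of_def using True xy(3) ne by blast
      then have pi: "p \<in> realization (A \<inter> B)" using xy(1) unfolding realization_def by simp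
      then have "\<not> \<bar>phi p\<bar> < 1" using p by (auto simp: realization_Int)
      then show ?thesis using ends[OF pi] bd xy(1) unfolding realization_boundary[OF pAB] by blast
    qed
  qed
  obtain h1 g1 where h1: "homeomorphism (realization A) (cball (0::complex) 1) h1 g1"
    "h1 ` realization (boundary A) = sphere 0 1" using A by (rule triangulates_diskE)
  obtain h2 g2 where h2: "homeomorphism (realization B) (cball (0::complex) 1) h2 g2"
    "h2 ` realization (boundary B) = sphere 0 1" using B by (rule triangulates_diskE)
  have sub: "realization (boundary A) \<subseteq> realization A" "realization (boundary B) \<subseteq> realization B"
    unfolding realization_boundary[OF pA] realization_boundary[OF pB] by auto
  have al: "realization A \<inter> realization B \<subseteq> realization (boundary A)"
    "realization A \<inter> realization B \<subseteq> realization (boundary B)"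
  proof -
    have "\<exists>x y. bd_edge A x y \<and> bd_edge B x y \<and> {v. p v \<noteq> 0} \<subseteq> {x, y}" if "p \<in> realization A \<inter> realization B" for p
    proof -
      have "{v. p v \<noteq> 0} \<in> complex_of E" using that AB by (auto simp: realization_def)
      then obtain e where "e \<in> E" "{v. p v \<noteq> 0} \<subseteq> e" unfolding complex_of_def by blast
      then show ?thesis using E by metis
    qed
    then show "realization A \<inter> realization B \<subseteq> realization (boundary A)"
      "realization A \<inter> realization B \<subseteq> realization (boundary B)"
      unfolding realization_boundary[OF pA] realization_boundary[OF pB] by blast+
  qed
  have clo: "closedin (top_of_set (realization A \<union> realization B)) (realization A)"
    "closedin (top_of_set (realization A \<union> realization B)) (realization B)"
    using closedin_realization[OF pA pAB] closedin_realization[OF pB pAB] by (auto simp: realization_Un)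
  obtain h g where "homeomorphism (realization A \<union> realization B) (cball (0::complex) 1) h g"
    "h ` ((realization (boundary A) \<union> realization (boundary B))
      - {p \<in> realization A \<inter> realization B. \<bar>phi p\<bar> < 1}) = sphere 0 1"
    using glue_disks[OF h1 sub(1) h2 sub(2) phi[unfolded realization_Int] al clo] by blast
  then show ?thesis
    unfolding triangulates_disk_def using pAB bdR by (auto simp: realization_Un)
qed

lemma realization_edge:
  assumes "b \<noteq> c"
  shows "p \<in> realization (complex_of {{b, c}}) \<longleftrightarrow>
    (\<forall>v. 0 \<le> p v) \<and> (\<forall>v. v \<notin> {b, c} \<longrightarrow> p v = 0) \<and> p b + p c = 1"
proof
  assume p: "p \<in> realization (complex_of {{b, c}})"
  then have sub: "{v. p v \<noteq> 0} \<subseteq> {b, c}" by (auto simp: realization_def complex_of_def)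
  have "sum p {b, c} = 1" by (rule realization_sum_eq[OF p _ sub]) simp
  then show "(\<forall>v. 0 \<le> p v) \<and> (\<forall>v. v \<notin> {b, c} \<longrightarrow> p v = 0) \<and> p b + p c = 1"
    using p sub assms by (auto simp: realization_nonneg)
next
  assume *: "(\<forall>v. 0 \<le> p v) \<and> (\<forall>v. v \<notin> {b, c} \<longrightarrow> p v = 0) \<and> p b + p c = 1"
  then have sub: "{v. p v \<noteq> 0} \<subseteq> {b, c}" by auto
  have "sum p {v. p v \<noteq> 0} = sum p {b, c}"
    by (rule sum.mono_neutral_left) (use sub in auto)
  then have 1: "sum p {v. p v \<noteq> 0} = 1" using * assms by simp
  then have "{v. p v \<noteq> 0} \<noteq> {}" by force
  then show "p \<in> realization (complex_of {{b, c}})"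
    using 1 sub * unfolding realization_def complex_of_def by simp
qed

text \<open>The arc is the edge \<open>bc\<close> with the difference of its two barycentric
  coordinates as parameter. The further boundary edges \<open>bb'\<close> and \<open>cc'\<close>
  keep its endpoints on the boundary of the union.\<close>

lemma glue_along_edge:
  assumes A: "triangulates_disk A" and B: "triangulates_disk B"
    and AB: "A \<inter> B = complex_of {{b, c}}" "bd_edge A b c" "bd_edge B b c"
    and ends: "bd_edge A b b'" "b' \<noteq> c" "bd_edge A c c'" "c' \<noteq> b"
  shows "triangulates_disk (A \<union> B)"
proof -
  have bc: "b \<noteq> c" using bd_edge_adj[OF triangulates_disk_pure[OF A] AB(2)] by (simp add: adj_def)
  define phi where "phi p = p c - p b" for p :: "'a \<Rightarrow> real"
  define psi where "psi t v = (if v = c then (1 + t) / 2 else if v = b then (1 - t) / 2 else 0)" for t :: real and v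
  note R = realization_edge[OF bc]
  have hom: "homeomorphism (realization (A \<inter> B)) {-1..1} phi psi"
    unfolding AB(1)
  proof (rule homeomorphismI)
    show "continuous_on (realization (complex_of {{b, c}})) phi" unfolding phi_def by (intro continuous_intros)
    show "continuous_on {-1..1} psi"
    proof (rule continuous_on_coordinatewise_then_product)
      fix v show "continuous_on {-1..1} (\<lambda>t. psi t v)"
        unfolding psi_def by (cases "v = b"; cases "v = c") (auto intro!: continuous_intros)
    qed
    show "phi ` realization (complex_of {{b, c}}) \<subseteq> {-1..1}"
    proof (intro subsetI, elim imageE)
      fix t p assume "t = phi p" "p \<in> realization (complex_of {{b, c}})"
      moreover from this have "0 \<le> p b" "0 \<le> p c" "p b + p c = 1" unfolding R by auto
      ultimately show "t \<in> {-1..1}" by (simp add: phi_def)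
    qed
    show "psi ` {-1..1} \<subseteq> realization (complex_of {{b, c}})"
    proof (intro subsetI, elim imageE)
      fix t p assume "p = psi t" "t \<in> {-1..1}"
      then show "p \<in> realization (complex_of {{b, c}})" using bc unfolding R by (auto simp: psi_def field_simps)
    qed
    show "psi (phi p) = p" if "p \<in> realization (complex_of {{b, c}})" for p
    proof
      fix v
      have "p b + p c = 1" "\<And>v. v \<notin> {b, c} \<Longrightarrow> p v = 0" using that unfolding R by auto
      then show "psi (phi p) v = p v" using bc by (auto simp: psi_def phi_def)
    qed
    show "phi (psi t) = t" if "t \<in> {-1..1}" for t using bc by (simp add: psi_def phi_def field_simps)
  qed
  have ab: "0 \<le> p b \<and> 0 \<le> p c \<and> p b + p c = 1 \<and> (\<forall>v. v \<notin> {b, c} \<longrightarrow> p v = 0)"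
    if "p \<in> realization (A \<inter> B)" for p using that unfolding AB(1) R by auto
  show ?thesis
  proof (rule glue_triangulated_disks[OF A B AB(1) _ hom])
    fix p x y assume p: "p \<in> realization (A \<inter> B)" "\<bar>phi p\<bar> < 1" "{v. p v \<noteq> 0} \<subseteq> {x, y}"
    then have "p b \<noteq> 0" "p c \<noteq> 0" using ab[OF p(1)] by (auto simp: phi_def)
    then show "{x, y} \<in> {{b, c}}" using p(3) bc by auto
  next
    fix p assume p: "p \<in> realization (A \<inter> B)" "\<not> \<bar>phi p\<bar> < 1"
    then have "p b = 0 \<or> p c = 0" using ab[OF p(1)] by (auto simp: phi_def abs_if split: if_splits)
    moreover have z: "\<And>v. v \<notin> {b, c} \<Longrightarrow> p v = 0" using ab[OF p(1)] by blast
    ultimately have "(\<forall>v. p v \<noteq> 0 \<longrightarrow> v = c) \<or> (\<forall>v. p v \<noteq> 0 \<longrightarrow> v = b)" by (metis insertE singletonD)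
    then have "{v. p v \<noteq> 0} \<subseteq> {c, c'} \<or> {v. p v \<noteq> 0} \<subseteq> {b, b'}" by auto
    moreover have "{b, b'} \<notin> {{b, c}}" "{c, c'} \<notin> {{b, c}}" using ends bc by (auto simp: doubleton_eq_iff)
    ultimately show "\<exists>x y. (bd_edge A x y \<or> bd_edge B x y) \<and> {x, y} \<notin> {{b, c}} \<and> {v. p v \<noteq> 0} \<subseteq> {x, y}"
      using ends by blast
  qed (use AB in blast)
qed

lemma realization_two_edges:
  assumes d: "a \<noteq> b" "b \<noteq> c" "a \<noteq> c"
  shows "p \<in> realization (complex_of {{a, c}, {b, c}}) \<longleftrightarrow>
    (\<forall>v. 0 \<le> p v) \<and> (\<forall>v. v \<notin> {a, b, c} \<longrightarrow> p v = 0) \<and> p a + p b + p c = 1 \<and> (p a = 0 \<or> p b = 0)"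
proof -
  have "complex_of {{a, c}, {b, c}} = complex_of {{a, c}} \<union> complex_of {{b, c}}"
    by (auto simp: complex_of_def)
  then show ?thesis using d by (auto simp: realization_Un realization_edge)
qed

text \<open>The arc is the path from \<open>a\<close> through \<open>c\<close> to \<open>b\<close>;
  one of the coordinates of \<open>a\<close> and \<open>b\<close> vanishes on it, so their
  difference parametrises it with \<open>c\<close> at 0. The vertex \<open>c\<close> becomes inner,
  hence the demand that its boundary edges in \<open>A\<close> are just these two; the new boundary
  edge \<open>ab\<close> contains both endpoints.\<close>

lemma glue_ear:
  assumes A: "triangulates_disk A" and d: "a \<noteq> b" "b \<noteq> c" "a \<noteq> c"
    and AB: "A \<inter> complex_of {{a, b, c}} = complex_of {{a, c}, {b, c}}"
    and bd: "bd_edge A a c" "bd_edge A b c" "\<And>x. bd_edge A c x \<Longrightarrow> x = a \<or> x = b"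
  shows "triangulates_disk (A \<union> complex_of {{a, b, c}})"
proof -
  let ?B = "complex_of {{a, b, c}}"
  define phi where "phi p = p b - p a" for p :: "'a \<Rightarrow> real"
  define psi where "psi t v = (if v = b then max t 0 else if v = a then max (- t) 0 else if v = c then 1 - \<bar>t\<bar> else 0)"
    for t :: real and v
  note R = realization_two_edges[OF d]
  have hom: "homeomorphism (realization (A \<inter> ?B)) {-1..1} phi psi"
    unfolding AB
  proof (rule homeomorphismI)
    show "continuous_on (realization (complex_of {{a, c}, {b, c}})) phi" unfolding phi_def by (intro continuous_intros)
    show "continuous_on {-1..1} psi"
    proof (rule continuous_on_coordinatewise_then_product)
      fix v show "continuous_on {-1..1} (\<lambda>t. psi t v)"
        unfolding psi_def by (cases "v = a"; cases "v = b"; cases "v = c") (auto intro!: continuous_intros)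
    qed
    show "phi ` realization (complex_of {{a, c}, {b, c}}) \<subseteq> {-1..1}"
    proof (intro subsetI, elim imageE)
      fix t p assume "t = phi p" "p \<in> realization (complex_of {{a, c}, {b, c}})"
      moreover from this have "0 \<le> p a" "0 \<le> p b" "0 \<le> p c" "p a + p b + p c = 1" unfolding R by auto
      ultimately show "t \<in> {-1..1}" by (simp add: phi_def)
    qed
    show "psi ` {-1..1} \<subseteq> realization (complex_of {{a, c}, {b, c}})"
    proof (intro subsetI, elim imageE)
      fix t p assume "p = psi t" "t \<in> {-1..1}"
      then show "p \<in> realization (complex_of {{a, c}, {b, c}})" using d unfolding R by (auto simp: psi_def max_def)
    qed
    show "psi (phi p) = p" if "p \<in> realization (complex_of {{a, c}, {b, c}})" for p
    proof
      fix v
      have "0 \<le> p a" "0 \<le> p b" "0 \<le> p c" "p a + p b + p c = 1" "p a = 0 \<or> p b = 0" "\<And>v. v \<notin> {a, b, c} \<Longrightarrow> p v = 0"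
        using that unfolding R by auto
      then show "psi (phi p) v = p v" using d by (auto simp: psi_def phi_def max_def)
    qed
    show "phi (psi t) = t" if "t \<in> {-1..1}" for t using d by (simp add: psi_def phi_def max_def)
  qed
  have ab: "0 \<le> p a \<and> 0 \<le> p b \<and> 0 \<le> p c \<and> p a + p b + p c = 1 \<and> (p a = 0 \<or> p b = 0) \<and> (\<forall>v. v \<notin> {a, b, c} \<longrightarrow> p v = 0)"
    if "p \<in> realization (A \<inter> ?B)" for p using that unfolding AB R by auto
  show ?thesis
  proof (rule glue_triangulated_disks[OF A triangle_triangulates_disk[OF d] AB _ hom])
    fix e assume "e \<in> {{a, c}, {b, c}}"
    then show "\<exists>x y. e = {x, y} \<and> bd_edge A x y \<and> bd_edge ?B x y"
      unfolding bd_edge_triangle[OF d] using bd(1,2) d by blast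
  next
    fix p x y assume p: "p \<in> realization (A \<inter> ?B)" "\<bar>phi p\<bar> < 1" "{v. p v \<noteq> 0} \<subseteq> {x, y}"
      and xy: "bd_edge A x y \<or> bd_edge ?B x y"
    have "p c \<noteq> 0" using ab[OF p(1)] p(2) by (auto simp: phi_def)
    then have c: "c = x \<or> c = y" using p(3) by auto
    from xy show "{x, y} \<in> {{a, c}, {b, c}}"
    proof
      assume "bd_edge A x y"
      then show ?thesis using c bd(3)[of x] bd(3)[of y] bd_edge_commute[of A x y] by auto
    next
      assume "bd_edge ?B x y"
      then show ?thesis unfolding bd_edge_triangle[OF d] using c by auto
    qed
  next
    fix p assume p: "p \<in> realization (A \<inter> ?B)" "\<not> \<bar>phi p\<bar> < 1"
    then have "p c = 0" using ab[OF p(1)] by (auto simp: phi_def abs_if split: if_splits)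
    moreover have z: "\<And>v. v \<notin> {a, b, c} \<Longrightarrow> p v = 0" using ab[OF p(1)] by blast
    ultimately have "{v. p v \<noteq> 0} \<subseteq> {a, b}" by auto
    moreover have "{a, b} \<notin> {{a, c}, {b, c}}" using d by (auto simp: doubleton_eq_iff)
    moreover have "bd_edge ?B a b" unfolding bd_edge_triangle[OF d] using d by blast
    ultimately show "\<exists>x y. (bd_edge A x y \<or> bd_edge ?B x y) \<and> {x, y} \<notin> {{a, c}, {b, c}} \<and> {v. p v \<noteq> 0} \<subseteq> {x, y}"
      by blast
  qed
qed

section \<open>Links\<close>

text \<open>The handshake lemma for the graph with adjacency \<open>R\<close>.\<close>

lemma even_card_symmetric_pairs:
  assumes "finite S" "\<And>x y. R x y \<Longrightarrow> R y x" "\<And>x. \<not> R x x"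
  shows "even (\<Sum>x\<in>S. card {y \<in> S. R x y})"
  using assms(1)
proof (induction S)
  case (insert a S)
  have split: "{y \<in> insert a S. R x y} = {y \<in> S. R x y} \<union> (if R x a then {a} else {})" for x
    by auto
  have 1: "card {y \<in> insert a S. R x y} = card {y \<in> S. R x y} + (if R x a then 1 else 0)" for x
    unfolding split using insert.hyps by (subst card_Un_disjoint) auto
  have "(\<Sum>x\<in>insert a S. card {y \<in> insert a S. R x y})
      = (\<Sum>x\<in>insert a S. card {y \<in> S. R x y} + (if R x a then 1 else 0))"
    by (intro sum.cong refl 1)
  also have "\<dots> = card {y \<in> S. R a y} + (\<Sum>x\<in>S. card {y \<in> S. R x y} + (if R x a then 1 else 0))"
    using insert.hyps assms(3)[of a] by simp
  also have "(\<Sum>x\<in>S. card {y \<in> S. R x y} + (if R x a then 1 else 0))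
      = (\<Sum>x\<in>S. card {y \<in> S. R x y}) + card {x \<in> S. R x a}"
    using insert.hyps by (simp add: sum.distrib sum.If_cases Int_def)
  also have "{x \<in> S. R x a} = {y \<in> S. R a y}" using assms(2) by blast
  finally show ?case using insert.IH by simp
qed simp

lemma finite_tri: "pure_2_complex K \<Longrightarrow> finite {z. tri K x y z}"
  by (rule finite_subset[OF _ finite_neighbours[of K x]])
    (auto simp: neighbours_adj intro: pure_2_complex_tri_adj(3))

lemma comb_disk_card_tri:
  assumes K: "comb_disk K" and xy: "adj K x y"
  shows "card {z. tri K x y z} = (if bd_edge K x y then 1 else 2)"
proof -
  note pure = comb_disk_pure[OF K]
  have fin: "finite {z. tri K x y z}" by (rule finite_tri[OF pure])
  obtain z where z: "tri K x y z" using pure_2_complex_adj_tri[OF pure xy] .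
  have "card {z. tri K x y z} = 2" if nb: "\<not> bd_edge K x y"
  proof -
    obtain w where w: "tri K x y w" "w \<noteq> z" using nb z unfolding bd_edge_def by metis
    have "{z. tri K x y z} = {z, w}" using comb_disk_two_faces[OF K z w(1)] z w by auto
    then show ?thesis using w(2) by simp
  qed
  then show ?thesis using bd_edge_card[of K x y] by auto
qed

lemma inner_edge_second_face:
  assumes "\<not> bd_edge K x y" "tri K x y z" obtains w where "tri K x y w" "w \<noteq> z"
  using assms unfolding bd_edge_def by metis

lemma bd_edge_unique: "bd_edge K x y \<Longrightarrow> tri K x y z \<Longrightarrow> tri K x y w \<Longrightarrow> z = w"
  unfolding bd_edge_def by metis

text \<open>Handshakes in the link of \<open>v\<close>, only counting faces from \<open>X\<close>.
  With all faces it controls boundary edges; for general \<open>X\<close> it says that the boundary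
  of a boundary vanishes modulo two.\<close>

lemma comb_disk_link_sum_even:
  assumes K: "comb_disk K"
  shows "even (\<Sum>x\<in>neighbours K v. card {y. tri K v x y \<and> {v, x, y} \<in> X})"
proof -
  note pure = comb_disk_pure[OF K]
  have "{y. tri K v x y \<and> {v, x, y} \<in> X} = {y \<in> neighbours K v. tri K v x y \<and> {v, x, y} \<in> X}" for x
    using pure_2_complex_tri_adj(3)[OF pure] by (auto simp: neighbours_adj)
  then show ?thesis
    using even_card_symmetric_pairs[OF finite_neighbours[OF pure, of v], of "\<lambda>x y. tri K v x y \<and> {v, x, y} \<in> X"]
    by (simp add: tri_swap23 insert_commute) (metis (no_types, lifting) insert_commute tri_distinct(2) tri_swap23)
qed

text \<open>In the link of \<open>v\<close> a boundary edge is a vertex of degree one and every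
  other edge a vertex of degree two; a single vertex of odd degree is impossible.\<close>

lemma bd_edge_second:
  assumes K: "comb_disk K" and vx: "bd_edge K v x"
  obtains y where "bd_edge K v y" "y \<noteq> x"
proof (rule ccontr)
  assume "\<not> thesis"
  then have only: "\<And>y. bd_edge K v y \<Longrightarrow> y = x" using that by blast
  note pure = comb_disk_pure[OF K]
  have x: "x \<in> neighbours K v" using bd_edge_adj[OF pure vx] by (simp add: neighbours_adj)
  have fin: "finite (neighbours K v)" by (rule finite_neighbours[OF pure])
  have "(\<Sum>y\<in>neighbours K v. card {z. tri K v y z}) = (\<Sum>y\<in>neighbours K v. if y = x then 1 else 2)"
  proof (rule sum.cong[OF refl])
    fix y assume "y \<in> neighbours K v"
    moreover have "bd_edge K v y \<longleftrightarrow> y = x" using only vx by blast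
    ultimately show "card {z. tri K v y z} = (if y = x then 1 else 2)"
      using comb_disk_card_tri[OF K, of v y] by (simp add: neighbours_adj)
  qed
  also have "\<dots> = 1 + 2 * card (neighbours K v - {x})"
    using x fin by (subst sum.remove[of _ x]) auto
  finally have "odd (\<Sum>y\<in>neighbours K v. card {z. tri K v y z})" by simp
  then show False using comb_disk_link_sum_even[OF K, of v UNIV] by simp
qed

text \<open>Removing a vertex \<open>x\<close> from the link of \<open>v\<close> leaves a graph each of whose components contains
  a former neighbour of \<open>x\<close>.\<close>

lemma link_remove_vertex:
  assumes K: "comb_disk K" and vx: "adj K v x" and vy: "adj K v y" "y \<noteq> x"
    and P: "\<And>a b. \<lbrakk>tri K v a b; a \<noteq> x; b \<noteq> x\<rbrakk> \<Longrightarrow> P a \<longleftrightarrow> P b"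
  obtains w where "tri K v x w" "P y \<longleftrightarrow> P w"
proof (rule ccontr)
  assume "\<not> thesis"
  then have no: "\<And>w. tri K v x w \<Longrightarrow> P w \<noteq> P y" using that by blast
  define Q where "Q z \<longleftrightarrow> z \<noteq> x \<and> P z = P y" for z
  have "Q y \<longleftrightarrow> Q x"
  proof (rule comb_disk_link[OF K _ vy(1) vx])
    fix a b assume t: "tri K v a b"
    show "Q a \<longleftrightarrow> Q b"
    proof (cases "a = x \<or> b = x")
      case True
      then show ?thesis using no[of a] no[of b] t tri_swap23[of K v a b] by (auto simp: Q_def)
    next
      case False
      then show ?thesis using P[OF t] by (simp add: Q_def)
    qed
  qed
  then show False using vy(2) by (simp add: Q_def)
qed

text \<open>The link of an inner vertex is a cycle and stays connected without \<open>x\<close>. In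
  terms of parity: all link degrees are two, so if \<open>w1\<close> and \<open>w2\<close> fell into
  different classes of \<open>P\<close>, the class of \<open>w1\<close> would be a graph in which
  only \<open>w1\<close>, having lost \<open>x\<close>, has odd degree.\<close>

lemma inner_link_remove_vertex:
  assumes K: "comb_disk K" and v: "\<not> bd_vert K v"
    and w: "tri K v x w1" "tri K v x w2"
    and P: "\<And>a b. \<lbrakk>tri K v a b; a \<noteq> x; b \<noteq> x\<rbrakk> \<Longrightarrow> P a \<longleftrightarrow> P b"
  shows "P w1 \<longleftrightarrow> P w2"
proof (rule ccontr)
  assume neq: "\<not> (P w1 \<longleftrightarrow> P w2)"
  then have w12: "w1 \<noteq> w2" by auto
  note pure = comb_disk_pure[OF K]
  define Y where "Y = {y. adj K v y \<and> y \<noteq> x \<and> P y = P w1}"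
  have fin: "finite Y"
    by (rule finite_subset[OF _ finite_neighbours[OF pure, of v]]) (auto simp: Y_def neighbours_adj)
  have w1: "w1 \<in> Y"
    using pure_2_complex_tri_adj(3)[OF pure w(1)] tri_distinct[OF w(1)] by (simp add: Y_def)
  have "card {z \<in> Y. tri K v y z} = (if y = w1 then 1 else 2)" if y: "y \<in> Y" for y
  proof -
    have vy: "adj K v y" "y \<noteq> x" "P y = P w1" using y by (auto simp: Y_def)
    have two: "card {z. tri K v y z} = 2"
      using comb_disk_card_tri[OF K vy(1)] v by (auto simp: bd_vert_def)
    have eq: "{z \<in> Y. tri K v y z} = {z. tri K v y z} - {x}"
    proof (intro equalityI subsetI)
      fix z assume z: "z \<in> {z. tri K v y z} - {x}"
      then have "adj K v z" using pure_2_complex_tri_adj(3)[OF pure] by blast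
      moreover have "P z = P w1" using P[of y z] z vy by simp
      ultimately show "z \<in> {z \<in> Y. tri K v y z}" using z by (simp add: Y_def)
    qed (auto simp: Y_def)
    have "tri K v y x \<longleftrightarrow> y = w1"
    proof
      assume "tri K v y x"
      then have "tri K v x y" using tri_swap23 by metis
      then have "y = w1 \<or> y = w2" using comb_disk_two_faces[OF K w, of y] w12 by auto
      then show "y = w1" using vy(3) neq by auto
    next
      assume "y = w1" then show "tri K v y x" using w(1) tri_swap23 by metis
    qed
    then show ?thesis
      unfolding eq using two finite_tri[OF pure, of v y] by (auto simp: card_Diff_singleton_if)
  qed
  then have "(\<Sum>y\<in>Y. card {z \<in> Y. tri K v y z}) = (\<Sum>y\<in>Y. if y = w1 then 1 else 2)"
    by (rule sum.cong[OF refl])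
  also have "\<dots> = 1 + 2 * card (Y - {w1})" using w1 fin by (subst sum.remove[of _ w1]) auto
  finally have "odd (\<Sum>y\<in>Y. card {z \<in> Y. tri K v y z})" by simp
  moreover have "even (\<Sum>y\<in>Y. card {z \<in> Y. tri K v y z})"
    by (rule even_card_symmetric_pairs[OF fin]) (auto simp: tri_swap23 dest: tri_distinct)
  ultimately show False by simp
qed

text \<open>The form in which connectedness of links yields degree bounds: it is enough to follow
  the faces around \<open>v\<close>.\<close>

lemma neighbours_closed:
  assumes K: "comb_disk K" and x: "x \<in> S" "adj K v x"
    and clo: "\<And>a b. a \<in> S \<Longrightarrow> tri K v a b \<Longrightarrow> b \<in> S"
  shows "neighbours K v \<subseteq> S"
proof
  fix y assume "y \<in> neighbours K v"
  then have "x \<in> S \<longleftrightarrow> y \<in> S"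
    using clo tri_swap23[of K v] by (intro comb_disk_link[OF K _ x(2)]) (auto simp: neighbours_adj)
  then show "y \<in> S" using x by simp
qed

lemma verts_closed:
  assumes K: "comb_disk K" and x: "x \<in> S" "x \<in> verts K"
    and clo: "\<And>a b. a \<in> S \<Longrightarrow> adj K a b \<Longrightarrow> b \<in> S"
  shows "verts K \<subseteq> S"
proof
  fix y assume "y \<in> verts K"
  moreover have "a \<in> S \<longleftrightarrow> b \<in> S" if "adj K a b" for a b
    using clo[of a b] clo[of b a] that adj_sym[OF that] by auto
  ultimately have "x \<in> S \<longleftrightarrow> y \<in> S"
    by (intro comb_disk_connected[OF K _ x(2)])
  then show "y \<in> S" using x by simp
qed

section \<open>Deleting vertices\<close>

lemma comb_diskI:
  assumes "pure_2_complex K"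
    "\<And>x y a b c. \<lbrakk>tri K x y a; tri K x y b; tri K x y c\<rbrakk> \<Longrightarrow> a = b \<or> a = c \<or> b = c"
    "\<And>v P x y. \<lbrakk>\<And>x y. tri K v x y \<Longrightarrow> P x \<longleftrightarrow> P y; adj K v x; adj K v y\<rbrakk> \<Longrightarrow> P x \<longleftrightarrow> P y"
    "\<And>P x y. \<lbrakk>\<And>x y. adj K x y \<Longrightarrow> P x \<longleftrightarrow> P y; x \<in> verts K; y \<in> verts K\<rbrakk> \<Longrightarrow> P x \<longleftrightarrow> P y"
    "bd_edge K u w"
    "\<And>c. cocycle K c \<Longrightarrow> \<exists>f. \<forall>x y. adj K x y \<longrightarrow> c x y = f y - f x"
  shows "comb_disk K"
  unfolding comb_disk_def
proof (intro conjI allI impI ballI)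
  fix x y a b c assume "tri K x y a" "tri K x y b" "tri K x y c"
  then show "a = b \<or> a = c \<or> b = c" by (rule assms(2))
next
  fix v P x y assume "\<forall>x y. tri K v x y \<longrightarrow> (P x \<longleftrightarrow> P y)" and xy: "adj K v x" "adj K v y"
  then have "\<And>x y. tri K v x y \<Longrightarrow> P x \<longleftrightarrow> P y" by simp
  then show "P x \<longleftrightarrow> P y" by (rule assms(3)[OF _ xy])
next
  fix P x y assume "\<forall>x y. adj K x y \<longrightarrow> (P x \<longleftrightarrow> P y)" and xy: "x \<in> verts K" "y \<in> verts K"
  then have "\<And>x y. adj K x y \<Longrightarrow> P x \<longleftrightarrow> P y" by simp
  then show "P x \<longleftrightarrow> P y" by (rule assms(4)[OF _ xy])
qed (use assms in auto)

text \<open>Every face meeting \<open>D\<close> lies in \<open>D \<union> Q\<close>, and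
  \<open>Q\<close> is a clique, so sending \<open>D\<close> to one vertex of \<open>Q\<close> is
  simplicial as far as predicates and cocycles are concerned; both are pulled back from
  \<open>H\<close> to \<open>K\<close> along it. The set \<open>Q\<close> is the edge along which a
  piece is cut off, or the 3-cycle that is filled by a new face; \<open>clique3\<close> bounds its
  size by three.\<close>

lemma comb_disk_delete:
  assumes K: "comb_disk K" and H: "H = delete_verts K D \<union> {Q}"
    and QD: "Q \<inter> D = {}" and q: "q0 \<in> Q" "q1 \<in> Q" "q0 \<noteq> q1"
    and faces: "\<And>x y z. tri K x y z \<Longrightarrow> x \<in> D \<Longrightarrow> y \<in> D \<union> Q"
    and clique: "\<And>x y. \<lbrakk>x \<in> Q; y \<in> Q; x \<noteq> y\<rbrakk> \<Longrightarrow> adj K x y"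
    and clique3: "\<And>x y z. \<lbrakk>x \<in> Q; y \<in> Q; z \<in> Q; x \<noteq> y; y \<noteq> z; x \<noteq> z\<rbrakk> \<Longrightarrow> Q = {x, y, z}"
    and pure: "pure_2_complex H"
    and two: "\<And>x y a b c. \<lbrakk>tri H x y a; tri H x y b; tri H x y c\<rbrakk> \<Longrightarrow> a = b \<or> a = c \<or> b = c"
    and bd: "bd_edge H u w"
  shows "comb_disk H"
proof (rule comb_diskI[OF pure two _ _ bd])
  note pK = comb_disk_pure[OF K]
  have adjH: "adj H x y \<longleftrightarrow> adj K x y \<and> x \<notin> D \<and> y \<notin> D" for x y
  proof
    assume xy: "adj H x y"
    then show "adj K x y \<and> x \<notin> D \<and> y \<notin> D"
    proof (cases "{x, y} = Q")
      case True
      then show ?thesis using clique[of x y] xy QD by (auto simp: adj_def)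
    qed (auto simp: adj_def H delete_verts_def)
  qed (auto simp: adj_def H delete_verts_def)
  have triH: "tri H x y z" if "tri K x y z" "x \<notin> D" "y \<notin> D" "z \<notin> D" for x y z
    using that by (auto simp: tri_def H delete_verts_def)
  have triQ: "tri H x y z" if "x \<in> Q" "y \<in> Q" "z \<in> Q" "x \<noteq> y" "y \<noteq> z" "x \<noteq> z" for x y z
    using clique3[OF that] that by (auto simp: tri_def H)
  have adjQ: "adj H x y" if "x \<in> Q" "y \<in> Q" "x \<noteq> y" for x y
    unfolding adjH using clique[OF that] QD that by blast
  have faces3: "y \<in> D \<union> Q \<and> z \<in> D \<union> Q" if "tri K x y z" "x \<in> D" for x y z
    using faces[OF that] faces[of x z y] that tri_swap23[of K x y z] by auto
  {
    fix v P x y assume P: "\<And>x y. tri H v x y \<Longrightarrow> P x \<longleftrightarrow> P y" and xy: "adj H v x" "adj H v y"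
    have vD: "v \<notin> D" using xy adjH by blast
    obtain q where q': "q \<in> Q" "q \<noteq> v" using q by metis
    \<comment> \<open>In the link of a vertex \<open>v\<close> of \<open>Q\<close> the deleted
      vertices must be sent to a vertex of \<open>Q\<close> other than \<open>v\<close>.\<close>
    define P' where "P' x = (if x \<in> D then P q else P x)" for x
    have "P' x \<longleftrightarrow> P' y"
    proof (rule comb_disk_link[OF K])
      fix x y assume t: "tri K v x y"
      have *: "P' x \<longleftrightarrow> P' y" if t: "tri K v x y" and "x \<in> D" "y \<notin> D" for x y
      proof -
        have "v \<in> Q" "y \<in> Q" using faces3[of x v y] t that vD tri_swap12[of K v x y] by auto
        then have "y = q \<or> tri H v y q" using triQ[of v y q] q' tri_distinct[OF t] by auto
        then have "P y \<longleftrightarrow> P q" using P[of y q] by auto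
        then show ?thesis using that by (simp add: P'_def)
      qed
      show "P' x \<longleftrightarrow> P' y"
      proof (cases "x \<in> D"; cases "y \<in> D")
        assume "x \<notin> D" "y \<notin> D"
        then show ?thesis using P[OF triH[OF t vD]] by (simp add: P'_def)
      qed (use * t tri_swap23[of K v x y] in \<open>auto simp: P'_def\<close>)
    qed (use xy adjH in auto)
    then show "P x \<longleftrightarrow> P y" using xy adjH by (simp add: P'_def)
  next
    fix P x y assume P: "\<And>x y. adj H x y \<Longrightarrow> P x \<longleftrightarrow> P y" and xy: "x \<in> verts H" "y \<in> verts H"
    define P' where "P' x = (if x \<in> D then P q0 else P x)" for x
    have vH: "v \<in> verts K \<and> v \<notin> D" if v: "v \<in> verts H" for v
    proof -
      obtain w where "adj H v w" using vert_adj[OF pure v] .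
      then show ?thesis using adjH adj_verts by metis
    qed
    have "P' x \<longleftrightarrow> P' y"
    proof (rule comb_disk_connected[OF K])
      fix x y assume a: "adj K x y"
      have *: "P' x \<longleftrightarrow> P' y" if a: "adj K x y" and "x \<in> D" "y \<notin> D" for x y
      proof -
        obtain z where "tri K x y z" using pure_2_complex_adj_tri[OF pK a] .
        then have "y \<in> Q" using faces3 that by blast
        then have "y = q0 \<or> adj H y q0" using adjQ[of y q0] q by auto
        then have "P y \<longleftrightarrow> P q0" using P[of y q0] by auto
        then show ?thesis using that by (simp add: P'_def)
      qed
      show "P' x \<longleftrightarrow> P' y"
      proof (cases "x \<in> D"; cases "y \<in> D")
        assume "x \<notin> D" "y \<notin> D"
        then show ?thesis using P[of x y] adjH a by (simp add: P'_def)
      qed (use * a adj_sym[OF a] in \<open>auto simp: P'_def\<close>)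
    qed (use xy vH in auto)
    then show "P x \<longleftrightarrow> P y" using xy vH by (simp add: P'_def)
  next
    fix c assume c: "cocycle H c"
    define r where "r x = (if x \<in> D then q0 else x)" for x
    \<comment> \<open>The retraction may collapse edges, so the cocycle is extended by zero to equal
      arguments.\<close>
    define c0 where "c0 x y = (if x = y then 0 else c x y)" for x y
    have anti: "c0 x y = - c0 y x" if "x = y \<or> adj H x y" for x y
      using c that unfolding cocycle_def c0_def by auto
    have r_adj: "r x = r y \<or> adj H (r x) (r y)" if a: "adj K x y" for x y
    proof (cases "x \<in> D \<or> y \<in> D")
      case True
      obtain z where z: "tri K x y z" using pure_2_complex_adj_tri[OF pK a] .
      then have "x \<in> D \<union> Q \<and> y \<in> D \<union> Q" using True faces3[OF z] faces3[of y x z] tri_swap12[of K x y z] by auto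
      then have R: "r x \<in> Q" "r y \<in> Q" using q by (auto simp: r_def)
      show ?thesis using adjQ[OF R] by blast
    qed (use a adjH in \<open>auto simp: r_def\<close>)
    have cH: "c x y + c y z + c z x = 0" if "tri H x y z" for x y z
      using c that unfolding cocycle_def by blast
    have "cocycle K (\<lambda>x y. c0 (r x) (r y))"
      unfolding cocycle_def
    proof (intro conjI allI impI)
      fix x y assume "adj K x y"
      then show "c0 (r x) (r y) = - c0 (r y) (r x)" by (intro anti r_adj)
    next
      fix x y z assume t: "tri K x y z"
      show "c0 (r x) (r y) + c0 (r y) (r z) + c0 (r z) (r x) = 0"
      proof (cases "x \<in> D \<or> y \<in> D \<or> z \<in> D")
        case True
        then have "x \<in> D \<union> Q \<and> y \<in> D \<union> Q \<and> z \<in> D \<union> Q"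
          using faces3[OF t] faces3[of y x z] faces3[of z x y] tri_perms[OF t] by auto
        then have R: "r x \<in> Q" "r y \<in> Q" "r z \<in> Q" using q by (auto simp: r_def)
        show ?thesis
        proof (cases "r x = r y \<or> r y = r z \<or> r x = r z")
          case True
          have A: "c0 a b = - c0 b a" if "a \<in> Q" "b \<in> Q" for a b
            using anti[of a b] adjQ[OF that] by blast
          have c00: "c0 a a = 0" for a by (simp add: c0_def)
          from True show ?thesis
          proof (elim disjE)
            assume e: "r x = r y" show ?thesis unfolding e c00 using A[OF R(3,2)] by simp
          next
            assume e: "r y = r z" show ?thesis unfolding e c00 using A[OF R(3,1)] by simp
          next
            assume e: "r x = r z" show ?thesis unfolding e c00 using A[OF R(3,2)] by simp
          qed
        next
          case False
          then have n: "r x \<noteq> r y" "r y \<noteq> r z" "r x \<noteq> r z" "r z \<noteq> r x" by auto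
          show ?thesis using cH[OF triQ[OF R n(1-3)]] n by (simp add: c0_def)
        qed
      next
        case False
        then have n: "x \<notin> D" "y \<notin> D" "z \<notin> D" by auto
        show ?thesis using cH[OF triH[OF t n]] tri_distinct[OF t] n by (simp add: r_def c0_def)
      qed
    qed
    then obtain f where f: "\<And>x y. adj K x y \<Longrightarrow> c0 (r x) (r y) = f y - f x"
      using comb_disk_cocycle[OF K] by blast
    have "c x y = f y - f x" if "adj H x y" for x y
      using f[of x y] that adjH[of x y] adj_distinct[OF that] by (auto simp: r_def c0_def)
    then show "\<exists>f. \<forall>x y. adj H x y \<longrightarrow> c x y = f y - f x" by blast
  }
qed

lemma tri_delete_verts: "tri (delete_verts K D) x y z \<longleftrightarrow> tri K x y z \<and> x \<notin> D \<and> y \<notin> D \<and> z \<notin> D"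
  by (auto simp: tri_def delete_verts_def)

lemma adj_delete_verts: "adj (delete_verts K D) x y \<longleftrightarrow> adj K x y \<and> x \<notin> D \<and> y \<notin> D"
  by (auto simp: adj_def delete_verts_def)

text \<open>Here \<open>D\<close> is the part of the disk on one side of \<open>ps\<close>. That
  edge is in the complex anyway and loses one of its two faces, which supplies the boundary edge of
  the result.\<close>

lemma comb_disk_delete_side:
  assumes K: "comb_disk K" and ps: "adj K p s" "p \<notin> D" "s \<notin> D"
    and d: "tri K p s d" "d \<in> D" and z: "tri K p s z" "z \<notin> D"
    and faces: "\<And>x y. adj K x y \<Longrightarrow> x \<in> D \<Longrightarrow> y \<in> D \<union> {p, s}"
  shows "comb_disk (delete_verts K D)" "bd_edge (delete_verts K D) p s"
proof -
  note pK = comb_disk_pure[OF K]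
  let ?H = "delete_verts K D"
  have H: "?H = ?H \<union> {{p, s}}" using ps by (auto simp: delete_verts_def adj_def)
  show bd: "bd_edge ?H p s"
    unfolding bd_edge_def tri_delete_verts using comb_disk_two_faces[OF K d(1) z(1)] z d ps by blast
  have pH: "pure_2_complex ?H"
    unfolding pure_2_complex_def
  proof (intro conjI ballI allI impI)
    show "finite ?H" "{} \<notin> ?H" using pK by (auto simp: delete_verts_def pure_2_complex_def)
  next
    fix s' t assume "s' \<in> ?H" "t \<noteq> {} \<and> t \<subseteq> s'"
    then show "t \<in> ?H" using pure_2_complex_subset[OF pK, of s' t] by (auto simp: delete_verts_def)
  next
    fix s' assume s': "s' \<in> ?H"
    have psz: "{p, s, z} \<in> ?H \<and> card {p, s, z} = 3" using z ps by (auto simp: delete_verts_def tri_def)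
    have "s' \<in> K" "s' \<inter> D = {}" using s' by (auto simp: delete_verts_def)
    then obtain a b c where abc: "tri K a b c" "s' \<subseteq> {a, b, c}" using pure_2_complex_face[OF pK] by blast
    show "\<exists>t\<in>?H. s' \<subseteq> t \<and> card t = 3"
    proof (cases "a \<in> D \<or> b \<in> D \<or> c \<in> D")
      case True
      then have "{a, b, c} \<subseteq> D \<union> {p, s}"
        using faces pure_2_complex_tri_adj[OF pK abc(1)] by blast
      then have "s' \<subseteq> {p, s, z}" using abc \<open>s' \<inter> D = {}\<close> by blast
      then show ?thesis using psz by blast
    next
      case False
      then have "{a, b, c} \<in> ?H \<and> card {a, b, c} = 3" using abc(1) by (auto simp: tri_def delete_verts_def)
      then show ?thesis using abc(2) by blast
    qed
  qed
  show "comb_disk ?H"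
  proof (rule comb_disk_delete[OF K H _ _ _ _ _ _ _ pH _ bd, where ?q0.0 = p and ?q1.0 = s])
    show "p \<noteq> s" using ps adj_distinct by metis
    fix x y z assume "tri K x y z" "x \<in> D"
    then show "y \<in> D \<union> {p, s}" using faces pure_2_complex_tri_adj(1)[OF pK] by blast
  next
    fix x y a b c assume "tri ?H x y a" "tri ?H x y b" "tri ?H x y c"
    then show "a = b \<or> a = c \<or> b = c" using comb_disk_two_faces[OF K, of x y] unfolding tri_delete_verts by blast
  next
    fix x y assume "x \<in> {p, s}" "y \<in> {p, s}" "x \<noteq> y"
    then show "adj K x y" using ps(1) adj_sym[OF ps(1)] by auto
  qed (use ps in auto)
qed

section \<open>Contracting edges\<close>

definition comb_class :: "'a set set \<Rightarrow> bool" where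
  "comb_class K \<longleftrightarrow> comb_disk K \<and> (\<forall>v\<in>verts K. 3 \<le> degree K v) \<and>
     (\<forall>v\<in>verts K. \<not> bd_vert K v \<longrightarrow> 4 \<le> degree K v)"

text \<open>Degree 4 after coning off the boundary.\<close>

definition small :: "'a set set \<Rightarrow> 'a \<Rightarrow> bool" where
  "small K v \<longleftrightarrow> degree K v = (if bd_vert K v then 3 else 4)"

section \<open>The complex after a contraction\<close>

lemma tri_contract:
  assumes "pure_2_complex K"
  shows "tri (contract K u v) x y z \<longleftrightarrow> x \<noteq> y \<and> y \<noteq> z \<and> x \<noteq> z \<and>
    (\<exists>a b c. tri K a b c \<and> identify u v a = x \<and> identify u v b = y \<and> identify u v c = z)"
proof
  assume t: "tri (contract K u v) x y z"
  then obtain s where s: "s \<in> K" "identify u v ` s = {x, y, z}"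
    unfolding tri_def contract_def by (metis imageE)
  have "x \<in> identify u v ` s" unfolding s(2) by simp
  then obtain a where a: "a \<in> s" "identify u v a = x" by (elim imageE) auto
  have "y \<in> identify u v ` s" unfolding s(2) by simp
  then obtain b where b: "b \<in> s" "identify u v b = y" by (elim imageE) auto
  have "z \<in> identify u v ` s" unfolding s(2) by simp
  then obtain c where c: "c \<in> s" "identify u v c = z" by (elim imageE) auto
  have "{a, b, c} \<in> K" by (rule pure_2_complex_subset[OF assms s(1)]) (use a b c in auto)
  then have "tri K a b c" using a b c tri_distinct[OF t] by (auto simp: tri_def)
  then show "x \<noteq> y \<and> y \<noteq> z \<and> x \<noteq> z \<and>
    (\<exists>a b c. tri K a b c \<and> identify u v a = x \<and> identify u v b = y \<and> identify u v c = z)"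
    using a b c tri_distinct[OF t] by blast
next
  assume *: "x \<noteq> y \<and> y \<noteq> z \<and> x \<noteq> z \<and>
    (\<exists>a b c. tri K a b c \<and> identify u v a = x \<and> identify u v b = y \<and> identify u v c = z)"
  then obtain a b c where abc: "tri K a b c" "identify u v a = x" "identify u v b = y" "identify u v c = z"
    by blast
  then have "{x, y, z} = identify u v ` {a, b, c}" by simp
  then show "tri (contract K u v) x y z" using * abc(1) unfolding tri_def contract_def by blast
qed

lemma adj_contract:
  assumes "pure_2_complex K"
  shows "adj (contract K u v) x y \<longleftrightarrow> x \<noteq> y \<and>
    (\<exists>a b. adj K a b \<and> identify u v a = x \<and> identify u v b = y)"
proof
  assume t: "adj (contract K u v) x y"
  then obtain s where s: "s \<in> K" "identify u v ` s = {x, y}"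
    unfolding adj_def contract_def by (metis imageE)
  have "x \<in> identify u v ` s" unfolding s(2) by simp
  then obtain a where a: "a \<in> s" "identify u v a = x" by (elim imageE) auto
  have "y \<in> identify u v ` s" unfolding s(2) by simp
  then obtain b where b: "b \<in> s" "identify u v b = y" by (elim imageE) auto
  have "{a, b} \<in> K" by (rule pure_2_complex_subset[OF assms s(1)]) (use a b in auto)
  then have "adj K a b" using a b adj_distinct[OF t] by (auto simp: adj_def)
  then show "x \<noteq> y \<and> (\<exists>a b. adj K a b \<and> identify u v a = x \<and> identify u v b = y)"
    using a b adj_distinct[OF t] by blast
next
  assume *: "x \<noteq> y \<and> (\<exists>a b. adj K a b \<and> identify u v a = x \<and> identify u v b = y)"
  then obtain a b where ab: "adj K a b" "identify u v a = x" "identify u v b = y"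
    by blast
  then have "{x, y} = identify u v ` {a, b}" by simp
  then show "adj (contract K u v) x y" using * ab(1) unfolding adj_def contract_def by blast
qed

lemma face_vertexE:
  assumes "s \<in> faces K" "u \<in> s"
  obtains x y where "s = {u, x, y}" "tri K u x y"
proof -
  obtain a b c where abc: "s = {a, b, c}" "tri K a b c" by (rule faces_triE[OF assms(1)])
  then consider "u = a" | "u = b" | "u = c" using assms(2) by blast
  then show thesis
  proof cases
    case 1 then show thesis using that abc by blast
  next
    case 2 then show thesis using that[of a c] abc tri_perms(1)[OF abc(2)] by (simp add: insert_commute)
  next
    case 3 then show thesis using that[of a b] abc tri_perms(4)[OF abc(2)] by (simp add: insert_commute)
  qed
qed

text \<open>The assumption \<open>common\<close> is the link condition: every 3-cycle through
  \<open>uv\<close> is facial. The assumption \<open>no_chord\<close> excludes inner edges joining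
  two boundary vertices, whose contraction would pinch the disk.\<close>

locale edge_contraction =
  fixes K :: "'a set set" and u v :: 'a
  assumes cls: "comb_class K" and uv: "adj K u v"
    and common: "\<And>w. adj K u w \<Longrightarrow> adj K v w \<Longrightarrow> tri K u v w"
    and no_chord: "\<not> bd_edge K u v \<Longrightarrow> \<not> (bd_vert K u \<and> bd_vert K v)"
begin

abbreviation "H \<equiv> contract K u v"
abbreviation "r \<equiv> identify u v"

lemma K: "comb_disk K" and deg3: "x \<in> verts K \<Longrightarrow> 3 \<le> degree K x"
  and deg4: "x \<in> verts K \<Longrightarrow> \<not> bd_vert K x \<Longrightarrow> 4 \<le> degree K x"
  using cls by (auto simp: comb_class_def)

lemma pK: "pure_2_complex K" using K by (rule comb_disk_pure)

lemma u_v: "u \<noteq> v" using uv by (rule adj_distinct)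

lemma r_simps: "r v = u" "x \<noteq> v \<Longrightarrow> r x = x" "r x \<noteq> v" "r x = u \<longleftrightarrow> x = u \<or> x = v"
  "y \<noteq> u \<Longrightarrow> r x = y \<longleftrightarrow> x = y \<and> y \<noteq> v"
  using u_v by (auto simp: identify_def)

lemma tri_H: "tri K a b c \<Longrightarrow> r a \<noteq> r b \<Longrightarrow> r b \<noteq> r c \<Longrightarrow> r a \<noteq> r c \<Longrightarrow> tri H (r a) (r b) (r c)"
  unfolding tri_contract[OF pK] by blast

lemma adj_H: "adj K a b \<Longrightarrow> r a \<noteq> r b \<Longrightarrow> adj H (r a) (r b)"
  unfolding adj_contract[OF pK] by blast

lemma tri_H_other: "x \<noteq> u \<Longrightarrow> y \<noteq> u \<Longrightarrow> tri H x y z \<longleftrightarrow> x \<noteq> v \<and> y \<noteq> v \<and> (\<exists>c. tri K x y c \<and> r c = z)"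
  unfolding tri_contract[OF pK] using r_simps tri_distinct[of K x y] by metis

lemma tri_H_u: "tri H u y z \<longleftrightarrow> y \<notin> {u, v} \<and> z \<notin> {u, v} \<and> (tri K u y z \<or> tri K v y z)"
proof
  assume "tri H u y z"
  then obtain a b c where *: "u \<noteq> y" "y \<noteq> z" "u \<noteq> z" "tri K a b c" "r a = u" "r b = y" "r c = z"
    unfolding tri_contract[OF pK] by blast
  then have "a = u \<or> a = v" "b = y \<and> b \<noteq> v" "c = z \<and> c \<noteq> v"
    using r_simps(4)[of a] r_simps(5)[of y b] r_simps(5)[of z c] by auto
  then show "y \<notin> {u, v} \<and> z \<notin> {u, v} \<and> (tri K u y z \<or> tri K v y z)" using * by auto
next
  assume *: "y \<notin> {u, v} \<and> z \<notin> {u, v} \<and> (tri K u y z \<or> tri K v y z)"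
  then have "r y = y" "r z = z" "r u = u" "y \<noteq> z" 
    using r_simps(2)[of y] r_simps(2)[of z] r_simps(2)[of u] u_v
      tri_distinct(2)[of K u y z] tri_distinct(2)[of K v y z] by auto
  then show "tri H u y z" using * r_simps(1) unfolding tri_contract[OF pK] by (metis insertCI)
qed

lemma adj_H_u: "adj H u y \<longleftrightarrow> y \<notin> {u, v} \<and> (adj K u y \<or> adj K v y)"
proof
  assume "adj H u y"
  then obtain a b where *: "u \<noteq> y" "adj K a b" "r a = u" "r b = y"
    unfolding adj_contract[OF pK] by blast
  then have "a = u \<or> a = v" "b = y \<and> b \<noteq> v"
    using r_simps(4)[of a] r_simps(5)[of y b] by auto
  then show "y \<notin> {u, v} \<and> (adj K u y \<or> adj K v y)" using * by auto
next
  assume *: "y \<notin> {u, v} \<and> (adj K u y \<or> adj K v y)"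
  then have "r y = y" "r u = u" using r_simps(2) u_v by auto
  then show "adj H u y" using * r_simps(1) unfolding adj_contract[OF pK] by (metis insertCI)
qed

lemma common_sym: "adj K w u \<Longrightarrow> adj K w v \<Longrightarrow> tri K u v w"
  using common adj_sym by metis

text \<open>Since \<open>w\<close> has degree at least three, the collapsing face cannot be its only
  one. The edge onto which this face collapses therefore still lies on a face, which keeps the
  contracted complex pure.\<close>

lemma third_face:
  assumes t: "tri K u v w"
  shows "(\<exists>z. tri K u w z \<and> z \<noteq> v) \<or> (\<exists>z. tri K v w z \<and> z \<noteq> u)"
proof (rule ccontr)
  assume no: "\<not> ?thesis"
  have "neighbours K w \<subseteq> {u, v}"
  proof (rule neighbours_closed[OF K, of u])
    show "adj K w u" by (rule pure_2_complex_tri_adj(6)[OF pK t])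
    fix a b assume "a \<in> {u, v}" "tri K w a b"
    then show "b \<in> {u, v}" using no tri_swap12[of K w a b] by auto
  qed simp
  then have "card (neighbours K w) \<le> card {u, v}" by (intro card_mono) auto
  then have "degree K w \<le> 2" unfolding degree_def using u_v by simp
  moreover have "w \<in> verts K" using tri_perms(4)[OF t] by (rule tri_verts)
  ultimately show False using deg3[of w] by simp
qed

lemma pure_H: "pure_2_complex H"
  unfolding pure_2_complex_def
proof (intro conjI ballI allI impI)
  show "finite H" "{} \<notin> H" using pK by (auto simp: contract_def pure_2_complex_def)
next
  fix s t assume st: "s \<in> H" "t \<noteq> {} \<and> t \<subseteq> s"
  then obtain s' where s': "s' \<in> K" "s = r ` s'" unfolding contract_def by blast
  then obtain t' where t': "t' \<subseteq> s'" "t = r ` t'" using st(2) by (meson subset_imageE)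
  then have "t' \<noteq> {}" using st by blast
  then have "t' \<in> K" using pure_2_complex_subset[OF pK s'(1)] t' by metis
  then show "t \<in> H" using t' unfolding contract_def by blast
next
  fix s assume "s \<in> H"
  then obtain s' where s': "s' \<in> K" "s = r ` s'" unfolding contract_def by blast
  obtain a b c where abc: "tri K a b c" "s' \<subseteq> {a, b, c}" by (rule pure_2_complex_face[OF pK s'(1)])
  have face: "\<exists>t\<in>H. s \<subseteq> t \<and> card t = 3" if "tri K a b c" "s \<subseteq> r ` {a, b, c}" "\<not> {u, v} \<subseteq> {a, b, c}" for a b c
  proof (intro bexI[of _ "r ` {a, b, c}"] conjI)
    show "r ` {a, b, c} \<in> H" using that(1) unfolding contract_def tri_def by blast
    have "inj_on r {a, b, c}" using that(3) by (auto simp: inj_on_def identify_def)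
    then show "card (r ` {a, b, c}) = 3" using that(1) by (simp add: card_image tri_def)
  qed (use that in auto)
  show "\<exists>t\<in>H. s \<subseteq> t \<and> card t = 3"
  proof (cases "{u, v} \<subseteq> {a, b, c}")
    case False
    then show ?thesis using face[OF abc(1)] abc(2) s'(2) by blast
  next
    case True
    then obtain w where w: "tri K u v w" "{a, b, c} = {u, v, w}"
      using abc(1) tri_perms[OF abc(1)] u_v by (elim insert_subset[THEN iffD1, elim_format]) auto
    then have s: "s \<subseteq> {u, w}" using s'(2) abc(2) u_v r_simps by (auto simp: identify_def)
    have wn: "w \<noteq> u" "w \<noteq> v" using tri_distinct[OF w(1)] by auto
    from third_face[OF w(1)] show ?thesis
    proof (elim disjE exE conjE)
      fix z assume z: "tri K u w z" "z \<noteq> v"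
      have "s \<subseteq> r ` {u, w, z}" using s wn r_simps(2)[of u] r_simps(2)[of w] u_v by auto
      then show ?thesis using face[OF z(1)] z(2) wn u_v by blast
    next
      fix z assume z: "tri K v w z" "z \<noteq> u"
      have "s \<subseteq> r ` {v, w, z}" using s wn r_simps(1) r_simps(2)[of w] u_v by auto
      then show ?thesis using face[OF z(1)] z(2) wn u_v by blast
    qed
  qed
qed

lemma side_unique:
  assumes "tri K u v y"
  shows "tri K u y a \<Longrightarrow> tri K u y b \<Longrightarrow> a \<noteq> v \<Longrightarrow> b \<noteq> v \<Longrightarrow> a = b"
    and "tri K v y a \<Longrightarrow> tri K v y b \<Longrightarrow> a \<noteq> u \<Longrightarrow> b \<noteq> u \<Longrightarrow> a = b"
proof -
  have "tri K u y v" "tri K v y u" using tri_perms[OF assms] by auto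
  then show "tri K u y a \<Longrightarrow> tri K u y b \<Longrightarrow> a \<noteq> v \<Longrightarrow> b \<noteq> v \<Longrightarrow> a = b"
    "tri K v y a \<Longrightarrow> tri K v y b \<Longrightarrow> a \<noteq> u \<Longrightarrow> b \<noteq> u \<Longrightarrow> a = b"
    using comb_disk_two_faces[OF K] by metis+
qed

text \<open>If \<open>y\<close> is adjacent to both ends, then \<open>uvy\<close> is a face by the
  link condition; it disappears, and \<open>uy\<close> and \<open>vy\<close> contribute at most one
  further face each. Otherwise all faces come from the same end.\<close>

lemma two_faces_H_u:
  assumes t: "tri H u y a" "tri H u y b" "tri H u y c"
  shows "a = b \<or> a = c \<or> b = c"
proof -
  have t': "tri K u y a \<or> tri K v y a" "tri K u y b \<or> tri K v y b" "tri K u y c \<or> tri K v y c"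
    and n: "a \<noteq> u" "a \<noteq> v" "b \<noteq> u" "b \<noteq> v" "c \<noteq> u" "c \<noteq> v"
    using t tri_H_u by auto
  show ?thesis
  proof (cases "adj K u y \<and> adj K v y")
    case True
    then have "tri K u v y" using common by blast
    then show ?thesis using side_unique[of y] t' n by metis
  next
    case False
    then have "(tri K u y a \<and> tri K u y b \<and> tri K u y c) \<or> (tri K v y a \<and> tri K v y b \<and> tri K v y c)"
      using t' pure_2_complex_tri_adj(1)[OF pK] by metis
    then show ?thesis using comb_disk_two_faces[OF K] by metis
  qed
qed

lemma two_faces_H:
  assumes t: "tri H x y a" "tri H x y b" "tri H x y c"
  shows "a = b \<or> a = c \<or> b = c"
proof -
  consider "x = u" | "y = u" | "x \<noteq> u" "y \<noteq> u" by blast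
  then show ?thesis
  proof cases
    case 1 then show ?thesis using two_faces_H_u t by blast
  next
    case 2 then show ?thesis using two_faces_H_u t tri_swap12 by metis
  next
    case 3
    then obtain a' b' c' where "tri K x y a'" "r a' = a" "tri K x y b'" "r b' = b" "tri K x y c'" "r c' = c"
      using t tri_H_other by metis
    then show ?thesis using comb_disk_two_faces[OF K, of x y a' b' c'] by auto
  qed
qed

text \<open>The new link of \<open>u\<close> consists of the links of \<open>u\<close> and
  \<open>v\<close> with the other end removed, joined at the opposite vertices of \<open>uv\<close>.
  If there are two of these, one end of the edge is inner, and its link, a cycle with one vertex
  removed, connects them.\<close>

lemma apexes_equal:
  assumes P: "\<And>x y. tri H u x y \<Longrightarrow> P x \<longleftrightarrow> P y" and w: "tri K u v w1" "tri K u v w2"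
  shows "P w1 \<longleftrightarrow> P w2"
proof (cases "w1 = w2")
  case False
  then have "\<not> bd_edge K u v" using bd_edge_unique w by metis
  then have "\<not> bd_vert K u \<or> \<not> bd_vert K v" using no_chord by blast
  then show ?thesis
  proof
    assume u: "\<not> bd_vert K u"
    show ?thesis
    proof (rule inner_link_remove_vertex[OF K u w])
      fix a b assume ab: "tri K u a b" "a \<noteq> v" "b \<noteq> v"
      then show "P a \<longleftrightarrow> P b" using P[of a b] tri_H_u[of a b] tri_distinct[OF ab(1)] by simp
    qed
  next
    assume v: "\<not> bd_vert K v"
    show ?thesis
    proof (rule inner_link_remove_vertex[OF K v tri_perms(1)[OF w(1)] tri_perms(1)[OF w(2)]])
      fix a b assume ab: "tri K v a b" "a \<noteq> u" "b \<noteq> u"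
      then show "P a \<longleftrightarrow> P b" using P[of a b] tri_H_u[of a b] tri_distinct[OF ab(1)] by simp
    qed
  qed
qed simp

text \<open>Together with \<open>apexes_equal\<close> this makes the link of the merged vertex
  connected: every vertex in it is tied to some opposite vertex of \<open>uv\<close>, inside the old
  link of whichever end it came from.\<close>

lemma link_H_u:
  assumes P: "\<And>x y. tri H u x y \<Longrightarrow> P x \<longleftrightarrow> P y" and y: "adj H u y"
  shows "\<exists>w. tri K u v w \<and> (P y \<longleftrightarrow> P w)"
proof -
  have y': "y \<noteq> u" "y \<noteq> v" "adj K u y \<or> adj K v y" using y adj_H_u by auto
  from y'(3) show ?thesis
  proof
    assume "adj K u y"
    then obtain w where "tri K u v w" "P y \<longleftrightarrow> P w"
    proof (rule link_remove_vertex[OF K uv _ y'(2), where P = P])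
      fix a b assume ab: "tri K u a b" "a \<noteq> v" "b \<noteq> v"
      then show "P a \<longleftrightarrow> P b" using P[of a b] tri_H_u[of a b] tri_distinct[OF ab(1)] by simp
    qed
    then show ?thesis by blast
  next
    assume "adj K v y"
    then obtain w where "tri K v u w" "P y \<longleftrightarrow> P w"
    proof (rule link_remove_vertex[OF K adj_sym[OF uv] _ y'(1), where P = P])
      fix a b assume ab: "tri K v a b" "a \<noteq> u" "b \<noteq> u"
      then show "P a \<longleftrightarrow> P b" using P[of a b] tri_H_u[of a b] tri_distinct[OF ab(1)] by simp
    qed
    then show ?thesis using tri_swap12 by metis
  qed
qed

lemma link_H:
  assumes P: "\<And>x y. tri H x0 x y \<Longrightarrow> P x \<longleftrightarrow> P y" and xy: "adj H x0 x" "adj H x0 y"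
  shows "P x \<longleftrightarrow> P y"
proof (cases "x0 = u")
  case True
  have P': "\<And>x y. tri H u x y \<Longrightarrow> P x \<longleftrightarrow> P y" using P unfolding True .
  have "\<exists>w. tri K u v w \<and> (P x \<longleftrightarrow> P w)" "\<exists>w. tri K u v w \<and> (P y \<longleftrightarrow> P w)"
    using link_H_u[of P, OF P'] xy unfolding True by simp_all
  then obtain w1 w2 where w: "tri K u v w1" "P x \<longleftrightarrow> P w1" "tri K u v w2" "P y \<longleftrightarrow> P w2"
    by (elim exE conjE)
  have "P w1 \<longleftrightarrow> P w2" by (rule apexes_equal[of P, OF P' w(1,3)])
  then show ?thesis using w(2,4) by simp
next
  case False
  obtain a0 x' where x': "adj K a0 x'" "r a0 = x0" "r x' = x" using xy(1) unfolding adj_contract[OF pK] by blast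
  obtain b0 y' where y': "adj K b0 y'" "r b0 = x0" "r y' = y" using xy(2) unfolding adj_contract[OF pK] by blast
  have eq: "a0 = x0" "b0 = x0" "x0 \<noteq> v" using x' y' False r_simps(5) by blast+
  have "P (r x') \<longleftrightarrow> P (r y')"
  proof (rule comb_disk_link[OF K, of x0 "\<lambda>x. P (r x)"])
    fix x y assume t: "tri K x0 x y"
    show "P (r x) \<longleftrightarrow> P (r y)"
    proof (cases "r x = r y")
      case False
      have rx0: "r x0 = x0" using eq(3) r_simps(2) by blast
      have "r x0 \<noteq> r x" "r x0 \<noteq> r y"
        using tri_distinct[OF t] \<open>x0 \<noteq> u\<close> eq(3) by (auto simp: identify_def)
      then have "tri H x0 (r x) (r y)" using tri_H[OF t] False rx0 by simp
      then show ?thesis by (rule P)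
    qed simp
  qed (use x' y' eq in auto)
  then show ?thesis using x' y' by simp
qed

lemma connected_H:
  assumes P: "\<And>x y. adj H x y \<Longrightarrow> P x \<longleftrightarrow> P y" and xy: "x \<in> verts H" "y \<in> verts H"
  shows "P x \<longleftrightarrow> P y"
proof -
  have pre: "\<exists>x'. x' \<in> verts K \<and> r x' = x" if "x \<in> verts H" for x
    using that unfolding verts_def contract_def by blast
  obtain x' y' where *: "x' \<in> verts K" "r x' = x" "y' \<in> verts K" "r y' = y"
    using pre[OF xy(1)] pre[OF xy(2)] by blast
  have "P (r x') \<longleftrightarrow> P (r y')"
  proof (rule comb_disk_connected[OF K _ *(1,3)])
    fix x y assume "adj K x y"
    then have "r x = r y \<or> adj H (r x) (r y)" using adj_H by blast
    then show "P (r x) \<longleftrightarrow> P (r y)" using P[of "r x" "r y"] by auto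
  qed
  then show ?thesis using * by simp
qed

lemma cocycle_H:
  assumes c: "cocycle H c"
  shows "\<exists>f. \<forall>x y. adj H x y \<longrightarrow> c x y = f y - f x"
proof -
  define c0 where "c0 x y = (if x = y then 0 else c x y)" for x y
  have c00: "c0 x x = 0" for x by (simp add: c0_def)
  have anti: "c0 x y = - c0 y x" if "x = y \<or> adj H x y" for x y
    using c that unfolding cocycle_def c0_def by auto
  have r_adj: "r x = r y \<or> adj H (r x) (r y)" if a: "adj K x y" for x y
    using adj_H[OF a] by blast
  have cH: "c x y + c y z + c z x = 0" if "tri H x y z" for x y z
    using c that unfolding cocycle_def by blast
  have "cocycle K (\<lambda>x y. c0 (r x) (r y))"
    unfolding cocycle_def
  proof (intro conjI allI impI)
    fix x y assume "adj K x y"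
    then show "c0 (r x) (r y) = - c0 (r y) (r x)" by (intro anti r_adj)
  next
    fix x y z assume t: "tri K x y z"
    note A = pure_2_complex_tri_adj[OF pK t]
    show "c0 (r x) (r y) + c0 (r y) (r z) + c0 (r z) (r x) = 0"
    proof (cases "r x = r y \<or> r y = r z \<or> r x = r z")
      case True
      then show ?thesis
      proof (elim disjE)
        assume e: "r x = r y" show ?thesis unfolding e c00 using anti[OF r_adj[OF A(2)]] by simp
      next
        assume e: "r y = r z" show ?thesis unfolding e c00 using anti[OF r_adj[OF A(3)]] by simp
      next
        assume e: "r x = r z" show ?thesis unfolding e c00 using anti[OF r_adj[OF A(2)]] by simp
      qed
    next
      case False
      then have n: "r x \<noteq> r y" "r y \<noteq> r z" "r x \<noteq> r z" "r z \<noteq> r x" by auto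
      show ?thesis using cH[OF tri_H[OF t n(1-3)]] n by (simp add: c0_def)
    qed
  qed
  then obtain f where f: "\<And>x y. adj K x y \<Longrightarrow> c0 (r x) (r y) = f y - f x"
    using comb_disk_cocycle[OF K] by blast
  \<comment> \<open>The pulled-back cocycle vanishes on \<open>uv\<close>, so the potential descends
    to the contracted complex.\<close>
  have "f u = f v" using f[OF uv] u_v r_simps(1) r_simps(2)[of u] by (simp add: c00)
  then have fr: "f (r x) = f x" for x by (simp add: identify_def)
  have "c x y = f y - f x" if xy: "adj H x y" for x y
  proof -
    obtain a b where ab: "adj K a b" "r a = x" "r b = y" "x \<noteq> y"
      using xy unfolding adj_contract[OF pK] by blast
    then have "c x y = f b - f a" using f[OF ab(1)] by (simp add: c0_def)
    then show ?thesis using fr[of a] fr[of b] ab by simp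
  qed
  then show ?thesis by blast
qed

lemma bd_edge_HI:
  assumes "adj H x y" "\<And>a b. tri H x y a \<Longrightarrow> tri H x y b \<Longrightarrow> a = b"
  shows "bd_edge H x y"
  using pure_2_complex_adj_tri[OF pure_H assms(1)] assms(2) unfolding bd_edge_def by metis

lemma bd_edge_H_other:
  assumes xy: "bd_edge K x y" "x \<notin> {u, v}" "y \<notin> {u, v}"
  shows "bd_edge H x y"
proof (rule bd_edge_HI)
  have "adj K x y" using bd_edge_adj[OF pK xy(1)] .
  then show "adj H x y" using adj_H[of x y] adj_distinct[of K x y] r_simps(2)[of x] r_simps(2)[of y] xy(2,3) by auto
  fix a b assume "tri H x y a" "tri H x y b"
  then obtain a' b' where "tri K x y a'" "r a' = a" "tri K x y b'" "r b' = b"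
    using tri_H_other xy by auto
  then show "a = b" using bd_edge_unique[OF xy(1)] by metis
qed

text \<open>When \<open>uy\<close> and \<open>vy\<close> merge, the one that was a boundary edge
  contributes only the face \<open>uvy\<close>, which collapses; at most one face is left from the
  other.\<close>

lemma bd_edge_H_u:
  assumes y: "bd_edge K u y \<or> bd_edge K v y" "y \<notin> {u, v}"
  shows "bd_edge H u y"
proof (rule bd_edge_HI)
  show "adj H u y" using y bd_edge_adj[OF pK] adj_H_u by blast
  fix a b assume "tri H u y a" "tri H u y b"
  then have t: "tri K u y a \<or> tri K v y a" "tri K u y b \<or> tri K v y b" "a \<notin> {u, v}" "b \<notin> {u, v}"
    using tri_H_u by auto
  show "a = b"
  proof (cases "adj K u y \<and> adj K v y")
    case True
    then have uvy: "tri K u v y" using common by blast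
    then have s: "tri K u y v" "tri K v y u" using tri_perms by metis+
    from y(1) show ?thesis
    proof
      assume "bd_edge K u y"
      then have "\<not> tri K u y a" "\<not> tri K u y b" using bd_edge_unique s(1) t by (metis insertCI)+
      then show ?thesis using side_unique(2)[OF uvy] t by auto
    next
      assume "bd_edge K v y"
      then have "\<not> tri K v y a" "\<not> tri K v y b" using bd_edge_unique s(2) t by (metis insertCI)+
      then show ?thesis using side_unique(1)[OF uvy] t by auto
    qed
  next
    case False
    from y(1) show ?thesis
    proof
      assume b: "bd_edge K u y"
      then have "\<not> adj K v y" using False bd_edge_adj[OF pK] by blast
      then have "tri K u y a" "tri K u y b" using t pure_2_complex_tri_adj(1)[OF pK] by blast+
      then show ?thesis using bd_edge_unique[OF b] by blast
    next
      assume b: "bd_edge K v y"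
      then have "\<not> adj K u y" using False bd_edge_adj[OF pK] by blast
      then have "tri K v y a" "tri K v y b" using t pure_2_complex_tri_adj(1)[OF pK] by blast+
      then show ?thesis using bd_edge_unique[OF b] by blast
    qed
  qed
qed

text \<open>A boundary vertex has two boundary edges, and at least one of them is not
  \<open>uv\<close> itself.\<close>

lemma bd_vert_H_u:
  assumes "bd_vert K u \<or> bd_vert K v" shows "bd_vert H u"
proof -
  have "\<exists>y. y \<notin> {u, v} \<and> (bd_edge K u y \<or> bd_edge K v y)"
    using assms
  proof
    assume "bd_vert K u"
    then obtain y where y: "bd_edge K u y" unfolding bd_vert_def by blast
    then obtain y' where "bd_edge K u y'" "y' \<noteq> y" using bd_edge_second[OF K] by blast
    then show ?thesis using y adj_distinct[OF bd_edge_adj[OF pK]] by (metis insertE singletonD)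
  next
    assume "bd_vert K v"
    then obtain y where y: "bd_edge K v y" unfolding bd_vert_def by blast
    then obtain y' where "bd_edge K v y'" "y' \<noteq> y" using bd_edge_second[OF K] by blast
    then show ?thesis using y adj_distinct[OF bd_edge_adj[OF pK]] by (metis insertE singletonD)
  qed
  then show ?thesis using bd_edge_H_u unfolding bd_vert_def by blast
qed

lemma bd_vert_H:
  assumes "bd_vert K x" "x \<notin> {u, v}" shows "bd_vert H x"
proof -
  obtain y where y: "bd_edge K x y" using assms(1) unfolding bd_vert_def by blast
  show ?thesis
  proof (cases "y \<in> {u, v}")
    case True
    then have "bd_edge H u x" using bd_edge_H_u[of x] y assms(2) bd_edge_commute[of K x y] by auto
    then show ?thesis using bd_edge_commute[of H u x] unfolding bd_vert_def by blast
  next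
    case False
    then show ?thesis using bd_edge_H_other[OF y assms(2)] unfolding bd_vert_def by blast
  qed
qed

lemma comb_disk_H: "comb_disk H"
proof -
  obtain x y where xy: "bd_edge K x y" using comb_disk_bd_edge[OF K] .
  then have "bd_vert K x" unfolding bd_vert_def by blast
  then have "\<exists>z. bd_vert H z" using bd_vert_H bd_vert_H_u by (cases "x \<in> {u, v}") blast+
  then obtain a b where ab: "bd_edge H a b" unfolding bd_vert_def by blast
  show ?thesis
    by (rule comb_diskI[OF pure_H two_faces_H link_H connected_H ab cocycle_H])
qed

section \<open>Degrees after a contraction\<close>

lemma neighbours_H:
  assumes "x \<noteq> u" "x \<noteq> v" shows "neighbours H x = r ` neighbours K x"
proof (intro equalityI subsetI)
  fix y assume "y \<in> neighbours H x"
  then obtain a b where "adj K a b" "r a = x" "r b = y" unfolding neighbours_adj adj_contract[OF pK] by blast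
  moreover from this have "a = x" using assms r_simps(5)[of x a] by simp
  ultimately show "y \<in> r ` neighbours K x" by (auto simp: neighbours_adj)
next
  fix y assume "y \<in> r ` neighbours K x"
  then obtain b where b: "adj K x b" "y = r b" unfolding neighbours_adj by blast
  moreover have "r x = x" "r x \<noteq> r b" using assms b adj_distinct[OF b(1)] by (auto simp: identify_def)
  ultimately show "y \<in> neighbours H x" using adj_H[OF b(1)] by (simp add: neighbours_adj)
qed

lemma degree_H:
  assumes x: "x \<noteq> u" "x \<noteq> v"
  shows "degree K x \<le> degree H x + (if tri K u v x then 1 else 0)"
proof (cases "tri K u v x")
  case True
  have fin: "finite (neighbours K x)" by (rule finite_neighbours[OF pK])
  have v: "v \<in> neighbours K x" using pure_2_complex_tri_adj(5)[OF pK True] by (simp add: neighbours_adj)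
  have inj: "inj_on r (neighbours K x - {v})" by (auto simp: inj_on_def identify_def)
  have "degree K x = card (neighbours K x - {v}) + 1"
    unfolding degree_def using v fin by (metis card.remove Suc_eq_plus1)
  also have "card (neighbours K x - {v}) = card (r ` (neighbours K x - {v}))"
    using inj by (simp add: card_image)
  also have "\<dots> \<le> card (neighbours H x)"
    unfolding neighbours_H[OF x] by (rule card_mono) (use fin in auto)
  finally show ?thesis using True by (simp add: degree_def)
next
  case False
  then have "\<not> (adj K x u \<and> adj K x v)" using common_sym by blast
  then have "inj_on r (neighbours K x)" by (auto simp: inj_on_def identify_def neighbours_adj)
  then show ?thesis using False unfolding degree_def neighbours_H[OF x] by (simp add: card_image)
qed

text \<open>By the link condition the neighbourhoods of \<open>u\<close> and \<open>v\<close>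
  overlap exactly in the opposite vertices, and \<open>u\<close> and \<open>v\<close> leave the
  union.\<close>

lemma degree_H_u: "degree H u + card {w. tri K u v w} + 2 = degree K u + degree K v"
proof -
  have fin: "finite (neighbours K u)" "finite (neighbours K v)" by (rule finite_neighbours[OF pK])+
  have n: "neighbours H u = neighbours K u \<union> neighbours K v - {u, v}"
    using adj_H_u by (auto simp: neighbours_adj)
  have i: "neighbours K u \<inter> neighbours K v = {w. tri K u v w}"
    using common pure_2_complex_tri_adj[OF pK] by (auto simp: neighbours_adj)
  have "u \<in> neighbours K v" "v \<in> neighbours K u" using uv adj_sym[OF uv] by (auto simp: neighbours_adj)
  then have sub: "{u, v} \<subseteq> neighbours K u \<union> neighbours K v" by simp
  have "card {u, v} \<le> card (neighbours K u \<union> neighbours K v)"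
    by (rule card_mono) (use fin sub in auto)
  then have "card (neighbours K u \<union> neighbours K v) = degree H u + 2"
    unfolding degree_def n card_Diff_subset[OF finite.insertI[OF finite.insertI[OF finite.emptyI]] sub] using u_v by simp
  then show ?thesis using card_Un_Int[OF fin] unfolding i by (simp add: degree_def)
qed

lemma verts_H: "x \<in> verts H \<Longrightarrow> x \<in> verts K \<and> x \<noteq> v"
  using adj_verts[OF uv] u_v by (auto simp: verts_def contract_def identify_def split: if_splits)

lemma card_verts_H: "card (verts H) < card (verts K)"
proof -
  have "v \<in> verts K" using adj_verts[OF adj_sym[OF uv]] .
  then have "verts H \<subset> verts K" using verts_H by blast
  then show ?thesis by (rule psubset_card_mono[OF finite_verts[OF pK]])
qed

text \<open>The merged vertex has degree at least 3 + 3 - 2 - 1 = 3 for a boundary edge, at least 3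
  + 4 - 2 - 2 = 3 for an inner edge, one of whose ends is inner, and at least 4 + 4 - 2 - 2 = 4 if
  both ends are inner. Opposite vertices lose one neighbour, which they can afford unless they are
  small.\<close>

lemma comb_class_H:
  assumes ns: "\<And>w. tri K u v w \<Longrightarrow> \<not> small K w"
  shows "comb_class H"
  unfolding comb_class_def
proof (intro conjI ballI impI comb_disk_H)
  have V: "u \<in> verts K" "v \<in> verts K" using adj_verts[OF uv] adj_verts[OF adj_sym[OF uv]] by auto
  have card: "card {w. tri K u v w} = (if bd_edge K u v then 1 else 2)"
    by (rule comb_disk_card_tri[OF K uv])
  have *: "3 \<le> degree H x \<and> (\<not> bd_vert H x \<longrightarrow> 4 \<le> degree H x)" if x: "x \<in> verts H" for x
  proof (cases "x = u")
    case True
    show ?thesis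
    proof (cases "bd_edge K u v")
      case True
      then have "bd_vert H u" using bd_vert_H_u unfolding bd_vert_def by blast
      then show ?thesis using degree_H_u deg3[OF V(1)] deg3[OF V(2)] True card \<open>x = u\<close> by simp
    next
      case False
      then have "\<not> bd_vert K u \<or> \<not> bd_vert K v" using no_chord by blast
      then have "degree K u + degree K v \<ge> 7"
        using deg3[OF V(1)] deg3[OF V(2)] deg4[OF V(1)] deg4[OF V(2)] by linarith
      moreover have "degree K u + degree K v \<ge> 8" if "\<not> bd_vert H u"
      proof -
        have "\<not> bd_vert K u" "\<not> bd_vert K v" using that bd_vert_H_u by blast+
        then show ?thesis using deg4[OF V(1)] deg4[OF V(2)] by linarith
      qed
      ultimately show ?thesis using degree_H_u False card \<open>x = u\<close> by auto
    qed
  next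
    case False
    then have xK: "x \<in> verts K" "x \<noteq> v" using verts_H[OF x] by auto
    have bd: "bd_vert H x" if "bd_vert K x" using bd_vert_H[OF that] False xK by blast
    have "3 \<le> degree K x" "\<not> bd_vert K x \<Longrightarrow> 4 \<le> degree K x" using deg3 deg4 xK by auto
    moreover have "tri K u v x \<Longrightarrow> degree K x \<noteq> (if bd_vert K x then 3 else 4)"
      using ns[of x] by (simp add: small_def)
    ultimately show ?thesis using degree_H[OF False xK(2)] bd
      by (cases "bd_vert K x"; cases "tri K u v x"; force)
  qed
  show "3 \<le> degree H x" if "x \<in> verts H" for x using * that by blast
  show "4 \<le> degree H x" if "x \<in> verts H" "\<not> bd_vert H x" for x using * that by blast
qed

text \<open>Two faces merged by the identification have the form \<open>uxy\<close> and
  \<open>vxy\<close>. Then \<open>x\<close>, \<open>y\<close> and \<open>v\<close> are all the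
  neighbours of \<open>u\<close>, and \<open>u\<close> is inner, contrary to the degree bound
  4.\<close>

lemma inj_H: "inj_on (\<lambda>t. r ` t) {t \<in> faces K. \<not> {u, v} \<subseteq> t}"
proof (rule inj_onI)
  have no: False if s: "s \<in> faces K" "\<not> {u, v} \<subseteq> s" and t: "t \<in> faces K" "\<not> {u, v} \<subseteq> t"
    and eq: "r ` s = r ` t" and us: "u \<in> s" "v \<in> t" for s t
  proof -
    have vs: "v \<notin> s" "u \<notin> t" using us s t by auto
    obtain x y where x: "s = {u, x, y}" "tri K u x y" by (rule face_vertexE[OF s(1) us(1)])
    have "r ` s = s" using vs by (force simp: identify_def)
    moreover have "r ` t = insert u (t - {v})" using us vs by (force simp: identify_def)
    ultimately have "s = insert u (t - {v})" using eq by simp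
    then have "t = insert v (s - {u})" using us vs by blast
    then have tv: "t = {v, x, y}" using x tri_distinct[OF x(2)] by auto
    have d: "x \<noteq> v" "y \<noteq> v" using vs x by auto
    have vxy: "tri K v x y" using t(1) tv by (simp add: faces_tri)
    have uvx: "tri K u v x" and uvy: "tri K u v y"
      using common pure_2_complex_tri_adj[OF pK x(2)] pure_2_complex_tri_adj[OF pK vxy] by auto
    have ux: "z = v \<or> z = y" if "tri K u x z" for z
      using comb_disk_two_faces[OF K that x(2) tri_perms(2)[OF uvx]] d by auto
    have uy: "z = v \<or> z = x" if "tri K u y z" for z
      using comb_disk_two_faces[OF K that tri_perms(2)[OF x(2)] tri_perms(2)[OF uvy]] d by auto
    have uv': "z = x \<or> z = y" if "tri K u v z" for z
      using comb_disk_two_faces[OF K that uvx uvy] tri_distinct[OF x(2)] by auto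
    have "neighbours K u \<subseteq> {v, x, y}"
    proof (rule neighbours_closed[OF K, of v])
      fix a b assume "a \<in> {v, x, y}" "tri K u a b"
      then show "b \<in> {v, x, y}" using ux uy uv' by blast
    qed (use uv in auto)
    then have "degree K u \<le> card {v, x, y}" unfolding degree_def by (intro card_mono) auto
    also have "\<dots> \<le> 3" by (simp add: card_insert_if)
    finally have "degree K u \<le> 3" .
    moreover have "\<not> bd_vert K u"
    proof
      assume "bd_vert K u"
      then obtain z where z: "bd_edge K u z" unfolding bd_vert_def by blast
      then have "z \<in> {v, x, y}" using \<open>neighbours K u \<subseteq> {v, x, y}\<close> bd_edge_adj[OF pK z] by (auto simp: neighbours_adj)
      then show False
        using bd_edge_unique[OF z] uvx uvy x(2) tri_perms[OF x(2)] tri_perms[OF uvx] tri_perms[OF uvy] d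
          tri_distinct[OF x(2)] by (metis insertE singletonD)
    qed
    ultimately show False using deg4[OF adj_verts[OF uv]] by simp
  qed
  fix s t assume s: "s \<in> {t \<in> faces K. \<not> {u, v} \<subseteq> t}" and t: "t \<in> {t \<in> faces K. \<not> {u, v} \<subseteq> t}"
    and eq: "r ` s = r ` t"
  have no': "\<not> (u \<in> s \<and> v \<in> t)" "\<not> (u \<in> t \<and> v \<in> s)" using no[of s t] no[of t s] s t eq by auto
  have ru: "u \<in> r ` A \<longleftrightarrow> u \<in> A \<or> v \<in> A" for A
    using r_simps(4) by (metis (no_types, lifting) image_iff)
  have rm: "r ` A - {u} = A - {u, v}" for A
  proof (intro equalityI subsetI)
    fix x assume "x \<in> r ` A - {u}"
    then obtain a where "a \<in> A" "x = r a" "r a \<noteq> u" by blast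
    then show "x \<in> A - {u, v}" using r_simps(4)[of a] r_simps(2)[of a] by simp
  next
    fix x assume x: "x \<in> A - {u, v}"
    then have "r x = x" using r_simps(2) by simp
    then show "x \<in> r ` A - {u}" using x by (metis Diff_iff image_eqI insertCI insertE singletonD)
  qed
  have "s - {u, v} = t - {u, v}" using rm[of s] rm[of t] eq by simp
  moreover have "u \<in> s \<or> v \<in> s \<longleftrightarrow> u \<in> t \<or> v \<in> t" using ru[of s] ru[of t] eq by simp
  ultimately show "s = t" using no' s t by blast
qed

end

section \<open>Decomposing disks\<close>

text \<open>A connected graph on \<open>S\<close> has at least \<open>card S - 1\<close> edges, each
  counted twice here. A subset is grown by one vertex at a time, every time along an edge leaving
  it.\<close>

lemma connected_degree_sum:
  assumes fin: "finite S" and ne: "S \<noteq> {}" and sym: "\<And>x y. R x y \<Longrightarrow> R y x" and irr: "\<And>x. \<not> R x x"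
    and con: "\<And>P x y. \<lbrakk>\<And>x y. \<lbrakk>x \<in> S; y \<in> S; R x y\<rbrakk> \<Longrightarrow> P x \<longleftrightarrow> P y; x \<in> S; y \<in> S\<rbrakk> \<Longrightarrow> P x \<longleftrightarrow> P y"
  shows "2 * card S \<le> (\<Sum>x\<in>S. card {y \<in> S. R x y}) + 2"
proof -
  have "\<exists>T. T \<subseteq> S \<and> card T = Suc k \<and> 2 * k \<le> (\<Sum>x\<in>T. card {y \<in> T. R x y})" if "Suc k \<le> card S" for k
    using that
  proof (induction k)
    case 0
    obtain a where "a \<in> S" using ne by blast
    then show ?case by (intro exI[of _ "{a}"]) simp
  next
    case (Suc k)
    then obtain T where T: "T \<subseteq> S" "card T = Suc k" "2 * k \<le> (\<Sum>x\<in>T. card {y \<in> T. R x y})" by auto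
    have finT: "finite T" using T(1) fin finite_subset by blast
    have "T \<noteq> S" using T(2) Suc.prems by auto
    then obtain b where b: "b \<in> S" "b \<notin> T" using T(1) by blast
    have "T \<noteq> {}" using T(2) by auto
    then obtain a where a: "a \<in> T" by blast
    have "\<exists>x y. x \<in> T \<and> y \<in> S - T \<and> R x y"
    proof (rule ccontr)
      assume no: "\<not> ?thesis"
      have "a \<in> T \<longleftrightarrow> b \<in> T"
      proof (rule con)
        fix x y assume "x \<in> S" "y \<in> S" "R x y"
        then show "x \<in> T \<longleftrightarrow> y \<in> T" using no sym by blast
      qed (use a b T in auto)
      then show False using a b by blast
    qed
    then obtain x y where xy: "x \<in> T" "y \<in> S" "y \<notin> T" "R x y" by blast
    let ?T = "insert y T"
    have s1: "(\<Sum>z\<in>T. card {w \<in> T. R z w}) + 1 \<le> (\<Sum>z\<in>T. card {w \<in> ?T. R z w})"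
    proof -
      have "(\<Sum>z\<in>T. card {w \<in> T. R z w}) < (\<Sum>z\<in>T. card {w \<in> ?T. R z w})"
      proof (rule sum_strict_mono_ex1[OF finT])
        show "\<forall>z\<in>T. card {w \<in> T. R z w} \<le> card {w \<in> ?T. R z w}"
          using finT by (intro ballI card_mono) auto
        have "{w \<in> T. R x w} \<subset> {w \<in> ?T. R x w}" using xy by blast
        then have "card {w \<in> T. R x w} < card {w \<in> ?T. R x w}" using finT by (intro psubset_card_mono) auto
        then show "\<exists>z\<in>T. card {w \<in> T. R z w} < card {w \<in> ?T. R z w}" using xy(1) by blast
      qed
      then show ?thesis by simp
    qed
    have s2: "card {w \<in> ?T. R y w} \<ge> 1"
    proof -
      have "x \<in> {w \<in> ?T. R y w}" using xy sym by blast
      then have "{w \<in> ?T. R y w} \<noteq> {}" by blast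
      moreover have "finite {w \<in> ?T. R y w}" using finT by simp
      ultimately show ?thesis by (simp add: Suc_leI card_gt_0_iff)
    qed
    have s3: "(\<Sum>z\<in>?T. card {w \<in> ?T. R z w}) = card {w \<in> ?T. R y w} + (\<Sum>z\<in>T. card {w \<in> ?T. R z w})"
      using finT xy(3) by (subst sum.insert) auto
    have "2 * k + 2 \<le> (\<Sum>z\<in>?T. card {w \<in> ?T. R z w})" unfolding s3 using s1 s2 T(3) by linarith
    then have "2 * Suc k \<le> (\<Sum>z\<in>?T. card {w \<in> ?T. R z w})" by simp
    then show ?case using T xy finT by (intro exI[of _ ?T]) simp
  qed
  moreover have "card S > 0" using fin ne by (simp add: card_gt_0_iff)
  ultimately obtain T where T: "T \<subseteq> S" "card T = card S" "2 * (card S - 1) \<le> (\<Sum>x\<in>T. card {y \<in> T. R x y})"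
    by (metis Suc_diff_1 order_refl)
  then have "T = S" using fin card_subset_eq by blast
  then show ?thesis using T by auto
qed

text \<open>The link of a boundary vertex is a path, so that it is disconnected by removing an inner edge
  of that path.\<close>

lemma bd_vert_link_split:
  assumes K: "comb_disk K" and c: "bd_vert K c" and t: "tri K c a b"
    and inner: "\<not> bd_edge K c a" "\<not> bd_edge K c b"
  obtains P where "P a" "\<not> P b" "\<And>x y. tri K c x y \<Longrightarrow> {x, y} \<noteq> {a, b} \<Longrightarrow> P x \<longleftrightarrow> P y"
proof -
  note pK = comb_disk_pure[OF K]
  let ?N = "neighbours K c"
  define R where "R x y \<longleftrightarrow> tri K c x y \<and> {x, y} \<noteq> {a, b}" for x y
  have fin: "finite ?N" by (rule finite_neighbours[OF pK])
  have ab: "a \<in> ?N" "b \<in> ?N" "a \<noteq> b"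
    using pure_2_complex_tri_adj[OF pK t] tri_distinct[OF t] by (auto simp: neighbours_adj)
  obtain p where p: "bd_edge K c p" using c unfolding bd_vert_def by blast
  obtain q where q: "bd_edge K c q" "q \<noteq> p" using bd_edge_second[OF K p] .
  have pq: "p \<in> ?N" "q \<in> ?N" "p \<noteq> a" "p \<noteq> b" "q \<noteq> a" "q \<noteq> b"
    using bd_edge_adj[OF pK] p q inner by (auto simp: neighbours_adj)
  \<comment> \<open>Without the link edge \<open>ab\<close> the vertices \<open>a\<close>,
    \<open>b\<close> and the path ends \<open>p\<close>, \<open>q\<close> have degree at most one
    and all others at most two, a sum of at most \<open>2 * card N - 4\<close>, where
    \<open>N\<close> is the neighbourhood of \<open>c\<close>. Connectedness would need at least
    \<open>2 * card N - 2\<close>.\<close>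
  have "\<exists>P x y. (\<forall>x y. R x y \<longrightarrow> (P x \<longleftrightarrow> P y)) \<and> x \<in> ?N \<and> y \<in> ?N \<and> P x \<and> \<not> P y"
  proof (rule ccontr)
    assume no: "\<not> ?thesis"
    have deg: "2 * card ?N \<le> (\<Sum>x\<in>?N. card {y \<in> ?N. R x y}) + 2"
    proof (rule connected_degree_sum[OF fin])
      show "?N \<noteq> {}" using ab by blast
      show "R y x" if "R x y" for x y using that tri_swap23[of K c x y] by (auto simp: R_def insert_commute)
      show "\<not> R x x" for x using tri_distinct(2)[of K c x x] by (auto simp: R_def)
      fix P x y assume *: "\<And>x y. \<lbrakk>x \<in> ?N; y \<in> ?N; R x y\<rbrakk> \<Longrightarrow> P x \<longleftrightarrow> P y" and "x \<in> ?N" "y \<in> ?N"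
      have RN: "x \<in> ?N \<and> y \<in> ?N" if "R x y" for x y
        using that pure_2_complex_tri_adj[OF pK, of c x y] by (auto simp: R_def neighbours_adj)
      have "\<forall>x y. R x y \<longrightarrow> (P x \<longleftrightarrow> P y)" using * RN by blast
      then show "P x \<longleftrightarrow> P y" using no \<open>x \<in> ?N\<close> \<open>y \<in> ?N\<close> by blast
    qed
    have bound: "(\<Sum>x\<in>?N. card {y \<in> ?N. R x y}) \<le> (\<Sum>x\<in>?N. if x \<in> {a, b, p, q} then 1 else 2)"
    proof (rule sum_mono)
      fix x assume x: "x \<in> ?N"
      have sub: "{y \<in> ?N. R x y} \<subseteq> {y. tri K c x y}" by (auto simp: R_def)
      have finx: "finite {y. tri K c x y}" by (rule finite_tri[OF pK])
      have card: "card {y. tri K c x y} = (if bd_edge K c x then 1 else 2)"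
        using comb_disk_card_tri[OF K] x by (simp add: neighbours_adj)
      show "card {y \<in> ?N. R x y} \<le> (if x \<in> {a, b, p, q} then 1 else 2)"
      proof (cases "x = a \<or> x = b")
        case True
        have "a \<in> {y. tri K c b y}" "b \<in> {y. tri K c a y}" using t tri_swap23[of K c a b] by auto
        then have "{y \<in> ?N. R x y} \<subset> {y. tri K c x y}"
          using True sub by (auto simp: R_def insert_commute)
        then have "card {y \<in> ?N. R x y} < card {y. tri K c x y}" by (rule psubset_card_mono[OF finx])
        then show ?thesis using True card inner by auto
      next
        case False
        have "card {y \<in> ?N. R x y} \<le> card {y. tri K c x y}" by (rule card_mono[OF finx sub])
        then show ?thesis using False card p q by (auto split: if_splits)
      qed
    qed
    have total: "(\<Sum>x\<in>?N. if x \<in> {a, b, p, q} then 1 else 2) + 4 = 2 * card ?N"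
    proof -
      have sub: "{a, b, p, q} \<subseteq> ?N" using ab pq by blast
      have c4: "card {a, b, p, q} = 4" using ab pq q by auto
      have "card ?N \<ge> 4" using card_mono[OF fin sub] c4 by simp
      have "(\<Sum>x\<in>?N. if x \<in> {a, b, p, q} then 1 else (2::nat)) = (\<Sum>x\<in>?N - {a, b, p, q}. 2) + (\<Sum>x\<in>{a, b, p, q}. 1)"
        by (subst sum.subset_diff[OF sub fin]) (intro arg_cong2[of _ _ _ _ "(+)"] sum.cong, auto)
      also have "\<dots> = 2 * (card ?N - 4) + 4" using c4 card_Diff_subset[OF _ sub] by simp
      finally show ?thesis using \<open>card ?N \<ge> 4\<close> by simp
    qed
    show False using deg bound total by linarith
  qed
  then obtain P x y where P: "\<And>x y. R x y \<Longrightarrow> P x \<longleftrightarrow> P y" and xy: "x \<in> ?N" "y \<in> ?N" "P x" "\<not> P y" by blast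
  have neq: "\<not> (P a \<longleftrightarrow> P b)"
  proof
    assume e: "P a \<longleftrightarrow> P b"
    have "P x \<longleftrightarrow> P y"
    proof (rule comb_disk_link[OF K])
      fix x y assume "tri K c x y"
      then show "P x \<longleftrightarrow> P y" using P[of x y] e by (cases "{x, y} = {a, b}") (auto simp: R_def doubleton_eq_iff)
    qed (use xy in \<open>auto simp: neighbours_adj\<close>)
    then show False using xy by simp
  qed
  show thesis
  proof (cases "P a")
    case True
    then show thesis using that[of P] neq P by (auto simp: R_def)
  next
    case False
    then show thesis using that[of "\<lambda>x. \<not> P x"] neq P by (auto simp: R_def)
  qed
qed

text \<open>The inverse of \<open>glue_ear\<close>. Since \<open>c\<close> is inner, its link is a
  cycle, and deleting the link edge \<open>ab\<close> leaves it connected; the links of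
  \<open>a\<close> and \<open>b\<close> are paths and lose only an end vertex. Predicates and
  cocycles are extended from \<open>K'\<close> over \<open>ab\<close> through the path
  \<open>acb\<close>.\<close>

lemma comb_disk_ear:
  assumes K: "comb_disk K" and ab: "bd_edge K a b" and t: "tri K a b c" and c: "\<not> bd_vert K c"
    and K': "K' = K - {{a, b}, {a, b, c}}"
  shows "comb_disk K'" "K = K' \<union> complex_of {{a, b, c}}" "K' \<inter> complex_of {{a, b, c}} = complex_of {{a, c}, {b, c}}"
    "bd_edge K' a c" "bd_edge K' b c" "\<And>x. bd_edge K' c x \<Longrightarrow> x = a \<or> x = b"
proof -
  note pK = comb_disk_pure[OF K]
  note d = tri_distinct[OF t]
  have tri': "tri K' x y z \<longleftrightarrow> tri K x y z \<and> {x, y, z} \<noteq> {a, b, c}" for x y z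
  proof -
    have "{x, y, z} \<noteq> {a, b}" if "tri K x y z"
      using tri_distinct[OF that] by auto
    then show ?thesis by (auto simp: tri_def K')
  qed
  have adj': "adj K' x y \<longleftrightarrow> adj K x y \<and> {x, y} \<noteq> {a, b}" for x y
  proof -
    have "card {x, y} \<le> 2" "card {a, b, c} = 3" using d by (auto simp: card_insert_if)
    then have "{x, y} \<noteq> {a, b, c}" by force
    then show ?thesis by (auto simp: adj_def K')
  qed
  have ab_c: "w = c" if "tri K a b w" for w using bd_edge_unique[OF ab that t] .
  have no_ab: "{a, b} \<subseteq> {x, y, z} \<Longrightarrow> {x, y, z} = {a, b, c}" if "tri K x y z" for x y z
  proof -
    assume "{a, b} \<subseteq> {x, y, z}"
    then have "tri K a b x \<or> tri K a b y \<or> tri K a b z" 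
      using that tri_perms[OF that] d(1) by auto
    then have "c \<in> {x, y, z}" using ab_c by auto
    then have "{a, b, c} \<subseteq> {x, y, z}" using \<open>{a, b} \<subseteq> {x, y, z}\<close> by simp
    moreover have "card {a, b, c} = 3" "card {x, y, z} = 3" using d tri_distinct[OF that] by auto
    ultimately show "{x, y, z} = {a, b, c}" by (metis card_subset_eq finite.emptyI finite.insertI)
  qed
  have ca: "\<not> bd_edge K c a" "\<not> bd_edge K c b" using c unfolding bd_vert_def by auto
  obtain dd where dd: "tri K c a dd" "dd \<noteq> b"
    using inner_edge_second_face[OF ca(1) tri_perms(4)[OF t]] .
  obtain e where e: "tri K c b e" "e \<noteq> a"
    using inner_edge_second_face[OF ca(2) tri_perms(5)[OF t]] .
  have dd': "tri K' c a dd" using dd d tri_distinct[OF dd(1)] by (auto simp: tri')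
  have e': "tri K' c b e" using e d tri_distinct[OF e(1)] by (auto simp: tri')
  have sab: "s = {a, b} \<or> s = {a, b, c}" if s: "s \<in> K" "{a, b} \<subseteq> s" for s
  proof -
    obtain x y z where xyz: "tri K x y z" "s \<subseteq> {x, y, z}" by (rule pure_2_complex_face[OF pK s(1)])
    then have "{x, y, z} = {a, b, c}" using no_ab[OF xyz(1)] s(2) by blast
    then show ?thesis using xyz(2) s(2) by (cases "c \<in> s") blast+
  qed
  have pure': "pure_2_complex K'"
    unfolding pure_2_complex_def
  proof (intro conjI ballI allI impI)
    show "finite K'" "{} \<notin> K'" using pK by (auto simp: K' pure_2_complex_def)
  next
    fix s u assume s: "s \<in> K'" and u: "u \<noteq> {} \<and> u \<subseteq> s"
    have "u \<in> K" by (rule pure_2_complex_subset[OF pK, of s]) (use s u in \<open>auto simp: K'\<close>)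
    moreover have "\<not> {a, b} \<subseteq> u" using sab[of s] s u by (auto simp: K')
    ultimately show "u \<in> K'" by (auto simp: K')
  next
    fix s assume s: "s \<in> K'"
    then obtain x y z where xyz: "tri K x y z" "s \<subseteq> {x, y, z}" using pure_2_complex_face[OF pK, of s] by (auto simp: K')
    have F: "{x, y, z} \<in> K' \<and> card {x, y, z} = 3" if "tri K' x y z" for x y z using that by (auto simp: tri_def)
    show "\<exists>t\<in>K'. s \<subseteq> t \<and> card t = 3"
    proof (cases "{x, y, z} = {a, b, c}")
      case False
      then have "tri K' x y z" using xyz by (simp add: tri')
      then show ?thesis using F xyz(2) by blast
    next
      case True
      then have "s \<subseteq> {c, a, dd} \<or> s \<subseteq> {c, b, e}" using xyz(2) sab[of s] s by (auto simp: K')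
      then show ?thesis using F[OF dd'] F[OF e'] by blast
    qed
  qed
  have bd': "bd_edge K' c x" if x: "x = a \<or> x = b" for x
    unfolding bd_edge_def
  proof -
    have "y = dd" if "tri K' c a y" for y
      using comb_disk_two_faces[OF K dd(1), of b y] that tri_perms(4)[OF t] dd(2) by (auto simp: tri' insert_commute)
    moreover have "y = e" if "tri K' c b y" for y
      using comb_disk_two_faces[OF K e(1), of a y] that tri_perms(5)[OF t] e(2) by (auto simp: tri' insert_commute)
    ultimately show "\<exists>!z. tri K' c x z" using x dd' e' by metis
  qed
  then show "bd_edge K' a c" "bd_edge K' b c" using bd_edge_commute[of K'] by auto
  show "x = a \<or> x = b" if "bd_edge K' c x" for x
  proof (rule ccontr)
    assume n: "\<not> (x = a \<or> x = b)"
    have "tri K' c x z \<longleftrightarrow> tri K c x z" for z using n tri_distinct[of K c x z] by (auto simp: tri')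
    then have "tri K' c x = tri K c x" by (intro ext)
    then have "bd_edge K c x" using that unfolding bd_edge_def by simp
    then show False using c unfolding bd_vert_def by blast
  qed
  have inK: "{a, b, c} \<in> K" using t by (simp add: tri_def)
  show "K = K' \<union> complex_of {{a, b, c}}"
    using pure_2_complex_subset[OF pK inK] by (auto simp: K' complex_of_def)
  show "K' \<inter> complex_of {{a, b, c}} = complex_of {{a, c}, {b, c}}" (is "?L = ?R")
  proof (intro equalityI subsetI)
    fix s assume "s \<in> ?L"
    then show "s \<in> ?R" by (auto simp: K' complex_of_def)
  next
    fix s assume s: "s \<in> ?R"
    then have "s \<noteq> {}" "s \<subseteq> {a, c} \<or> s \<subseteq> {b, c}" by (auto simp: complex_of_def)
    moreover from this have "s \<subseteq> {a, b, c}" "\<not> {a, b} \<subseteq> s" using d by auto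
    moreover from this have "s \<in> K" using pure_2_complex_subset[OF pK inK] calculation by blast
    ultimately show "s \<in> ?L" by (auto simp: K' complex_of_def)
  qed
  show "comb_disk K'"
  proof (rule comb_diskI[OF pure' _ _ _ bd'[of a]])
    fix x y p q r assume "tri K' x y p" "tri K' x y q" "tri K' x y r"
    then show "p = q \<or> p = r \<or> q = r" using comb_disk_two_faces[OF K, of x y p q r] by (simp add: tri')
  next
    fix v P x y assume P: "\<And>x y. tri K' v x y \<Longrightarrow> P x \<longleftrightarrow> P y" and xy: "adj K' v x" "adj K' v y"
    have end_case: "P x \<longleftrightarrow> P c" if v: "v = a \<and> w = b \<or> v = b \<and> w = a" and x: "adj K' v x" for w x
    proof -
      have vw: "adj K v w" using v bd_edge_adj[OF pK ab] adj_sym[OF bd_edge_adj[OF pK ab]] by auto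
      have x': "adj K v x" "x \<noteq> w" using x v by (auto simp: adj')
      obtain w' where w': "tri K v w w'" "P x \<longleftrightarrow> P w'"
      proof (rule link_remove_vertex[OF K vw x', where P = P])
        fix p q assume pq: "tri K v p q" "p \<noteq> w" "q \<noteq> w"
        have "w \<in> {a, b, c}" "w \<notin> {v, p, q}" using v d pq by auto
        then have "{v, p, q} \<noteq> {a, b, c}" by metis
        then show "P p \<longleftrightarrow> P q" using P[of p q] pq by (simp add: tri')
      qed
      have "tri K a b w'" using v w'(1) tri_swap12[of K a b w'] by auto
      then show ?thesis using w'(2) ab_c by blast
    qed
    consider "v = a \<or> v = b" | "v = c" | "v \<notin> {a, b, c}" by blast
    then show "P x \<longleftrightarrow> P y"
    proof cases
      case 1
      then show ?thesis using end_case[of b x] end_case[of b y] end_case[of a x] end_case[of a y] xy by auto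
    next
      case 2
      have "P b \<longleftrightarrow> P dd"
      proof (rule inner_link_remove_vertex[OF K c tri_perms(4)[OF t] dd(1)])
        fix p q assume pq: "tri K c p q" "p \<noteq> a" "q \<noteq> a"
        have "a \<in> {a, b, c}" "a \<notin> {c, p, q}" using d pq by auto
        then have "{c, p, q} \<noteq> {a, b, c}" by metis
        then show "P p \<longleftrightarrow> P q" using P[of p q] pq 2 by (simp add: tri')
      qed
      moreover have "P a \<longleftrightarrow> P dd" using P[of a dd] dd' 2 by simp
      ultimately have pab: "P a \<longleftrightarrow> P b" by simp
      show ?thesis
      proof (rule comb_disk_link[OF K])
        fix p q assume pq: "tri K c p q"
        show "P p \<longleftrightarrow> P q"
        proof (cases "{c, p, q} = {a, b, c}")
          case True
          then have "p = a \<and> q = b \<or> p = b \<and> q = a" using d tri_distinct[OF pq] by auto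
          then show ?thesis using pab by auto
        next
          case False
          then show ?thesis using P[of p q] pq 2 by (simp add: tri')
        qed
      qed (use xy 2 in \<open>auto simp: adj'\<close>)
    next
      case 3
      show ?thesis
      proof (rule comb_disk_link[OF K])
        fix p q assume pq: "tri K v p q"
        have "{v, p, q} \<noteq> {a, b, c}" using 3 by auto
        then show "P p \<longleftrightarrow> P q" using P[of p q] pq by (simp add: tri')
      qed (use xy in \<open>auto simp: adj'\<close>)
    qed
  next
    fix P x y assume P: "\<And>x y. adj K' x y \<Longrightarrow> P x \<longleftrightarrow> P y" and xy: "x \<in> verts K'" "y \<in> verts K'"
    have ac: "adj K' c a" "adj K' c b" using pure_2_complex_tri_adj(1)[OF pure'] dd' e' by auto
    show "P x \<longleftrightarrow> P y"
    proof (rule comb_disk_connected[OF K])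
      fix p q assume pq: "adj K p q"
      show "P p \<longleftrightarrow> P q"
      proof (cases "{p, q} = {a, b}")
        case True
        then show ?thesis using P[OF ac(1)] P[OF ac(2)] by (auto simp: doubleton_eq_iff)
      next
        case False
        then show ?thesis using P[of p q] pq by (simp add: adj')
      qed
    qed (use xy in \<open>auto simp: verts_def K'\<close>)
  next
    fix g assume g: "cocycle K' g"
    have ac: "adj K' c a" "adj K' c b" using pure_2_complex_tri_adj(1)[OF pure'] dd' e' by auto
    have anti: "g x y = - g y x" if "adj K' x y" for x y using g that unfolding cocycle_def by blast
    \<comment> \<open>The value on the missing edge is forced by the cocycle condition on the face
      \<open>abc\<close>.\<close>
    define h where "h x y = (if x = a \<and> y = b then g a c + g c b else if x = b \<and> y = a then g b c + g c a else g x y)" for x y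
    have h: "h x y = g x y" if "{x, y} \<noteq> {a, b}" for x y
    proof -
      have "\<not> (x = a \<and> y = b)" "\<not> (x = b \<and> y = a)" using that by blast+
      then show ?thesis unfolding h_def by (simp only: if_False)
    qed
    have "cocycle K h"
      unfolding cocycle_def
    proof (intro conjI allI impI)
      fix x y assume xy: "adj K x y"
      show "h x y = - h y x"
      proof (cases "{x, y} = {a, b}")
        case True
        then have "x = a \<and> y = b \<or> x = b \<and> y = a" by (simp add: doubleton_eq_iff)
        then show ?thesis using anti[OF ac(1)] anti[OF ac(2)] d(1,4) by (elim disjE) (simp_all add: h_def)
      next
        case False
        moreover from this have "{y, x} \<noteq> {a, b}" by (simp add: insert_commute)
        ultimately show ?thesis using anti[of x y] xy h[of x y] h[of y x] by (simp add: adj')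
      qed
    next
      fix x y z assume xyz: "tri K x y z"
      show "h x y + h y z + h z x = 0"
      proof (cases "{x, y, z} = {a, b, c}")
        case True
        then have "x \<in> {a, b, c}" "y \<in> {a, b, c}" "z \<in> {a, b, c}" by blast+
        then have "x = a \<and> y = b \<and> z = c \<or> x = a \<and> y = c \<and> z = b \<or> x = b \<and> y = a \<and> z = c
            \<or> x = b \<and> y = c \<and> z = a \<or> x = c \<and> y = a \<and> z = b \<or> x = c \<and> y = b \<and> z = a"
          using tri_distinct(1-3)[OF xyz] by blast
        then show ?thesis using anti[OF ac(1)] anti[OF ac(2)] d by (elim disjE) (simp_all add: h_def)
      next
        case False
        then have "\<not> {a, b} \<subseteq> {x, y, z}" using no_ab[OF xyz] by blast
        then have "h x y = g x y" "h y z = g y z" "h z x = g z x" by (auto intro!: h)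
        moreover have "g x y + g y z + g z x = 0" using g xyz False unfolding cocycle_def tri' by blast
        ultimately show ?thesis by simp
      qed
    qed
    then obtain f where f: "\<And>x y. adj K x y \<Longrightarrow> h x y = f y - f x" using comb_disk_cocycle[OF K] by blast
    have "g x y = f y - f x" if "adj K' x y" for x y using f[of x y] h[of x y] that by (simp add: adj')
    then show "\<exists>f. \<forall>x y. adj K' x y \<longrightarrow> g x y = f y - f x" by blast
  qed simp
qed

text \<open>A simplex is a clique, so none meets both \<open>D\<close> and \<open>D'\<close>; each
  side with the edge \<open>ps\<close> is what remains after deleting the other.\<close>

lemma comb_disk_split:
  assumes K: "comb_disk K" and ps: "adj K p s"
    and part: "verts K = D \<union> D' \<union> {p, s}" "D \<inter> D' = {}" "p \<notin> D \<union> D'" "s \<notin> D \<union> D'"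
    and no_adj: "\<And>x y. x \<in> D \<Longrightarrow> y \<in> D' \<Longrightarrow> \<not> adj K x y"
    and d: "tri K p s d" "d \<in> D" and d': "tri K p s d'" "d' \<in> D'"
  defines "A \<equiv> delete_verts K D'" and "B \<equiv> delete_verts K D"
  shows "comb_disk A" "comb_disk B" "K = A \<union> B" "A \<inter> B = complex_of {{p, s}}"
    "bd_edge A p s" "bd_edge B p s" "card (faces A) < card (faces K)" "card (faces B) < card (faces K)"
proof -
  note pK = comb_disk_pure[OF K]
  have V: "x \<in> D \<union> D' \<union> {p, s}" if "x \<in> s'" "s' \<in> K" for x s'
    using that part(1) unfolding verts_def by blast
  have adjV: "y \<in> D \<union> D' \<union> {p, s}" if "adj K x y" for x y
    using V[of y "{x, y}"] that by (auto simp: adj_def)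
  have out: "p \<notin> D" "s \<notin> D" "p \<notin> D'" "s \<notin> D'" "d \<notin> D'" "d' \<notin> D"
    using part d d' by auto
  have nD': "y \<in> D' \<union> {p, s}" if "adj K x y" "x \<in> D'" for x y
    using adjV[OF that(1)] no_adj[of y x] adj_sym[OF that(1)] that(2) by auto
  have nD: "y \<in> D \<union> {p, s}" if "adj K x y" "x \<in> D" for x y
    using adjV[OF that(1)] no_adj[of x y] that by auto
  show "comb_disk A" "bd_edge A p s"
    unfolding A_def using comb_disk_delete_side[OF K ps out(3,4) d' d(1) out(5) nD'] by simp_all
  show "comb_disk B" "bd_edge B p s"
    unfolding B_def using comb_disk_delete_side[OF K ps out(1,2) d d'(1) out(6) nD] by simp_all
  have sep: "s' \<inter> D = {} \<or> s' \<inter> D' = {}" if s': "s' \<in> K" for s'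
  proof (rule ccontr)
    assume "\<not> ?thesis"
    then obtain x y where xy: "x \<in> s'" "x \<in> D" "y \<in> s'" "y \<in> D'" by blast
    have "{x, y} \<in> K" by (rule pure_2_complex_subset[OF pK s']) (use xy in auto)
    then have "adj K x y" using xy part(2) by (auto simp: adj_def)
    then show False using no_adj xy by blast
  qed
  show "K = A \<union> B" using sep by (auto simp: A_def B_def delete_verts_def)
  show "A \<inter> B = complex_of {{p, s}}"
  proof (intro equalityI subsetI)
    fix s' assume s': "s' \<in> A \<inter> B"
    then have "s' \<in> K" "s' \<inter> D = {}" "s' \<inter> D' = {}" by (auto simp: A_def B_def delete_verts_def)
    then have "s' \<subseteq> {p, s}" "s' \<noteq> {}" using V[of _ s'] pure_2_complex_nonempty[OF pK] by blast+
    then show "s' \<in> complex_of {{p, s}}" by (simp add: complex_of_def)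
  next
    fix s' assume "s' \<in> complex_of {{p, s}}"
    then have s': "s' \<noteq> {}" "s' \<subseteq> {p, s}" by (auto simp: complex_of_def)
    have "{p, s} \<in> K" using ps by (simp add: adj_def)
    then have "s' \<in> K" by (rule pure_2_complex_subset[OF pK _ s'])
    moreover have "s' \<inter> D = {}" "s' \<inter> D' = {}" using s'(2) out by blast+
    ultimately show "s' \<in> A \<inter> B" by (simp add: A_def B_def delete_verts_def)
  qed
  have fin: "finite (faces K)" using pK by (simp add: faces_def pure_2_complex_def)
  have "faces A \<subset> faces K"
  proof
    show "faces A \<subseteq> faces K" by (auto simp: A_def faces_def delete_verts_def)
    have "{p, s, d'} \<in> faces K" "{p, s, d'} \<notin> faces A"
      using d' by (auto simp: faces_tri A_def tri_delete_verts)
    then show "faces A \<noteq> faces K" by blast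
  qed
  then show "card (faces A) < card (faces K)" by (rule psubset_card_mono[OF fin])
  have "faces B \<subset> faces K"
  proof
    show "faces B \<subseteq> faces K" by (auto simp: B_def faces_def delete_verts_def)
    have "{p, s, d} \<in> faces K" "{p, s, d} \<notin> faces B"
      using d by (auto simp: faces_tri B_def tri_delete_verts)
    then show "faces B \<noteq> faces K" by blast
  qed
  then show "card (faces B) < card (faces K)" by (rule psubset_card_mono[OF fin])
qed

text \<open>The cocycle counting the passages through \<open>c\<close> between the two sides of its link is a
  coboundary \<open>f\<close>; the level sets of \<open>f\<close> split the disk along the edge \<open>bc\<close>.\<close>

lemma bd_vert_split:
  assumes K: "comb_disk K" and ab: "bd_edge K a b" and t: "tri K a b c" and c: "bd_vert K c"
    and inner: "\<not> bd_edge K a c" "\<not> bd_edge K b c"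
  obtains D D' d where "verts K = D \<union> D' \<union> {b, c}" "D \<inter> D' = {}" "b \<notin> D \<union> D'" "c \<notin> D \<union> D'"
    "\<And>x y. x \<in> D \<Longrightarrow> y \<in> D' \<Longrightarrow> \<not> adj K x y" "a \<in> D" "tri K b c d" "d \<in> D'"
proof -
  note pK = comb_disk_pure[OF K]
  note dis = tri_distinct[OF t]
  have inner': "\<not> bd_edge K c a" "\<not> bd_edge K c b" using inner bd_edge_commute by metis+
  obtain P where P: "P a" "\<not> P b" "\<And>x y. tri K c x y \<Longrightarrow> {x, y} \<noteq> {a, b} \<Longrightarrow> P x \<longleftrightarrow> P y"
    using bd_vert_link_split[OF K c tri_perms(4)[OF t] inner'] by blast
  \<comment> \<open>The value 1 is given to steps from \<open>c\<close> into the part of its link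
    where \<open>P\<close> holds. Only the face \<open>abc\<close> has one end of a link edge in
    each part, and the value on \<open>ab\<close> corrects the sum there; no other face contains
    \<open>ab\<close>, because it is a boundary edge.\<close>
  define g where "g x y = (if x = c then (if P y then 1 else 0) else if y = c then (if P x then - 1 else 0)
      else if x = a \<and> y = b then - 1 else if x = b \<and> y = a then 1 else (0::int))" for x y
  have gc: "g c y = (if P y then 1 else 0)" "y \<noteq> c \<Longrightarrow> g y c = (if P y then - 1 else 0)" for y
    by (auto simp: g_def)
  have g0: "g x y = 0" if "x \<noteq> c" "y \<noteq> c" "{x, y} \<noteq> {a, b}" for x y
    using that by (auto simp: g_def)
  have gab: "g a b = - 1" "g b a = 1" using dis by (auto simp: g_def)
  have at_c: "g c y + g y z + g z c = 0" if tt: "tri K c y z" for y z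
  proof (cases "{y, z} = {a, b}")
    case True
    then have "y = a \<and> z = b \<or> y = b \<and> z = a" by (auto simp: doubleton_eq_iff)
    then show ?thesis using gab P(1,2) gc dis by auto
  next
    case False
    then show ?thesis using P(3)[OF tt] g0[of y z] gc tri_distinct[OF tt] by auto
  qed
  have "cocycle K g"
    unfolding cocycle_def
  proof (intro conjI allI impI)
    fix x y assume "adj K x y"
    then show "g x y = - g y x" using adj_distinct[of K x y] dis by (auto simp: g_def)
  next
    fix x y z assume xyz: "tri K x y z"
    consider "x = c" | "y = c" | "z = c" | "c \<notin> {x, y, z}" by blast
    then show "g x y + g y z + g z x = 0"
    proof cases
      case 1 then show ?thesis using at_c[of y z] xyz by simp
    next
      case 2 then show ?thesis using at_c[of z x] tri_perms(3)[OF xyz] by simp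
    next
      case 3 then show ?thesis using at_c[of x y] tri_perms(4)[OF xyz] by simp
    next
      case 4
      have no: "{x', y'} \<noteq> {a, b}" if "tri K x' y' z'" "z' \<noteq> c" for x' y' z'
      proof
        assume "{x', y'} = {a, b}"
        then have "tri K a b z'" using that(1) tri_swap12[of K a b z'] by (auto simp: doubleton_eq_iff)
        then show False using bd_edge_unique[OF ab _ t] that(2) by blast
      qed
      have "g x y = 0" "g y z = 0" "g z x = 0"
        using no[OF xyz] no[OF tri_perms(3)[OF xyz]] no[OF tri_perms(4)[OF xyz]] 4 by (auto intro!: g0)
      then show ?thesis by simp
    qed
  qed
  then obtain f where f: "\<And>x y. adj K x y \<Longrightarrow> g x y = f y - f x" using comb_disk_cocycle[OF K] by blast
  have adjs: "adj K c a" "adj K c b" "adj K b c" using pure_2_complex_tri_adj[OF pK t] by auto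
  have fa: "f a = f c + 1" and fb: "f b = f c" using f[OF adjs(1)] f[OF adjs(2)] gc P(1,2) by auto
  \<comment> \<open>Off \<open>c\<close> the potential changes only along \<open>ab\<close>, and
    \<open>b\<close> lies on the level of \<open>c\<close>. Once \<open>b\<close> and
    \<open>c\<close> are set aside, no edge crosses from above this level to below or onto
    it.\<close>
  define D where "D = {x \<in> verts K. x \<noteq> c \<and> f x > f c}"
  define D' where "D' = {x \<in> verts K. x \<noteq> c \<and> x \<noteq> b \<and> f x \<le> f c}"
  obtain e where e: "tri K b c e" "e \<noteq> a"
    using inner_edge_second_face[OF inner(2) tri_perms(3)[OF t]] .
  have e': "tri K c b e" using e(1) tri_swap12 by metis
  have "\<not> P e" using P(3)[OF e'] e(2) P(2) dis by (auto simp: doubleton_eq_iff)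
  then have fe: "f e = f c" using f[OF pure_2_complex_tri_adj(3)[OF pK e']] gc by simp
  show thesis
  proof (rule that[of D D' e])
    show "verts K = D \<union> D' \<union> {b, c}"
      using adj_verts[OF adjs(2)] adj_verts[OF adjs(3)] by (auto simp: D_def D'_def not_less)
    show "D \<inter> D' = {}" by (auto simp: D_def D'_def)
    show "b \<notin> D \<union> D'" "c \<notin> D \<union> D'" using fb by (auto simp: D_def D'_def)
    show "a \<in> D" using fa tri_verts[OF t] dis by (simp add: D_def)
    show "tri K b c e" by (fact e(1))
    show "e \<in> D'" using fe tri_verts[OF tri_perms(4)[OF e(1)]] tri_distinct[OF e(1)] by (simp add: D'_def)
    show "\<not> adj K x y" if xy: "x \<in> D" "y \<in> D'" for x y
    proof
      assume "adj K x y"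
      then have "g x y < 0" using f[of x y] xy by (auto simp: D_def D'_def)
      then have "{x, y} = {a, b}" using g0[of x y] xy by (auto simp: D_def D'_def)
      then show False using xy fa by (auto simp: D_def D'_def doubleton_eq_iff)
    qed
  qed
qed

text \<open>Take the vertex \<open>c\<close> opposite to a boundary edge \<open>ab\<close>. If it is
  inner, the face is an ear. Otherwise look at \<open>ac\<close> and \<open>bc\<close>: if both are
  boundary edges, the complex is a triangle; if exactly one is, the other cuts off the face
  \<open>abc\<close>; if neither is, \<open>bd_vert_split\<close> supplies a cut along
  \<open>bc\<close>. The principle serves both for gluing homeomorphisms and for cohomology modulo
  two.\<close>

theorem comb_disk_induct [consumes 1, case_names triangle edge ear]:
  assumes K: "comb_disk K"
    and triangle: "\<And>a b c. \<lbrakk>a \<noteq> b; b \<noteq> c; a \<noteq> c\<rbrakk> \<Longrightarrow> Q (complex_of {{a, b, c}})"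
    and edge: "\<And>A B b c. \<lbrakk>comb_disk A; comb_disk B; Q A; Q B; A \<inter> B = complex_of {{b, c}};
        bd_edge A b c; bd_edge B b c\<rbrakk> \<Longrightarrow> Q (A \<union> B)"
    and ear: "\<And>A a b c. \<lbrakk>comb_disk A; Q A; a \<noteq> b; b \<noteq> c; a \<noteq> c;
        A \<inter> complex_of {{a, b, c}} = complex_of {{a, c}, {b, c}}; bd_edge A a c; bd_edge A b c;
        \<And>x. bd_edge A c x \<Longrightarrow> x = a \<or> x = b\<rbrakk> \<Longrightarrow> Q (A \<union> complex_of {{a, b, c}})"
  shows "Q K"
  using K
proof (induction "card (faces K)" arbitrary: K rule: less_induct)
  case less
  note K = less.prems
  note pK = comb_disk_pure[OF K]
  have split: "Q K" if ps: "adj K p s"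
    and part: "verts K = D \<union> D' \<union> {p, s}" "D \<inter> D' = {}" "p \<notin> D \<union> D'" "s \<notin> D \<union> D'"
    and no_adj: "\<And>x y. x \<in> D \<Longrightarrow> y \<in> D' \<Longrightarrow> \<not> adj K x y"
    and d: "tri K p s d" "d \<in> D" and d': "tri K p s d'" "d' \<in> D'" for p s D D' d d'
  proof -
    note sp = comb_disk_split[OF K ps part no_adj d d']
    have "Q (delete_verts K D' \<union> delete_verts K D)"
      by (rule edge[OF sp(1,2) less.hyps[OF sp(7) sp(1)] less.hyps[OF sp(8) sp(2)] sp(4,5,6)])
    then show ?thesis using sp(3) by simp
  qed
  have fin: "finite (faces K)" using pK by (simp add: faces_def pure_2_complex_def)
  obtain a b where ab: "bd_edge K a b" using comb_disk_bd_edge[OF K] .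
  then obtain c where t: "tri K a b c" unfolding bd_edge_def by (elim ex1E)
  note d = tri_distinct[OF t]
  have corner: "Q K \<or> bd_edge K b c" if ab: "bd_edge K a b" and t: "tri K a b c" and ac: "bd_edge K a c" for a b
  proof (rule disjCI)
    note d = tri_distinct[OF t]
    assume nb: "\<not> bd_edge K b c"
    have N: "neighbours K a \<subseteq> {b, c}"
    proof (rule neighbours_closed[OF K, of b])
      fix x y assume "x \<in> {b, c}" "tri K a x y"
      then show "y \<in> {b, c}" using bd_edge_unique[OF ab t] bd_edge_unique[OF ac tri_perms(2)[OF t]] by auto
    qed (use bd_edge_adj[OF pK ab] in auto)
    obtain e where e: "tri K b c e" "e \<noteq> a" using inner_edge_second_face[OF nb tri_perms(3)[OF t]] .
    have V: "a \<in> verts K" "b \<in> verts K" "c \<in> verts K" "e \<in> verts K"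
      using tri_verts[OF t] tri_verts[OF e(1)] tri_verts[OF tri_perms(3)[OF e(1)]] tri_verts[OF tri_perms(4)[OF e(1)]]
      tri_verts[OF tri_perms(4)[OF t]] by auto
    show "Q K"
    proof (rule split[of b c "{a}" "verts K - {a, b, c}" a e])
      show "adj K b c" by (rule pure_2_complex_tri_adj(2)[OF pK t])
      show "\<not> adj K x y" if "x \<in> {a}" "y \<in> verts K - {a, b, c}" for x y
        using that N by (auto simp: neighbours_adj)
      show "e \<in> verts K - {a, b, c}" using V e tri_distinct[OF e(1)] by simp
      show "tri K b c a" by (rule tri_perms(3)[OF t])
    qed (use V d e(1) in auto)
  qed
  show ?case
  proof (cases "bd_vert K c")
    case False
    let ?K' = "K - {{a, b}, {a, b, c}}"
    note E = comb_disk_ear[OF K ab t False refl]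
    have "faces ?K' \<subset> faces K"
    proof
      show "faces ?K' \<subseteq> faces K" by (auto simp: faces_def)
      have "{a, b, c} \<in> faces K" "{a, b, c} \<notin> faces ?K'" using t by (auto simp: faces_tri tri_def)
      then show "faces ?K' \<noteq> faces K" by blast
    qed
    then have less: "card (faces ?K') < card (faces K)" by (rule psubset_card_mono[OF fin])
    have "Q (?K' \<union> complex_of {{a, b, c}})"
      by (rule ear[OF E(1) less.hyps[OF less E(1)] d(1,2,3) E(3,4,5,6)])
    then show ?thesis using E(2) by simp
  next
    case True
    consider "bd_edge K a c" "bd_edge K b c" | "bd_edge K a c" "\<not> bd_edge K b c" | "\<not> bd_edge K a c" "bd_edge K b c"
      | "\<not> bd_edge K a c" "\<not> bd_edge K b c" by blast
    then show ?thesis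
    proof cases
      case 2 then show ?thesis using corner[OF ab t] by blast
    next
      case 3
      have "bd_edge K b a" "tri K b a c" using ab t bd_edge_commute tri_swap12 by metis+
      then show ?thesis using corner 3 by blast
    next
      case 4
      obtain D D' dd where *: "verts K = D \<union> D' \<union> {b, c}" "D \<inter> D' = {}" "b \<notin> D \<union> D'" "c \<notin> D \<union> D'"
        "\<And>x y. x \<in> D \<Longrightarrow> y \<in> D' \<Longrightarrow> \<not> adj K x y" "a \<in> D" "tri K b c dd" "dd \<in> D'"
        using bd_vert_split[OF K ab t True 4] by blast
      show ?thesis
        by (rule split[OF pure_2_complex_tri_adj(2)[OF pK t] *(1-5) tri_perms(3)[OF t] *(6-8)])
    next
      case 1
      have cl: "y \<in> {a, b, c}" if x: "x \<in> {a, b, c}" and xy: "adj K x y" for x y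
      proof -
        have ub: "w = c" if "tri K a b w" for w using bd_edge_unique[OF ab that t] .
        have uc: "w = b" if "tri K a c w" for w using bd_edge_unique[OF 1(1) that tri_perms(2)[OF t]] .
        have ua: "w = a" if "tri K b c w" for w using bd_edge_unique[OF 1(2) that tri_perms(3)[OF t]] .
        have step: "q \<in> {a, b, c}" if "x \<in> {a, b, c}" "p \<in> {a, b, c}" "tri K x p q" for x p q
        proof -
          have "tri K p x q" using that(3) tri_swap12 by metis
          moreover have "x = a \<and> p = b \<or> x = b \<and> p = a \<or> x = a \<and> p = c \<or> x = c \<and> p = a \<or> x = b \<and> p = c \<or> x = c \<and> p = b"
            using that(1,2) tri_distinct(1)[OF that(3)] by blast
          ultimately have "tri K a b q \<or> tri K a c q \<or> tri K b c q"
            using that(3) by (elim disjE conjE) simp_all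
          then have "q = c \<or> q = b \<or> q = a" using ub uc ua by blast
          then show ?thesis by blast
        qed
        obtain p where p: "p \<in> {a, b, c}" "adj K x p"
          using x pure_2_complex_tri_adj[OF pK t] by blast
        have "neighbours K x \<subseteq> {a, b, c}" by (rule neighbours_closed[OF K p step[OF x]])
        then show ?thesis using xy by (auto simp: neighbours_adj)
      qed
      have V: "verts K \<subseteq> {a, b, c}"
        using verts_closed[OF K, of a "{a, b, c}"] cl tri_verts[OF t] by blast
      have "K = complex_of {{a, b, c}}"
      proof (intro equalityI subsetI)
        fix s assume "s \<in> K"
        then have "s \<subseteq> {a, b, c}" using V unfolding verts_def by blast
        then show "s \<in> complex_of {{a, b, c}}" using pure_2_complex_nonempty[OF pK \<open>s \<in> K\<close>] by (simp add: complex_of_def)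
      next
        fix s assume "s \<in> complex_of {{a, b, c}}"
        then show "s \<in> K" using pure_2_complex_subset[OF pK, of "{a, b, c}" s] t by (simp add: complex_of_def tri_def)
      qed
      then show ?thesis using triangle[OF d(1,2,3)] by simp
    qed
  qed
qed

theorem comb_disk_triangulates_disk: "comb_disk K \<Longrightarrow> triangulates_disk K"
proof (induction K rule: comb_disk_induct)
  case (triangle a b c)
  then show ?case by (rule triangle_triangulates_disk)
next
  case (edge A B b c)
  obtain b' where b': "bd_edge A b b'" "b' \<noteq> c" using bd_edge_second[OF edge.hyps(1,4)] .
  have "bd_edge A c b" using edge.hyps(4) bd_edge_commute by metis
  then obtain c' where c': "bd_edge A c c'" "c' \<noteq> b" using bd_edge_second[OF edge.hyps(1)] by metis
  show ?case by (rule glue_along_edge[OF edge.IH edge.hyps(3-5) b' c'])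
next
  case (ear A a b c)
  then show ?case by (intro glue_ear)
qed

section \<open>Cycles modulo two\<close>

text \<open>The value on the face \<open>xyz\<close> of the coboundary of \<open>C\<close> modulo
  two: whether an odd number of its sides belongs to \<open>C\<close>.\<close>

definition par :: "'a set set \<Rightarrow> 'a \<Rightarrow> 'a \<Rightarrow> 'a \<Rightarrow> bool" where
  "par C x y z \<longleftrightarrow> (({x, y} \<in> C) \<noteq> (({y, z} \<in> C) \<noteq> ({x, z} \<in> C)))"

text \<open>Vanishing of the first cohomology modulo two, by the decomposition into triangles. In an
  ear the value on the new edge \<open>ab\<close> is determined by the two sides already
  present.\<close>

lemma even_cocycle_coboundary:
  assumes "comb_disk K" "\<And>x y z. tri K x y z \<Longrightarrow> \<not> par C x y z"
  shows "\<exists>F. \<forall>x y. adj K x y \<longrightarrow> ({x, y} \<in> C \<longleftrightarrow> (x \<in> F) \<noteq> (y \<in> F))"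
  using assms
proof (induction K rule: comb_disk_induct)
  case (triangle a b c)
  define F where "F = {x. x \<noteq> a \<and> {a, x} \<in> C}"
  have "tri (complex_of {{a, b, c}}) a b c" unfolding tri_complex_of_triangle[OF triangle(1-3)] by simp
  then have p: "\<not> par C a b c" by (rule triangle(4))
  have "{x, y} \<in> C \<longleftrightarrow> (x \<in> F) \<noteq> (y \<in> F)" if xy: "adj (complex_of {{a, b, c}}) x y" for x y
  proof -
    have "x \<in> {a, b, c}" "y \<in> {a, b, c}" "x \<noteq> y" using xy by (auto simp: adj_def complex_of_def)
    then have "x = a \<and> y = b \<or> x = b \<and> y = a \<or> x = a \<and> y = c \<or> x = c \<and> y = a \<or> x = b \<and> y = c \<or> x = c \<and> y = b"
      by blast
    then show ?thesis using p triangle(1-3)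
      by (elim disjE conjE) (simp_all add: F_def par_def insert_commute; argo)+
  qed
  then show ?case by blast
next
  case (edge A B b c)
  note pA = comb_disk_pure[OF edge.hyps(1)] and pB = comb_disk_pure[OF edge.hyps(2)]
  have "\<not> par C x y z" if "tri A x y z" for x y z using edge.prems[of x y z] that by (simp add: tri_Un)
  then obtain FA where FA: "\<And>x y. adj A x y \<Longrightarrow> {x, y} \<in> C \<longleftrightarrow> (x \<in> FA) \<noteq> (y \<in> FA)" using edge.IH(1) by blast
  have "\<not> par C x y z" if "tri B x y z" for x y z using edge.prems[of x y z] that by (simp add: tri_Un)
  then obtain FB0 where FB0: "\<And>x y. adj B x y \<Longrightarrow> {x, y} \<in> C \<longleftrightarrow> (x \<in> FB0) \<noteq> (y \<in> FB0)" using edge.IH(2) by blast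
  \<comment> \<open>A potential modulo two may be complemented; this makes the two sides agree at
    \<open>b\<close>, and then also at \<open>c\<close>, since \<open>bc\<close> belongs to
    both.\<close>
  define FB where "FB = (if (b \<in> FA) = (b \<in> FB0) then FB0 else - FB0)"
  have FB: "{x, y} \<in> C \<longleftrightarrow> (x \<in> FB) \<noteq> (y \<in> FB)" if "adj B x y" for x y
    using FB0[OF that] by (auto simp: FB_def)
  have b: "b \<in> FA \<longleftrightarrow> b \<in> FB" by (simp add: FB_def)
  have c: "c \<in> FA \<longleftrightarrow> c \<in> FB"
    using FA[OF bd_edge_adj[OF pA edge.hyps(4)]] FB[OF bd_edge_adj[OF pB edge.hyps(5)]] b by blast
  define F where "F = {x. if x \<in> verts A then x \<in> FA else x \<in> FB}"
  have inA: "x \<in> F \<longleftrightarrow> x \<in> FA" if "x \<in> verts A" for x using that by (simp add: F_def)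
  have inB: "x \<in> F \<longleftrightarrow> x \<in> FB" if x: "x \<in> verts B" for x
  proof (cases "x \<in> verts A")
    case True
    then have "{x} \<in> A \<inter> B" using x verts_iff[OF pA] verts_iff[OF pB] by simp
    then have "x = b \<or> x = c" unfolding edge.hyps(3) complex_of_def by blast
    then show ?thesis using b c inA[OF True] by blast
  qed (simp add: F_def)
  have "{x, y} \<in> C \<longleftrightarrow> (x \<in> F) \<noteq> (y \<in> F)" if "adj (A \<union> B) x y" for x y
  proof -
    have "adj A x y \<or> adj B x y" using that by (auto simp: adj_def)
    then show ?thesis
    proof
      assume a: "adj A x y"
      show ?thesis using FA[OF a] inA[OF adj_verts[OF a]] inA[OF adj_verts[OF adj_sym[OF a]]] by simp
    next
      assume a: "adj B x y"
      show ?thesis using FB[OF a] inB[OF adj_verts[OF a]] inB[OF adj_verts[OF adj_sym[OF a]]] by simp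
    qed
  qed
  then show ?case by blast
next
  case (ear A a b c)
  note pA = comb_disk_pure[OF ear.hyps(1)]
  have "\<not> par C x y z" if "tri A x y z" for x y z using ear.prems[of x y z] that by (simp add: tri_Un)
  then obtain F where F: "\<And>x y. adj A x y \<Longrightarrow> {x, y} \<in> C \<longleftrightarrow> (x \<in> F) \<noteq> (y \<in> F)" using ear.IH(1) by blast
  have "tri (complex_of {{a, b, c}}) a b c" unfolding tri_complex_of_triangle[OF ear.hyps(2-4)] by simp
  then have p: "\<not> par C a b c" by (intro ear.prems) (simp add: tri_Un)
  have ac: "{a, c} \<in> C \<longleftrightarrow> (a \<in> F) \<noteq> (c \<in> F)" "{b, c} \<in> C \<longleftrightarrow> (b \<in> F) \<noteq> (c \<in> F)"
    using F bd_edge_adj[OF pA] ear.hyps by blast+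
  then have ab: "{a, b} \<in> C \<longleftrightarrow> (a \<in> F) \<noteq> (b \<in> F)" using p unfolding par_def by argo
  have "{x, y} \<in> C \<longleftrightarrow> (x \<in> F) \<noteq> (y \<in> F)" if "adj (A \<union> complex_of {{a, b, c}}) x y" for x y
  proof (cases "adj A x y")
    case False
    then have xy: "x \<in> {a, b, c}" "y \<in> {a, b, c}" "x \<noteq> y" using that by (auto simp: adj_def complex_of_def)
    then have "x = a \<and> y = b \<or> x = b \<and> y = a \<or> x = a \<and> y = c \<or> x = c \<and> y = a \<or> x = b \<and> y = c \<or> x = c \<and> y = b"
      by blast
    then show ?thesis using ac ab by (elim disjE conjE) (simp_all add: insert_commute; argo)+
  qed (rule F)
  then show ?case by blast
qed

text \<open>Modulo two, the coefficient of the edge \<open>xy\<close> in the boundary of the 2-chain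
  \<open>X\<close>.\<close>

definition cnt :: "'a set set \<Rightarrow> 'a set set \<Rightarrow> 'a \<Rightarrow> 'a \<Rightarrow> nat" where
  "cnt K X x y = card {z. tri K x y z \<and> {x, y, z} \<in> X}"

lemma cnt_commute: "cnt K X x y = cnt K X y x"
  unfolding cnt_def using tri_swap12[of K x y] by (simp add: insert_commute)

text \<open>The boundary of a chain has even degree at \<open>v\<close>, so if it is confined to two
  edges there, it contains both or neither.\<close>

lemma cnt_parity_transfer:
  assumes K: "comb_disk K" and pq: "adj K v p" "adj K v q" "p \<noteq> q"
    and ev: "\<And>x. \<lbrakk>adj K v x; x \<noteq> p; x \<noteq> q\<rbrakk> \<Longrightarrow> even (cnt K X v x)"
  shows "even (cnt K X v p) \<longleftrightarrow> even (cnt K X v q)"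
proof -
  have fin: "finite (neighbours K v)" by (rule finite_neighbours[OF comb_disk_pure[OF K]])
  have pq': "p \<in> neighbours K v" "q \<in> neighbours K v - {p}" using pq by (auto simp: neighbours_adj)
  have "(\<Sum>x\<in>neighbours K v. cnt K X v x) = cnt K X v p + (cnt K X v q + (\<Sum>x\<in>neighbours K v - {p} - {q}. cnt K X v x))"
    using fin pq' by (subst sum.remove[of _ p], simp, simp, subst sum.remove[of _ q]) auto
  moreover have "even (\<Sum>x\<in>neighbours K v - {p} - {q}. cnt K X v x)"
    by (rule dvd_sum) (auto simp: neighbours_adj ev)
  moreover have "even (\<Sum>x\<in>neighbours K v. cnt K X v x)"
    using comb_disk_link_sum_even[OF K, of v X] by (simp add: cnt_def)
  ultimately show ?thesis by simp
qed

lemma cnt_all_or_none: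
  assumes K: "comb_disk K" and ev: "even (cnt K X x y)" and z: "tri K x y z" "{x, y, z} \<in> X" and w: "tri K x y w"
  shows "{x, y, w} \<in> X"
proof (rule ccontr)
  assume "{x, y, w} \<notin> X"
  then have "{u. tri K x y u \<and> {x, y, u} \<in> X} = {z}"
    using comb_disk_two_faces[OF K z(1) w] z by auto
  then show False using ev by (simp add: cnt_def)
qed

text \<open>An edge with even count has all or none of its faces in \<open>X\<close>, so membership
  in \<open>X\<close> spreads from face to face around the connected link of
  \<open>v\<close>.\<close>

lemma faces_at_vertex:
  assumes K: "comb_disk K" and ev: "\<And>x. adj K v x \<Longrightarrow> even (cnt K X v x)"
    and t: "tri K v x y" "{v, x, y} \<in> X" and pq: "tri K v p q"
  shows "{v, p, q} \<in> X"
proof -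
  note pK = comb_disk_pure[OF K]
  define P where "P x \<longleftrightarrow> (\<exists>z. tri K v x z \<and> {v, x, z} \<in> X)" for x
  have P1: "{v, x, z} \<in> X" if h: "P x" "tri K v x z" for x z
  proof -
    obtain z' where z': "tri K v x z'" "{v, x, z'} \<in> X" using h(1) unfolding P_def by blast
    show ?thesis by (rule cnt_all_or_none[OF K ev[OF pure_2_complex_tri_adj(1)[OF pK h(2)]] z' h(2)])
  qed
  have sw: "tri K v q p \<and> {v, q, p} = {v, p, q}" if "tri K v p q" for p q
    using tri_perms(2)[OF that] by (auto simp: insert_commute)
  have "P p \<longleftrightarrow> P q" if "tri K v p q" for p q
    using P1[of p q] P1[of q p] sw[OF that] that unfolding P_def by metis
  then have "P x \<longleftrightarrow> P p"
    by (rule comb_disk_link[OF K _ pure_2_complex_tri_adj(1)[OF pK t(1)] pure_2_complex_tri_adj(1)[OF pK pq]])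
  moreover have "P x" using t unfolding P_def by blast
  ultimately show ?thesis using P1 pq by blast
qed

text \<open>A disk carries no nonzero 2-cycle modulo two: membership would spread from vertex to
  vertex over the whole complex, up to a boundary edge, whose single face gives an odd
  count.\<close>

lemma no_closed_surface:
  assumes K: "comb_disk K" and ev: "\<And>x y. adj K x y \<Longrightarrow> even (cnt K X x y)"
  shows "\<not> (tri K u v w \<and> {u, v, w} \<in> X)"
proof
  assume uvw: "tri K u v w \<and> {u, v, w} \<in> X"
  note pK = comb_disk_pure[OF K]
  define Q where "Q v \<longleftrightarrow> (\<forall>x y. tri K v x y \<longrightarrow> {v, x, y} \<in> X)" for v
  have Q: "Q v" if t: "tri K v x y" "{v, x, y} \<in> X" for v x y
    unfolding Q_def using faces_at_vertex[OF K ev t] by blast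
  have Qadj: "Q b" if ab: "adj K a b" "Q a" for a b
  proof -
    obtain z where z: "tri K a b z" using pure_2_complex_adj_tri[OF pK ab(1)] .
    then have "{a, b, z} \<in> X" using ab(2) unfolding Q_def by simp
    then have "{b, a, z} \<in> X" by (simp add: insert_commute)
    then show ?thesis by (rule Q[OF tri_perms(1)[OF z]])
  qed
  obtain a b where ab: "bd_edge K a b" using comb_disk_bd_edge[OF K] .
  have "Q u \<longleftrightarrow> Q a"
  proof (rule comb_disk_connected[OF K])
    show "Q x \<longleftrightarrow> Q y" if "adj K x y" for x y using Qadj[OF that] Qadj[OF adj_sym[OF that]] by blast
    show "u \<in> verts K" using uvw tri_verts by metis
    show "a \<in> verts K" using adj_verts[OF bd_edge_adj[OF pK ab]] .
  qed
  then have "Q a" using Q uvw by blast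
  then have "{z. tri K a b z \<and> {a, b, z} \<in> X} = {z. tri K a b z}" unfolding Q_def by blast
  then have "cnt K X a b = 1" using ab unfolding cnt_def bd_edge_card by simp
  then show False using ev[OF bd_edge_adj[OF pK ab]] by simp
qed

text \<open>Edge sets play the role of dual paths avoiding the 3-cycle: \<open>free\<close> faces are joined to the boundary
  by such a path, \<open>eqv\<close> faces to each other.  If both faces at \<open>ab\<close> were free, or joined to each other,
  a coboundary would meet the 3-cycle in \<open>ab\<close> only.\<close>

lemma three_cycle_bounds:
  assumes K: "comb_disk K" and abc: "adj K a b" "adj K b c" "adj K a c"
  obtains X where "X \<subseteq> faces K"
    "\<And>x y. adj K x y \<Longrightarrow> odd (cnt K X x y) \<longleftrightarrow> {x, y} \<in> {{a, b}, {b, c}, {a, c}}"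
proof -
  note pK = comb_disk_pure[OF K]
  let ?Cyc = "{{a, b}, {b, c}, {a, c}}"
  have d: "a \<noteq> b" "b \<noteq> c" "a \<noteq> c" using abc adj_distinct by metis+
  \<comment> \<open>On faces of \<open>K\<close>, the coboundary of the edge set \<open>C\<close> is
    the face set \<open>T\<close>.\<close>
  define D where "D C T \<longleftrightarrow> (\<forall>x y z. tri K x y z \<longrightarrow> (par C x y z \<longleftrightarrow> {x, y, z} \<in> T))" for C T
  define sd where "sd A B = (A - B) \<union> (B - A)" for A B :: "'a set set"
  have sd: "s \<in> sd A B \<longleftrightarrow> (s \<in> A) \<noteq> (s \<in> B)" for s A B by (auto simp: sd_def)
  have D_sd: "D (sd C C') (sd T T')" if "D C T" "D C' T'" for C C' T T'
  proof -
    have "par (sd C C') x y z \<longleftrightarrow> par C x y z \<noteq> par C' x y z" for x y z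
      unfolding par_def sd by argo
    then show ?thesis using that unfolding D_def sd by metis
  qed
  have D_edge: "D {{x, y}} {t \<in> faces K. {x, y} \<subseteq> t}" if xy: "x \<noteq> y" for x y
    unfolding D_def
  proof (intro allI impI)
    fix p q r assume t: "tri K p q r"
    note n = tri_distinct[OF t]
    have "{x, y} \<subseteq> {p, q, r} \<longleftrightarrow> {p, q} = {x, y} \<or> {q, r} = {x, y} \<or> {p, r} = {x, y}"
      using xy by auto
    moreover have "{p, q} \<noteq> {q, r}" "{p, q} \<noteq> {p, r}" "{q, r} \<noteq> {p, r}" using n by (auto simp: doubleton_eq_iff)
    ultimately show "par {{x, y}} p q r \<longleftrightarrow> {p, q, r} \<in> {t \<in> faces K. {x, y} \<subseteq> t}"
      using t by (simp add: par_def faces_tri) metis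
  qed
  have no: False if C: "D C {}" "{a, b} \<in> C" "{b, c} \<notin> C" "{a, c} \<notin> C" for C
  proof -
    have "\<exists>F. \<forall>x y. adj K x y \<longrightarrow> ({x, y} \<in> C \<longleftrightarrow> (x \<in> F) \<noteq> (y \<in> F))"
      by (rule even_cocycle_coboundary[OF K]) (use C(1) in \<open>simp add: D_def\<close>)
    then obtain F where F: "\<forall>x y. adj K x y \<longrightarrow> ({x, y} \<in> C \<longleftrightarrow> (x \<in> F) \<noteq> (y \<in> F))" by (elim exE)
    show False using F[rule_format, OF abc(1)] F[rule_format, OF abc(2)] F[rule_format, OF abc(3)] C(2-4) by argo
  qed
  define free where "free t \<longleftrightarrow> (\<exists>C. C \<inter> ?Cyc = {} \<and> D C {t})" for t
  define eqv where "eqv t t' \<longleftrightarrow> (\<exists>C. C \<inter> ?Cyc = {} \<and> D C (sd {t} {t'}))" for t t'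
  have eqv_refl: "eqv t t" for t
    unfolding eqv_def by (intro exI[of _ "{}"]) (simp add: D_def par_def sd_def)
  have cyc_sd: "sd C C' \<inter> ?Cyc = {}" if "C \<inter> ?Cyc = {}" "C' \<inter> ?Cyc = {}" for C C'
    using that by (auto simp: sd_def)
  have eqv_trans: "eqv t t''" if h: "eqv t t'" "eqv t' t''" for t t' t''
  proof -
    obtain C C' where C: "C \<inter> ?Cyc = {}" "D C (sd {t} {t'})" "C' \<inter> ?Cyc = {}" "D C' (sd {t'} {t''})"
      using h unfolding eqv_def by blast
    have "sd (sd {t} {t'}) (sd {t'} {t''}) = sd {t} {t''}" by (auto simp: sd_def)
    then show ?thesis unfolding eqv_def using D_sd[OF C(2,4)] cyc_sd[OF C(1,3)] by metis
  qed
  have eqv_sym: "eqv t' t" if "eqv t t'" for t t'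
    using that unfolding eqv_def sd_def by (simp add: Un_commute)
  have free_eqv: "free t'" if h: "eqv t' t" "free t" for t t'
  proof -
    obtain C C' where C: "C \<inter> ?Cyc = {}" "D C (sd {t'} {t})" "C' \<inter> ?Cyc = {}" "D C' {t}"
      using h unfolding eqv_def free_def by blast
    have "sd (sd {t'} {t}) {t} = {t'}" by (auto simp: sd_def)
    then show ?thesis unfolding free_def using D_sd[OF C(2,4)] cyc_sd[OF C(1,3)] by metis
  qed
  let ?e = "{{a, b}}"
  have e_cyc: "{b, c} \<notin> ?e" "{a, c} \<notin> ?e" using d by (auto simp: doubleton_eq_iff)
  \<comment> \<open>Adding the edge \<open>ab\<close> to such a set cancels its coboundary; the sum
    would be a coboundary that meets the 3-cycle exactly once, whereas it must meet every cycle
    evenly.\<close>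
  have through: False if h: "D C {t \<in> faces K. {a, b} \<subseteq> t}" "C \<inter> ?Cyc = {}" for C
  proof (rule no)
    show "D (sd ?e C) {}" using D_sd[OF D_edge[OF d(1)] h(1)] by (simp add: sd_def)
    show "{a, b} \<in> sd ?e C" "{b, c} \<notin> sd ?e C" "{a, c} \<notin> sd ?e C" using h(2) e_cyc unfolding sd by auto
  qed
  \<comment> \<open>Of two faces at \<open>ab\<close> at least one is not free, and they are not
    joined; a single face at \<open>ab\<close> is not free.\<close>
  have "\<exists>z. tri K a b z \<and> \<not> free {a, b, z} \<and> (\<forall>w. tri K a b w \<and> w \<noteq> z \<longrightarrow> \<not> eqv {a, b, w} {a, b, z})"
  proof (cases "bd_edge K a b")
    case True
    then obtain z where z: "tri K a b z" unfolding bd_edge_def by (elim ex1E)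
    have "{z. tri K a b z} = {z}" using bd_edge_unique[OF True z] z by blast
    then have "{t \<in> faces K. {a, b} \<subseteq> t} = {{a, b, z}}"
      using bij_betw_imp_surj_on[OF edge_faces_bij[OF d(1), of K]] by simp
    then have "\<not> free {a, b, z}" using through unfolding free_def by metis
    then show ?thesis using z bd_edge_unique[OF True z] by blast
  next
    case False
    obtain z where z: "tri K a b z" using pure_2_complex_adj_tri[OF pK abc(1)] .
    obtain w where w: "tri K a b w" "w \<noteq> z" using inner_edge_second_face[OF False z] .
    have zw: "u = z \<or> u = w" if "tri K a b u" for u using comb_disk_two_faces[OF K z w(1) that] w(2) by auto
    have ne: "{a, b, z} \<noteq> {a, b, w}" using w tri_distinct[OF w(1)] tri_distinct[OF z] by auto
    have "{t \<in> faces K. {a, b} \<subseteq> t} = (\<lambda>z. {a, b, z}) ` {z. tri K a b z}"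
      using edge_faces_bij[OF d(1), of K] by (simp add: bij_betw_def)
    also have "{z. tri K a b z} = {z, w}" using zw z w by blast
    finally have F: "{t \<in> faces K. {a, b} \<subseteq> t} = sd {{a, b, z}} {{a, b, w}}" using ne by (auto simp: sd_def)
    have ne1: "\<not> eqv {a, b, z} {a, b, w}" using through unfolding eqv_def F by blast
    have "\<not> (free {a, b, z} \<and> free {a, b, w})"
    proof
      assume "free {a, b, z} \<and> free {a, b, w}"
      then obtain C C' where C: "C \<inter> ?Cyc = {}" "D C {{a, b, z}}" "C' \<inter> ?Cyc = {}" "D C' {{a, b, w}}"
        unfolding free_def by blast
      show False using through[unfolded F] D_sd[OF C(2,4)] cyc_sd[OF C(1,3)] by blast
    qed
    then show ?thesis using ne1 eqv_sym zw z w by metis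
  qed
  then obtain z where z: "tri K a b z" "\<not> free {a, b, z}" "\<And>w. tri K a b w \<Longrightarrow> w \<noteq> z \<Longrightarrow> \<not> eqv {a, b, w} {a, b, z}"
    by blast
  \<comment> \<open>The class of this face under joining. An edge off the 3-cycle joins its two
    faces, so the class has both or neither of them; if it is a boundary edge, its face is free and
    lies outside the class.\<close>
  define X where "X = {t \<in> faces K. eqv t {a, b, z}}"
  have inX: "{x, y, w} \<in> X \<longleftrightarrow> eqv {x, y, w} {a, b, z}" if "tri K x y w" for x y w
    using that by (simp add: X_def faces_tri)
  have other: "even (cnt K X x y)" if xy: "adj K x y" "{x, y} \<notin> ?Cyc" for x y
  proof -
    have xny: "x \<noteq> y" using adj_distinct[OF xy(1)] .
    have C: "{{x, y}} \<inter> ?Cyc = {}" using xy(2) by simp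
    obtain u where u: "tri K x y u" using pure_2_complex_adj_tri[OF pK xy(1)] .
    have im: "{t \<in> faces K. {x, y} \<subseteq> t} = (\<lambda>z. {x, y, z}) ` {z. tri K x y z}"
      using edge_faces_bij[OF xny, of K] by (simp add: bij_betw_def)
    show ?thesis
    proof (cases "bd_edge K x y")
      case True
      have one: "{z. tri K x y z} = {u}" using u bd_edge_unique[OF True u] by blast
      have "free {x, y, u}" unfolding free_def using C D_edge[OF xny] unfolding im one by (metis image_empty image_insert)
      then have "\<not> eqv {x, y, u} {a, b, z}" using free_eqv eqv_sym z(2) by blast
      then have "{x, y, u} \<notin> X" using inX[OF u] by simp
      moreover have "w = u" if "tri K x y w" for w using bd_edge_unique[OF True that u] .
      ultimately have "{z. tri K x y z \<and> {x, y, z} \<in> X} = {}" by blast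
      then show ?thesis unfolding cnt_def by (simp only: card.empty even_zero)
    next
      case False
      obtain w where w: "tri K x y w" "w \<noteq> u" using inner_edge_second_face[OF False u] .
      have two: "{z. tri K x y z} = {u, w}" using comb_disk_two_faces[OF K u w(1)] u w by blast
      have ne: "{x, y, u} \<noteq> {x, y, w}" using w tri_distinct[OF w(1)] tri_distinct[OF u] by auto
      have "{t \<in> faces K. {x, y} \<subseteq> t} = sd {{x, y, u}} {{x, y, w}}" unfolding im two using ne by (auto simp: sd_def)
      then have "eqv {x, y, u} {x, y, w}" unfolding eqv_def using C D_edge[OF xny] by metis
      then have "{x, y, u} \<in> X \<longleftrightarrow> {x, y, w} \<in> X" using inX[OF u] inX[OF w(1)] eqv_trans eqv_sym by blast
      moreover have "tri K x y v \<longleftrightarrow> v = u \<or> v = w" for v using two by blast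
      ultimately have "{z. tri K x y z \<and> {x, y, z} \<in> X} = (if {x, y, u} \<in> X then {u, w} else {})"
        by auto
      then have "cnt K X x y = card (if {x, y, u} \<in> X then {u, w} else {})" unfolding cnt_def by (rule arg_cong)
      then show ?thesis using w(2) by simp
    qed
  qed
  \<comment> \<open>At \<open>ab\<close> only the chosen face lies in \<open>X\<close>. The odd
    count then passes to \<open>ac\<close> and \<open>bc\<close> through the corners
    \<open>a\<close> and \<open>b\<close>.\<close>
  have "{w. tri K a b w \<and> {a, b, w} \<in> X} = {z}" using z inX eqv_refl by blast
  then have ab: "odd (cnt K X a b)" by (simp add: cnt_def)
  have "even (cnt K X a b) \<longleftrightarrow> even (cnt K X a c)"
    by (rule cnt_parity_transfer[OF K abc(1,3) d(2)]) (use other d in \<open>auto simp: doubleton_eq_iff\<close>)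
  then have ac: "odd (cnt K X a c)" using ab by simp
  have "even (cnt K X b a) \<longleftrightarrow> even (cnt K X b c)"
    by (rule cnt_parity_transfer[OF K adj_sym[OF abc(1)] abc(2) d(3)]) (use other d in \<open>auto simp: doubleton_eq_iff\<close>)
  then have bc: "odd (cnt K X b c)" using ab cnt_commute by metis
  show thesis
  proof (rule that)
    show "X \<subseteq> faces K" by (auto simp: X_def)
    fix x y assume xy: "adj K x y"
    have "odd (cnt K X x y)" if "{x, y} \<in> ?Cyc"
    proof -
      have "x = a \<and> y = b \<or> x = b \<and> y = a \<or> x = b \<and> y = c \<or> x = c \<and> y = b \<or> x = a \<and> y = c \<or> x = c \<and> y = a"
        using that by (auto simp: doubleton_eq_iff)
      then show ?thesis using ab bc ac cnt_commute by metis
    qed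
    then show "odd (cnt K X x y) \<longleftrightarrow> {x, y} \<in> ?Cyc" using other[OF xy] by argo
  qed
qed

section \<open>Flags and octahedra\<close>

lemma third_vertex:
  "\<lbrakk>comb_disk K; tri K x y a; tri K x y b; a \<noteq> b; tri K x y z\<rbrakk> \<Longrightarrow> z = a \<or> z = b"
  using comb_disk_two_faces by metis

text \<open>Four faces in cyclic order around \<open>w\<close>. In a combinatorial disk such a cycle
  is the whole link, so \<open>w\<close> is then inner of degree 4.\<close>

definition cyc4 :: "'a set set \<Rightarrow> 'a \<Rightarrow> 'a \<Rightarrow> 'a \<Rightarrow> 'a \<Rightarrow> 'a \<Rightarrow> bool" where
  "cyc4 K w p q r s \<longleftrightarrow> tri K w p q \<and> tri K w q r \<and> tri K w r s \<and> tri K w s p \<and> p \<noteq> r \<and> q \<noteq> s"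

lemma cyc4_rotate: "cyc4 K w p q r s \<Longrightarrow> cyc4 K w q r s p"
  by (auto simp: cyc4_def)

lemma cyc4_reverse: "cyc4 K w p q r s \<Longrightarrow> cyc4 K w s r q p"
  by (auto simp: cyc4_def dest: tri_perms(2))

lemma cyc4_distinct:
  assumes "cyc4 K w p q r s" shows "distinct [w, p, q, r, s]"
  using assms unfolding cyc4_def by (auto dest: tri_distinct)

lemma cyc4_tri:
  assumes K: "comb_disk K" and c: "cyc4 K w p q r s" and t: "tri K w p x"
  shows "x = q \<or> x = s"
proof -
  have "tri K w p q" "tri K w s p" "q \<noteq> s" using c by (auto simp: cyc4_def)
  then show ?thesis using third_vertex[OF K _ tri_perms(2) _ t] by metis
qed

lemma cyc4_neighbours:
  assumes K: "comb_disk K" and c: "cyc4 K w p q r s"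
  shows "neighbours K w = {p, q, r, s}"
proof
  note pK = comb_disk_pure[OF K]
  note c' = cyc4_rotate[OF c] cyc4_rotate[OF cyc4_rotate[OF c]] cyc4_rotate[OF cyc4_rotate[OF cyc4_rotate[OF c]]]
  have t: "tri K w p q" "tri K w r s" using c unfolding cyc4_def by auto
  have A: "adj K w p" "adj K w q" "adj K w r" "adj K w s"
    using pure_2_complex_tri_adj(1,3)[OF pK t(1)] pure_2_complex_tri_adj(1,3)[OF pK t(2)] by auto
  show "{p, q, r, s} \<subseteq> neighbours K w" using A by (simp add: neighbours_adj)
  show "neighbours K w \<subseteq> {p, q, r, s}"
  proof (rule neighbours_closed[OF K _ A(1)])
    fix a b assume ab: "a \<in> {p, q, r, s}" "tri K w a b"
    then consider "a = p" | "a = q" | "a = r" | "a = s" by blast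
    then show "b \<in> {p, q, r, s}"
      using cyc4_tri[OF K c, of b] cyc4_tri[OF K c'(1), of b] cyc4_tri[OF K c'(2), of b] cyc4_tri[OF K c'(3), of b] ab(2)
      by cases auto
  qed simp
qed

lemma cyc4_inner:
  assumes K: "comb_disk K" and c: "cyc4 K w p q r s" shows "\<not> bd_vert K w"
proof
  assume "bd_vert K w"
  then obtain x where x: "bd_edge K w x" unfolding bd_vert_def by blast
  have "x \<in> {p, q, r, s}"
    using bd_edge_adj[OF comb_disk_pure[OF K] x] cyc4_neighbours[OF K c] by (auto simp: neighbours_adj)
  moreover have False if "bd_edge K w p" "cyc4 K w p q r s" for p q r s
    using that bd_edge_unique[OF that(1), of q s] tri_perms(2)[of K w s p] unfolding cyc4_def by auto
  ultimately show False
    using x c cyc4_rotate[OF c] cyc4_rotate[OF cyc4_rotate[OF c]] cyc4_rotate[OF cyc4_rotate[OF cyc4_rotate[OF c]]]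
    by blast
qed

lemma cyc4_pair:
  assumes K: "comb_disk K" and c: "cyc4 K w p q r s" and t: "tri K w x y"
  shows "{x, y} \<in> {{p, q}, {q, r}, {r, s}, {s, p}}"
proof -
  have "x \<in> {p, q, r, s}"
    using pure_2_complex_tri_adj(1)[OF comb_disk_pure[OF K] t] cyc4_neighbours[OF K c] by (auto simp: neighbours_adj)
  then consider "x = p" | "x = q" | "x = r" | "x = s" by blast
  then show ?thesis
  proof cases
    case 1 then show ?thesis using cyc4_tri[OF K c, of y] t by (auto simp: insert_commute)
  next
    case 2 then show ?thesis using cyc4_tri[OF K cyc4_rotate[OF c], of y] t by (auto simp: insert_commute)
  next
    case 3 then show ?thesis using cyc4_tri[OF K cyc4_rotate[OF cyc4_rotate[OF c]], of y] t by (auto simp: insert_commute)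
  next
    case 4 then show ?thesis
      using cyc4_tri[OF K cyc4_rotate[OF cyc4_rotate[OF cyc4_rotate[OF c]]], of y] t by (auto simp: insert_commute)
  qed
qed

text \<open>From the face \<open>wpq\<close> one walks around \<open>w\<close> in both directions.
  Meeting already at \<open>r = s\<close> would leave only three neighbours; with four of them the
  walk has to close up after \<open>s\<close>.\<close>

lemma inner_degree_4:
  assumes K: "comb_disk K" and w: "\<not> bd_vert K w" "degree K w = 4" and t: "tri K w p q"
  obtains r s where "cyc4 K w p q r s"
proof -
  note pK = comb_disk_pure[OF K]
  have nb: "\<not> bd_edge K w x" for x using w unfolding bd_vert_def by blast
  have t': "tri K w q p" by (rule tri_perms(2)[OF t])
  obtain r where r: "tri K w q r" "r \<noteq> p" using inner_edge_second_face[OF nb t'] .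
  obtain s where s: "tri K w p s" "s \<noteq> q" using inner_edge_second_face[OF nb t] .
  have r': "tri K w r q" by (rule tri_perms(2)[OF r(1)])
  obtain x where x: "tri K w r x" "x \<noteq> q" using inner_edge_second_face[OF nb r'] .
  have q3: "z = p \<or> z = r" if "tri K w q z" for z using third_vertex[OF K t' r(1) _ that] r(2) by auto
  have p3: "z = q \<or> z = s" if "tri K w p z" for z using third_vertex[OF K t s(1) _ that] s(2) by auto
  have r3: "z = q \<or> z = x" if "tri K w r z" for z using third_vertex[OF K r' x(1) _ that] x(2) by auto
  have rs: "r \<noteq> s"
  proof
    assume rs: "r = s"
    have "x = p" using r3[of p] tri_perms(2)[OF s(1)] tri_distinct[OF t] rs by auto
    have "neighbours K w \<subseteq> {p, q, r}"
    proof (rule neighbours_closed[OF K _ pure_2_complex_tri_adj(1)[OF pK t]])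
      fix a b assume ab: "a \<in> {p, q, r}" "tri K w a b"
      then consider "a = p" | "a = q" | "a = r" by blast
      then show "b \<in> {p, q, r}" using ab(2) p3[of b] q3[of b] r3[of b] rs \<open>x = p\<close> by cases auto
    qed simp
    then have "card (neighbours K w) \<le> card {p, q, r}" by (intro card_mono) auto
    also have "\<dots> \<le> 3" by (simp add: card_insert_if)
    finally show False using w(2) by (simp add: degree_def)
  qed
  have d: "p \<noteq> q" "p \<noteq> s" "q \<noteq> r" "r \<noteq> x" using tri_distinct[OF t] tri_distinct[OF s(1)] tri_distinct[OF r(1)] tri_distinct[OF x(1)] by auto
  have sub: "{p, q, r, s} \<subseteq> neighbours K w"
    using pure_2_complex_tri_adj(1,3)[OF pK t] pure_2_complex_tri_adj(3)[OF pK r(1)] pure_2_complex_tri_adj(3)[OF pK s(1)]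
    by (simp add: neighbours_adj)
  have "card {p, q, r, s} = 4" using d r(2) s(2) rs by auto
  then have N: "neighbours K w = {p, q, r, s}"
    using card_subset_eq[OF finite_neighbours[OF pK] sub] w(2) by (simp add: degree_def)
  have "x \<in> {p, q, r, s}" using pure_2_complex_tri_adj(3)[OF pK x(1)] N by (auto simp: neighbours_adj)
  moreover have "x \<noteq> p"
  proof
    assume "x = p"
    then have "tri K w r p" using x(1) by simp
    then have "tri K w p r" by (rule tri_perms(2))
    then show False using p3[of r] d rs by blast
  qed
  ultimately have "x = s" using x(2) d by blast
  then have "cyc4 K w p q r s"
    using t r s x tri_perms(2)[OF s(1)] unfolding cyc4_def by blast
  then show thesis by (rule that)
qed

lemma degree_3_neighbours:
  assumes pK: "pure_2_complex K" and d: "degree K v = 3" and a: "adj K v x" "adj K v y" "adj K v z" "x \<noteq> y" "y \<noteq> z" "x \<noteq> z"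
  shows "neighbours K v = {x, y, z}"
proof -
  have "{x, y, z} \<subseteq> neighbours K v" using a by (simp add: neighbours_adj)
  moreover have "card {x, y, z} = 3" using a by simp
  ultimately show ?thesis using card_subset_eq[OF finite_neighbours[OF pK]] d by (metis degree_def)
qed

definition flag_at :: "'a set set \<Rightarrow> 'a \<Rightarrow> 'a \<Rightarrow> 'a \<Rightarrow> 'a \<Rightarrow> 'a \<Rightarrow> bool" where
  "flag_at K w p q r s \<longleftrightarrow> cyc4 K w p q r s \<and> neighbours K q = {w, p, r} \<and> neighbours K r = {w, q, s} \<and>
     bd_edge K q p \<and> bd_edge K q r \<and> bd_edge K r s"

text \<open>The links of the three vertices \<open>v1\<close>, \<open>v2\<close>, \<open>v3\<close>
  describe an octahedron whose face \<open>a1 a2 a3\<close> is left open. They make the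
  \<open>v1\<close>, \<open>v2\<close>, \<open>v3\<close> inner and the \<open>a1\<close>,
  \<open>a2\<close>, \<open>a3\<close> pairwise adjacent.\<close>

definition octahedron_at :: "'a set set \<Rightarrow> 'a \<Rightarrow> 'a \<Rightarrow> 'a \<Rightarrow> 'a \<Rightarrow> 'a \<Rightarrow> 'a \<Rightarrow> bool" where
  "octahedron_at K v1 v2 v3 a1 a2 a3 \<longleftrightarrow>
     cyc4 K v1 a3 v2 v3 a2 \<and> cyc4 K v2 a3 v1 v3 a1 \<and> cyc4 K v3 a2 v1 v2 a1"

section \<open>Consecutive small vertices in the link of an inner vertex\<close>

lemma small_degree: "small K v \<Longrightarrow> bd_vert K v \<Longrightarrow> degree K v = 3" "small K v \<Longrightarrow> \<not> bd_vert K v \<Longrightarrow> degree K v = 4"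
  by (auto simp: small_def)

text \<open>The three neighbours of \<open>q\<close> are \<open>w\<close>, \<open>p\<close> and
  \<open>r\<close>. Two of the edges to them are boundary edges, and \<open>qw\<close> is not one,
  as \<open>w\<close> is inner.\<close>

lemma small_bd_ends:
  assumes K: "comb_disk K" and c: "cyc4 K w p q r s" and q: "small K q" "bd_vert K q"
  shows "neighbours K q = {w, p, r}" "bd_edge K q p" "bd_edge K q r"
proof -
  note pK = comb_disk_pure[OF K]
  have t: "tri K w p q" "tri K w q r" and pr: "p \<noteq> r" using c by (auto simp: cyc4_def)
  show N: "neighbours K q = {w, p, r}"
    by (rule degree_3_neighbours[OF pK small_degree(1)[OF q]])
      (use pure_2_complex_tri_adj[OF pK t(1)] pure_2_complex_tri_adj[OF pK t(2)] pr tri_distinct[OF t(1)] tri_distinct[OF t(2)] in auto)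
  obtain x where x: "bd_edge K q x" using q(2) unfolding bd_vert_def by blast
  obtain y where y: "bd_edge K q y" "y \<noteq> x" using bd_edge_second[OF K x] .
  have no: "\<not> bd_edge K q w" using cyc4_inner[OF K c] bd_edge_commute unfolding bd_vert_def by metis
  have "x \<in> {w, p, r}" "y \<in> {w, p, r}"
    using bd_edge_adj[OF pK x] bd_edge_adj[OF pK y(1)] unfolding N[symmetric] by (auto simp: neighbours_adj)
  then have "x = p \<and> y = r \<or> x = r \<and> y = p" using no x y by blast
  then show "bd_edge K q p" "bd_edge K q r" using x y by auto
qed

text \<open>If one of \<open>q\<close>, \<open>r\<close> is on the boundary, then \<open>qr\<close>
  is a boundary edge, so both are, and a flag results. If both are inner, their links are 4-cycles
  that share the vertex \<open>t\<close> across \<open>qr\<close> from \<open>w\<close>, and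
  \<open>w\<close>, \<open>q\<close>, \<open>r\<close> span an octahedron.\<close>

lemma small_pair_cases:
  assumes K: "comb_disk K" and c: "cyc4 K w p q r s" and q: "small K q" and r: "small K r"
  shows "flag_at K w p q r s \<or> (\<exists>t. octahedron_at K w q r t s p)"
proof (cases "bd_vert K q")
  case True
  note Q = small_bd_ends[OF K c q True]
  have "bd_edge K r q" using Q(3) bd_edge_commute by metis
  then have "bd_vert K r" unfolding bd_vert_def by blast
  then have "neighbours K r = {w, q, s}" "bd_edge K r s"
    using small_bd_ends[OF K cyc4_rotate[OF c] r] by auto
  then show ?thesis using Q c unfolding flag_at_def by blast
next
  case False
  have rb: "\<not> bd_vert K r"
  proof
    assume "bd_vert K r"
    then have "bd_edge K r q" using small_bd_ends[OF K cyc4_rotate[OF c] r] by blast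
    then show False using False bd_edge_commute unfolding bd_vert_def by metis
  qed
  have t: "tri K w p q" "tri K w q r" "tri K w r s" "p \<noteq> r" "q \<noteq> s" using c by (auto simp: cyc4_def)
  obtain r' t' where cq: "cyc4 K q p w r' t'"
    using inner_degree_4[OF K False small_degree(2)[OF q False] tri_perms(5)[OF t(1)]] .
  have qw: "tri K q w p" "tri K q w r" using tri_perms(4)[OF t(1)] tri_perms(1)[OF t(2)] by auto
  have "tri K q w r'" "r' \<noteq> p" using cq by (auto simp: cyc4_def)
  then have r': "r' = r" using third_vertex[OF K qw t(4)] by blast
  have rw: "tri K r w q" "tri K r w s" "tri K r q w" using tri_perms[OF t(2)] tri_perms[OF t(3)] by auto
  obtain s' u where cr: "cyc4 K r q w s' u" using inner_degree_4[OF K rb small_degree(2)[OF r rb] rw(3)] .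
  have "tri K r w s'" "s' \<noteq> q" using cr by (auto simp: cyc4_def)
  then have s': "s' = s" using third_vertex[OF K rw(1,2) t(5)] by blast
  have ru: "tri K r u q" "u \<noteq> w" using cr by (auto simp: cyc4_def)
  have "tri K q r t'" "t' \<noteq> w" using cq r' by (auto simp: cyc4_def)
  moreover have "tri K q r u" by (rule tri_perms(4)[OF ru(1)])
  moreover have "tri K q r w" using tri_perms[OF t(2)] by auto
  ultimately have u: "u = t'" using comb_disk_two_faces[OF K, of q r] ru(2) by metis
  have "cyc4 K r s w q t'" using cyc4_reverse[OF cyc4_rotate[OF cyc4_rotate[OF cyc4_rotate[OF cr]]]] unfolding s' u .
  then have "octahedron_at K w q r t' s p" using c cq unfolding octahedron_at_def r' by blast
  then show ?thesis by blast
qed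

lemma octahedron_at_perms:
  assumes "octahedron_at K v1 v2 v3 a1 a2 a3"
  shows "octahedron_at K v2 v1 v3 a2 a1 a3" "octahedron_at K v1 v3 v2 a1 a3 a2"
proof -
  have c: "cyc4 K v1 a3 v2 v3 a2" "cyc4 K v2 a3 v1 v3 a1" "cyc4 K v3 a2 v1 v2 a1"
    using assms by (auto simp: octahedron_at_def)
  have c': "cyc4 K v1 a2 v3 v2 a3" "cyc4 K v2 a1 v3 v1 a3" "cyc4 K v3 a1 v2 v1 a2"
    using cyc4_reverse[OF c(1)] cyc4_reverse[OF c(2)] cyc4_reverse[OF c(3)] by auto
  show "octahedron_at K v2 v1 v3 a2 a1 a3" "octahedron_at K v1 v3 v2 a1 a3 a2"
    using c c' by (auto simp: octahedron_at_def)
qed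

lemma octahedron_at_tri:
  assumes "octahedron_at K v1 v2 v3 a1 a2 a3"
  shows "tri K v1 v2 v3" "tri K v1 a2 a3" "tri K v2 a1 a3" "tri K v3 a1 a2"
    "tri K v1 v2 a3" "tri K v1 v3 a2" "tri K v2 v3 a1"
  using assms by (auto simp: octahedron_at_def cyc4_def intro: tri_perms(2))

lemma octahedron_at_neighbours:
  assumes K: "comb_disk K" and o: "octahedron_at K v1 v2 v3 a1 a2 a3"
  shows "neighbours K v1 = {a3, v2, v3, a2}" "neighbours K v2 = {a3, v1, v3, a1}" "neighbours K v3 = {a2, v1, v2, a1}"
    "\<not> bd_vert K v1" "\<not> bd_vert K v2" "\<not> bd_vert K v3"
  using o cyc4_neighbours[OF K] cyc4_inner[OF K] unfolding octahedron_at_def by blast+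

lemma octahedron_at_distinct:
  assumes o: "octahedron_at K v1 v2 v3 a1 a2 a3"
  shows "distinct [v1, v2, v3, a1, a2, a3]"
proof -
  have "distinct [v1, a3, v2, v3, a2]" "distinct [v2, a3, v1, v3, a1]" "distinct [v3, a2, v1, v2, a1]"
    using o unfolding octahedron_at_def by (blast dest: cyc4_distinct)+
  then show ?thesis by auto
qed

text \<open>With the eighth face the octahedron would be a closed surface; by connectedness it would
  be the whole complex, leaving no boundary edge.\<close>

lemma octahedron_not_closed:
  assumes K: "comb_disk K" and o: "octahedron_at K v1 v2 v3 a1 a2 a3"
  shows "\<not> tri K a1 a2 a3"
proof
  assume t: "tri K a1 a2 a3"
  note pK = comb_disk_pure[OF K]
  note T = octahedron_at_tri[OF o]
  note d = octahedron_at_distinct[OF o]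
  have c1: "cyc4 K a1 a2 a3 v2 v3"
    using t tri_perms(3)[OF T(3)] tri_perms(4)[OF T(7)] tri_perms(1)[OF T(4)] d by (simp add: cyc4_def eq_commute)
  have c2: "cyc4 K a2 a1 a3 v1 v3"
    using tri_perms(1)[OF t] tri_perms(3)[OF T(2)] tri_perms(4)[OF T(6)] tri_perms(4)[OF T(4)] d by (simp add: cyc4_def eq_commute)
  have c3: "cyc4 K a3 a1 a2 v1 v2"
    using tri_perms(4)[OF t] tri_perms(5)[OF T(2)] tri_perms(4)[OF T(5)] tri_perms(4)[OF T(3)] d by (simp add: cyc4_def eq_commute)
  have cv: "cyc4 K v1 a3 v2 v3 a2" "cyc4 K v2 a3 v1 v3 a1" "cyc4 K v3 a2 v1 v2 a1"
    using o by (auto simp: octahedron_at_def)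
  let ?U = "{v1, v2, v3, a1, a2, a3}"
  have "neighbours K x \<subseteq> ?U" if "x \<in> ?U" for x
    using that cyc4_neighbours[OF K c1] cyc4_neighbours[OF K c2] cyc4_neighbours[OF K c3]
      cyc4_neighbours[OF K cv(1)] cyc4_neighbours[OF K cv(2)] cyc4_neighbours[OF K cv(3)] by auto
  then have V: "verts K \<subseteq> ?U"
    by (intro verts_closed[OF K, of v1] tri_verts[OF T(1)]) (auto simp: neighbours_adj)
  obtain x y where xy: "bd_edge K x y" using comb_disk_bd_edge[OF K] .
  then have "x \<in> ?U" "bd_vert K x" using V adj_verts[OF bd_edge_adj[OF pK xy]] unfolding bd_vert_def by blast+
  then show False
    using cyc4_inner[OF K c1] cyc4_inner[OF K c2] cyc4_inner[OF K c3]
      cyc4_inner[OF K cv(1)] cyc4_inner[OF K cv(2)] cyc4_inner[OF K cv(3)] by blast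
qed

text \<open>No contraction passes the degree count of \<open>comb_class_H\<close>: a small opposite
  vertex blocks every edge that satisfies the link and chord conditions.\<close>

definition irreducible_class :: "'a set set \<Rightarrow> bool" where
  "irreducible_class K \<longleftrightarrow> comb_class K \<and> (\<forall>u v. edge_contraction K u v \<longrightarrow> (\<exists>w. tri K u v w \<and> small K w))"

lemma irreducible_classD:
  assumes "irreducible_class K" shows "comb_class K" "comb_disk K" "pure_2_complex K"
  using assms by (auto simp: irreducible_class_def comb_class_def dest: comb_disk_pure)

lemma irreducible_small:
  assumes I: "irreducible_class K" and uv: "adj K u v"
    and common: "\<And>w. \<lbrakk>adj K u w; adj K v w\<rbrakk> \<Longrightarrow> tri K u v w"
    and nc: "bd_edge K u v \<or> \<not> bd_vert K u \<or> \<not> bd_vert K v"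
  obtains w where "tri K u v w" "small K w"
proof -
  have "edge_contraction K u v"
    by unfold_locales (use irreducible_classD(1)[OF I] uv common nc in auto)
  then show thesis using I that unfolding irreducible_class_def by blast
qed

text \<open>The spoke \<open>wp\<close> forces \<open>q\<close> or \<open>s\<close> to be small, the
  spoke \<open>wq\<close> forces \<open>p\<close> or \<open>r\<close>. Any choice of one vertex from
  each pair is a consecutive pair of the link, and a rotation of the cycle brings it to the middle
  position.\<close>

lemma small_pair_exists:
  assumes I: "irreducible_class K" and w: "\<not> bd_vert K w" "small K w" "w \<in> verts K"
    and facial: "\<And>x y. \<lbrakk>adj K w x; adj K w y; adj K x y\<rbrakk> \<Longrightarrow> tri K w x y"
  obtains p q r s where "cyc4 K w p q r s" "small K q" "small K r"
proof -
  note K = irreducible_classD(2)[OF I] and pK = irreducible_classD(3)[OF I]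
  obtain p where "adj K w p" using vert_adj[OF pK w(3)] .
  then obtain q where "tri K w p q" using pure_2_complex_adj_tri[OF pK] by blast
  then obtain r s where c: "cyc4 K w p q r s" using inner_degree_4[OF K w(1) small_degree(2)[OF w(2,1)]] by blast
  have pick: "small K q \<or> small K s" if c: "cyc4 K w p q r s" for p q r s
  proof -
    have wp: "adj K w p" using c pure_2_complex_tri_adj(1)[OF pK] unfolding cyc4_def by blast
    obtain z where "tri K w p z" "small K z"
    proof (rule irreducible_small[OF I wp])
      show "tri K w p y" if "adj K w y" "adj K p y" for y by (rule facial[OF wp that])
    qed (use w(1) in auto)
    then show ?thesis using cyc4_tri[OF K c] by blast
  qed
  have "small K q \<or> small K s" "small K r \<or> small K p" using pick[OF c] pick[OF cyc4_rotate[OF c]] by auto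
  then consider "small K q" "small K r" | "small K q" "small K p" | "small K s" "small K r" | "small K s" "small K p" by blast
  then show thesis
  proof cases
    case 1 then show thesis using that c by blast
  next
    case 2 then show thesis using that cyc4_rotate[OF cyc4_rotate[OF cyc4_rotate[OF c]]] by blast
  next
    case 3 then show thesis using that cyc4_rotate[OF c] by blast
  next
    case 4 then show thesis using that cyc4_rotate[OF cyc4_rotate[OF c]] by blast
  qed
qed

section \<open>Reductions\<close>

lemma disk_class_4_iff: "disk_class_4 K \<longleftrightarrow> comb_class K"
proof -
  have "(\<forall>v\<in>inner_verts K. 4 \<le> degree K v) \<longleftrightarrow> (\<forall>v\<in>verts K. \<not> bd_vert K v \<longrightarrow> 4 \<le> degree K v)" if "pure_2_complex K"
    unfolding inner_verts_def using boundary_verts_iff[OF that] by auto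
  moreover have "triangulates_disk K \<longleftrightarrow> comb_disk K"
    using triangulates_disk_comb_disk comb_disk_triangulates_disk by blast
  ultimately show ?thesis
    unfolding disk_class_4_def comb_class_def using comb_disk_pure by blast
qed

text \<open>Such an edge is triode detecting because the result stays in the class, where a vertex
  of degree 3 is necessarily on the boundary.\<close>

lemma contraction_step:
  assumes e: "edge_contraction K u v" and ns: "\<And>w. tri K u v w \<Longrightarrow> \<not> small K w"
  shows "generating_step (contract K u v) K" "card (verts (contract K u v)) < card (verts K)"
proof -
  interpret edge_contraction K u v by (rule e)
  have H: "comb_class H" by (rule comb_class_H[OF ns])
  then have D: "disk_class_4 H" "disk_class_4 K" using cls by (auto simp: disk_class_4_iff)
  have "triode H w" if "w \<in> verts H" "degree H w = 3" for w
  proof -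
    have "bd_vert H w" using H that unfolding comb_class_def by force
    then show ?thesis using that boundary_verts_iff[OF pure_H] by (simp add: triode_def)
  qed
  moreover have "contractible_edge K u v"
    unfolding contractible_edge_def using uv inj_H D(1) by (simp add: edges_adj disk_class_4_def)
  ultimately have "triode_detecting K u v" unfolding triode_detecting_def by blast
  then show "generating_step H K" unfolding generating_step_def three_splitting_triode_def using D by blast
  show "card (verts H) < card (verts K)" by (rule card_verts_H)
qed

lemma reducible_or_irreducible:
  assumes "comb_class K"
  shows "irreducible_class K \<or> (\<exists>H. generating_step H K \<and> card (verts H) < card (verts K))"
proof (cases "irreducible_class K")
  case False
  then obtain u v where uv: "edge_contraction K u v" and ns: "\<not> (\<exists>w. tri K u v w \<and> small K w)"
    using assms unfolding irreducible_class_def by blast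
  from ns have "\<And>w. tri K u v w \<Longrightarrow> \<not> small K w" by simp
  from contraction_step[OF uv this] show ?thesis by blast
qed simp

lemma verts_delete_verts:
  assumes "pure_2_complex K" shows "verts (delete_verts K D) = verts K - D"
proof (intro equalityI subsetI)
  fix x assume "x \<in> verts K - D"
  then have "{x} \<in> delete_verts K D" using verts_iff[OF assms] by (simp add: delete_verts_def)
  then show "x \<in> verts (delete_verts K D)" unfolding verts_def by blast
qed (auto simp: verts_def delete_verts_def)

lemma card_verts_delete:
  assumes "pure_2_complex K" "x \<in> D" "x \<in> verts K"
  shows "card (verts K - D) < card (verts K)"
  by (rule psubset_card_mono[OF finite_verts[OF assms(1)]]) (use assms in auto)

lemma neighbours_delete_verts: "x \<notin> D \<Longrightarrow> neighbours (delete_verts K D) x = neighbours K x - D"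
  by (auto simp: neighbours_adj adj_delete_verts)

lemma degree_minus:
  assumes "pure_2_complex K" "neighbours H x = neighbours K x - D" "finite D"
  shows "degree K x = degree H x + card (neighbours K x \<inter> D)"
proof -
  have fin: "finite (neighbours K x)" by (rule finite_neighbours[OF assms(1)])
  have "card (neighbours K x) = card (neighbours K x - D) + card (neighbours K x \<inter> D)"
    using fin by (subst card_Un_disjoint[symmetric]) (auto intro: arg_cong[of _ _ card])
  then show ?thesis by (simp add: degree_def assms(2))
qed

text \<open>Only \<open>p\<close> and \<open>s\<close> lose neighbours. As \<open>ps\<close> becomes
  a boundary edge, degree 3 suffices for both.\<close>

lemma comb_class_delete_side:
  assumes cls: "comb_class K" and ps: "adj K p s" "p \<notin> D" "s \<notin> D" and fin: "finite D"
    and d: "tri K p s d" "d \<in> D" and z: "tri K p s z" "z \<notin> D"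
    and faces: "\<And>x y. adj K x y \<Longrightarrow> x \<in> D \<Longrightarrow> y \<in> D \<union> {p, s}"
    and deg: "card (neighbours K p \<inter> D) + 3 \<le> degree K p" "card (neighbours K s \<inter> D) + 3 \<le> degree K s"
  shows "comb_class (delete_verts K D)"
proof -
  have K: "comb_disk K" using cls by (simp add: comb_class_def)
  note pK = comb_disk_pure[OF K]
  let ?H = "delete_verts K D"
  have H: "comb_disk ?H" "bd_edge ?H p s"
    by (rule comb_disk_delete_side[OF K ps d z]; erule (1) faces)+
  have "3 \<le> degree ?H x \<and> (\<not> bd_vert ?H x \<longrightarrow> 4 \<le> degree ?H x)" if x: "x \<in> verts ?H" for x
  proof -
    have xD: "x \<notin> D" "x \<in> verts K" using x verts_delete_verts[OF pK] by auto
    note dx = degree_minus[OF pK neighbours_delete_verts[OF xD(1)] fin]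
    show ?thesis
    proof (cases "x = p \<or> x = s")
      case True
      have "bd_edge ?H s p" using H(2) bd_edge_commute by metis
      then have "bd_vert ?H x" using True H(2) unfolding bd_vert_def by blast
      then show ?thesis using True deg dx by auto
    next
      case False
      have nD: "y \<notin> D" if "adj K x y" for y
        using faces[OF adj_sym[OF that]] xD(1) False by blast
      then have "neighbours K x \<inter> D = {}" by (auto simp: neighbours_adj)
      then have dx': "degree ?H x = degree K x" using dx by simp
      have "bd_vert ?H x" if "bd_vert K x"
      proof -
        obtain y where y: "bd_edge K x y" using \<open>bd_vert K x\<close> unfolding bd_vert_def by blast
        have "tri ?H x y u \<longleftrightarrow> tri K x y u" for u
          using nD pure_2_complex_tri_adj(1,3)[OF pK, of x y u] xD(1) by (auto simp: tri_delete_verts)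
        then have "tri ?H x y = tri K x y" by (intro ext)
        then have "bd_edge ?H x y" using y unfolding bd_edge_def by simp
        then show ?thesis unfolding bd_vert_def by blast
      qed
      then show ?thesis using cls xD(2) dx' unfolding comb_class_def by auto
    qed
  qed
  then show ?thesis using H(1) unfolding comb_class_def by blast
qed

lemma complex_of_eqI:
  assumes pK: "pure_2_complex K" and T: "\<And>x y z. tri K x y z \<Longrightarrow> {x, y, z} \<in> T" and TK: "T \<subseteq> K"
  shows "K = complex_of T"
proof (intro equalityI subsetI)
  fix s assume s: "s \<in> K"
  obtain x y z where "tri K x y z" "s \<subseteq> {x, y, z}" by (rule pure_2_complex_face[OF pK s])
  then show "s \<in> complex_of T" using T pure_2_complex_nonempty[OF pK s] unfolding complex_of_def by blast
next
  fix s assume "s \<in> complex_of T"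
  then obtain t where "s \<noteq> {}" "t \<in> T" "s \<subseteq> t" unfolding complex_of_def by blast
  then show "s \<in> K" using pure_2_complex_subset[OF pK] TK by blast
qed

subsection \<open>Flags\<close>

lemma flag_at_reverse: "flag_at K w p q r s \<Longrightarrow> flag_at K w s r q p"
  using cyc4_reverse[of K w p q r s] bd_edge_commute[of K] unfolding flag_at_def by (auto simp: insert_commute)

lemma flag_at_facts:
  assumes K: "comb_disk K" and f: "flag_at K w p q r s"
  shows "cyc4 K w p q r s" "neighbours K q = {w, p, r}" "neighbours K r = {w, q, s}"
    "bd_edge K q p" "bd_edge K q r" "bd_edge K r s" "adj K p s" "\<not> adj K p r" "\<not> adj K q s" "bd_vert K p" "bd_vert K s"
    "tri K w p q" "tri K w s p" "tri K w r s" "tri K w q r" "distinct [w, p, q, r, s]" "\<not> bd_vert K w"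
proof -
  show c: "cyc4 K w p q r s" and N: "neighbours K q = {w, p, r}" "neighbours K r = {w, q, s}" and
    b: "bd_edge K q p" "bd_edge K q r" "bd_edge K r s" using f by (auto simp: flag_at_def)
  show d: "distinct [w, p, q, r, s]" by (rule cyc4_distinct[OF c])
  show t: "tri K w p q" "tri K w s p" "tri K w r s" "tri K w q r" using c by (auto simp: cyc4_def)
  show "adj K p s" by (rule pure_2_complex_tri_adj(5)[OF comb_disk_pure[OF K] t(2)])
  show "\<not> adj K q s" using N(1) d by (auto simp: neighbours_adj)
  have "\<not> adj K r p" using N(2) d by (auto simp: neighbours_adj)
  then show "\<not> adj K p r" using adj_sym by metis
  show "bd_vert K p" "bd_vert K s" using b bd_edge_commute unfolding bd_vert_def by metis+
  show "\<not> bd_vert K w" by (rule cyc4_inner[OF K c])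
qed

text \<open>If the degree were 4, the neighbours of \<open>p\<close> would be \<open>q\<close>,
  \<open>w\<close>, \<open>s\<close> and \<open>z\<close>, and \<open>pz\<close> would be a boundary
  edge with \<open>s\<close> as its only opposite vertex. Irreducibility would make \<open>s\<close>
  small, of degree 3, although \<open>r\<close>, \<open>w\<close>, \<open>p\<close> and
  \<open>z\<close> are neighbours of it.\<close>

lemma flag_side_degree:
  assumes I: "irreducible_class K" and f: "flag_at K w p q r s"
    and facial: "\<And>x y z. \<lbrakk>adj K x y; adj K y z; adj K x z\<rbrakk> \<Longrightarrow> tri K x y z"
    and z: "tri K p s z" "z \<noteq> w"
  shows "5 \<le> degree K p"
proof (rule ccontr)
  assume less: "\<not> ?thesis"
  note K = irreducible_classD(2)[OF I] and pK = irreducible_classD(3)[OF I]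
  note F = flag_at_facts[OF K f]
  note A = pure_2_complex_tri_adj[OF pK F(12)] pure_2_complex_tri_adj[OF pK F(13)] pure_2_complex_tri_adj[OF pK z(1)]
    pure_2_complex_tri_adj[OF pK F(14)]
  have d: "z \<noteq> q" "z \<noteq> p" "z \<noteq> s" "z \<noteq> r" using A F(8,9) tri_distinct[OF z(1)] adj_sym by blast+
  have sub: "{q, w, s, z} \<subseteq> neighbours K p" using A by (simp add: neighbours_adj)
  have "card {q, w, s, z} = 4" using F(16) d z(2) by auto
  then have "{q, w, s, z} = neighbours K p"
    using less card_mono[OF finite_neighbours[OF pK] sub] unfolding degree_def
    by (intro card_seteq[OF finite_neighbours[OF pK] sub]) simp
  then have N: "neighbours K p = {q, w, s, z}" by simp
  have zs: "y = s" if "tri K p z y" for y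
  proof -
    have "y \<in> {q, w, s, z}" using pure_2_complex_tri_adj(3)[OF pK that] N by (auto simp: neighbours_adj)
    moreover have "y \<noteq> z" using tri_distinct[OF that] by simp
    moreover have "y \<noteq> q"
    proof
      assume "y = q"
      then have "tri K q p z" using tri_perms(4)[OF that] by simp
      moreover have "tri K q p w" by (rule tri_perms(5)[OF F(12)])
      ultimately show False using bd_edge_unique[OF F(4)] z(2) by blast
    qed
    moreover have "y \<noteq> w"
    proof
      assume "y = w"
      then have "tri K w p z" using tri_perms(4)[OF that] by simp
      then show False using cyc4_tri[OF K F(1)] d by blast
    qed
    ultimately show ?thesis by blast
  qed
  have pzs: "tri K p z s" by (rule tri_perms(2)[OF z(1)])
  have bd: "bd_edge K p z" unfolding bd_edge_def using pzs zs by blast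
  have pz: "adj K p z" by (rule pure_2_complex_tri_adj(3)[OF pK z(1)])
  obtain y where y: "tri K p z y" "small K y"
  proof (rule irreducible_small[OF I pz])
    show "tri K p z u" if "adj K p u" "adj K z u" for u using facial[OF pz that(2,1)] .
  qed (use bd in auto)
  then have "small K s" using zs[OF y(1)] by simp
  then have "degree K s = 3" by (rule small_degree(1)[OF _ F(11)])
  moreover have "{r, w, p, z} \<subseteq> neighbours K s" using A by (simp add: neighbours_adj)
  then have "card {r, w, p, z} \<le> degree K s" unfolding degree_def by (rule card_mono[OF finite_neighbours[OF pK]])
  moreover have "card {r, w, p, z} = 4" using F(16) d z(2) by auto
  ultimately show False by simp
qed

lemma link_cyc4:
  assumes K: "comb_disk K" and c: "cyc4 K w p q r s"
  shows "link K w = complex_of {{p, q}, {q, r}, {r, s}, {s, p}}"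
proof (intro equalityI subsetI)
  note pK = comb_disk_pure[OF K]
  note d = cyc4_distinct[OF c]
  fix t assume "t \<in> link K w"
  then have t: "t \<in> K" "w \<notin> t" "insert w t \<in> K" by (auto simp: link_def)
  obtain x y z where xyz: "tri K x y z" "insert w t \<subseteq> {x, y, z}" by (rule pure_2_complex_face[OF pK t(3)])
  have "{x, y, z} \<in> faces K" "w \<in> {x, y, z}" using xyz by (auto simp: faces_tri)
  then obtain y' z' where yz: "{x, y, z} = {w, y', z'}" "tri K w y' z'" by (rule face_vertexE)
  then have "t \<subseteq> {y', z'}" using xyz(2) t(2) by blast
  moreover have "{y', z'} \<in> {{p, q}, {q, r}, {r, s}, {s, p}}" by (rule cyc4_pair[OF K c yz(2)])
  ultimately show "t \<in> complex_of {{p, q}, {q, r}, {r, s}, {s, p}}"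
    using pure_2_complex_nonempty[OF pK t(1)] unfolding complex_of_def by blast
next
  note pK = comb_disk_pure[OF K]
  fix t assume "t \<in> complex_of {{p, q}, {q, r}, {r, s}, {s, p}}"
  then obtain x y where xy: "t \<noteq> {}" "t \<subseteq> {x, y}" "{x, y} \<in> {{p, q}, {q, r}, {r, s}, {s, p}}"
    unfolding complex_of_def by blast
  have "insert w ` {{p, q}, {q, r}, {r, s}, {s, p}} \<subseteq> K" using c by (simp add: cyc4_def tri_def)
  then have wxy: "{w, x, y} \<in> K" using imageI[OF xy(3), of "insert w"] by blast
  have "\<forall>e\<in>{{p, q}, {q, r}, {r, s}, {s, p}}. w \<notin> e" using cyc4_distinct[OF c] by simp
  then have "w \<notin> {x, y}" using xy(3) by blast
  then have "w \<notin> t" using xy(2) by blast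
  moreover have "t \<in> K" by (rule pure_2_complex_subset[OF pK wxy xy(1)]) (use xy(2) in blast)
  moreover have "insert w t \<in> K" by (rule pure_2_complex_subset[OF pK wxy]) (use xy(2) in blast)+
  ultimately show "t \<in> link K w" by (simp add: link_def)
qed

text \<open>If \<open>ps\<close> is a boundary edge, the flag is everything. Otherwise
  \<open>p\<close> and \<open>s\<close> have degree at least 5 and lose two neighbours each, so the
  flag is removable; the same bound shows that no neighbour of \<open>w\<close> has degree
  4.\<close>

lemma flag_reduction:
  assumes I: "irreducible_class K" and f: "flag_at K w p q r s"
    and facial: "\<And>x y z. \<lbrakk>adj K x y; adj K y z; adj K x z\<rbrakk> \<Longrightarrow> tri K x y z"
  shows "flag_disk K \<or> (\<exists>H. generating_step H K \<and> card (verts H) < card (verts K))"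
proof (cases "bd_edge K p s")
  note K = irreducible_classD(2)[OF I] and pK = irreducible_classD(3)[OF I]
  note F = flag_at_facts[OF K f]
  note Nw = cyc4_neighbours[OF K F(1)]
  case True
  have swap: "y = w" if "tri K p s y" for y using bd_edge_unique[OF True that tri_perms(5)[OF F(13)]] .
  have side: "neighbours K p \<subseteq> {q, w, s}" if f: "flag_at K w p q r s" and ps: "\<And>y. tri K p s y \<Longrightarrow> y = w" for p q r s
  proof -
    note F = flag_at_facts[OF K f]
    have qw: "y = w" if "tri K p q y" for y
      using bd_edge_unique[OF F(4) tri_perms(1)[OF that] tri_perms(5)[OF F(12)]] .
    have w2: "y = q \<or> y = s" if "tri K p w y" for y using cyc4_tri[OF K F(1) tri_perms(1)[OF that]] .
    show ?thesis
    proof (rule neighbours_closed[OF K _ pure_2_complex_tri_adj(2)[OF pK F(12)]])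
      fix a b assume "a \<in> {q, w, s}" "tri K p a b"
      then show "b \<in> {q, w, s}" using qw w2 ps by blast
    qed simp
  qed
  have swap': "y = w" if "tri K s p y" for y using swap tri_perms(1)[OF that] by blast
  have Np: "neighbours K p \<subseteq> {q, w, s}" "neighbours K s \<subseteq> {r, w, p}"
    using side[OF f swap] side[OF flag_at_reverse[OF f] swap'] by blast+
  let ?U = "{w, p, q, r, s}"
  have "neighbours K x \<subseteq> ?U" if "x \<in> ?U" for x
    using that Np Nw F(2,3) by blast
  then have V: "verts K \<subseteq> ?U"
    by (intro verts_closed[OF K, of w] tri_verts[OF F(12)]) (auto simp: neighbours_adj)
  have "{x, y, z} \<in> {{w, p, q}, {w, q, r}, {w, r, s}, {w, s, p}}" if t: "tri K x y z" for x y z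
  proof -
    have sub: "{x, y, z} \<subseteq> ?U"
      using V tri_verts[OF t] tri_verts[OF tri_perms(3)[OF t]] tri_verts[OF tri_perms(4)[OF t]] by blast
    have "w \<in> {x, y, z}"
    proof (rule ccontr)
      assume "w \<notin> {x, y, z}"
      then have sub': "{x, y, z} \<subseteq> {p, q, r, s}" using sub by blast
      have no: "\<not> adj K p r" "\<not> adj K q s" "\<not> adj K r p" "\<not> adj K s q"
        using F(8,9) adj_sym[of K r p] adj_sym[of K s q] by auto
      have c: "\<not> (a \<in> {p, r} \<and> b \<in> {p, r}) \<and> \<not> (a \<in> {q, s} \<and> b \<in> {q, s})" if "adj K a b" for a b
        using no that adj_distinct[OF that] by blast
      note A = pure_2_complex_tri_adj[OF pK t]
      show False using c[OF A(1)] c[OF A(2)] c[OF A(3)] sub' by blast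
    qed
    moreover have "{x, y, z} \<in> faces K" using t by (simp add: faces_tri)
    ultimately obtain y' z' where yz: "{x, y, z} = {w, y', z'}" "tri K w y' z'" by (metis face_vertexE)
    show ?thesis unfolding yz(1) using imageI[OF cyc4_pair[OF K F(1) yz(2)], of "insert w"] by simp
  qed
  moreover have "{{w, p, q}, {w, q, r}, {w, r, s}, {w, s, p}} \<subseteq> K" using F(12-15) by (auto simp: tri_def)
  ultimately have "K = complex_of {{w, p, q}, {w, q, r}, {w, r, s}, {w, s, p}}" by (rule complex_of_eqI[OF pK])
  then have "flag_disk K" unfolding flag_disk_def using F(16) by blast
  then show ?thesis by blast
next
  note cls = irreducible_classD(1)[OF I] and K = irreducible_classD(2)[OF I] and pK = irreducible_classD(3)[OF I]
  note F = flag_at_facts[OF K f]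
  note Nw = cyc4_neighbours[OF K F(1)]
  case False
  have psw: "tri K p s w" by (rule tri_perms(5)[OF F(13)])
  obtain z where z: "tri K p s z" "z \<noteq> w" using inner_edge_second_face[OF False psw] .
  have dp: "5 \<le> degree K p" by (rule flag_side_degree[OF I f facial z])
  have ds: "5 \<le> degree K s"
    by (rule flag_side_degree[OF I flag_at_reverse[OF f] facial tri_perms(1)[OF z(1)] z(2)])
  have dq: "degree K q = 3" "degree K r = 3" "degree K w = 4" using F(2,3,16) Nw by (auto simp: degree_def)
  let ?D = "{q, r, w}"
  have zD: "z \<notin> ?D"
    using z(2) F(8,9) pure_2_complex_tri_adj[OF pK z(1)] adj_sym[of K s q] by auto
  have Dn: "y \<in> ?D \<union> {p, s}" if "adj K x y" "x \<in> ?D" for x y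
  proof -
    have "y \<in> neighbours K x" using that(1) by (simp add: neighbours_adj)
    then show ?thesis using that(2) F(2,3) Nw by auto
  qed
  have np: "neighbours K p \<inter> ?D \<subseteq> {q, w}" "neighbours K s \<inter> ?D \<subseteq> {r, w}"
    using F(8,9) adj_sym[of K s q] by (auto simp: neighbours_adj)
  then have "card (neighbours K p \<inter> ?D) \<le> 2" "card (neighbours K s \<inter> ?D) \<le> 2"
    using card_mono[OF _ np(1)] card_mono[OF _ np(2)] F(16) by auto
  then have "comb_class (delete_verts K ?D)"
    using dp ds F(16) by (intro comb_class_delete_side[OF cls F(7) _ _ _ psw _ z(1) zD Dn]) auto
  then have D: "disk_class_4 (delete_verts K ?D)" "disk_class_4 K" using cls by (simp_all add: disk_class_4_iff)
  have "w \<in> inner_verts K"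
    using F(17) tri_verts[OF F(12)] boundary_verts_iff[OF pK] by (simp add: inner_verts_def)
  moreover have "\<forall>y\<in>neighbours K w. degree K y \<noteq> 4" unfolding Nw using dp ds dq by auto
  moreover have "{{p, q}, {q, r}, {r, s}} \<subseteq> boundary K"
    using F(4-6,16) boundary_edge_iff[OF pK] bd_edge_commute[of K p q] by auto
  moreover have "{p, s} \<notin> boundary K" using False F(16) boundary_edge_iff[OF pK] by auto
  ultimately have "flag K w p q r s"
    unfolding flag_def using dq F(16) link_cyc4[OF K F(1)] by auto
  then have "flag_addition (delete_verts K ?D) K" unfolding flag_addition_def using D by blast
  then have "generating_step (delete_verts K ?D) K" unfolding generating_step_def using D by blast
  moreover have "card (verts (delete_verts K ?D)) < card (verts K)"
    unfolding verts_delete_verts[OF pK] by (rule card_verts_delete[OF pK _ tri_verts[OF F(12)]]) simp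
  ultimately show ?thesis by blast
qed

subsection \<open>Octahedra\<close>

lemma octahedron_at_component:
  assumes K: "comb_disk K" and o: "octahedron_at K v1 v2 v3 a1 a2 a3"
  shows "octahedron_component K v1 v2 v3 a1 a2 a3" "{v1, v2, v3} \<inter> verts (boundary K) = {}"
proof -
  note pK = comb_disk_pure[OF K]
  note T = octahedron_at_tri[OF o] and d = octahedron_at_distinct[OF o] and N = octahedron_at_neighbours[OF K o]
  show b: "{v1, v2, v3} \<inter> verts (boundary K) = {}" using N(4-6) boundary_verts_iff[OF pK] by auto
  have deg: "degree K v1 = 4" "degree K v2 = 4" "degree K v3 = 4"
    unfolding degree_def N using d by auto
  have E: "{{v1, v2}, {v2, v3}, {v1, v3}} \<subseteq> edges K" "{{a1, a2}, {a2, a3}, {a1, a3}} \<subseteq> edges K"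
    using pure_2_complex_tri_adj[OF pK T(1)] pure_2_complex_tri_adj[OF pK T(2)]
      pure_2_complex_tri_adj[OF pK T(3)] pure_2_complex_tri_adj[OF pK T(4)] by (auto simp: edges_adj)
  have I: "neighbours K v2 \<inter> neighbours K v3 = {v1, a1}" "neighbours K v1 \<inter> neighbours K v3 = {v2, a2}"
    "neighbours K v1 \<inter> neighbours K v2 = {v3, a3}"
    unfolding N using d by auto
  show "octahedron_component K v1 v2 v3 a1 a2 a3"
    unfolding octahedron_component_def using d E deg I b by blast
qed

lemma octahedron_at_outside:
  assumes K: "comb_disk K" and o: "octahedron_at K v1 v2 v3 a1 a2 a3"
    and xy: "adj K x y" "x \<in> {v1, v2, v3}"
  shows "y \<in> {v1, v2, v3} \<union> {a1, a2, a3}"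
proof -
  have "y \<in> neighbours K x" using xy by (simp add: neighbours_adj)
  then show ?thesis using xy(2) octahedron_at_neighbours(1-3)[OF K o] by auto
qed

text \<open>At a corner \<open>a\<^sub>1\<close> of degree 5 the edge to the only vertex outside could be contracted.\<close>

lemma octahedron_inner_corner:
  assumes I: "irreducible_class K" and o: "octahedron_at K v1 v2 v3 a1 a2 a3"
    and a1: "\<not> bd_vert K a1" and ns: "\<not> small K a2" "\<not> small K a3"
  shows "degree K a1 \<noteq> 5"
proof
  assume deg: "degree K a1 = 5"
  note K = irreducible_classD(2)[OF I] and pK = irreducible_classD(3)[OF I]
  note T = octahedron_at_tri[OF o] and d = octahedron_at_distinct[OF o] and N = octahedron_at_neighbours[OF K o]
  have nb: "\<not> bd_edge K a1 x" for x using a1 unfolding bd_vert_def by blast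
  have nt: "\<not> tri K a1 a2 a3" by (rule octahedron_not_closed[OF K o])
  have t2: "tri K a1 a2 v3" by (rule tri_perms(3)[OF T(4)])
  have t3: "tri K a1 a3 v2" by (rule tri_perms(3)[OF T(3)])
  obtain y where y: "tri K a1 a2 y" "y \<noteq> v3" using inner_edge_second_face[OF nb t2] .
  obtain y' where y': "tri K a1 a3 y'" "y' \<noteq> v2" using inner_edge_second_face[OF nb t3] .
  have out: "x \<noteq> v1 \<and> x \<noteq> v2 \<and> x \<noteq> v3" if "adj K a2 x" "x \<noteq> v3" "x \<noteq> v1" for x
  proof -
    have "x \<noteq> v2"
    proof
      assume "x = v2"
      then have "a2 \<in> neighbours K v2" using adj_sym[OF that(1)] by (simp add: neighbours_adj)
      then show False unfolding N using d by auto
    qed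
    then show ?thesis using that by blast
  qed
  have v1n: "\<not> adj K a1 v1"
  proof
    assume "adj K a1 v1"
    then have "a1 \<in> neighbours K v1" using adj_sym[of K a1 v1] by (simp add: neighbours_adj)
    then show False unfolding N using d by auto
  qed
  have yN: "adj K a1 y" "adj K a2 y" "y \<noteq> a1" "y \<noteq> a2" using pure_2_complex_tri_adj[OF pK y(1)] tri_distinct[OF y(1)] by auto
  have yv: "y \<noteq> v1" "y \<noteq> v2" using out[OF yN(2) y(2)] yN(1) v1n by blast+
  have ya3: "y \<noteq> a3" using y(1) nt by blast
  have A: "adj K a1 a2" "adj K a1 a3" "adj K a1 v2" "adj K a1 v3"
    using pure_2_complex_tri_adj[OF pK t2] pure_2_complex_tri_adj[OF pK t3] by auto
  have sub: "{a2, a3, v2, v3, y} \<subseteq> neighbours K a1" using A yN by (simp add: neighbours_adj)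
  have "card {a2, a3, v2, v3, y} = 5" using d yv ya3 yN y(2) by auto
  then have N1: "neighbours K a1 = {a2, a3, v2, v3, y}"
    using card_subset_eq[OF finite_neighbours[OF pK] sub] deg by (simp add: degree_def)
  have "y' = y"
  proof -
    have A': "adj K a1 y'" "adj K a3 y'" using pure_2_complex_tri_adj[OF pK y'(1)] by auto
    then have "y' \<in> {a2, a3, v2, v3, y}" using N1 by (auto simp: neighbours_adj)
    moreover have "y' \<noteq> a3" using tri_distinct[OF y'(1)] by blast
    moreover have "y' \<noteq> a2" using y'(1) nt tri_perms(2)[of K a1 a3 a2] by blast
    moreover have "y' \<noteq> v3"
    proof
      assume "y' = v3"
      then have "a3 \<in> neighbours K v3" using adj_sym[OF A'(2)] by (simp add: neighbours_adj)
      then show False unfolding N using d by auto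
    qed
    ultimately show ?thesis using y'(2) by blast
  qed
  then have y3: "tri K a1 a3 y" using y'(1) by simp
  have ynv: "\<not> adj K y v2" "\<not> adj K y v3"
  proof -
    have "y \<notin> neighbours K v2" "y \<notin> neighbours K v3" unfolding N using yv ya3 yN y(2) by auto
    then show "\<not> adj K y v2" "\<not> adj K y v3" using adj_sym[of K y v2] adj_sym[of K y v3] by (auto simp: neighbours_adj)
  qed
  have common: "tri K a1 y u" if u: "adj K a1 u" "adj K y u" for u
  proof -
    have "u \<in> {a2, a3, v2, v3, y}" using u(1) N1 by (auto simp: neighbours_adj)
    moreover have "u \<noteq> y" using adj_distinct[OF u(2)] by blast
    ultimately have "u = a2 \<or> u = a3" using u(2) ynv by blast
    then show ?thesis using tri_perms(2)[OF y(1)] tri_perms(2)[OF y3] by blast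
  qed
  obtain u where u: "tri K a1 y u" "small K u"
    by (rule irreducible_small[OF I yN(1)]) (use common a1 in auto)
  have "adj K a1 u" "adj K y u" using pure_2_complex_tri_adj[OF pK u(1)] by auto
  then have "u \<in> {a2, a3, v2, v3, y}" "u \<noteq> y" "u \<noteq> v2" "u \<noteq> v3"
    using N1 adj_distinct[of K y u] ynv unfolding neighbours_adj by blast+
  then show False using u(2) ns by blast
qed

text \<open>Degree 5 leaves \<open>a2\<close> a single neighbour \<open>z\<close> outside the
  octahedron. Then \<open>a2 z\<close> is a boundary edge whose only opposite vertex is
  \<open>a3\<close>, which is not small, so the edge would be contractible.\<close>

lemma octahedron_bd_corner_degree:
  assumes I: "irreducible_class K" and o: "octahedron_at K v1 v2 v3 a1 a2 a3"
    and b: "bd_edge K a1 a2" "bd_vert K a2" and N1: "neighbours K a1 = {a2, a3, v2, v3}"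
    and ns: "\<not> small K a3" and z: "tri K a2 a3 z" "z \<noteq> v1"
  shows "6 \<le> degree K a2"
proof (rule ccontr)
  assume less: "\<not> ?thesis"
  note K = irreducible_classD(2)[OF I] and pK = irreducible_classD(3)[OF I]
  note T = octahedron_at_tri[OF o] and d = octahedron_at_distinct[OF o] and N = octahedron_at_neighbours[OF K o]
  have A: "adj K a2 z" "adj K a3 z" "adj K a2 a3" using pure_2_complex_tri_adj[OF pK z(1)] by auto
  have A': "adj K a2 a1" "adj K a2 v1" "adj K a2 v3"
    using pure_2_complex_tri_adj[OF pK T(2)] pure_2_complex_tri_adj[OF pK T(4)] by auto
  have za: "z \<noteq> a2" "z \<noteq> a3" using tri_distinct[OF z(1)] by auto
  have zv: "z \<noteq> v2" "z \<noteq> v3"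
  proof -
    have "z \<in> neighbours K a2" "z \<in> neighbours K a3" using A by (auto simp: neighbours_adj)
    then have "a2 \<in> neighbours K z" "a3 \<in> neighbours K z"
      using adj_sym by (auto simp: neighbours_adj)
    moreover have "a2 \<notin> neighbours K v2" "a3 \<notin> neighbours K v3" unfolding N using d by auto
    ultimately show "z \<noteq> v2" "z \<noteq> v3" by blast+
  qed
  have za1: "z \<noteq> a1"
  proof
    assume "z = a1"
    then have "tri K a1 a2 a3" using tri_perms(4)[OF z(1)] by simp
    then show False using octahedron_not_closed[OF K o] by blast
  qed
  have sub: "{a1, a3, v1, v3, z} \<subseteq> neighbours K a2" using A A' by (simp add: neighbours_adj)
  have "card {a1, a3, v1, v3, z} = 5" using d zv za1 za z(2) by auto
  then have "{a1, a3, v1, v3, z} = neighbours K a2"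
    using less unfolding degree_def by (intro card_seteq[OF finite_neighbours[OF pK] sub]) simp
  then have N2: "neighbours K a2 = {a1, a3, v1, v3, z}" by simp
  have nz: "\<not> adj K z a1" "\<not> adj K z v1" "\<not> adj K z v3"
  proof -
    have "z \<notin> neighbours K a1" "z \<notin> neighbours K v1" "z \<notin> neighbours K v3"
      unfolding N1 N using zv za za1 z(2) by auto
    then show "\<not> adj K z a1" "\<not> adj K z v1" "\<not> adj K z v3"
      using adj_sym[of K z] by (auto simp: neighbours_adj)
  qed
  have only: "u = a3" if u: "adj K a2 u" "adj K z u" for u
  proof -
    have "u \<in> {a1, a3, v1, v3, z}" using u(1) N2 by (auto simp: neighbours_adj)
    then show ?thesis using u(2) nz adj_distinct[OF u(2)] by blast
  qed
  have z': "tri K a2 z a3" by (rule tri_perms(2)[OF z(1)])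
  have "bd_edge K a2 z"
    unfolding bd_edge_def using z' only pure_2_complex_tri_adj(2,3)[OF pK] by blast
  then obtain u where u: "tri K a2 z u" "small K u"
    using irreducible_small[OF I A(1)] only z' by blast
  then have "u = a3" using only pure_2_complex_tri_adj(2,3)[OF pK u(1)] by blast
  then show False using u(2) ns by blast
qed

text \<open>With degree 4 the corner \<open>a1\<close> has no neighbour outside the octahedron, so
  \<open>a1 a2\<close> and \<open>a1 a3\<close> are boundary edges and the octahedron is external.
  If \<open>a2 a3\<close> is a boundary edge as well, nothing else exists. Otherwise the octahedron
  is deleted together with \<open>a1\<close>: \<open>a2\<close> and \<open>a3\<close> lose three
  neighbours each, which degree 6 allows.\<close>

lemma octahedron_bd_corner:
  assumes I: "irreducible_class K" and o: "octahedron_at K v1 v2 v3 a1 a2 a3"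
    and a1: "degree K a1 = 4" and ns: "\<not> small K a2" "\<not> small K a3"
  shows "octahedron_disk K \<or> (\<exists>H. generating_step H K \<and> card (verts H) < card (verts K))"
proof -
  note cls = irreducible_classD(1)[OF I] and K = irreducible_classD(2)[OF I] and pK = irreducible_classD(3)[OF I]
  note T = octahedron_at_tri[OF o] and d = octahedron_at_distinct[OF o] and N = octahedron_at_neighbours[OF K o]
  note nt = octahedron_not_closed[OF K o]
  have A: "adj K a1 a2" "adj K a1 a3" "adj K a1 v2" "adj K a1 v3" "adj K a2 a3"
    using pure_2_complex_tri_adj[OF pK T(2)] pure_2_complex_tri_adj[OF pK T(3)] pure_2_complex_tri_adj[OF pK T(4)] by auto
  have sub: "{a2, a3, v2, v3} \<subseteq> neighbours K a1" using A by (simp add: neighbours_adj)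
  have "card {a2, a3, v2, v3} = 4" using d by auto
  then have N1: "neighbours K a1 = {a2, a3, v2, v3}"
    using card_subset_eq[OF finite_neighbours[OF pK] sub] a1 by (simp add: degree_def)
  have bd1: "bd_edge K a1 a2"
    unfolding bd_edge_def
  proof (rule ex1I)
    show "tri K a1 a2 v3" by (rule tri_perms(3)[OF T(4)])
    fix u assume u: "tri K a1 a2 u"
    have "u \<in> {a2, a3, v2, v3}" using pure_2_complex_tri_adj(3)[OF pK u] N1 by (auto simp: neighbours_adj)
    moreover have "u \<noteq> v2"
    proof
      assume "u = v2"
      then have "a2 \<in> neighbours K v2" using pure_2_complex_tri_adj(5)[OF pK u] by (simp add: neighbours_adj)
      then show False unfolding N using d by auto
    qed
    ultimately show "u = v3" using u nt tri_distinct[OF u] by blast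
  qed
  have bd2: "bd_edge K a1 a3"
    unfolding bd_edge_def
  proof (rule ex1I)
    show "tri K a1 a3 v2" by (rule tri_perms(3)[OF T(3)])
    fix u assume u: "tri K a1 a3 u"
    have "u \<in> {a2, a3, v2, v3}" using pure_2_complex_tri_adj(3)[OF pK u] N1 by (auto simp: neighbours_adj)
    moreover have "u \<noteq> v3"
    proof
      assume "u = v3"
      then have "a3 \<in> neighbours K v3" using pure_2_complex_tri_adj(5)[OF pK u] by (simp add: neighbours_adj)
      then show False unfolding N using d by auto
    qed
    ultimately show "u = v2" using tri_perms(2)[OF u] nt tri_distinct[OF u] by blast
  qed
  have bv: "bd_vert K a2" "bd_vert K a3"
    using bd1 bd2 bd_edge_commute[of K a1] unfolding bd_vert_def by blast+
  have t23: "tri K a2 a3 v1" by (rule tri_perms(3)[OF T(2)])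
  show ?thesis
  proof (cases "bd_edge K a2 a3")
    case True
    have side: "neighbours K a2 \<subseteq> {a1, v3, v1, a3}"
      if o: "octahedron_at K v1 v2 v3 a1 a2 a3" and b: "bd_edge K a1 a2" "bd_edge K a2 a3" for v1 v2 v3 a1 a2 a3
    proof -
      note T = octahedron_at_tri[OF o]
      have 1: "y = v3" if "tri K a2 a1 y" for y
        using bd_edge_unique[OF b(1) tri_perms(1)[OF that] tri_perms(3)[OF T(4)]] .
      have 2: "y = v1" if "tri K a2 a3 y" for y using bd_edge_unique[OF b(2) that tri_perms(3)[OF T(2)]] .
      have d: "a1 \<noteq> v1" "a3 \<noteq> v3" using octahedron_at_distinct[OF o] by auto
      have 3: "y = a1 \<or> y = v1" if "tri K a2 v3 y" for y
        using third_vertex[OF K tri_perms(4)[OF T(4)] tri_perms(5)[OF T(6)] d(1) that] .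
      have 4: "y = a3 \<or> y = v3" if "tri K a2 v1 y" for y
        using third_vertex[OF K tri_perms(1)[OF T(2)] tri_perms(4)[OF T(6)] d(2) that] .
      show ?thesis
      proof (rule neighbours_closed[OF K _ pure_2_complex_tri_adj(2)[OF pK T(2)]])
        fix x y assume "x \<in> {a1, v3, v1, a3}" "tri K a2 x y"
        then show "y \<in> {a1, v3, v1, a3}" using 1 2 3 4 by blast
      qed simp
    qed
    have "bd_edge K a3 a2" using True bd_edge_commute by metis
    then have N23: "neighbours K a2 \<subseteq> {a1, v3, v1, a3}" "neighbours K a3 \<subseteq> {a1, v2, v1, a2}"
      using side[OF o bd1 True] side[OF octahedron_at_perms(2)[OF o] bd2] by auto
    let ?U = "{v1, v2, v3, a1, a2, a3}"
    have "neighbours K v1 \<subseteq> ?U" "neighbours K v2 \<subseteq> ?U" "neighbours K v3 \<subseteq> ?U" "neighbours K a1 \<subseteq> ?U"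
      unfolding N(1-3) N1 by blast+
    moreover have "neighbours K a2 \<subseteq> ?U" "neighbours K a3 \<subseteq> ?U" using N23 by blast+
    ultimately have "neighbours K x \<subseteq> ?U" if "x \<in> ?U" for x using that by blast
    then have V: "verts K \<subseteq> ?U"
      by (intro verts_closed[OF K, of v1] tri_verts[OF T(1)]) (auto simp: neighbours_adj)
    let ?T = "{{v1, v2, v3}, {a1, v2, v3}, {v1, a2, v3}, {v1, v2, a3}, {v1, a2, a3}, {a1, v2, a3}, {a1, a2, v3}}"
    have "{x, y, z} \<in> ?T" if t: "tri K x y z" for x y z
    proof -
      have sub: "{x, y, z} \<subseteq> ?U"
        using V tri_verts[OF t] tri_verts[OF tri_perms(3)[OF t]] tri_verts[OF tri_perms(4)[OF t]] by blast
      have f: "{x, y, z} \<in> faces K" using t by (simp add: faces_tri)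
      have cyc: "{x, y, z} \<in> {{v, p, q}, {v, q, r}, {v, r, s}, {v, s, p}}"
        if c: "cyc4 K v p q r s" and v: "v \<in> {x, y, z}" for v p q r s
      proof -
        obtain y' z' where yz: "{x, y, z} = {v, y', z'}" "tri K v y' z'" by (rule face_vertexE[OF f v])
        show ?thesis unfolding yz(1) using imageI[OF cyc4_pair[OF K c yz(2)], of "insert v"] by simp
      qed
      have C: "cyc4 K v1 a3 v2 v3 a2" "cyc4 K v2 a3 v1 v3 a1" "cyc4 K v3 a2 v1 v2 a1"
        using o by (auto simp: octahedron_at_def)
      have "v1 \<in> {x, y, z} \<or> v2 \<in> {x, y, z} \<or> v3 \<in> {x, y, z}"
      proof (rule ccontr)
        assume "\<not> ?thesis"
        then have "{x, y, z} \<subseteq> {a1, a2, a3}" using sub by blast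
        moreover have "card {x, y, z} = card {a1, a2, a3}" using tri_distinct[OF t] d by simp
        ultimately have "{x, y, z} = {a1, a2, a3}" by (intro card_subset_eq) auto
        then have "tri K a1 a2 a3" using t d by (simp add: tri_def)
        then show False using nt by blast
      qed
      then show ?thesis
      proof (elim disjE)
        assume "v1 \<in> {x, y, z}"
        from cyc[OF C(1) this] show ?thesis by (elim insertE emptyE) (simp_all add: insert_commute)
      next
        assume "v2 \<in> {x, y, z}"
        from cyc[OF C(2) this] show ?thesis by (elim insertE emptyE) (simp_all add: insert_commute)
      next
        assume "v3 \<in> {x, y, z}"
        from cyc[OF C(3) this] show ?thesis by (elim insertE emptyE) (simp_all add: insert_commute)
      qed
    qed
    moreover have "?T \<subseteq> K" using T unfolding tri_def by (simp add: insert_commute)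
    ultimately have "K = complex_of ?T" by (rule complex_of_eqI[OF pK])
    then have "octahedron_disk K" unfolding octahedron_disk_def using d by blast
    then show ?thesis by blast
  next
    case False
    obtain z where z: "tri K a2 a3 z" "z \<noteq> v1" using inner_edge_second_face[OF False t23] .
    have d2: "6 \<le> degree K a2" by (rule octahedron_bd_corner_degree[OF I o bd1 bv(1) N1 ns(2) z])
    have "neighbours K a1 = {a3, a2, v3, v2}" unfolding N1 by auto
    then have d3: "6 \<le> degree K a3"
      by (rule octahedron_bd_corner_degree[OF I octahedron_at_perms(2)[OF o] bd2 bv(2) _ ns(1) tri_perms(1)[OF z(1)] z(2)])
    let ?D = "{a1, v1, v2, v3}"
    have out: "y \<in> ?D \<union> {a2, a3}" if "adj K x y" "x \<in> ?D" for x y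
    proof -
      have "y \<in> neighbours K x" using that(1) by (simp add: neighbours_adj)
      then show ?thesis using that(2) N(1-3) N1 by auto
    qed
    have n2: "v2 \<notin> neighbours K a2" "v3 \<notin> neighbours K a3"
    proof -
      have "a2 \<notin> neighbours K v2" "a3 \<notin> neighbours K v3" unfolding N using d by auto
      then show "v2 \<notin> neighbours K a2" "v3 \<notin> neighbours K a3"
        using adj_sym[of K a2 v2] adj_sym[of K a3 v3] unfolding neighbours_adj by blast+
    qed
    have zD: "z \<notin> ?D"
    proof -
      have "z \<noteq> a1" using z(1) nt tri_perms(4)[of K a2 a3 a1] by blast
      moreover have "z \<noteq> v2" "z \<noteq> v3"
        using n2 pure_2_complex_tri_adj[OF pK z(1)] by (auto simp: neighbours_adj)
      ultimately show ?thesis using z(2) by blast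
    qed
    have sub2: "neighbours K a2 \<inter> ?D \<subseteq> {a1, v1, v3}" "neighbours K a3 \<inter> ?D \<subseteq> {a1, v1, v2}"
      using n2 by auto
    have "card (neighbours K a2 \<inter> ?D) \<le> card {a1, v1, v3}" "card (neighbours K a3 \<inter> ?D) \<le> card {a1, v1, v2}"
      by (intro card_mono sub2; simp)+
    then have c2: "card (neighbours K a2 \<inter> ?D) \<le> 3" "card (neighbours K a3 \<inter> ?D) \<le> 3" using d by auto
    have "comb_class (delete_verts K ?D)"
      using d c2 d2 d3 by (intro comb_class_delete_side[OF cls A(5) _ _ _ t23 _ z(1) zD out]) auto
    then have D: "disk_class_4 (delete_verts K ?D)" "disk_class_4 K" using cls by (simp_all add: disk_class_4_iff)
    have "external_octahedron K v1 v2 v3 a1 a2 a3"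
      unfolding external_octahedron_def using octahedron_at_component(1)[OF K o] bd1 bd2 boundary_edge_iff[OF pK] d by auto
    then have "octahedron_addition (delete_verts K ?D) K" unfolding octahedron_addition_def using D(1) by blast
    then have "generating_step (delete_verts K ?D) K" unfolding generating_step_def using D by blast
    moreover have "card (verts (delete_verts K ?D)) < card (verts K)"
      unfolding verts_delete_verts[OF pK] by (rule card_verts_delete[OF pK _ tri_verts[OF T(1)]]) simp
    ultimately show ?thesis by blast
  qed
qed

text \<open>Each corner is adjacent to two of the three deleted vertices, which explains the bounds
  5 and 6: they leave degree 3 on the boundary and 4 inside.\<close>

lemma octahedron_removal:
  assumes cls: "comb_class K" and o: "octahedron_at K v1 v2 v3 a1 a2 a3"
    and deg: "\<And>a. a \<in> {a1, a2, a3} \<Longrightarrow> 5 \<le> degree K a \<and> (\<not> bd_vert K a \<longrightarrow> 6 \<le> degree K a)"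
  shows "\<exists>H. generating_step H K \<and> card (verts H) < card (verts K)"
proof -
  have K: "comb_disk K" using cls by (simp add: comb_class_def)
  note pK = comb_disk_pure[OF K]
  note T = octahedron_at_tri[OF o] and d = octahedron_at_distinct[OF o] and N = octahedron_at_neighbours[OF K o]
  let ?D = "{v1, v2, v3}" and ?Q = "{a1, a2, a3}"
  define H where H: "H = delete_verts K ?D \<union> {?Q}"
  note out = octahedron_at_outside[OF K o]
  have QD: "?Q \<inter> ?D = {}" using d by auto
  have Qadj: "adj K x y" if "x \<in> ?Q" "y \<in> ?Q" "x \<noteq> y" for x y
    using that pure_2_complex_tri_adj[OF pK T(2)] pure_2_complex_tri_adj[OF pK T(3)] pure_2_complex_tri_adj[OF pK T(4)] by blast
  have Qtri: "\<exists>v\<in>?D. tri K x y v" if "x \<in> ?Q" "y \<in> ?Q" "x \<noteq> y" for x y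
    using that tri_perms[OF T(2)] tri_perms[OF T(3)] tri_perms[OF T(4)] by blast
  have adjH: "adj H x y \<longleftrightarrow> adj K x y \<and> x \<notin> ?D \<and> y \<notin> ?D" for x y
  proof -
    have "card {x, y} \<le> 2" "card ?Q = 3" using d by (auto simp: card_insert_if)
    then have "{x, y} \<noteq> ?Q" by force
    then show ?thesis by (auto simp: adj_def delete_verts_def H)
  qed
  have triH: "tri H x y z \<longleftrightarrow> tri K x y z \<and> x \<notin> ?D \<and> y \<notin> ?D \<and> z \<notin> ?D \<or> {x, y, z} = ?Q \<and> x \<noteq> y \<and> y \<noteq> z \<and> x \<noteq> z" for x y z
    by (auto simp: tri_def delete_verts_def H)
  have pH: "pure_2_complex H"
    unfolding pure_2_complex_def
  proof (intro conjI ballI allI impI)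
    show "finite H" "{} \<notin> H" using pK by (auto simp: delete_verts_def pure_2_complex_def H)
  next
    fix s t assume s: "s \<in> H" and t: "t \<noteq> {} \<and> t \<subseteq> s"
    show "t \<in> H"
    proof (cases "t = ?Q")
      case False
      have "t \<in> K"
      proof (cases "s = ?Q")
        case True
        then have "t \<subset> ?Q" using t False by blast
        then have "t \<subseteq> {a1, a2} \<or> t \<subseteq> {a2, a3} \<or> t \<subseteq> {a1, a3}" by blast
        moreover have "{a1, a2} \<in> K" "{a2, a3} \<in> K" "{a1, a3} \<in> K"
          using Qadj[of a1 a2] Qadj[of a2 a3] Qadj[of a1 a3] d by (auto simp: adj_def)
        ultimately show ?thesis using pure_2_complex_subset[OF pK _ conjunct1[OF t]] by metis
      next
        case False
        then have "s \<in> K" using s by (simp add: delete_verts_def H)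
        then show ?thesis using pure_2_complex_subset[OF pK _ conjunct1[OF t] conjunct2[OF t]] by simp
      qed
      moreover have "t \<inter> ?D = {}" using s t QD by (auto simp: delete_verts_def H)
      ultimately show ?thesis by (simp add: delete_verts_def H)
    qed (simp add: H)
  next
    fix s assume s: "s \<in> H"
    show "\<exists>t\<in>H. s \<subseteq> t \<and> card t = 3"
    proof (cases "s \<subseteq> ?Q")
      case True
      then show ?thesis using d by (intro bexI[of _ ?Q]) (auto simp: H)
    next
      case False
      then have sK: "s \<in> K" "s \<inter> ?D = {}" using s by (auto simp: delete_verts_def H)
      obtain x y z where xyz: "tri K x y z" "s \<subseteq> {x, y, z}" by (rule pure_2_complex_face[OF pK sK(1)])
      have "{x, y, z} \<inter> ?D = {}"
      proof (rule ccontr)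
        assume "{x, y, z} \<inter> ?D \<noteq> {}"
        then have "{x, y, z} \<subseteq> ?D \<union> ?Q" using out pure_2_complex_tri_adj[OF pK xyz(1)] by blast
        then show False using xyz(2) sK(2) False by blast
      qed
      then have "{x, y, z} \<in> H" "card {x, y, z} = 3" using xyz(1) by (auto simp: tri_def delete_verts_def H)
      then show ?thesis using xyz(2) by blast
    qed
  qed
  \<comment> \<open>A boundary edge between two corners exchanges its face inside the octahedron for
    the new face \<open>a1 a2 a3\<close>; every other boundary edge keeps its face.\<close>
  have bdH: "bd_edge H x y" if b: "bd_edge K x y" for x y
  proof -
    have xD: "x \<notin> ?D" "y \<notin> ?D"
      using N(4-6) b bd_edge_commute[of K x y] unfolding bd_vert_def by blast+
    have xy: "x \<noteq> y" using adj_distinct[OF bd_edge_adj[OF pK b]] .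
    obtain z where z: "tri K x y z" using b unfolding bd_edge_def by (elim ex1E)
    show ?thesis
    proof (cases "x \<in> ?Q \<and> y \<in> ?Q")
      case True
      then obtain v where v: "v \<in> ?D" "tri K x y v" using Qtri xy by blast
      have "\<not> (tri K x y u \<and> u \<notin> ?D)" for u using bd_edge_unique[OF b v(2)] v(1) by blast
      then have *: "tri H x y u \<longleftrightarrow> {x, y, u} = ?Q \<and> x \<noteq> y \<and> y \<noteq> u \<and> x \<noteq> u" for u unfolding triH by blast
      have "\<exists>u. ?Q - {x, y} = {u}"
        using True xy d by (auto simp: insert_Diff_if)
      then obtain u where u: "?Q - {x, y} = {u}" by blast
      have "tri H x y u" unfolding * using u True xy by blast
      moreover have "u' = u" if "tri H x y u'" for u' using that u unfolding * by blast
      ultimately show ?thesis unfolding bd_edge_def by blast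
    next
      case False
      have "tri H x y u \<longleftrightarrow> tri K x y u" for u
      proof
        assume "tri H x y u" then show "tri K x y u" using False unfolding triH by blast
      next
        assume u: "tri K x y u"
        have "u \<notin> ?D" using out[of u x] out[of u y] pure_2_complex_tri_adj[OF pK u] False xD by blast
        then show "tri H x y u" using u xD unfolding triH by blast
      qed
      then have "tri H x y = tri K x y" by (intro ext)
      then show ?thesis using b unfolding bd_edge_def by simp
    qed
  qed
  obtain u w where uw: "bd_edge K u w" using comb_disk_bd_edge[OF K] .
  have diskH: "comb_disk H"
  proof (rule comb_disk_delete[OF K H QD _ _ _ _ _ _ pH _ bdH[OF uw], where ?q0.0 = a1 and ?q1.0 = a2])
    show "y \<in> ?D \<union> ?Q" if "tri K x y z" "x \<in> ?D" for x y z
      using out[OF pure_2_complex_tri_adj(1)[OF pK that(1)] that(2)] .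
    show "?Q = {x, y, z}" if "x \<in> ?Q" "y \<in> ?Q" "z \<in> ?Q" "x \<noteq> y" "y \<noteq> z" "x \<noteq> z" for x y z
      using that by (intro card_subset_eq[symmetric]) (use d in auto)
    fix x y a b c assume abc: "tri H x y a" "tri H x y b" "tri H x y c"
    have third: False if h: "tri H x y a" "tri H x y b" "tri H x y c" "{x, y, a} = ?Q" "a \<noteq> b" "a \<noteq> c" "b \<noteq> c" for a b c
    proof -
      have xy: "x \<in> ?Q" "y \<in> ?Q" "x \<noteq> y" using h(4) tri_distinct[OF h(1)] by auto
      obtain v where v: "v \<in> ?D" "tri K x y v" using Qtri[OF xy] by blast
      have nq: "{x, y, e} \<noteq> ?Q" if "e \<noteq> a" "tri H x y e" for e
        using h(4) that tri_distinct[OF that(2)] tri_distinct[OF h(1)] by blast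
      have "tri K x y b" "b \<notin> ?D" "tri K x y c" "c \<notin> ?D" using h(2,3,5,6) nq[of b] nq[of c] unfolding triH by auto
      then show False using comb_disk_two_faces[OF K v(2), of b c] h(7) v(1) by blast
    qed
    show "a = b \<or> a = c \<or> b = c"
    proof (rule ccontr)
      assume n: "\<not> ?thesis"
      have "{x, y, a} \<noteq> ?Q" "{x, y, b} \<noteq> ?Q" "{x, y, c} \<noteq> ?Q"
        using third[OF abc] third[OF abc(2,1,3)] third[OF abc(3,1,2)] n by blast+
      then have "tri K x y a" "tri K x y b" "tri K x y c" using abc unfolding triH by auto
      then show False using comb_disk_two_faces[OF K] n by blast
    qed
  qed (use Qadj d in auto)
  have Nb: "neighbours H x = neighbours K x - ?D" if "x \<notin> ?D" for x
    using that by (auto simp: neighbours_adj adjH)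
  have vH: "x \<in> verts K \<and> x \<notin> ?D" if x: "x \<in> verts H" for x
  proof -
    obtain y where "adj H x y" using vert_adj[OF pH x] .
    then show ?thesis using adjH adj_verts by metis
  qed
  have "3 \<le> degree H x \<and> (\<not> bd_vert H x \<longrightarrow> 4 \<le> degree H x)" if x: "x \<in> verts H" for x
  proof -
    have xK: "x \<in> verts K" "x \<notin> ?D" using vH[OF x] by auto
    have dx: "degree K x = degree H x + card (neighbours K x \<inter> ?D)"
      by (rule degree_minus[OF pK Nb[OF xK(2)]]) simp
    have bx: "bd_vert H x" if "bd_vert K x" using that bdH unfolding bd_vert_def by blast
    show ?thesis
    proof (cases "x \<in> ?Q")
      case False
      have "neighbours K x \<inter> ?D = {}"
      proof (rule ccontr)
        assume "neighbours K x \<inter> ?D \<noteq> {}"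
        then obtain y where "y \<in> ?D" "adj K x y" unfolding neighbours_adj by blast
        then show False using out[OF adj_sym, of x y] xK(2) False by blast
      qed
      then show ?thesis using dx bx cls xK(1) unfolding comb_class_def by auto
    next
      case True
      have "a1 \<notin> neighbours K v1" "a2 \<notin> neighbours K v2" "a3 \<notin> neighbours K v3" unfolding N using d by auto
      then have "v1 \<notin> neighbours K a1" "v2 \<notin> neighbours K a2" "v3 \<notin> neighbours K a3"
        using adj_sym[of K a1 v1] adj_sym[of K a2 v2] adj_sym[of K a3 v3] unfolding neighbours_adj by blast+
      then have "neighbours K x \<inter> ?D \<subseteq> {v2, v3} \<or> neighbours K x \<inter> ?D \<subseteq> {v1, v3} \<or> neighbours K x \<inter> ?D \<subseteq> {v1, v2}"
        using True by blast
      then have "card (neighbours K x \<inter> ?D) \<le> 2"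
      proof (elim disjE)
        show "card (neighbours K x \<inter> ?D) \<le> 2" if "neighbours K x \<inter> ?D \<subseteq> {v2, v3}"
          using card_mono[OF _ that] d by simp
        show "card (neighbours K x \<inter> ?D) \<le> 2" if "neighbours K x \<inter> ?D \<subseteq> {v1, v3}"
          using card_mono[OF _ that] d by simp
        show "card (neighbours K x \<inter> ?D) \<le> 2" if "neighbours K x \<inter> ?D \<subseteq> {v1, v2}"
          using card_mono[OF _ that] d by simp
      qed
      then show ?thesis using deg[OF True] dx bx by auto
    qed
  qed
  then have "comb_class H" using diskH unfolding comb_class_def by blast
  then have D: "disk_class_4 H" "disk_class_4 K" using cls by (simp_all add: disk_class_4_iff)
  have "H = remove_octahedron K v1 v2 v3 a1 a2 a3"
    using octahedron_at_component(2)[OF K o] by (simp add: remove_octahedron_def H)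
  then have "octahedron_addition H K"
    unfolding octahedron_addition_def using octahedron_at_component(1)[OF K o] D(1) by blast
  then have "generating_step H K" unfolding generating_step_def using D by blast
  moreover have "card (verts H) < card (verts K)"
  proof (rule psubset_card_mono[OF finite_verts[OF pK]])
    show "verts H \<subset> verts K" using vH tri_verts[OF T(1)] by blast
  qed
  ultimately show ?thesis by blast
qed

text \<open>A corner that is not small has degree at least 4 on the boundary and 5 inside, one less
  than a removal needs. The two extreme degrees are the cases of \<open>octahedron_bd_corner\<close>
  and \<open>octahedron_inner_corner\<close>; symmetry carries them to all three corners.\<close>

lemma octahedron_reduction:
  assumes I: "irreducible_class K" and o: "octahedron_at K v1 v2 v3 a1 a2 a3"
    and ns: "\<not> small K a1" "\<not> small K a2" "\<not> small K a3"
  shows "octahedron_disk K \<or> (\<exists>H. generating_step H K \<and> card (verts H) < card (verts K))"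
proof -
  note cls = irreducible_classD(1)[OF I] and pK = irreducible_classD(3)[OF I]
  have corner: "(octahedron_disk K \<or> (\<exists>H. generating_step H K \<and> card (verts H) < card (verts K)))
      \<or> 5 \<le> degree K a1 \<and> (\<not> bd_vert K a1 \<longrightarrow> 6 \<le> degree K a1)"
    if o: "octahedron_at K v1 v2 v3 a1 a2 a3" and ns: "\<not> small K a1" "\<not> small K a2" "\<not> small K a3"
    for v1 v2 v3 a1 a2 a3
  proof (cases "bd_vert K a1")
    case True
    have "a1 \<in> verts K" using tri_verts[OF tri_perms(3)[OF octahedron_at_tri(3)[OF o]]] .
    then have "degree K a1 \<ge> 4" using cls ns(1) True unfolding comb_class_def small_def by force
    then show ?thesis using octahedron_bd_corner[OF I o _ ns(2,3)] True by (cases "degree K a1 = 4") auto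
  next
    case False
    have "a1 \<in> verts K" using tri_verts[OF tri_perms(3)[OF octahedron_at_tri(3)[OF o]]] .
    then have "degree K a1 \<ge> 5" using cls ns(1) False unfolding comb_class_def small_def by force
    then show ?thesis using octahedron_inner_corner[OF I o False ns(2,3)] by auto
  qed
  have o2: "octahedron_at K v2 v1 v3 a2 a1 a3" by (rule octahedron_at_perms(1)[OF o])
  have o3: "octahedron_at K v3 v1 v2 a3 a1 a2"
    by (rule octahedron_at_perms(1)[OF octahedron_at_perms(2)[OF o]])
  show ?thesis
    using corner[OF o ns] corner[OF o2 ns(2,1,3)] corner[OF o3 ns(3,1,2)] octahedron_removal[OF cls o] by blast
qed

section \<open>Innermost separating triangles\<close>

text \<open>A non-facial 3-cycle together with a face set \<open>X\<close> whose boundary modulo two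
  it is; \<open>X\<close> plays the part of the inside.\<close>

definition bounding :: "'a set set \<Rightarrow> 'a set set \<Rightarrow> 'a \<Rightarrow> 'a \<Rightarrow> 'a \<Rightarrow> bool" where
  "bounding K X a b c \<longleftrightarrow> adj K a b \<and> adj K b c \<and> adj K a c \<and> \<not> tri K a b c \<and> X \<subseteq> faces K \<and>
     (\<forall>x y. adj K x y \<longrightarrow> (odd (cnt K X x y) \<longleftrightarrow> {x, y} \<in> {{a, b}, {b, c}, {a, c}}))"

locale innermost_cycle =
  fixes K X :: "'a set set" and a b c :: 'a
  assumes I: "irreducible_class K" and bnd: "bounding K X a b c"
    and minimal: "\<And>X' a' b' c'. bounding K X' a' b' c' \<Longrightarrow> card X \<le> card X'"
begin

text \<open>One face in \<open>X\<close> is demanded; as counts are even at vertices off the cycle,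
  all faces at such a vertex then lie in \<open>X\<close>.\<close>

definition interior :: "'a \<Rightarrow> bool" where
  "interior w \<longleftrightarrow> w \<notin> {a, b, c} \<and> (\<exists>y z. tri K w y z \<and> {w, y, z} \<in> X)"

lemma cls: "comb_class K" and K: "comb_disk K" and pK: "pure_2_complex K"
  using irreducible_classD[OF I] by auto

lemma abc: "adj K a b" "adj K b c" "adj K a c" and nt: "\<not> tri K a b c" and XF: "X \<subseteq> faces K"
  and odd: "\<And>x y. adj K x y \<Longrightarrow> odd (cnt K X x y) \<longleftrightarrow> {x, y} \<in> {{a, b}, {b, c}, {a, c}}"
  using bnd by (auto simp: bounding_def)

lemma even_off: "adj K w x \<Longrightarrow> w \<notin> {a, b, c} \<Longrightarrow> even (cnt K X w x)"
  using odd[of w x] by blast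

lemma interior_faces:
  assumes w: "interior w" and t: "tri K w y z" shows "{w, y, z} \<in> X"
proof -
  obtain y' z' where "tri K w y' z'" "{w, y', z'} \<in> X" "w \<notin> {a, b, c}" using w unfolding interior_def by blast
  then show ?thesis using faces_at_vertex[OF K even_off _ _ t] by blast
qed

lemma interior_step:
  assumes w: "interior w" and t: "tri K w y z" and y: "y \<notin> {a, b, c}" shows "interior y"
proof -
  have "{y, w, z} \<in> X" using interior_faces[OF w t] by (simp add: insert_commute)
  then show ?thesis using y tri_perms(1)[OF t] unfolding interior_def by blast
qed

text \<open>A boundary edge at \<open>w\<close> would have its only face in \<open>X\<close>, an odd
  count away from the cycle.\<close>

lemma interior_inner: assumes w: "interior w" shows "\<not> bd_vert K w"
proof
  assume "bd_vert K w"
  then obtain y where y: "bd_edge K w y" unfolding bd_vert_def by blast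
  have "{z. tri K w y z \<and> {w, y, z} \<in> X} = {z. tri K w y z}" using interior_faces[OF w] by blast
  then have "cnt K X w y = 1" using y unfolding cnt_def bd_edge_card by simp
  then show False using even_off[OF bd_edge_adj[OF pK y]] w unfolding interior_def by simp
qed

lemma finX: "finite X"
  by (rule finite_subset[OF XF]) (use pK in \<open>simp add: faces_def pure_2_complex_def\<close>)

text \<open>Otherwise \<open>wyz\<close> would bound a face set properly contained in \<open>X\<close>.\<close>

lemma interior_facial:
  assumes w: "interior w" and wyz: "adj K w y" "adj K w z" "adj K y z"
  shows "tri K w y z"
proof (rule ccontr)
  assume n: "\<not> tri K w y z"
  obtain X' where X': "X' \<subseteq> faces K"
    "\<And>x y'. adj K x y' \<Longrightarrow> odd (cnt K X' x y') \<longleftrightarrow> {x, y'} \<in> {{w, y}, {y, z}, {w, z}}"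
    using three_cycle_bounds[OF K wyz(1,3,2)] by blast
  have "bounding K X' w y z" unfolding bounding_def using wyz n X' by blast
  then have min: "card X \<le> card X'" by (rule minimal)
  have wabc: "w \<notin> {a, b, c}" using w unfolding interior_def by blast
  have in_step: "interior x" if "adj K w x" "x \<notin> {a, b, c}" for x
  proof -
    obtain u where "tri K w x u" using pure_2_complex_adj_tri[OF pK \<open>adj K w x\<close>] .
    then show ?thesis using interior_step[OF w] that by blast
  qed
  let ?Cyc = "{{a, b}, {b, c}, {a, c}}"
  \<comment> \<open>The part of the second inside that sticks out of \<open>X\<close>. Once it is
    empty, \<open>X'\<close> is contained in \<open>X\<close>, properly since their boundaries
    differ, contrary to minimality.\<close>
  define Y where "Y = X' - X"
  have evenY: "even (cnt K Y p q)" if pq: "adj K p q" "{p, q} \<notin> ?Cyc" for p q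
  proof -
    have ev: "even (cnt K X p q)" using odd[OF pq(1)] pq(2) by blast
    show ?thesis
    proof (cases "\<exists>u. tri K p q u \<and> {p, q, u} \<in> X")
      case True
      then have "{p, q, u} \<in> X" if "tri K p q u" for u using cnt_all_or_none[OF K ev _ _ that] by blast
      then have "{u. tri K p q u \<and> {p, q, u} \<in> Y} = {}" unfolding Y_def by blast
      then show ?thesis unfolding cnt_def by (simp only: card.empty even_zero)
    next
      case False
      have eq: "cnt K Y p q = cnt K X' p q"
        unfolding cnt_def Y_def using False by (intro arg_cong[of _ _ card]) blast
      obtain u where u: "tri K p q u" using pure_2_complex_adj_tri[OF pK pq(1)] .
      have not_int: "\<not> interior p" "\<not> interior q"
        using interior_faces[of p q u] interior_faces[of q p u] u tri_perms(1)[OF u] False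
        by (auto simp: insert_commute)
      \<comment> \<open>An edge without faces in \<open>X\<close> has no interior end, so of the
        second 3-cycle it could only be \<open>yz\<close>. In that case \<open>y\<close> and
        \<open>z\<close> are corners of the first cycle and \<open>yz\<close> is one of its
        sides.\<close>
      have "{p, q} \<notin> {{w, y}, {y, z}, {w, z}}"
      proof
        assume "{p, q} \<in> {{w, y}, {y, z}, {w, z}}"
        moreover have "p \<noteq> w" "q \<noteq> w" using not_int w by auto
        ultimately have yz: "{p, q} = {y, z}" by blast
        then have "\<not> interior y" "\<not> interior z" using not_int by (auto simp: doubleton_eq_iff)
        then have "y \<in> {a, b, c}" "z \<in> {a, b, c}" using in_step wyz by blast+
        then have "{y, z} \<in> ?Cyc" using adj_distinct[OF wyz(3)] by blast
        then show False using pq(2) yz by simp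
      qed
      then show ?thesis using X'(2)[OF pq(1)] eq by simp
    qed
  qed
  have d: "a \<noteq> b" "b \<noteq> c" "a \<noteq> c" using abc adj_distinct by metis+
  have tr1: "even (cnt K Y a b) \<longleftrightarrow> even (cnt K Y a c)"
    by (rule cnt_parity_transfer[OF K abc(1,3) d(2)]) (use evenY d in \<open>auto simp: doubleton_eq_iff\<close>)
  have "even (cnt K Y b a) \<longleftrightarrow> even (cnt K Y b c)"
    by (rule cnt_parity_transfer[OF K adj_sym[OF abc(1)] abc(2) d(3)]) (use evenY d in \<open>auto simp: doubleton_eq_iff\<close>)
  then have tr2: "even (cnt K Y a b) \<longleftrightarrow> even (cnt K Y b c)" using cnt_commute[of K Y a b] by simp
  have onCyc: "even (cnt K Y p q) \<longleftrightarrow> even (cnt K Y a b)" if "{p, q} \<in> ?Cyc" for p q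
  proof -
    have "p = a \<and> q = b \<or> p = b \<and> q = a \<or> p = b \<and> q = c \<or> p = c \<and> q = b \<or> p = a \<and> q = c \<or> p = c \<and> q = a"
      using that by (auto simp: doubleton_eq_iff)
    then show ?thesis
      using tr1 tr2 cnt_commute[of K Y b a] cnt_commute[of K Y c b] cnt_commute[of K Y c a] by (elim disjE conjE) simp_all
  qed
  obtain w1 w2 where w12: "tri K w w1 w2" using pure_2_complex_adj_tri[OF pK wyz(1)] .
  \<comment> \<open>The counts of \<open>Y\<close> on the three sides of the cycle share one parity.
    If they were odd, the disjoint union of \<open>X\<close> and \<open>Y\<close> would be a closed
    surface.\<close>
  have evenab: "even (cnt K Y a b)"
  proof (rule ccontr)
    assume oddY: "\<not> even (cnt K Y a b)"
    have "even (cnt K (X \<union> Y) p q)" if pq: "adj K p q" for p q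
    proof -
      have split: "{u. tri K p q u \<and> {p, q, u} \<in> X \<union> Y} = {u. tri K p q u \<and> {p, q, u} \<in> X} \<union> {u. tri K p q u \<and> {p, q, u} \<in> Y}"
        by blast
      have "cnt K (X \<union> Y) p q = cnt K X p q + cnt K Y p q"
        unfolding cnt_def split
      proof (rule card_Un_disjoint)
        show "finite {u. tri K p q u \<and> {p, q, u} \<in> X}" "finite {u. tri K p q u \<and> {p, q, u} \<in> Y}"
          by (rule finite_subset[OF _ finite_tri[OF pK, of p q]]; blast)+
      qed (auto simp: Y_def)
      then show ?thesis using odd[OF pq] onCyc[of p q] evenY[OF pq] oddY by (cases "{p, q} \<in> ?Cyc") auto
    qed
    then have "\<not> (tri K w w1 w2 \<and> {w, w1, w2} \<in> X \<union> Y)" by (rule no_closed_surface[OF K])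
    then show False using w12 interior_faces[OF w w12] by blast
  qed
  have allY: "even (cnt K Y p q)" if "adj K p q" for p q
    using evenY[OF that] onCyc[of p q] evenab by blast
  have "X' \<subseteq> X"
  proof
    fix t assume t: "t \<in> X'"
    then have "t \<in> faces K" using X'(1) by blast
    then obtain p q u where t': "t = {p, q, u}" "tri K p q u" by (rule faces_triE)
    have "\<not> (tri K p q u \<and> {p, q, u} \<in> Y)" by (rule no_closed_surface[OF K allY])
    then show "t \<in> X" using t t' unfolding Y_def by blast
  qed
  moreover have "X' \<noteq> X"
  proof
    assume "X' = X"
    then have "odd (cnt K X w y)" using X'(2)[OF wyz(1)] by simp
    then show False using even_off[OF wyz(1) wabc] by simp
  qed
  ultimately have "card X' < card X" using finX by (intro psubset_card_mono) auto
  then show False using min by simp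
qed

text \<open>The odd count provides a face in \<open>X\<close> at each side of the cycle. Its third
  vertex is not the third corner, since the cycle is not facial.\<close>

lemma corner_neighbour:
  assumes "adj K p q" "{p, q} \<in> {{a, b}, {b, c}, {a, c}}" "r \<in> {a, b, c}" "{a, b, c} = {p, q, r}"
  obtains x where "tri K p q x" "{p, q, x} \<in> X" "interior x"
proof -
  have "odd (cnt K X p q)" using odd[OF assms(1)] assms(2) by blast
  then have "{x. tri K p q x \<and> {p, q, x} \<in> X} \<noteq> {}" unfolding cnt_def by force
  then obtain x where x: "tri K p q x" "{p, q, x} \<in> X" by blast
  have "x \<noteq> r"
  proof
    assume "x = r"
    then have "{a, b, c} \<in> faces K" using x(1) assms(4) by (simp add: faces_tri)
    then show False using nt by (simp add: faces_tri)
  qed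
  then have "x \<notin> {a, b, c}" unfolding assms(4) using tri_distinct[OF x(1)] by blast
  moreover have "tri K x p q" "{x, p, q} \<in> X" using x tri_perms(4)[OF x(1)] by (auto simp: insert_commute)
  ultimately have "interior x" unfolding interior_def by blast
  then show thesis using that x by blast
qed

text \<open>The two sides of the cycle at \<open>p\<close> have interior apexes \<open>x\<close> and
  \<open>y\<close>. They differ, for otherwise the three corners would be all the neighbours of this
  inner vertex. So \<open>p\<close> has four neighbours \<open>q\<close>, \<open>r\<close>,
  \<open>x\<close>, \<open>y\<close>, too many for a small boundary vertex; and if \<open>p\<close>
  were inner of degree 4, the second face at \<open>pq\<close> would have apex \<open>y\<close> and
  lie in \<open>X\<close>, making the count at \<open>pq\<close> even.\<close>

lemma corner_not_small:
  assumes pqr: "adj K p q" "adj K p r" "adj K q r" "{a, b, c} = {p, q, r}"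
    and e: "{p, q} \<in> {{a, b}, {b, c}, {a, c}}" "{p, r} \<in> {{a, b}, {b, c}, {a, c}}"
  shows "\<not> small K p"
proof
  assume small: "small K p"
  have pqr': "{a, b, c} = {p, r, q}" using pqr(4) by auto
  obtain x where x: "tri K p q x" "{p, q, x} \<in> X" "interior x"
    using corner_neighbour[OF pqr(1) e(1) _ pqr(4)] pqr(4) by blast
  obtain y where y: "tri K p r y" "{p, r, y} \<in> X" "interior y"
    using corner_neighbour[OF pqr(2) e(2) _ pqr'] pqr(4) by blast
  have xo: "x \<notin> {p, q, r}" "y \<notin> {p, q, r}" using x(3) y(3) pqr(4) unfolding interior_def by auto
  have d: "p \<noteq> q" "q \<noteq> r" "p \<noteq> r" using pqr adj_distinct by metis+
  have Ax: "adj K p x" "adj K q x" "adj K x p" "adj K x q" using pure_2_complex_tri_adj[OF pK x(1)] by auto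
  have Ay: "adj K p y" "adj K r y" "adj K y p" "adj K y r" using pure_2_complex_tri_adj[OF pK y(1)] by auto
  have xy: "x \<noteq> y"
  proof
    assume eq: "x = y"
    have xqr: "tri K x q r" by (rule interior_facial[OF x(3) Ax(4) _ pqr(3)]) (use Ay eq in simp)
    have xpq: "tri K x p q" "tri K x q p" using tri_perms[OF x(1)] by auto
    have xpr: "tri K x p r" "tri K x r p" using tri_perms[OF y(1)] eq by auto
    have 1: "u = q \<or> u = r" if "tri K x p u" for u using third_vertex[OF K xpq(1) xpr(1) d(2) that] .
    have 2: "u = p \<or> u = r" if "tri K x q u" for u using third_vertex[OF K xpq(2) xqr d(3) that] .
    have 3: "u = p \<or> u = q" if "tri K x r u" for u using third_vertex[OF K xpr(2) tri_perms(2)[OF xqr] d(1) that] .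
    have "neighbours K x \<subseteq> {p, q, r}"
    proof (rule neighbours_closed[OF K _ Ax(3)])
      fix u v assume "u \<in> {p, q, r}" "tri K x u v"
      then show "v \<in> {p, q, r}" using 1 2 3 by blast
    qed simp
    then have "card (neighbours K x) \<le> card {p, q, r}" by (intro card_mono) auto
    also have "\<dots> \<le> 3" by (simp add: card_insert_if)
    finally have "degree K x \<le> 3" by (simp add: degree_def)
    moreover have "x \<in> verts K" using adj_verts[OF Ax(3)] .
    ultimately show False using cls interior_inner[OF x(3)] unfolding comb_class_def by force
  qed
  have sub: "{q, r, x, y} \<subseteq> neighbours K p" using pqr Ax Ay by (simp add: neighbours_adj)
  have c4: "card {q, r, x, y} = 4" using d xo xy by auto
  show False
  proof (cases "bd_vert K p")
    case True
    then have "degree K p = 3" by (rule small_degree(1)[OF small])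
    then show False using card_mono[OF finite_neighbours[OF pK] sub] c4 by (simp add: degree_def)
  next
    case False
    then have deg: "degree K p = 4" by (rule small_degree(2)[OF small])
    have nb: "\<not> bd_edge K p q" using False unfolding bd_vert_def by blast
    obtain x' where x': "tri K p q x'" "x' \<noteq> x" using inner_edge_second_face[OF nb x(1)] .
    have N: "neighbours K p = {q, r, x, y}"
      using card_subset_eq[OF finite_neighbours[OF pK] sub] c4 deg by (simp add: degree_def)
    have "x' \<in> {q, r, x, y}" using pure_2_complex_tri_adj(3)[OF pK x'(1)] N by (auto simp: neighbours_adj)
    moreover have "x' \<noteq> q" using tri_distinct[OF x'(1)] by blast
    moreover have "x' \<noteq> r"
    proof
      assume "x' = r"
      then have "{a, b, c} \<in> faces K" using x'(1) pqr(4) by (simp add: faces_tri)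
      then show False using nt by (simp add: faces_tri)
    qed
    ultimately have "x' = y" using x'(2) by blast
    then have "tri K y p q" using tri_perms(4)[OF x'(1)] by simp
    then have "{p, q, x'} \<in> X" using interior_faces[OF y(3)] \<open>x' = y\<close> by (metis insert_commute)
    then have "{u. tri K p q u \<and> {p, q, u} \<in> X} = {x, x'}"
      using x x' third_vertex[OF K x(1) x'(1) x'(2)[symmetric]] by blast
    then have "cnt K X p q = card {x, x'}" unfolding cnt_def by (rule arg_cong)
    then have "even (cnt K X p q)" using x'(2) by simp
    then show False using odd[OF pqr(1)] e(1) by blast
  qed
qed

lemma corners_not_small: assumes "p \<in> {a, b, c}" shows "\<not> small K p"
proof -
  have "\<not> small K a" by (rule corner_not_small[OF abc(1,3,2)]) auto
  moreover have "\<not> small K b" by (rule corner_not_small[OF adj_sym[OF abc(1)] abc(2,3)]) auto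
  moreover have "\<not> small K c" by (rule corner_not_small[OF adj_sym[OF abc(3)] adj_sym[OF abc(2)] abc(1)]) auto
  ultimately show ?thesis using assms by blast
qed

text \<open>A small vertex opposite to an edge at an interior vertex is itself interior, as corners
  are not small. A flag needs boundary vertices, so the small pair in its link yields an octahedron.
  The open 3-cycle of that octahedron is not facial, so its vertices are not interior and must be
  corners of the innermost cycle.\<close>

lemma octahedron_inside:
  obtains v1 v2 v3 a1 a2 a3 where "octahedron_at K v1 v2 v3 a1 a2 a3"
    "\<not> small K a1" "\<not> small K a2" "\<not> small K a3"
proof -
  obtain w0 where w0: "interior w0" using corner_neighbour[OF abc(1), of c] by blast
  have w0a: "\<exists>y. adj K w0 y"
    using w0 pure_2_complex_tri_adj(1)[OF pK] unfolding interior_def by blast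
  then obtain y where y: "adj K w0 y" by blast
  obtain w where w: "tri K w0 y w" "small K w"
  proof (rule irreducible_small[OF I y])
    show "tri K w0 y u" if "adj K w0 u" "adj K y u" for u by (rule interior_facial[OF w0 y that])
  qed (use interior_inner[OF w0] in auto)
  have wi: "interior w"
    using interior_step[OF w0 tri_perms(2)[OF w(1)]] w(2) corners_not_small by blast
  have wV: "w \<in> verts K" by (rule tri_verts[OF tri_perms(4)[OF w(1)]])
  obtain p q r s where c: "cyc4 K w p q r s" "small K q" "small K r"
    by (rule small_pair_exists[OF I interior_inner[OF wi] w(2) wV interior_facial[OF wi]])
  have t: "tri K w p q" "tri K w q r" "tri K w r s" "tri K w s p" using c(1) by (auto simp: cyc4_def)
  have qi: "interior q" using interior_step[OF wi t(2)] c(2) corners_not_small by blast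
  have "\<not> flag_at K w p q r s"
    using interior_inner[OF qi] unfolding flag_at_def bd_vert_def by blast
  then obtain t' where o: "octahedron_at K w q r t' s p" using small_pair_cases[OF K c] by blast
  note T = octahedron_at_tri[OF o]
  note A2 = pure_2_complex_tri_adj[OF pK T(2)] and A3 = pure_2_complex_tri_adj[OF pK T(3)]
    and A4 = pure_2_complex_tri_adj[OF pK T(4)]
  have n: "\<not> tri K t' s p" by (rule octahedron_not_closed[OF K o])
  have cor: "x \<in> {a, b, c}" if x: "tri K v x u" "interior v" and y: "adj K x y" "adj K x z" "adj K y z" "\<not> tri K x y z" for v x u y z
  proof (rule ccontr)
    assume "x \<notin> {a, b, c}"
    then have "interior x" by (rule interior_step[OF x(2,1)])
    then show False using interior_facial y by blast
  qed
  have n': "\<not> tri K s t' p" "\<not> tri K p t' s" using n tri_perms(1)[of K s t' p] tri_perms(3)[of K p t' s] by auto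
  have "s \<in> {a, b, c}" by (rule cor[OF T(2) wi A4(5) A2(2) A3(2) n'(1)])
  moreover have "p \<in> {a, b, c}" by (rule cor[OF tri_perms(2)[OF T(2)] wi A3(5) A2(5) A4(2) n'(2)])
  moreover have "t' \<in> {a, b, c}" by (rule cor[OF T(3) qi A4(2) A3(2) A2(2) n])
  ultimately show thesis using that[OF o] corners_not_small by blast
qed

end

lemma nonfacial_reduction:
  assumes I: "irreducible_class K" and xyz: "adj K x y" "adj K y z" "adj K x z" "\<not> tri K x y z"
  shows "octahedron_disk K \<or> (\<exists>H. generating_step H K \<and> card (verts H) < card (verts K))"
proof -
  note K = irreducible_classD(2)[OF I]
  obtain X where "X \<subseteq> faces K" "\<And>u v. adj K u v \<Longrightarrow> odd (cnt K X u v) \<longleftrightarrow> {u, v} \<in> {{x, y}, {y, z}, {x, z}}"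
    using three_cycle_bounds[OF K xyz(1,2,3)] by blast
  then have B: "bounding K X x y z" unfolding bounding_def using xyz by blast
  define B' where "B' p \<longleftrightarrow> (case p of (X, a, b, c) \<Rightarrow> bounding K X a b c)" for p
  have "B' (X, x, y, z)" using B by (simp add: B'_def)
  then obtain p where p: "B' p" "\<And>q. B' q \<Longrightarrow> card (fst p) \<le> card (fst q)"
    using ex_has_least_nat[of B' "(X, x, y, z)" "\<lambda>p. card (fst p)"] by blast
  obtain X0 a b c where p0: "p = (X0, a, b, c)" by (cases p) auto
  interpret innermost_cycle K X0 a b c
  proof
    show "bounding K X0 a b c" using p(1) p0 by (simp add: B'_def)
    show "card X0 \<le> card X'" if "bounding K X' a' b' c'" for X' a' b' c'
      using p(2)[of "(X', a', b', c')"] that p0 by (simp add: B'_def)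
  qed (rule I)
  obtain v1 v2 v3 a1 a2 a3 where "octahedron_at K v1 v2 v3 a1 a2 a3" "\<not> small K a1" "\<not> small K a2" "\<not> small K a3"
    by (rule octahedron_inside)
  then show ?thesis by (rule octahedron_reduction[OF I])
qed

section \<open>The main theorem\<close>

text \<open>The vertex \<open>w\<close> opposite to the boundary edge \<open>uv\<close> is inner:
  with degree 3 on the boundary, one of its two boundary edges would end in \<open>u\<close> or
  \<open>v\<close>, and that vertex would have degree at most 2. In the link of \<open>w\<close> an
  octahedron is impossible, as its open 3-cycle would be facial.\<close>

lemma facial_reduction:
  assumes I: "irreducible_class K"
    and facial: "\<And>x y z. \<lbrakk>adj K x y; adj K y z; adj K x z\<rbrakk> \<Longrightarrow> tri K x y z"
  shows "flag_disk K \<or> (\<exists>H. generating_step H K \<and> card (verts H) < card (verts K))"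
proof -
  note cls = irreducible_classD(1)[OF I] and K = irreducible_classD(2)[OF I] and pK = irreducible_classD(3)[OF I]
  obtain u v where uv: "bd_edge K u v" using comb_disk_bd_edge[OF K] .
  have auv: "adj K u v" by (rule bd_edge_adj[OF pK uv])
  obtain w where w: "tri K u v w" "small K w"
  proof (rule irreducible_small[OF I auv])
    show "tri K u v y" if "adj K u y" "adj K v y" for y by (rule facial[OF auv that(2,1)])
  qed (use uv in auto)
  have ear: False if uv: "bd_edge K u v" and uw: "bd_edge K u w" and t: "tri K u v w" for u v
  proof -
    have "neighbours K u \<subseteq> {v, w}"
    proof (rule neighbours_closed[OF K _ pure_2_complex_tri_adj(1)[OF pK t]])
      fix x y assume "x \<in> {v, w}" "tri K u x y"
      then show "y \<in> {v, w}" using bd_edge_unique[OF uv t] bd_edge_unique[OF uw tri_perms(2)[OF t]] by blast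
    qed simp
    then have "card (neighbours K u) \<le> card {v, w}" by (intro card_mono) auto
    also have "\<dots> \<le> 2" by (simp add: card_insert_if)
    finally have "degree K u \<le> 2" by (simp add: degree_def)
    then show False using cls tri_verts[OF t] unfolding comb_class_def by force
  qed
  have winner: "\<not> bd_vert K w"
  proof
    assume bw: "bd_vert K w"
    then obtain x where x: "bd_edge K w x" unfolding bd_vert_def by blast
    obtain y where y: "bd_edge K w y" "y \<noteq> x" using bd_edge_second[OF K x] .
    have deg: "card (neighbours K w) = 3" using small_degree(1)[OF w(2) bw] by (simp add: degree_def)
    note A = pure_2_complex_tri_adj[OF pK w(1)]
    have "\<exists>e\<in>{u, v}. bd_edge K w e"
    proof (rule ccontr)
      assume "\<not> ?thesis"
      then have xy: "x \<notin> {u, v}" "y \<notin> {u, v}" using x y by auto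
      have sub: "{u, v, x, y} \<subseteq> neighbours K w"
        using A bd_edge_adj[OF pK x] bd_edge_adj[OF pK y(1)] by (simp add: neighbours_adj)
      have "card {u, v, x, y} = 4" using xy y(2) tri_distinct[OF w(1)] by auto
      then show False using card_mono[OF finite_neighbours[OF pK] sub] deg by simp
    qed
    then have "bd_edge K u w \<or> bd_edge K v w" using bd_edge_commute[of K w u] bd_edge_commute[of K w v] by auto
    then show False using ear[OF uv _ w(1)] ear[of v u] uv bd_edge_commute[of K u v] tri_perms(1)[OF w(1)] by blast
  qed
  have wV: "w \<in> verts K" by (rule tri_verts[OF tri_perms(4)[OF w(1)]])
  obtain p q r s where c: "cyc4 K w p q r s" "small K q" "small K r"
  proof (rule small_pair_exists[OF I winner w(2) wV])
    show "tri K w x y" if "adj K w x" "adj K w y" "adj K x y" for x y by (rule facial[OF that(1,3,2)])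
  qed
  have "flag_at K w p q r s"
  proof (rule ccontr)
    assume "\<not> ?thesis"
    then obtain t where o: "octahedron_at K w q r t s p" using small_pair_cases[OF K c] by blast
    note T = octahedron_at_tri[OF o]
    have "tri K t s p"
      by (rule facial[OF pure_2_complex_tri_adj(2)[OF pK T(4)] pure_2_complex_tri_adj(2)[OF pK T(2)]
            pure_2_complex_tri_adj(2)[OF pK T(3)]])
    then show False using octahedron_not_closed[OF K o] by blast
  qed
  then show ?thesis by (rule flag_reduction[OF I _ facial])
qed

lemma reduction:
  assumes "comb_class K"
  shows "flag_disk K \<or> octahedron_disk K \<or> (\<exists>H. generating_step H K \<and> card (verts H) < card (verts K))"
proof (cases "irreducible_class K")
  case False
  then show ?thesis using reducible_or_irreducible[OF assms] by blast
next
  case I: True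
  show ?thesis
  proof (cases "\<exists>x y z. adj K x y \<and> adj K y z \<and> adj K x z \<and> \<not> tri K x y z")
    case True
    then obtain x y z where "adj K x y" "adj K y z" "adj K x z" "\<not> tri K x y z" by blast
    then show ?thesis using nonfacial_reduction[OF I] by blast
  next
    case False
    then have "\<And>x y z. \<lbrakk>adj K x y; adj K y z; adj K x z\<rbrakk> \<Longrightarrow> tri K x y z" by blast
    from facial_reduction[OF I this] show ?thesis by blast
  qed
qed

theorem theorem2:
  fixes G :: "'a set set"
  assumes "disk_class_4 G"
  shows "\<exists>G\<^sub>0. (flag_disk G\<^sub>0 \<or> octahedron_disk G\<^sub>0) \<and> generating_step\<^sup>*\<^sup>* G\<^sub>0 G"
  using assms
proof (induction "card (verts G)" arbitrary: G rule: less_induct)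
  case less
  have "comb_class G" using less.prems by (simp add: disk_class_4_iff)
  then consider "flag_disk G \<or> octahedron_disk G"
    | H where "generating_step H G" "card (verts H) < card (verts G)"
    using reduction by blast
  then show ?case
  proof cases
    case 1
    then show ?thesis by blast
  next
    case 2
    then have "disk_class_4 H" by (simp add: generating_step_def)
    then obtain G0 where "flag_disk G0 \<or> octahedron_disk G0" "generating_step\<^sup>*\<^sup>* G0 H"
      using less.hyps[OF 2(2)] by blast
    then show ?thesis using 2(1) rtranclp.rtrancl_into_rtrancl by metis
  qed
qed

end
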